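(* Let assumptions (AS1)–(AS4) listed in the context hold, and let $(\overline X(\cdot),\bar u(\cdot))$ be an optimal pair of Problem (OP). Let $(Y(\cdot),Z(\cdot))$ be the transposition solution of the $H$-valued backward stochastic evolution equation $$\begin{cases}dY(t)=-A^*Y(t)dt+\big[-a_x(t,\overline X(t),\bar u(t))^*Y(t)-b_x(t,\overline X(t),\bar u(t))^*Z(t)+g_x(t,\overline X(t),\bar u(t))\big]dt+Z(t)dW(t)&\text{in }[0,T),\\ Y(T)=-h_x(\overline X(T)).\end{cases}$$ Then $$\big\langle a_u(t,\overline X(t),\bar u(t))^*Y(t)+b_u(t,\overline X(t),\bar u(t))^*Z(t)-g_u(t,\overline X(t),\bar u(t)),\ \rho-\bar u(t)\big\rangle_{H_1}\le0,\quad\forall\rho\in U,\ \text{a.e. }(t,\omega)\in[0,T]\times\Omega.$$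
   Context: Setting. $T>0$; $(\Omega,\mathcal F,\mathbf F,\mathbb P)$, $\mathbf F=\{\mathcal F_t\}_{t\in[0,T]}$, is a complete filtered probability space satisfying the usual condition and carrying a one-dimensional standard Brownian motion $W$; "adapted" means progressively measurable and $\mathbb F$ is the progressive $\sigma$-field. $H$ is a separable real Hilbert space, $A$ generates a $C_0$-semigroup on $H$. For a Banach space $X$: $L^2_{\mathcal F_t}(\Omega;X)$, $L^2_{\mathbb F}(t,T;X)$, $L^1_{\mathbb F}(t,T;L^2(\Omega;X))$ are the usual spaces of $\mathcal F_t$-measurable random variables, respectively adapted processes; $D_{\mathbb F}([0,T];L^2(\Omega;X))$ is the space of adapted processes right continuous with left limits in $L^2_{\mathcal F_T}(\Omega;X)$. Problem (OP). $U$ is a separable metric space (specified further in (AS3)), $\mathcal U[0,T]$ is the set of adapted processes $u:[0,T]\times\Omega\to U$. For $u\in\mathcal U[0,T]$ and fixed $X_0\in H$, the state $X$ is the mild solution of $$dX=(AX+a(t,X,u))dt+b(t,X,u)dW(t)\ \text{in }(0,T],\quad X(0)=X_0,$$ and the cost is $\mathcal J(u)=\mathbb E\big(\int_0^Tg(t,X(t),u(t))dt+h(X(T))\big)$. Problem (OP): find $\bar u\in\mathcal U[0,T]$ with $\mathcal J(\bar u)=\inf_{u\in\mathcal U[0,T]}\mathcal J(u)$; such $\bar u$ with its state $\overline X$ forms an optimal pair $(\overline X,\bar u)$. Assumptions ($\mathcal C$ denotes a constant). (AS1) $a,b:[0,T]\times\Omega\times H\times U\to H$ satisfy, for $\psi=a,b$: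 i) for any $(x,u)$, $\psi(\cdot,\cdot,x,u)$ is $\mathbb F$-measurable; ii) for any $(t,x)$, $\psi(t,x,\cdot):U\to H$ is continuous; iii) for any $(x_1,x_2,u)\in H\times H\times U$ and a.e. $(t,\omega)$, $|\psi(t,x_1,u)-\psi(t,x_2,u)|_H\le\mathcal C|x_1-x_2|_H$ and $|\psi(t,0,u)|_H\le\mathcal C$. (AS2) $g:[0,T]\times\Omega\times H\times U\to\mathbb R$ and $h:\Omega\times H\to\mathbb R$ satisfy: i) for any $(x,u)$, $g(\cdot,\cdot,x,u)$ is $\mathbb F$-measurable and $h(\cdot,x)$ is $\mathcal F_T$-measurable; ii) for a.e. $(t,\omega)$ and any $x\in H$, $g(t,\omega,x,\cdot)$ is continuous; iii) for all $(t,x_1,x_2,u)$, a.s., $|g(t,x_1,u)-g(t,x_2,u)|+|h(x_1)-h(x_2)|\le\mathcal C|x_1-x_2|_H$ and $|g(t,0,u)|+|h(0)|\le\mathcal C$. (AS3) $U$ is a convex subset of a separable Hilbert space $H_1$ and its metric is induced by the norm of $H_1$. (AS4) For a.e. $(t,\omega)\in(0,T)\times\Omega$, $a(t,\cdot,\cdot),b(t,\cdot,\cdot):H\times U\to H$, $g(t,\cdot,\cdot):H\times U\to\mathbb R$ and $h:H\to\mathbb R$ are $C^1$, and for any $(x,u)\in H\times U$ and a.e. $(t,\omega)$, $|a_x|_{\mathcal L(H)}+|b_x|_{\mathcal L(H)}+|g_x|_H+|h_x|_H\le\mathcal C$ and $|a_u|_{\mathcal L(H_1;H)}+|b_u|_{\mathcal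 L(H_1;H)}+|g_u|_{H_1}\le\mathcal C$ (all at $(t,x,u)$, resp. $x$). Transposition solution. $(Y,Z)\in D_{\mathbb F}([0,T];L^2(\Omega;H))\times L^2_{\mathbb F}(0,T;H)$ is the transposition solution of $dY=-A^*Ydt+f(t,Y,Z)dt+ZdW$, $Y(T)=Y_T$ if for every $t\in[0,T]$, $\psi_1\in L^1_{\mathbb F}(t,T;L^2(\Omega;H))$, $\psi_2\in L^2_{\mathbb F}(t,T;H)$, $\zeta\in L^2_{\mathcal F_t}(\Omega;H)$ and the mild solution $\varphi$ of $d\varphi=(A\varphi+\psi_1)ds+\psi_2dW(s)$ on $(t,T]$, $\varphi(t)=\zeta$, $$\mathbb E\langle\varphi(T),Y_T\rangle_H-\mathbb E\int_t^T\langle\varphi,f(s,Y,Z)\rangle_Hds=\mathbb E\langle\zeta,Y(t)\rangle_H+\mathbb E\int_t^T\langle\psi_1,Y\rangle_Hds+\mathbb E\int_t^T\langle\psi_2,Z\rangle_Hds.$$ It exists and is unique here. *)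

theory Defs
  imports "HOL-Probability.Probability"
begin

section \<open>Stochastic basis\<close>

text \<open>
  The time horizon is \<open>T > 0\<close>; the filtration \<open>F\<close> and the Brownian motion \<open>W\<close> are indexed by
  \<^typ>\<open>real\<close> and only their values on \<open>[0,T]\<close> matter. \<open>F\<close> may be larger than the filtration
  generated by \<open>W\<close>.
\<close>

locale brownian_basis = prob_space M + complete_measure M
  for M :: "'w measure" +
  fixes T :: real
    and F :: "real \<Rightarrow> 'w measure"
    and W :: "real \<Rightarrow> 'w \<Rightarrow> real"
  assumes T_pos: "0 < T"
    and subalg: "\<And>t. t \<in> {0..T} \<Longrightarrow> subalgebra M (F t)"
    and mono: "\<And>s t. \<lbrakk>0 \<le> s; s \<le> t; t \<le> T\<rbrakk> \<Longrightarrow> sets (F s) \<subseteq> sets (F t)"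
    and right_cont: "\<And>t. \<lbrakk>0 \<le> t; t < T\<rbrakk> \<Longrightarrow> sets (F t) = (\<Inter>s\<in>{t<..T}. sets (F s))"
    and null: "null_sets M \<subseteq> sets (F 0)"
    and W_adapted: "\<And>t. t \<in> {0..T} \<Longrightarrow> W t \<in> borel_measurable (F t)"
    and W_path: "AE \<omega> in M. W 0 \<omega> = 0 \<and> continuous_on {0..T} (\<lambda>t. W t \<omega>)"
    and W_indep: "\<And>s t. \<lbrakk>0 \<le> s; s < t; t \<le> T\<rbrakk> \<Longrightarrow>
      indep_set (sets (F s)) {(\<lambda>\<omega>. W t \<omega> - W s \<omega>) -` B \<inter> space M | B. B \<in> sets borel}"
    and W_normal: "\<And>s t. \<lbrakk>0 \<le> s; s < t; t \<le> T\<rbrakk> \<Longrightarrow>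
      distributed M lborel (\<lambda>\<omega>. W t \<omega> - W s \<omega>) (\<lambda>x. ennreal (normal_density 0 (sqrt (t - s)) x))"

abbreviation time_space :: "'w measure \<Rightarrow> real \<Rightarrow> real \<Rightarrow> (real \<times> 'w) measure" where
  "time_space M a b \<equiv> restrict_space lborel {a..b} \<Otimes>\<^sub>M M"

text \<open>The progressive \<open>\<sigma>\<close>-field on \<open>[a,b] \<times> \<Omega>\<close>; \<open>\<bbbF>\<close> is the case \<open>a = 0\<close>, \<open>b = T\<close>.\<close>

definition progressive_field :: "(real \<Rightarrow> 'w measure) \<Rightarrow> real \<Rightarrow> real \<Rightarrow> (real \<times> 'w) measure" where
  "progressive_field F a b = sigma ({a..b} \<times> space (F b))
     {B. B \<subseteq> {a..b} \<times> space (F b) \<and>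
         (\<forall>t\<in>{a..b}. B \<inter> ({a..t} \<times> space (F b)) \<in> sets (restrict_space borel {a..t} \<Otimes>\<^sub>M F t))}"

definition adapted ::
  "(real \<Rightarrow> 'w measure) \<Rightarrow> real \<Rightarrow> real \<Rightarrow> (real \<Rightarrow> 'w \<Rightarrow> 'x::topological_space) \<Rightarrow> bool" where
  "adapted F a b f \<longleftrightarrow> (\<lambda>(t, \<omega>). f t \<omega>) \<in> borel_measurable (progressive_field F a b)"

lemma (in brownian_basis) adapted_iff_progressively_measurable:
  assumes "0 \<le> a" "a \<le> b" "b \<le> T"
  shows "adapted F a b f \<longleftrightarrow>
    (\<forall>t\<in>{a..b}. (\<lambda>(s, \<omega>). f s \<omega>) \<in> borel_measurable (restrict_space borel {a..t} \<Otimes>\<^sub>M F t))"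
proof -
  let ?X = "{a..b} \<times> space M"
  let ?P = "\<lambda>t. restrict_space borel {a..t} \<Otimes>\<^sub>M F t"
  let ?A = "{B. B \<subseteq> ?X \<and> (\<forall>t\<in>{a..b}. B \<inter> ({a..t} \<times> space M) \<in> sets (?P t))}"
  have sp: "space (F t) = space M" if "t \<in> {a..b}" for t
    using subalg[of t] that assms by (auto simp: subalgebra_def)
  have spP: "space (?P t) = {a..t} \<times> space M" if "t \<in> {a..b}" for t
    using sp[OF that] by (simp add: space_pair_measure space_restrict_space)
  have sig: "sigma_algebra ?X ?A"
  proof (rule sigma_algebra_iff2[THEN iffD2], intro conjI ballI allI impI)
    show "?A \<subseteq> Pow ?X" by auto
    show "{} \<in> ?A" by auto
  next
    fix B assume B: "B \<in> ?A"
    have "(?X - B) \<inter> ({a..t} \<times> space M) \<in> sets (?P t)" if t: "t \<in> {a..b}" for t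
    proof -
      have "(?X - B) \<inter> ({a..t} \<times> space M) = space (?P t) - B \<inter> ({a..t} \<times> space M)"
        using t by (auto simp: spP)
      also have "\<dots> \<in> sets (?P t)" using B t by blast
      finally show ?thesis .
    qed
    then show "?X - B \<in> ?A" by auto
  next
    fix B :: "nat \<Rightarrow> (real \<times> 'w) set" assume B: "range B \<subseteq> ?A"
    have "(\<Union>i. B i) \<inter> ({a..t} \<times> space M) \<in> sets (?P t)" if t: "t \<in> {a..b}" for t
    proof -
      have "(\<Union>i. B i) \<inter> ({a..t} \<times> space M) = (\<Union>i. B i \<inter> ({a..t} \<times> space M))" by auto
      also have "\<dots> \<in> sets (?P t)" using B t by (intro sets.countable_UN) auto
      finally show ?thesis .
    qed
    with B show "(\<Union>i. B i) \<in> ?A" by auto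
  qed
  have spb: "space (F b) = space M" using sp assms by simp
  have space: "space (progressive_field F a b) = ?X"
    unfolding progressive_field_def spb by (rule space_measure_of) auto
  have sets: "sets (progressive_field F a b) = ?A"
    unfolding progressive_field_def spb using sigma_algebra.sets_measure_of_eq[OF sig] by simp
  have pre: "((\<lambda>(s, \<omega>). f s \<omega>) -` B \<inter> ?X) \<inter> ({a..t} \<times> space M)
      = (\<lambda>(s, \<omega>). f s \<omega>) -` B \<inter> space (?P t)" if "t \<in> {a..b}" for t B
    using that by (auto simp: spP)
  show ?thesis
    unfolding adapted_def measurable_def using pre by (auto simp: space sets)
qed


section \<open>Spaces of random variables and processes\<close>

definition L2_rv :: "'w measure \<Rightarrow> 'w measure \<Rightarrow> ('w \<Rightarrow> 'x::real_normed_vector) set" where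
  "L2_rv M G = {\<xi>. \<xi> \<in> borel_measurable G \<and> integrable M (\<lambda>\<omega>. (norm (\<xi> \<omega>))\<^sup>2)}"

text \<open>
  The elements of \<open>L\<^sup>2\<^sub>F(a,b;X)\<close> and of \<open>L\<^sup>1\<^sub>F(a,b;L\<^sup>2(\<Omega>;X))\<close> are understood up to equality for almost
  every \<open>(t,\<omega>)\<close>: a process belongs to the space if it coincides almost everywhere with an adapted
  process of finite norm. (The coefficients of the state equation are regular only almost
  everywhere, so compositions such as \<open>b(t,X,u)\<close> are adapted only in this sense.)
\<close>

definition L2_proc ::
  "'w measure \<Rightarrow> (real \<Rightarrow> 'w measure) \<Rightarrow> real \<Rightarrow> real \<Rightarrow> (real \<Rightarrow> 'w \<Rightarrow> 'x::real_normed_vector) set" where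
  "L2_proc M F a b = {f. \<exists>f'. adapted F a b f' \<and>
     (AE (t, \<omega>) in time_space M a b. f t \<omega> = f' t \<omega>) \<and>
     integrable (time_space M a b) (\<lambda>(t, \<omega>). (norm (f' t \<omega>))\<^sup>2)}"

definition L1_L2_proc ::
  "'w measure \<Rightarrow> (real \<Rightarrow> 'w measure) \<Rightarrow> real \<Rightarrow> real \<Rightarrow> (real \<Rightarrow> 'w \<Rightarrow> 'x::real_normed_vector) set" where
  "L1_L2_proc M F a b = {f. \<exists>f'. adapted F a b f' \<and>
     (AE (t, \<omega>) in time_space M a b. f t \<omega> = f' t \<omega>) \<and>
     (AE t in restrict_space lborel {a..b}. integrable M (\<lambda>\<omega>. (norm (f' t \<omega>))\<^sup>2)) \<and>
     integrable (restrict_space lborel {a..b}) (\<lambda>t. sqrt (LINT \<omega>|M. (norm (f' t \<omega>))\<^sup>2))}"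

text \<open>Adapted processes that are continuous, resp. right continuous with left limits, in \<open>L\<^sup>2(\<Omega>;X)\<close>.\<close>

definition C_proc ::
  "'w measure \<Rightarrow> (real \<Rightarrow> 'w measure) \<Rightarrow> real \<Rightarrow> real \<Rightarrow> (real \<Rightarrow> 'w \<Rightarrow> 'x::real_normed_vector) set" where
  "C_proc M F a b = {X. adapted F a b X \<and> (\<forall>t\<in>{a..b}. X t \<in> L2_rv M (F b)) \<and>
     (\<forall>t\<in>{a..b}. ((\<lambda>s. LINT \<omega>|M. (norm (X s \<omega> - X t \<omega>))\<^sup>2) \<longlongrightarrow> 0) (at t within {a..b}))}"

definition D_proc ::
  "'w measure \<Rightarrow> (real \<Rightarrow> 'w measure) \<Rightarrow> real \<Rightarrow> real \<Rightarrow> (real \<Rightarrow> 'w \<Rightarrow> 'x::real_normed_vector) set" where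
  "D_proc M F a b = {X. adapted F a b X \<and> (\<forall>t\<in>{a..b}. X t \<in> L2_rv M (F b)) \<and>
     (\<forall>t\<in>{a..<b}. ((\<lambda>s. LINT \<omega>|M. (norm (X s \<omega> - X t \<omega>))\<^sup>2) \<longlongrightarrow> 0) (at t within {t<..b})) \<and>
     (\<forall>t\<in>{a<..b}. \<exists>\<eta>\<in>L2_rv M (F b).
        ((\<lambda>s. LINT \<omega>|M. (norm (X s \<omega> - \<eta> \<omega>))\<^sup>2) \<longlongrightarrow> 0) (at t within {a..<t}))}"


section \<open>Ito integral\<close>

text \<open>
  A step process on \<open>[a,b]\<close> is given by grid points \<open>a = \<tau> 0 \<le> \<dots> \<le> \<tau> n = b\<close> and bounded
  \<open>F (\<tau> i)\<close>-measurable values \<open>\<xi> i\<close> on \<open>(\<tau> i, \<tau> (i + 1)]\<close>.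
\<close>

definition step_data ::
  "(real \<Rightarrow> 'w measure) \<Rightarrow> real \<Rightarrow> real \<Rightarrow> nat \<Rightarrow> (nat \<Rightarrow> real) \<Rightarrow>
    (nat \<Rightarrow> 'w \<Rightarrow> 'x::real_normed_vector) \<Rightarrow> bool" where
  "step_data F a b n \<tau> \<xi> \<longleftrightarrow> \<tau> 0 = a \<and> \<tau> n = b \<and>
     (\<forall>i<n. \<tau> i \<le> \<tau> (Suc i) \<and> \<xi> i \<in> borel_measurable (F (\<tau> i)) \<and>
       (\<exists>B. \<forall>\<omega>\<in>space (F (\<tau> i)). norm (\<xi> i \<omega>) \<le> B))"

definition step_process ::
  "nat \<Rightarrow> (nat \<Rightarrow> real) \<Rightarrow> (nat \<Rightarrow> 'w \<Rightarrow> 'x::real_normed_vector) \<Rightarrow> real \<Rightarrow> 'w \<Rightarrow> 'x" where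
  "step_process n \<tau> \<xi> t \<omega> = (\<Sum>i<n. indicat_real {\<tau> i<..\<tau> (Suc i)} t *\<^sub>R \<xi> i \<omega>)"

definition step_integral ::
  "(real \<Rightarrow> 'w \<Rightarrow> real) \<Rightarrow> nat \<Rightarrow> (nat \<Rightarrow> real) \<Rightarrow> (nat \<Rightarrow> 'w \<Rightarrow> 'x::real_normed_vector) \<Rightarrow> 'w \<Rightarrow> 'x" where
  "step_integral W n \<tau> \<xi> \<omega> = (\<Sum>i<n. (W (\<tau> (Suc i)) \<omega> - W (\<tau> i) \<omega>) *\<^sub>R \<xi> i \<omega>)"

text \<open>\<open>J\<close> is (a version of) the integral of \<open>f\<close> over \<open>[a,b]\<close> with respect to \<open>W\<close>.\<close>

definition has_ito_integral ::
  "'w measure \<Rightarrow> (real \<Rightarrow> 'w measure) \<Rightarrow> (real \<Rightarrow> 'w \<Rightarrow> real) \<Rightarrow> real \<Rightarrow> real \<Rightarrow>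
    (real \<Rightarrow> 'w \<Rightarrow> 'x::real_normed_vector) \<Rightarrow> ('w \<Rightarrow> 'x) \<Rightarrow> bool" where
  "has_ito_integral M F W a b f J \<longleftrightarrow>
     f \<in> L2_proc M F a b \<and> J \<in> L2_rv M (F b) \<and>
     (\<exists>n \<tau> \<xi>. (\<forall>k. step_data F a b (n k) (\<tau> k) (\<xi> k)) \<and>
       (\<lambda>k. \<integral>\<^sup>+(t, \<omega>). ennreal ((norm (step_process (n k) (\<tau> k) (\<xi> k) t \<omega> - f t \<omega>))\<^sup>2)
              \<partial>time_space M a b) \<longlonglongrightarrow> 0 \<and>
       (\<lambda>k. \<integral>\<^sup>+\<omega>. ennreal ((norm (step_integral W (n k) (\<tau> k) (\<xi> k) \<omega> - J \<omega>))\<^sup>2) \<partial>M) \<longlonglongrightarrow> 0)"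


section \<open>Semigroups and mild solutions\<close>

definition C0_semigroup :: "(real \<Rightarrow> 'h::real_normed_vector \<Rightarrow>\<^sub>L 'h) \<Rightarrow> bool" where
  "C0_semigroup S \<longleftrightarrow> S 0 = id_blinfun \<and>
     (\<forall>s\<ge>0. \<forall>t\<ge>0. S (s + t) = S s o\<^sub>L S t) \<and>
     (\<forall>x. ((\<lambda>t. S t x) \<longlongrightarrow> x) (at_right 0))"

text \<open>The operator \<open>A\<close> with domain \<open>domA\<close> (its values off \<open>domA\<close> are irrelevant) generates \<open>S\<close>.\<close>

definition generates_C0_semigroup ::
  "'h::real_normed_vector set \<Rightarrow> ('h \<Rightarrow> 'h) \<Rightarrow> (real \<Rightarrow> 'h \<Rightarrow>\<^sub>L 'h) \<Rightarrow> bool" where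
  "generates_C0_semigroup domA A S \<longleftrightarrow> C0_semigroup S \<and>
     domA = {x. \<exists>y. ((\<lambda>t. (S t x - x) /\<^sub>R t) \<longlongrightarrow> y) (at_right 0)} \<and>
     (\<forall>x\<in>domA. ((\<lambda>t. (S t x - x) /\<^sub>R t) \<longlongrightarrow> A x) (at_right 0))"

text \<open>
  \<open>X\<close> is a mild solution of \<open>dX = (A X + f) dt + g dW\<close> on \<open>(a,b]\<close>, \<open>X a = \<zeta>\<close>. A nonlinear equation
  is covered by letting the processes \<open>f\<close> and \<open>g\<close> depend on \<open>X\<close>.
\<close>

definition mild_solution ::
  "'w measure \<Rightarrow> (real \<Rightarrow> 'w measure) \<Rightarrow> (real \<Rightarrow> 'w \<Rightarrow> real) \<Rightarrow> (real \<Rightarrow> 'h \<Rightarrow>\<^sub>L 'h) \<Rightarrow> real \<Rightarrow> real \<Rightarrow>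
    ('w \<Rightarrow> 'h) \<Rightarrow> (real \<Rightarrow> 'w \<Rightarrow> 'h) \<Rightarrow> (real \<Rightarrow> 'w \<Rightarrow> 'h) \<Rightarrow>
    (real \<Rightarrow> 'w \<Rightarrow> 'h::{real_inner, banach, second_countable_topology}) \<Rightarrow> bool" where
  "mild_solution M F W S a b \<zeta> f g X \<longleftrightarrow> X \<in> C_proc M F a b \<and>
     (\<forall>t\<in>{a..b}. \<exists>J. has_ito_integral M F W a t (\<lambda>s \<omega>. S (t - s) (g s \<omega>)) J \<and>
       (AE \<omega> in M. set_integrable lebesgue {a..t} (\<lambda>s. S (t - s) (f s \<omega>)) \<and>
          X t \<omega> = S (t - a) (\<zeta> \<omega>) + (LINT s:{a..t}|lebesgue. S (t - s) (f s \<omega>)) + J \<omega>))"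


section \<open>The control problem\<close>

definition admissible_control ::
  "'w measure \<Rightarrow> (real \<Rightarrow> 'w measure) \<Rightarrow> real \<Rightarrow> 'k::topological_space set \<Rightarrow> (real \<Rightarrow> 'w \<Rightarrow> 'k) \<Rightarrow> bool" where
  "admissible_control M F T U u \<longleftrightarrow> adapted F 0 T u \<and> (\<forall>t\<in>{0..T}. \<forall>\<omega>\<in>space M. u t \<omega> \<in> U)"

definition admissible_pair ::
  "'w measure \<Rightarrow> (real \<Rightarrow> 'w measure) \<Rightarrow> (real \<Rightarrow> 'w \<Rightarrow> real) \<Rightarrow> real \<Rightarrow> (real \<Rightarrow> 'h \<Rightarrow>\<^sub>L 'h) \<Rightarrow>
    'k::topological_space set \<Rightarrow> (real \<Rightarrow> 'w \<Rightarrow> 'h \<Rightarrow> 'k \<Rightarrow> 'h) \<Rightarrow> (real \<Rightarrow> 'w \<Rightarrow> 'h \<Rightarrow> 'k \<Rightarrow> 'h) \<Rightarrow> 'h \<Rightarrow>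
    (real \<Rightarrow> 'w \<Rightarrow> 'h::{real_inner, banach, second_countable_topology}) \<Rightarrow> (real \<Rightarrow> 'w \<Rightarrow> 'k) \<Rightarrow> bool" where
  "admissible_pair M F W T S U a b X0 X u \<longleftrightarrow> admissible_control M F T U u \<and>
     mild_solution M F W S 0 T (\<lambda>_. X0)
       (\<lambda>t \<omega>. a t \<omega> (X t \<omega>) (u t \<omega>)) (\<lambda>t \<omega>. b t \<omega> (X t \<omega>) (u t \<omega>)) X"

definition cost ::
  "'w measure \<Rightarrow> real \<Rightarrow> (real \<Rightarrow> 'w \<Rightarrow> 'h \<Rightarrow> 'k \<Rightarrow> real) \<Rightarrow> ('w \<Rightarrow> 'h \<Rightarrow> real) \<Rightarrow>
    (real \<Rightarrow> 'w \<Rightarrow> 'h) \<Rightarrow> (real \<Rightarrow> 'w \<Rightarrow> 'k) \<Rightarrow> real" where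
  "cost M T g h X u =
     (LINT \<omega>|M. (LINT t:{0..T}|lebesgue. g t \<omega> (X t \<omega>) (u t \<omega>)) + h \<omega> (X T \<omega>))"

text \<open>
  Under the assumptions below the state is determined by the control up to modification, so the
  infimum over admissible pairs is the infimum over controls. It is taken in \<^typ>\<open>ereal\<close>, where it
  is meaningful without a lower bound.
\<close>

definition optimal_pair ::
  "'w measure \<Rightarrow> (real \<Rightarrow> 'w measure) \<Rightarrow> (real \<Rightarrow> 'w \<Rightarrow> real) \<Rightarrow> real \<Rightarrow> (real \<Rightarrow> 'h \<Rightarrow>\<^sub>L 'h) \<Rightarrow>
    'k::topological_space set \<Rightarrow> (real \<Rightarrow> 'w \<Rightarrow> 'h \<Rightarrow> 'k \<Rightarrow> 'h) \<Rightarrow> (real \<Rightarrow> 'w \<Rightarrow> 'h \<Rightarrow> 'k \<Rightarrow> 'h) \<Rightarrow>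
    (real \<Rightarrow> 'w \<Rightarrow> 'h \<Rightarrow> 'k \<Rightarrow> real) \<Rightarrow> ('w \<Rightarrow> 'h \<Rightarrow> real) \<Rightarrow> 'h \<Rightarrow>
    (real \<Rightarrow> 'w \<Rightarrow> 'h::{real_inner, banach, second_countable_topology}) \<Rightarrow> (real \<Rightarrow> 'w \<Rightarrow> 'k) \<Rightarrow> bool" where
  "optimal_pair M F W T S U a b g h X0 Xbar ubar \<longleftrightarrow>
     admissible_pair M F W T S U a b X0 Xbar ubar \<and>
     ereal (cost M T g h Xbar ubar) =
       (INF (X, u) \<in> {(X, u). admissible_pair M F W T S U a b X0 X u}. ereal (cost M T g h X u))"


section \<open>Assumptions on the data\<close>

definition AS1_coeff ::
  "'w measure \<Rightarrow> (real \<Rightarrow> 'w measure) \<Rightarrow> real \<Rightarrow> 'k::topological_space set \<Rightarrow>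
    (real \<Rightarrow> 'w \<Rightarrow> 'h::real_normed_vector \<Rightarrow> 'k \<Rightarrow> 'h) \<Rightarrow> bool" where
  "AS1_coeff M F T U \<psi> \<longleftrightarrow>
     (\<forall>x. \<forall>u\<in>U. adapted F 0 T (\<lambda>t \<omega>. \<psi> t \<omega> x u)) \<and>
     (\<forall>t\<in>{0..T}. \<forall>x. AE \<omega> in M. continuous_on U (\<psi> t \<omega> x)) \<and>
     (\<exists>C. \<forall>x1 x2. \<forall>u\<in>U. AE (t, \<omega>) in time_space M 0 T.
        norm (\<psi> t \<omega> x1 u - \<psi> t \<omega> x2 u) \<le> C * norm (x1 - x2) \<and> norm (\<psi> t \<omega> 0 u) \<le> C)"

definition AS1 where
  "AS1 M F T U a b \<longleftrightarrow> AS1_coeff M F T U a \<and> AS1_coeff M F T U b"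

definition AS2 ::
  "'w measure \<Rightarrow> (real \<Rightarrow> 'w measure) \<Rightarrow> real \<Rightarrow> 'k::topological_space set \<Rightarrow>
    (real \<Rightarrow> 'w \<Rightarrow> 'h::real_normed_vector \<Rightarrow> 'k \<Rightarrow> real) \<Rightarrow> ('w \<Rightarrow> 'h \<Rightarrow> real) \<Rightarrow> bool" where
  "AS2 M F T U g h \<longleftrightarrow>
     (\<forall>x. \<forall>u\<in>U. adapted F 0 T (\<lambda>t \<omega>. g t \<omega> x u)) \<and>
     (\<forall>x. (\<lambda>\<omega>. h \<omega> x) \<in> borel_measurable (F T)) \<and>
     (AE (t, \<omega>) in time_space M 0 T. \<forall>x. continuous_on U (g t \<omega> x)) \<and>
     (\<exists>C. \<forall>t\<in>{0..T}. \<forall>x1 x2. \<forall>u\<in>U. AE \<omega> in M.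
        \<bar>g t \<omega> x1 u - g t \<omega> x2 u\<bar> + \<bar>h \<omega> x1 - h \<omega> x2\<bar> \<le> C * norm (x1 - x2) \<and>
        \<bar>g t \<omega> 0 u\<bar> + \<bar>h \<omega> 0\<bar> \<le> C)"

text \<open>
  \<open>f\<close> is continuously (Frechet) differentiable on \<open>H \<times> U\<close> with partial derivatives \<open>fx\<close>, \<open>fu\<close>. The set \<open>U\<close> need
  not be open, so the derivative is taken within \<open>H \<times> U\<close>; if \<open>U\<close> has empty interior, \<open>fu\<close> is only
  determined in the directions \<open>v - u\<close> with \<open>u, v \<in> U\<close>.
\<close>

definition C1_on_prod ::
  "'k::real_normed_vector set \<Rightarrow> ('h::real_normed_vector \<Rightarrow> 'k \<Rightarrow> 'y::real_normed_vector) \<Rightarrow>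
    ('h \<Rightarrow> 'k \<Rightarrow> 'h \<Rightarrow>\<^sub>L 'y) \<Rightarrow> ('h \<Rightarrow> 'k \<Rightarrow> 'k \<Rightarrow>\<^sub>L 'y) \<Rightarrow> bool" where
  "C1_on_prod U f fx fu \<longleftrightarrow>
     (\<forall>x. \<forall>u\<in>U. ((\<lambda>(y, v). f y v) has_derivative (\<lambda>(y, v). fx x u y + fu x u v))
        (at (x, u) within UNIV \<times> U)) \<and>
     continuous_on (UNIV \<times> U) (\<lambda>(x, u). fx x u) \<and>
     continuous_on (UNIV \<times> U) (\<lambda>(x, u). fu x u)"

text \<open>
  \<open>gx\<close>, \<open>gu\<close>, \<open>hx\<close> are gradients, i.e. the derivatives of the real-valued functions \<open>g\<close> and \<open>h\<close> are
  identified with vectors of \<open>H\<close> and \<open>H\<^sub>1\<close>.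
\<close>

definition AS4 ::
  "'w measure \<Rightarrow> real \<Rightarrow> 'k::real_inner set \<Rightarrow>
    (real \<Rightarrow> 'w \<Rightarrow> 'h::real_inner \<Rightarrow> 'k \<Rightarrow> 'h) \<Rightarrow> (real \<Rightarrow> 'w \<Rightarrow> 'h \<Rightarrow> 'k \<Rightarrow> 'h) \<Rightarrow>
    (real \<Rightarrow> 'w \<Rightarrow> 'h \<Rightarrow> 'k \<Rightarrow> real) \<Rightarrow> ('w \<Rightarrow> 'h \<Rightarrow> real) \<Rightarrow>
    (real \<Rightarrow> 'w \<Rightarrow> 'h \<Rightarrow> 'k \<Rightarrow> 'h \<Rightarrow>\<^sub>L 'h) \<Rightarrow> (real \<Rightarrow> 'w \<Rightarrow> 'h \<Rightarrow> 'k \<Rightarrow> 'k \<Rightarrow>\<^sub>L 'h) \<Rightarrow>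
    (real \<Rightarrow> 'w \<Rightarrow> 'h \<Rightarrow> 'k \<Rightarrow> 'h \<Rightarrow>\<^sub>L 'h) \<Rightarrow> (real \<Rightarrow> 'w \<Rightarrow> 'h \<Rightarrow> 'k \<Rightarrow> 'k \<Rightarrow>\<^sub>L 'h) \<Rightarrow>
    (real \<Rightarrow> 'w \<Rightarrow> 'h \<Rightarrow> 'k \<Rightarrow> 'h) \<Rightarrow> (real \<Rightarrow> 'w \<Rightarrow> 'h \<Rightarrow> 'k \<Rightarrow> 'k) \<Rightarrow> ('w \<Rightarrow> 'h \<Rightarrow> 'h) \<Rightarrow> bool" where
  "AS4 M T U a b g h ax au bx bu gx gu hx \<longleftrightarrow>
     (AE (t, \<omega>) in time_space M 0 T.
        C1_on_prod U (a t \<omega>) (ax t \<omega>) (au t \<omega>) \<and>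
        C1_on_prod U (b t \<omega>) (bx t \<omega>) (bu t \<omega>) \<and>
        C1_on_prod U (g t \<omega>) (\<lambda>x u. blinfun_inner_right (gx t \<omega> x u))
          (\<lambda>x u. blinfun_inner_right (gu t \<omega> x u))) \<and>
     (AE \<omega> in M. (\<forall>x. (h \<omega> has_derivative (\<lambda>y. hx \<omega> x \<bullet> y)) (at x)) \<and>
        continuous_on UNIV (hx \<omega>)) \<and>
     (\<exists>C. \<forall>x. \<forall>u\<in>U. AE (t, \<omega>) in time_space M 0 T.
        norm (ax t \<omega> x u) + norm (bx t \<omega> x u) + norm (gx t \<omega> x u) + norm (hx \<omega> x) \<le> C \<and>
        norm (au t \<omega> x u) + norm (bu t \<omega> x u) + norm (gu t \<omega> x u) \<le> C)"


section \<open>Transposition solutions\<close>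

text \<open>
  \<open>(Y,Z)\<close> is the transposition solution of \<open>dY = - A\<^sup>* Y dt + f(t,Y,Z) dt + Z dW\<close>, \<open>Y T = YT\<close>, where
  \<open>A\<close> generates \<open>S\<close>.
\<close>

definition transposition_solution ::
  "'w measure \<Rightarrow> (real \<Rightarrow> 'w measure) \<Rightarrow> (real \<Rightarrow> 'w \<Rightarrow> real) \<Rightarrow> real \<Rightarrow> (real \<Rightarrow> 'h \<Rightarrow>\<^sub>L 'h) \<Rightarrow>
    (real \<Rightarrow> 'w \<Rightarrow> 'h \<Rightarrow> 'h \<Rightarrow> 'h) \<Rightarrow> ('w \<Rightarrow> 'h) \<Rightarrow>
    (real \<Rightarrow> 'w \<Rightarrow> 'h::{real_inner, banach, second_countable_topology}) \<Rightarrow> (real \<Rightarrow> 'w \<Rightarrow> 'h) \<Rightarrow> bool" where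
  "transposition_solution M F W T S f YT Y Z \<longleftrightarrow>
     Y \<in> D_proc M F 0 T \<and> Z \<in> L2_proc M F 0 T \<and>
     (\<forall>t\<in>{0..T}. \<forall>\<psi>1\<in>L1_L2_proc M F t T. \<forall>\<psi>2\<in>L2_proc M F t T. \<forall>\<zeta>\<in>L2_rv M (F t). \<forall>\<phi>.
        mild_solution M F W S t T \<zeta> \<psi>1 \<psi>2 \<phi> \<longrightarrow>
        (LINT \<omega>|M. \<phi> T \<omega> \<bullet> YT \<omega>)
          - (LINT \<omega>|M. (LINT s:{t..T}|lebesgue. \<phi> s \<omega> \<bullet> f s \<omega> (Y s \<omega>) (Z s \<omega>)))
        = (LINT \<omega>|M. \<zeta> \<omega> \<bullet> Y t \<omega>)
          + (LINT \<omega>|M. (LINT s:{t..T}|lebesgue. \<psi>1 s \<omega> \<bullet> Y s \<omega>))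
          + (LINT \<omega>|M. (LINT s:{t..T}|lebesgue. \<psi>2 s \<omega> \<bullet> Z s \<omega>)))"

end

theory Submission
  imports Defs
begin

text \<open>
  Convexity of \<open>U\<close> allows the convex perturbations \<open>u + \<epsilon> v\<close> of the optimal control \<open>u\<close> whenever \<open>u\<close> and \<open>u + v\<close>
  take values in \<open>U\<close>. Picard iteration started at the optimal state yields the perturbed
  state, at distance \<open>O(\<epsilon>)\<close> in mean square. No linearized state equation is needed: \<open>a\<close>, \<open>b\<close>, \<open>g\<close>, \<open>h\<close> are expanded to first order
  directly at the perturbed state, with remainders \<open>o(\<epsilon>)\<close> after pairing with \<open>Y\<close>, \<open>Z\<close> or \<open>1\<close>, and the difference of
  the two states, which solves a linear equation with initial value zero, is used as the test process
  for the transposition solution. The terms with \<open>a\<^sub>x\<close>, \<open>b\<^sub>x\<close>, \<open>g\<^sub>x\<close>, \<open>h\<^sub>x\<close> then cancel, and optimality leaves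
  \<open>E \<integral> (\<langle>a\<^sub>u v, Y\<rangle> + \<langle>b\<^sub>u v, Z\<rangle> - \<langle>g\<^sub>u, v\<rangle>) dt \<le> 0\<close>. Choosing \<open>\<epsilon> = (1/4)\<^sup>k\<close> makes the mean square convergence almost
  sure, so that dominated convergence applies to the remainders. Finally \<open>v\<close> is localized to
  progressive sets where the pointwise inequality would fail for a given \<open>\<rho>\<close>, and \<open>\<rho>\<close> ranges over a countable dense
  subset of \<open>U\<close>.
\<close>

section \<open>Hilbert space operators and semigroups\<close>

text \<open>The obstacle throughout is measurability. No partial derivative is assumed measurable in
  (t, \<omega>), and if \<open>U\<close> has empty interior, \<open>au\<close>, \<open>bu\<close>,
  \<open>gu\<close> carry information only in directions between points of \<open>U\<close>. A
  derivative therefore enters the integrals only through its value in a direction along which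
  \<open>U\<close> admits difference quotients; this value is measurable, up to a null set, as a
  limit of such quotients. Hence variations v must keep u + v in \<open>U\<close>, and the final
  localization uses a set cut out by a progressive version of the integrand, not by the integrand
  itself. Optimality compares pairs of state and control, so one state near the optimal one suffices
  for each perturbed control. Only the order of its distance matters, so second moments are
  estimated with crude constants. Approximations and iterations are run at the rate (1/16)^k in
  second moment: increments are then summable pointwise, and every limit is an explicit
  \<open>lim\<close> that inherits progressive measurability, whereas a mean square limit would only
  be a class of functions.\<close>

text \<open>The representing vector is the minimiser of the quadratic functional \<open>J\<close>:
  the parallelogram law (\<open>par\<close>) makes a minimising sequence Cauchy, and stationarity of
  the limit along every line is the claimed identity.\<close>

lemma riesz_representation:
  fixes f :: "'h::{real_inner, banach} \<Rightarrow> real"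
  assumes "bounded_linear f"
  shows "\<exists>y. \<forall>x. f x = x \<bullet> y"
proof -
  interpret f: bounded_linear f by fact
  define J where "J x = (norm x)\<^sup>2 - 2 * f x" for x
  obtain K where K: "\<And>x. norm (f x) \<le> norm x * K" using f.bounded by blast
  have low: "- (K\<^sup>2) \<le> J x" for x
  proof -
    have "2 * f x \<le> 2 * (norm x * K)" using K[of x] by simp
    moreover have "0 \<le> (norm x - K)\<^sup>2" by simp
    ultimately show ?thesis unfolding J_def by (simp add: power2_diff)
  qed
  define m where "m = Inf (range J)"
  have bdd: "bdd_below (range J)" using low by (auto intro!: bdd_belowI)
  have m_le: "m \<le> J x" for x unfolding m_def using bdd by (auto intro: cInf_lower)
  have "\<exists>x. J x < m + 1 / Suc n" for n
    using cInf_lessD[of "range J" "m + 1 / Suc n"] by (auto simp: m_def)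
  then obtain x where x: "\<And>n. J (x n) < m + 1 / Suc n" by metis
  have par: "(norm (x n - x k))\<^sup>2 \<le> 2 / Suc n + 2 / Suc k" for n k
  proof -
    have "(norm (x n - x k))\<^sup>2 = 2 * J (x n) + 2 * J (x k) - 4 * J ((1/2) *\<^sub>R (x n + x k))"
      by (simp add: J_def f.scale f.add power2_norm_eq_inner inner_simps inner_commute algebra_simps)
    also have "\<dots> \<le> 2 * (m + 1 / Suc n) + 2 * (m + 1 / Suc k) - 4 * m"
      by (intro diff_mono add_mono mult_left_mono m_le less_imp_le[OF x]) auto
    finally show ?thesis by simp
  qed
  have "Cauchy x"
  proof (rule metric_CauchyI)
    fix e :: real assume "0 < e"
    then obtain N where N: "4 / e\<^sup>2 < real N" using reals_Archimedean2 by blast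
    have "dist (x n) (x k) < e" if "N \<le> n" "N \<le> k" for n k
    proof -
      have N0: "0 < real N" using N \<open>0 < e\<close> by (meson divide_nonneg_nonneg le_less_trans zero_le_numeral zero_le_power2)
      have "2 / Suc n \<le> 2 / real N" "2 / Suc k \<le> 2 / real N"
        using that N0 by (auto intro!: divide_left_mono)
      then have "(norm (x n - x k))\<^sup>2 \<le> 4 / real N" using par[of n k] by simp
      also have "\<dots> < e\<^sup>2" using N N0 \<open>0 < e\<close> by (simp add: field_simps)
      finally show ?thesis using \<open>0 < e\<close> by (simp add: dist_norm power_less_imp_less_base)
    qed
    then show "\<exists>N. \<forall>m\<ge>N. \<forall>n\<ge>N. dist (x m) (x n) < e" by blast
  qed
  then obtain y where y: "x \<longlonglongrightarrow> y" using Cauchy_convergent convergent_def by blast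
  have "(\<lambda>n. J (x n)) \<longlonglongrightarrow> J y" unfolding J_def
    by (intro tendsto_intros f.tendsto y)
  moreover have "(\<lambda>n. m + 1 / Suc n) \<longlonglongrightarrow> m + 0"
    by (intro tendsto_intros LIMSEQ_Suc[OF lim_1_over_n])
  ultimately have Jy: "J y \<le> m"
    using LIMSEQ_le x by (metis (no_types, lifting) add.right_neutral less_imp_le)
  have "f z = z \<bullet> y" for z
  proof -
    define c where "c = y \<bullet> z - f z"
    \<comment> \<open>Along a line through the minimiser the functional is a quadratic polynomial in
      \<open>s\<close> that never drops below its value at 0, so its linear coefficient has to
      vanish.\<close>
    have q: "0 \<le> s\<^sup>2 * (norm z)\<^sup>2 + 2 * s * c" for s
    proof -
      have "J y \<le> J (y + s *\<^sub>R z)" using Jy m_le[of "y + s *\<^sub>R z"] by linarith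
      moreover have "(norm (y + s *\<^sub>R z))\<^sup>2 = (norm y)\<^sup>2 + 2 * s * (y \<bullet> z) + s\<^sup>2 * (norm z)\<^sup>2"
        by (simp add: power2_norm_eq_inner inner_simps inner_commute[of z y]) (simp add: power2_eq_square algebra_simps)
      ultimately show ?thesis by (simp add: J_def c_def f.add f.scale right_diff_distrib)
    qed
    have "c = 0"
    proof (rule ccontr)
      assume c: "c \<noteq> 0"
      \<comment> \<open>The summand 1 keeps the test point \<open>s = - c / N\<close> meaningful
        when z = 0.\<close>
      define N where "N = (norm z)\<^sup>2 + 1"
      have "N > 0" unfolding N_def by (simp add: add_nonneg_pos)
      have "(c/N)\<^sup>2 * (norm z)\<^sup>2 \<le> (c/N)\<^sup>2 * N" by (intro mult_left_mono) (auto simp: N_def)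
      also have "\<dots> = c\<^sup>2 / N" using \<open>N > 0\<close> by (simp add: power2_eq_square)
      finally have "c\<^sup>2 / N + 2 * (- c / N) * c \<ge> 0" using q[of "- c / N"] by simp
      then have "c\<^sup>2 / N \<le> 0" by (simp add: power2_eq_square)
      then show False using \<open>N > 0\<close> c by (simp add: divide_le_0_iff)
    qed
    then show ?thesis by (simp add: c_def inner_commute)
  qed
  then show ?thesis by blast
qed

text \<open>\<open>adjoint\<close> is a Hilbert choice, so its defining identity is available only
  once some adjoint is known to exist. The Riesz representation supplies one.\<close>

lemma inner_adjoint:
  fixes A :: "'a::{real_inner, banach} \<Rightarrow>\<^sub>L 'b::real_inner"
  shows "x \<bullet> adjoint (blinfun_apply A) y = A x \<bullet> y"
proof -
  have "\<exists>z. \<forall>x. A x \<bullet> y = x \<bullet> z" for y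
    by (rule riesz_representation)
      (rule bounded_linear_compose[OF bounded_linear_inner_left blinfun.bounded_linear_right])
  then have "\<exists>B. \<forall>x y. A x \<bullet> y = x \<bullet> B y" by metis
  then have "\<forall>x y. A x \<bullet> y = x \<bullet> adjoint (blinfun_apply A) y"
    unfolding adjoint_def by (rule someI_ex)
  then show ?thesis by simp
qed

text \<open>The gliding hump argument of Sokal.\<close>

lemma uniform_boundedness:
  fixes A :: "nat \<Rightarrow> 'a::banach \<Rightarrow>\<^sub>L 'b::real_normed_vector"
  assumes bdd: "\<And>x. \<exists>K. \<forall>n. norm (A n x) \<le> K"
  shows "\<exists>K. \<forall>n. norm (A n) \<le> K"
proof (rule ccontr)
  assume unb: "\<nexists>K. \<forall>n. norm (A n) \<le> K"
  \<comment> \<open>Norms growing like 4^k will outweigh corrections of size (1/3)^k, which are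
    small enough to be summable.\<close>
  have "\<exists>n. norm (A n) > 4 ^ k" for k using unb by (metis not_le)
  then obtain n where n: "\<And>k. norm (A (n k)) > 4 ^ k" by metis
  \<comment> \<open>As \<open>2 *\<^sub>R z\<close> is the difference of \<open>x + z\<close> and
    \<open>x - z\<close>, one of these two points has an image at least as long as that of
    \<open>z\<close>. A ball around any centre thus detects the operator norm as well as a ball
    around 0. Every factor below 1 is attained; 2/3 leaves room for the tail sum 1/2 below.\<close>
  have hump: "\<exists>y. norm (y - x) \<le> r \<and> norm (B y) \<ge> 2/3 * r * norm B"
    if r: "r > 0" for x and r :: real and B :: "'a \<Rightarrow>\<^sub>L 'b"
  proof (rule ccontr)
    assume neg: "\<nexists>y. norm (y - x) \<le> r \<and> norm (B y) \<ge> 2/3 * r * norm B"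
    have 0: "norm (B z) \<le> 2/3 * r * norm B" if "norm z \<le> r" for z
    proof -
      have "norm (B (x + z)) < 2/3 * r * norm B" "norm (B (x - z)) < 2/3 * r * norm B"
        using neg[unfolded not_ex, rule_format, of "x + z"]
              neg[unfolded not_ex, rule_format, of "x - z"] that by (auto simp: not_le)
      moreover have "B (2 *\<^sub>R z) = B (x + z) - B (x - z)"
        by (simp add: blinfun.bilinear_simps flip: scaleR_2)
      then have "2 * norm (B z) \<le> norm (B (x + z)) + norm (B (x - z))"
        by (metis abs_numeral blinfun.scaleR_right norm_scaleR norm_triangle_ineq4)
      ultimately show ?thesis by simp
    qed
    have "norm (B z) \<le> (2/3 * norm B) * norm z" for z
    proof (cases "z = 0")
      case False
      have "norm (B ((r / norm z) *\<^sub>R z)) \<le> 2/3 * r * norm B"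
        by (rule 0) (use r False in auto)
      then show ?thesis using r False by (simp add: blinfun.scaleR_right field_simps)
    qed (simp add: blinfun.zero_right)
    then have "norm B \<le> 2/3 * norm B" by (intro norm_blinfun_bound) auto
    then have "norm B = 0" by simp
    then show False using neg r by (auto dest!: spec[of _ x])
  qed
  define P where "P k y x \<longleftrightarrow> norm (y - x) \<le> (1/3) ^ k \<and>
      norm (A (n k) y) \<ge> 2/3 * (1/3) ^ k * norm (A (n k))" for k y x
  have "\<exists>y. P k y x" for k x unfolding P_def using hump[of "(1/3)^k"] by simp
  then obtain G where G: "\<And>k x. P k (G k x) x" by metis
  define x where "x = rec_nat 0 (\<lambda>k y. G (Suc k) y)"
  have xS: "x (Suc k) = G (Suc k) (x k)" for k by (simp add: x_def)
  have step: "norm (x (Suc k) - x k) \<le> (1/3) ^ Suc k"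
    "norm (A (n (Suc k)) (x (Suc k))) \<ge> 2/3 * (1/3) ^ Suc k * norm (A (n (Suc k)))" for k
    using G[of "Suc k" "x k"] unfolding P_def xS by auto
  have far: "norm (x (k + j) - x k) \<le> 1/2 * (1/3) ^ k * (1 - (1/3)^j)" for k j
  proof (induction j)
    case (Suc j)
    have "norm (x (k + Suc j) - x k) \<le> norm (x (Suc (k + j)) - x (k + j)) + norm (x (k + j) - x k)"
      using norm_triangle_ineq[of "x (Suc (k+j)) - x (k+j)" "x (k+j) - x k"] by simp
    also have "\<dots> \<le> (1/3) ^ Suc (k + j) + 1/2 * (1/3) ^ k * (1 - (1/3)^j)"
      by (intro add_mono step Suc)
    also have "\<dots> = 1/2 * (1/3) ^ k * (1 - (1/3)^Suc j)" by (simp add: power_add field_simps)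
    finally show ?case .
  qed simp
  have far': "norm (x j - x k) \<le> 1/2 * (1/3)^k" if "k \<le> j" for j k
  proof -
    have "1/2 * (1/3::real)^k * (1 - (1/3)^(j - k)) \<le> 1/2 * (1/3)^k * 1" by (intro mult_left_mono) auto
    moreover have "k + (j - k) = j" using that by simp
    ultimately show ?thesis using far[of k "j - k"] by (simp only: mult_1_right)
  qed
  have "Cauchy x"
  proof (rule metric_CauchyI)
    fix e :: real assume "0 < e"
    then obtain N where N: "(1/3) ^ N < e" using real_arch_pow_inv[of e "1/3"] by auto
    have "dist (x i) (x j) < e" if "N \<le> i" "N \<le> j" for i j
      using far'[OF that(1)] far'[OF that(2)] N dist_triangle_less_add[of "x i" "x N" "e/2" "x j" "e/2"]
      by (simp add: dist_norm norm_minus_commute)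
    then show "\<exists>N. \<forall>m\<ge>N. \<forall>n\<ge>N. dist (x m) (x n) < e" by blast
  qed
  then obtain z where z: "x \<longlonglongrightarrow> z" using Cauchy_convergent convergent_def by blast
  have zk: "norm (z - x k) \<le> 1/2 * (1/3)^k" for k
    by (rule LIMSEQ_le_const2[of "\<lambda>j. norm (x j - x k)"])
      (intro tendsto_intros z, use far' in blast)
  obtain K where K: "\<And>i. norm (A i z) \<le> K" using bdd by blast
  \<comment> \<open>In units of (1/3)^(k+1) times the operator norm, the hump contributes 2/3 and
    all later corrections together remove at most 1/2. The remaining 1/6, multiplied by a norm above
    4^(k+1), is unbounded in k.\<close>
  have "1/6 * (4/3) ^ Suc k \<le> K" for k
  proof -
    let ?B = "A (n (Suc k))"
    have "norm (?B (x (Suc k))) \<le> norm (?B z) + norm (?B (x (Suc k) - z))"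
      by (simp add: blinfun.diff_right norm_triangle_sub)
    also have "norm (?B (x (Suc k) - z)) \<le> norm ?B * (1/2 * (1/3)^Suc k)"
      by (rule order_trans[OF norm_blinfun], intro mult_left_mono)
        (use zk[of "Suc k"] in \<open>simp_all only: norm_minus_commute norm_ge_zero\<close>)
    also have "norm (?B z) \<le> K" by (rule K)
    finally have "2/3 * (1/3) ^ Suc k * norm ?B \<le> K + norm ?B * (1/2 * (1/3) ^ Suc k)"
      using step(2)[of k] by linarith
    moreover have "norm ?B * (1/2 * (1/3) ^ Suc k) = 1/2 * ((1/3) ^ Suc k * norm ?B)"
      "2/3 * (1/3) ^ Suc k * norm ?B = 2/3 * ((1/3) ^ Suc k * norm ?B)"
      "1/6 * (1/3) ^ Suc k * norm ?B = 1/6 * ((1/3) ^ Suc k * norm ?B)"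
      by (simp_all only: mult_ac)
    ultimately have "1/6 * (1/3) ^ Suc k * norm ?B \<le> K" by linarith
    moreover have "1/6 * (1/3) ^ Suc k * 4 ^ Suc k \<le> 1/6 * (1/3) ^ Suc k * norm ?B"
      using n[of "Suc k"] by (intro mult_left_mono) auto
    moreover have "(4/3::real) ^ Suc k = (1/3) ^ Suc k * 4 ^ Suc k"
      by (simp only: flip: power_mult_distrib) simp
    ultimately show ?thesis by (metis (no_types, lifting) mult.assoc order_trans)
  qed
  then have le: "1/6 * (4/3) ^ Suc k \<le> K" for k .
  obtain k where k: "6 * K < (4/3) ^ k" using real_arch_pow[of "4/3" "6 * K"] by auto
  have "(4/3::real) ^ k \<le> (4/3) ^ Suc k" by simp
  then show False using le[of k] k by linarith
qed

section \<open>Norm bounds and joint continuity of a C0-semigroup\<close>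

lemma C0_semigroup_add:
  "C0_semigroup S \<Longrightarrow> 0 \<le> s \<Longrightarrow> 0 \<le> t \<Longrightarrow> S (s + t) x = S s (S t x)"
  by (simp add: C0_semigroup_def)

text \<open>Norms that are unbounded near 0 would explode along times tending to 0, although every
  orbit converges along these times; \<open>uniform_boundedness\<close> excludes this. The semigroup
  law then multiplies the local bound. A bound K of at least 1 has increasing powers and may serve
  as a divisor later.\<close>

lemma C0_semigroup_bounded:
  fixes S :: "real \<Rightarrow> 'h::banach \<Rightarrow>\<^sub>L 'h"
  assumes S: "C0_semigroup S"
  shows "\<exists>K\<ge>1. \<forall>t\<in>{0..b}. norm (S t) \<le> K"
proof -
  have "\<exists>d>0. \<exists>K. \<forall>t\<in>{0..d}. norm (S t) \<le> K"
  proof (rule ccontr)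
    assume "\<not> ?thesis"
    then have "\<forall>k::nat. \<exists>t\<in>{0..1 / Suc k}. norm (S t) > k"
      by (metis not_le of_nat_0_less_iff zero_less_Suc zero_less_divide_1_iff)
    then obtain t where t: "\<And>k. t k \<in> {0..1 / Suc k}" "\<And>k. norm (S (t k)) > real k" by metis
    have t0: "t \<longlonglongrightarrow> 0"
    proof (rule real_tendsto_sandwich[of "\<lambda>_. 0" _ _ "\<lambda>k. 1 / Suc k"])
      show "(\<lambda>k. 1 / real (Suc k)) \<longlonglongrightarrow> 0" by (intro LIMSEQ_Suc[OF lim_1_over_n])
    qed (use t(1) in auto)
    have "(\<lambda>k. S (t k) x) \<longlonglongrightarrow> x" for x
    proof -
      have *: "((\<lambda>r. S r x) \<longlongrightarrow> x) (at 0 within {0..})"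
      proof -
        have S0: "S 0 x = x" and r: "((\<lambda>t. S t x) \<longlongrightarrow> x) (at_right 0)"
          using S by (auto simp: C0_semigroup_def)
        have "at (0::real) within {0..} = at_right 0"
          by (rule at_within_nhd[of _ UNIV]) auto
        then show ?thesis using r by simp
      qed
      have "continuous_on {0} (\<lambda>r. S r x)" by simp
      have "continuous (at 0 within {0..}) (\<lambda>r. S r x)"
        using * S by (simp add: continuous_within C0_semigroup_def)
      then have "(\<lambda>k. S (t k) x) \<longlonglongrightarrow> S 0 x"
        using continuous_within_sequentially[of 0 "{0..}" "\<lambda>r. S r x"] t0 t(1)
        by (auto simp: o_def)
      then show ?thesis using S by (simp add: C0_semigroup_def)
    qed
    then have "\<exists>K. \<forall>k. norm (S (t k) x) \<le> K" for x
      using convergent_imp_bounded[of "\<lambda>k. S (t k) x"] by (auto simp: bounded_iff)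
    then obtain K where "\<And>k. norm (S (t k)) \<le> K" using uniform_boundedness[of "\<lambda>k. S (t k)"] by blast
    moreover obtain k :: nat where "K < k" using reals_Archimedean2 by blast
    ultimately show False using t(2)[of k] by (meson less_irrefl less_le_trans order_less_trans)
  qed
  then obtain d K0 where d: "d > 0" and K0: "\<And>t. t \<in> {0..d} \<Longrightarrow> norm (S t) \<le> K0" by blast
  define K where "K = max 1 K0"
  have K1: "K \<ge> 1" and K: "\<And>t. t \<in> {0..d} \<Longrightarrow> norm (S t) \<le> K"
    using K0 by (force simp: K_def)+
  have bd: "norm (S t) \<le> K ^ Suc n" if "t \<in> {0..real n * d}" for t n
    using that
  proof (induction n arbitrary: t)
    case 0
    then show ?case using K[of t] d by auto
  next
    case (Suc n)
    show ?case
    proof (cases "t \<le> d")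
      case True
      then have "norm (S t) \<le> K" using K Suc by auto
      also have "K \<le> K ^ Suc (Suc n)" using self_le_power[OF K1, of "Suc (Suc n)"] by simp
      finally show ?thesis .
    next
      case False
      have "S t = S d o\<^sub>L S (t - d)"
        using S False d unfolding C0_semigroup_def
        by (metis add.commute diff_add_cancel less_eq_real_def not_le diff_ge_0_iff_ge)
      then have "norm (S t) \<le> norm (S d) * norm (S (t - d))" by (simp add: norm_blinfun_compose)
      also have "\<dots> \<le> K * K ^ Suc n"
        by (intro mult_mono K Suc.IH) (use False Suc.prems d K1 in \<open>auto simp: algebra_simps\<close>)
      finally show ?thesis by simp
    qed
  qed
  obtain n :: nat where "b / d < n" using reals_Archimedean2 by blast
  then have "b < n * d" using d by (simp add: field_simps)
  then have "\<forall>t\<in>{0..b}. norm (S t) \<le> K ^ Suc n" using bd[of _ n] by auto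
  then show ?thesis using K1 by (intro exI[of _ "K ^ Suc n"]) (auto intro: one_le_power simp del: power_Suc)
qed

text \<open>Factoring out the smaller of two times reduces continuity in time to right continuity at
  0, and the local norm bound takes care of the vector. It is the joint form that later makes
  \<open>S (t - s) (f s \<omega>)\<close> measurable in (s, \<omega>).\<close>

lemma C0_semigroup_continuous:
  fixes S :: "real \<Rightarrow> 'h::banach \<Rightarrow>\<^sub>L 'h"
  assumes S: "C0_semigroup S"
  shows "continuous_on ({0..} \<times> UNIV) (\<lambda>(t, x). S t x)"
  unfolding continuous_on_iff
proof (intro ballI allI impI)
  fix p :: "real \<times> 'h" and e :: real assume "p \<in> {0..} \<times> UNIV" and e: "0 < e"
  then obtain t x where p: "p = (t, x)" and t: "0 \<le> t" by auto
  obtain K where K1: "K \<ge> 1" and K: "\<And>s. s \<in> {0..t + 1} \<Longrightarrow> norm (S s) \<le> K"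
    using C0_semigroup_bounded[OF S, of "t + 1"] by blast
  have "((\<lambda>r. S r x) \<longlongrightarrow> x) (at_right 0)" using S by (auto simp: C0_semigroup_def)
  moreover have "e / (2 * K) > 0" using e K1 by simp
  ultimately have "eventually (\<lambda>r. dist (S r x) x < e / (2 * K)) (at_right 0)" by (rule tendstoD)
  then obtain d where d: "d > 0" "\<And>r. 0 < r \<Longrightarrow> r < d \<Longrightarrow> dist (S r x) x < e / (2 * K)"
    unfolding eventually_at_right_field by auto
  have small: "norm (S r x - x) < e / (2 * K)" if "0 \<le> r" "r < d" for r
    using d(2)[of r] that S e K1 by (cases "r = 0") (auto simp: C0_semigroup_def dist_norm)
  have near: "norm (S s x - S t x) < e / 2" if s: "0 \<le> s" "\<bar>s - t\<bar> < min 1 d" for s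
  proof -
    define p q where "p = min s t" and "q = max s t"
    have "norm (S s x - S t x) = norm (S q x - S p x)"
      by (auto simp: p_def q_def min_def max_def norm_minus_commute)
    also have "S q x = S p (S (q - p) x)"
      using C0_semigroup_add[OF S, of p "q - p" x] s t by (auto simp: p_def q_def)
    also have "norm (S p (S (q - p) x) - S p x) \<le> norm (S p) * norm (S (q - p) x - x)"
      by (metis blinfun.diff_right norm_blinfun)
    also have "\<dots> \<le> K * norm (S (q - p) x - x)"
      using K[of p] s t by (intro mult_right_mono) (auto simp: p_def)
    also have "\<dots> < K * (e / (2 * K))"
      using small[of "q - p"] K1 s by (intro mult_strict_left_mono) (auto simp: p_def q_def)
    finally show ?thesis using K1 by simp
  qed
  define \<delta> where "\<delta> = min (min 1 d) (e / (2 * K))"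
  have "\<delta> > 0" using d e K1 by (simp add: \<delta>_def)
  moreover have "dist (S s y) (S t x) < e" if s: "0 \<le> s" "dist (s, y) (t, x) < \<delta>" for s y
  proof -
    have 1: "dist s t < \<delta>" "dist y x < \<delta>"
      using s dist_fst_le[of "(s,y)" "(t,x)"] dist_snd_le[of "(s,y)" "(t,x)"] by auto
    have "norm (S s (y - x)) \<le> norm (S s) * norm (y - x)" by (rule norm_blinfun)
    also have "\<dots> \<le> K * norm (y - x)"
      using K[of s] s 1 by (intro mult_right_mono) (auto simp: dist_norm \<delta>_def)
    also have "\<dots> < K * (e / (2 * K))"
      using 1 K1 by (intro mult_strict_left_mono) (auto simp: dist_norm \<delta>_def)
    finally have "norm (S s (y - x)) < e / 2" using K1 by simp
    moreover have "norm (S s x - S t x) < e / 2" using near[of s] s 1 by (auto simp: \<delta>_def dist_norm)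
    ultimately show ?thesis
      using norm_triangle_ineq[of "S s (y - x)" "S s x - S t x"] by (simp add: dist_norm blinfun.diff_right)
  qed
  ultimately show "\<exists>d>0. \<forall>x'\<in>{0..} \<times> UNIV. dist x' p < d \<longrightarrow>
      dist (case x' of (t, x) \<Rightarrow> S t x) (case p of (t, x) \<Rightarrow> S t x) < e"
    unfolding p by (intro exI[of _ \<delta>] conjI ballI impI) (auto simp del: dist_Pair_Pair)
qed

section \<open>Measurability up to null sets\<close>

text \<open>The coefficients are continuous in \<open>(x,u)\<close> only for almost every \<open>(t,\<omega>)\<close>, so their compositions with
  adapted processes are progressively measurable only up to a null set.\<close>

definition ae_measurable ::
  "'z measure \<Rightarrow> 'z measure \<Rightarrow> ('z \<Rightarrow> 'y::topological_space) \<Rightarrow> bool" where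
  "ae_measurable G N f \<longleftrightarrow> (\<exists>f'\<in>borel_measurable G. AE z in N. f z = f' z)"

lemma ae_measurableI: "f \<in> borel_measurable G \<Longrightarrow> ae_measurable G N f"
  by (auto simp: ae_measurable_def)

lemma ae_measurableI_AE:
  "f' \<in> borel_measurable G \<Longrightarrow> AE z in N. f z = f' z \<Longrightarrow> ae_measurable G N f"
  by (auto simp: ae_measurable_def)

lemma ae_measurable_const: "ae_measurable G N (\<lambda>z. c)"
  by (rule ae_measurableI) simp

lemma ae_measurable_cong_AE:
  assumes "ae_measurable G N f" "AE z in N. g z = f z"
  shows "ae_measurable G N g"
proof -
  obtain f' where f': "f' \<in> borel_measurable G" "AE z in N. f z = f' z"
    using assms(1) by (auto simp: ae_measurable_def)
  from assms(2) f'(2) have "AE z in N. g z = f' z" by eventually_elim simp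
  with f'(1) show ?thesis by (auto simp: ae_measurable_def)
qed

lemma ae_measurable_comp:
  assumes "ae_measurable G N f" "h \<in> borel_measurable borel"
  shows "ae_measurable G N (\<lambda>z. h (f z))"
proof -
  obtain f' where [measurable]: "f' \<in> borel_measurable G" and f': "AE z in N. f z = f' z"
    using assms(1) by (auto simp: ae_measurable_def)
  note [measurable] = assms(2)
  have "(\<lambda>z. h (f' z)) \<in> borel_measurable G" by measurable
  moreover have "AE z in N. h (f z) = h (f' z)" using f' by eventually_elim simp
  ultimately show ?thesis by (blast intro: ae_measurableI_AE)
qed

lemma ae_measurable_Pair:
  fixes f :: "'z \<Rightarrow> 'x::second_countable_topology" and g :: "'z \<Rightarrow> 'y::second_countable_topology"
  assumes "ae_measurable G N f" "ae_measurable G N g"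
  shows "ae_measurable G N (\<lambda>z. (f z, g z))"
proof -
  obtain f' g' where [measurable]: "f' \<in> borel_measurable G" "g' \<in> borel_measurable G"
    and *: "AE z in N. f z = f' z" "AE z in N. g z = g' z"
    using assms by (auto simp: ae_measurable_def)
  from * have "AE z in N. (f z, g z) = (f' z, g' z)" by eventually_elim simp
  moreover have "(\<lambda>z. (f' z, g' z)) \<in> borel_measurable G" by measurable
  ultimately show ?thesis by (blast intro: ae_measurableI_AE)
qed

lemma ae_measurable_comp2:
  fixes f :: "'z \<Rightarrow> 'x::second_countable_topology" and g :: "'z \<Rightarrow> 'y::second_countable_topology"
  assumes "ae_measurable G N f" "ae_measurable G N g"
    and "(\<lambda>p. h (fst p) (snd p)) \<in> borel_measurable borel"
  shows "ae_measurable G N (\<lambda>z. h (f z) (g z))"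
  using ae_measurable_comp[OF ae_measurable_Pair[OF assms(1,2)] assms(3)] by simp

lemma ae_measurable_add:
  fixes f g :: "'z \<Rightarrow> 'x::{second_countable_topology, real_normed_vector}"
  shows "ae_measurable G N f \<Longrightarrow> ae_measurable G N g \<Longrightarrow> ae_measurable G N (\<lambda>z. f z + g z)"
  by (rule ae_measurable_comp2[where h="(+)"]) (auto intro!: borel_measurable_continuous_onI continuous_intros)

lemma ae_measurable_diff:
  fixes f g :: "'z \<Rightarrow> 'x::{second_countable_topology, real_normed_vector}"
  shows "ae_measurable G N f \<Longrightarrow> ae_measurable G N g \<Longrightarrow> ae_measurable G N (\<lambda>z. f z - g z)"
  by (rule ae_measurable_comp2[where h="(-)"]) (auto intro!: borel_measurable_continuous_onI continuous_intros)

lemma ae_measurable_inner: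
  fixes f g :: "'z \<Rightarrow> 'x::{second_countable_topology, real_inner}"
  shows "ae_measurable G N f \<Longrightarrow> ae_measurable G N g \<Longrightarrow> ae_measurable G N (\<lambda>z. f z \<bullet> g z)"
  by (rule ae_measurable_comp2[where h="(\<bullet>)"]) (auto intro!: borel_measurable_continuous_onI continuous_intros)

lemma ae_measurable_norm:
  fixes f :: "'z \<Rightarrow> 'x::{second_countable_topology, real_normed_vector}"
  shows "ae_measurable G N f \<Longrightarrow> ae_measurable G N (\<lambda>z. norm (f z))"
  by (rule ae_measurable_comp[where h="norm"]) auto

lemma ae_measurable_scaleR:
  fixes f :: "'z \<Rightarrow> 'x::{second_countable_topology, real_normed_vector}"
  shows "ae_measurable G N f \<Longrightarrow> ae_measurable G N (\<lambda>z. c *\<^sub>R f z)"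
  by (rule ae_measurable_comp[where h="\<lambda>x. c *\<^sub>R x"]) auto

lemma ae_measurable_LIMSEQ:
  fixes f :: "nat \<Rightarrow> 'z \<Rightarrow> 'x::{second_countable_topology, banach}"
  assumes f: "\<And>n. ae_measurable G N (f n)" and lim: "AE z in N. (\<lambda>n. f n z) \<longlonglongrightarrow> g z"
  shows "ae_measurable G N g"
proof -
  have "\<exists>f'. f' \<in> borel_measurable G \<and> (AE z in N. f n z = f' z)" for n
    using f[of n] by (auto simp: ae_measurable_def)
  then obtain f' where [measurable]: "\<And>n. f' n \<in> borel_measurable G"
    and eq: "\<And>n. AE z in N. f n z = f' n z" by metis
  have "AE z in N. \<forall>n. f n z = f' n z" using eq by (simp add: AE_all_countable)
  with lim have "AE z in N. g z = lim (\<lambda>n. f' n z)"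
  proof eventually_elim
    case (elim z)
    then have "(\<lambda>n. f' n z) = (\<lambda>n. f n z)" by auto
    then show ?case using limI[OF elim(1)] by simp
  qed
  moreover have "(\<lambda>z. lim (\<lambda>n. f' n z)) \<in> borel_measurable G" by measurable
  ultimately show ?thesis by (blast intro: ae_measurableI_AE)
qed

lemma (in complete_measure) borel_measurable_cong_AE:
  assumes "f \<in> borel_measurable M" "AE z in M. g z = f z"
  shows "g \<in> borel_measurable M"
proof (rule borel_measurableI)
  fix S :: "'b set" assume "open S"
  have 1: "f -` S \<inter> space M \<in> sets M" using assms(1) \<open>open S\<close> by (auto intro: measurable_sets)
  have 2: "AE z in M. z \<in> f -` S \<inter> space M \<longleftrightarrow> z \<in> g -` S \<inter> space M"
    using assms(2) by eventually_elim auto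
  show "g -` S \<inter> space M \<in> sets M" by (rule in_sets_AE[OF 2 1]) simp
qed

lemma (in complete_measure) ae_measurable_borel:
  assumes "ae_measurable G M f" "sets G \<subseteq> sets M" "space G = space M"
  shows "f \<in> borel_measurable M"
proof -
  obtain f' where f': "f' \<in> borel_measurable G" "AE z in M. f z = f' z"
    using assms(1) by (auto simp: ae_measurable_def)
  have "f' \<in> borel_measurable M" using f'(1) assms(2,3) by (auto simp: measurable_def)
  then show ?thesis using f'(2) by (rule borel_measurable_cong_AE)
qed

text \<open>This is the reason why integrals over the time strip are later taken over its
  \<open>completion\<close>: compositions with the coefficients are honestly measurable
  there.\<close>

lemma ae_measurable_completion:
  assumes "ae_measurable G N f" "sets G \<subseteq> sets N" "space G = space N"
  shows "f \<in> borel_measurable (completion N)"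
proof (rule completion.ae_measurable_borel)
  show "ae_measurable N (completion N) f"
    using assms by (auto simp: ae_measurable_def AE_completion_iff measurable_def)
qed auto

section \<open>Separability: common null sets and Caratheodory functions\<close>

lemma separable_metric:
  fixes V :: "'e::{metric_space, second_countable_topology} set"
  obtains D where "countable D" "D \<subseteq> V" "\<And>p e. p \<in> V \<Longrightarrow> 0 < e \<Longrightarrow> \<exists>d\<in>D. dist d p < e"
proof -
  obtain D where D: "countable D" "D \<subseteq> V" "V \<subseteq> closure D" by (rule separable[of V])
  then show thesis by (intro that[of D]) (auto simp: closure_approachable)
qed

text \<open>Exchanges the order of "for all p" and "almost everywhere": countably many null sets
  belong to a dense subset of \<open>V\<close>, and continuity carries the inequality to the other
  points.\<close>

lemma AE_ball_le_0:
  fixes f :: "'z \<Rightarrow> 'e::{metric_space, second_countable_topology} \<Rightarrow> real"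
  assumes cont: "AE z in N. continuous_on V (f z)"
    and le: "\<And>p. p \<in> V \<Longrightarrow> AE z in N. f z p \<le> 0"
  shows "AE z in N. \<forall>p\<in>V. f z p \<le> 0"
proof -
  obtain D where D: "countable D" "D \<subseteq> V" "\<And>p e. p \<in> V \<Longrightarrow> 0 < e \<Longrightarrow> \<exists>d\<in>D. dist d p < e"
    by (rule separable_metric[of V]) (rule that)
  have "AE z in N. \<forall>p\<in>D. f z p \<le> 0" using D le by (subst AE_ball_countable) auto
  with cont show ?thesis
  proof eventually_elim
    case (elim z)
    show ?case
    proof
      fix p assume p: "p \<in> V"
      show "f z p \<le> 0"
      proof (rule field_le_epsilon)
        fix e :: real assume "0 < e"
        then obtain r where r: "r > 0" "\<And>q. q \<in> V \<Longrightarrow> dist q p < r \<Longrightarrow> dist (f z q) (f z p) < e"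
          using elim(1) p unfolding continuous_on_iff by meson
        obtain d where "d \<in> D" "dist d p < r" using D(3)[OF p r(1)] by blast
        then show "f z p \<le> 0 + e" using r(2)[of d] elim(2) D(2) by (force simp: dist_real_def)
      qed
    qed
  qed
qed

text \<open>A map measurable in z and continuous in e stays measurable after e is replaced by a
  measurable \<open>p z\<close>, because \<open>p\<close> is a pointwise limit of maps with
  countably many values. Continuity holds only almost everywhere, and so does the identification of
  the limit.\<close>

lemma ae_measurable_caratheodory:
  fixes \<psi> :: "'z \<Rightarrow> 'e::{metric_space, second_countable_topology} \<Rightarrow> 'y::{banach, second_countable_topology}"
  assumes p: "p \<in> borel_measurable G" and pV: "\<And>z. z \<in> space G \<Longrightarrow> p z \<in> V"
    and meas: "\<And>e. e \<in> V \<Longrightarrow> (\<lambda>z. \<psi> z e) \<in> borel_measurable G"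
    and cont: "AE z in N. continuous_on V (\<psi> z)" and space: "space N = space G"
  shows "ae_measurable G N (\<lambda>z. \<psi> z (p z))"
proof (cases "space G = {}")
  case True
  then have "AE z in N. \<psi> z (p z) = 0" using space by (intro AE_I2) auto
  then show ?thesis by (rule ae_measurable_cong_AE[OF ae_measurable_const])
next
  case False
  then have "V \<noteq> {}" using pV by auto
  obtain D where D: "countable D" "D \<subseteq> V" "\<And>p e. p \<in> V \<Longrightarrow> 0 < e \<Longrightarrow> \<exists>d\<in>D. dist d p < e"
    by (rule separable_metric[of V]) (rule that)
  have "D \<noteq> {}" using D(3) \<open>V \<noteq> {}\<close> by (metis all_not_in_conv less_numeral_extra(1))
  define d where "d = from_nat_into D"
  have dD: "d k \<in> D" for k using \<open>D \<noteq> {}\<close> by (simp add: d_def from_nat_into)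
  have ex: "\<exists>k. dist (d k) q < 1 / Suc n" if "q \<in> V" for q n
    using D(3)[OF that, of "1 / Suc n"] from_nat_into_surj[OF D(1)] unfolding d_def
    by (metis of_nat_0_less_iff zero_less_Suc zero_less_divide_1_iff)
  \<comment> \<open>The first point of the dense sequence within 1/(n+1) of \<open>p z\<close>. A
    least index is measurable, and inserting countably many fixed points only uses measurability of
    \<open>\<psi>\<close> at fixed arguments.\<close>
  define K where "K n z = (LEAST k. dist (d k) (p z) < 1 / Suc n)" for n z
  have K: "dist (d (K n z)) (p z) < 1 / Suc n" if "z \<in> space G" for n z
    unfolding K_def using LeastI_ex[OF ex[OF pV[OF that]]] .
  note p[measurable]
  have [measurable]: "K n \<in> measurable G (count_space UNIV)" for n
    unfolding K_def by measurable
  have "(\<lambda>z. \<psi> z (d (K n z))) \<in> borel_measurable G" for n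
  proof (rule measurable_compose_countable[where f="\<lambda>k z. \<psi> z (d k)" and g="K n"])
    show "(\<lambda>z. \<psi> z (d i)) \<in> borel_measurable G" for i
      by (rule meas) (use D(2) dD[of i] in blast)
  qed fact
  then have "ae_measurable G N (\<lambda>z. \<psi> z (d (K n z)))" for n by (rule ae_measurableI)
  then show ?thesis
  proof (rule ae_measurable_LIMSEQ)
    show "AE z in N. (\<lambda>n. \<psi> z (d (K n z))) \<longlonglongrightarrow> \<psi> z (p z)"
      using cont AE_space
    proof eventually_elim
      case (elim z)
      then have z: "z \<in> space G" using space by simp
      have "(\<lambda>n. d (K n z)) \<longlonglongrightarrow> p z"
      proof (rule metric_LIMSEQ_I)
        fix r :: real assume "0 < r"
        then obtain m where m: "1 / real (Suc m) < r" using nat_approx_posE by blast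
        have "dist (d (K n z)) (p z) < r" if "m \<le> n" for n
        proof -
          have "1 / real (Suc n) \<le> 1 / real (Suc m)" using that by (intro divide_left_mono) auto
          then show ?thesis using K[OF z, of n] m by linarith
        qed
        then show "\<exists>no. \<forall>n\<ge>no. dist (d (K n z)) (p z) < r" by blast
      qed
      then show ?case
        by (rule continuous_on_tendsto_compose[OF elim(1) _ pV[OF z]])
          (use dD D(2) in \<open>intro always_eventually allI; blast\<close>)
    qed
  qed
qed

section \<open>Null sets, sections and iterated integrals on the time strip\<close>

text \<open>\<open>Q\<close> is an arbitrary predicate, so its exceptional set need not be
  measurable; the swap of coordinates is applied to a measurable null set that contains it.\<close>

lemma (in pair_sigma_finite) AE_pair_swap:
  assumes "AE z in M1 \<Otimes>\<^sub>M M2. Q (fst z) (snd z)"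
  shows "AE y in M2. AE x in M1. Q x y"
proof -
  interpret Q: pair_sigma_finite M2 M1 ..
  have "AE z in M2 \<Otimes>\<^sub>M M1. Q (snd z) (fst z)"
  proof -
    obtain N where N: "N \<in> null_sets (M1 \<Otimes>\<^sub>M M2)"
      "{z \<in> space (M1 \<Otimes>\<^sub>M M2). \<not> Q (fst z) (snd z)} \<subseteq> N"
      using assms by (auto elim: AE_E3 simp: eventually_ae_filter)
    have "AE z in M1 \<Otimes>\<^sub>M M2. z \<notin> N" using N(1) by (rule AE_not_in)
    then have "AE z in distr (M2 \<Otimes>\<^sub>M M1) (M1 \<Otimes>\<^sub>M M2) (\<lambda>(x, y). (y, x)). z \<notin> N"
      by (subst (asm) distr_pair_swap)
    then have "AE z in M2 \<Otimes>\<^sub>M M1. (snd z, fst z) \<notin> N"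
      using AE_distr_iff[of "\<lambda>(x, y). (y, x)" "M2 \<Otimes>\<^sub>M M1" "M1 \<Otimes>\<^sub>M M2" "\<lambda>z. z \<notin> N"] N(1)
      by (auto simp: case_prod_unfold pred_def)
    with AE_space show ?thesis
      by eventually_elim (use N(2) in \<open>auto simp: space_pair_measure\<close>)
  qed
  from Q.AE_pair[OF this] show ?thesis by simp
qed

lemma sets_progressive_subset_space:
  "space (progressive_field F a b) = {a..b} \<times> space (F b)"
  unfolding progressive_field_def by (rule space_measure_of) auto

lemma nn_integral_restrict_Icc:
  "(\<integral>\<^sup>+s. f s \<partial>restrict_space lborel {a..b::real}) = (\<integral>\<^sup>+s. f s * indicator {a..b} s \<partial>lborel)"
  by (rule nn_integral_restrict_space) simp

text \<open>A bridge between two conventions: mild solutions, costs and transposition identities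
  integrate over \<open>lebesgue\<close>, while Fubini works with the restricted
  \<open>lborel\<close>. Completeness of \<open>lebesgue\<close> makes \<open>q\<close> measurable,
  as it agrees almost everywhere with a measurable function.\<close>

lemma set_lebesgue_integral_cong_restrict:
  fixes q q' :: "real \<Rightarrow> 'y::{banach, second_countable_topology}"
  assumes q': "integrable (restrict_space lborel {a..b}) q'"
    and eq: "AE s in restrict_space lborel {a..b}. q s = q' s"
  shows "set_integrable lebesgue {a..b} q"
    and "(LINT s:{a..b}|lebesgue. q s) = (LINT s|restrict_space lborel {a..b}. q' s)"
proof -
  have q'': "integrable lborel (\<lambda>s. indicator {a..b} s *\<^sub>R q' s)"
    using q' by (simp add: integrable_restrict_space)
  then have m: "(\<lambda>s. indicator {a..b} s *\<^sub>R q' s) \<in> borel_measurable lborel" by auto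
  have i: "integrable lebesgue (\<lambda>s. indicator {a..b} s *\<^sub>R q' s)"
    using q'' m by (simp add: integrable_completion)
  have ae: "AE s in lebesgue. indicator {a..b} s *\<^sub>R q s = indicator {a..b} s *\<^sub>R q' s"
  proof -
    have "AE s in lborel. s \<in> {a..b} \<longrightarrow> q s = q' s"
      using eq by (simp add: AE_restrict_space_iff)
    then have "AE s in lebesgue. s \<in> {a..b} \<longrightarrow> q s = q' s" by (rule AE_completion)
    then show ?thesis by eventually_elim (auto simp: indicator_def)
  qed
  have qm: "(\<lambda>s. indicator {a..b} s *\<^sub>R q s) \<in> borel_measurable lebesgue"
    by (rule completion.borel_measurable_cong_AE[OF _ ae]) (use i in auto)
  show "set_integrable lebesgue {a..b} q"
    unfolding set_integrable_def using integrable_cong_AE[OF qm _ ae] i by auto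
  show "(LINT s:{a..b}|lebesgue. q s) = (LINT s|restrict_space lborel {a..b}. q' s)"
  proof -
    have "(LINT s:{a..b}|lebesgue. q s) = (LINT s|lebesgue. indicator {a..b} s *\<^sub>R q' s)"
      unfolding set_lebesgue_integral_def by (rule integral_cong_AE[OF qm _ ae]) (use i in auto)
    also have "\<dots> = (LINT s|lborel. indicator {a..b} s *\<^sub>R q' s)"
      using m by (rule integral_completion)
    also have "\<dots> = (LINT s|restrict_space lborel {a..b}. q' s)"
      by (simp add: integral_restrict_space)
    finally show ?thesis .
  qed
qed

lemma finite_measure_restrict_Icc: "finite_measure (restrict_space lborel {a..b::real})"
  by (rule finite_measureI)
    (cases "a \<le> b"; simp add: space_restrict_space emeasure_restrict_space emeasure_lborel_Icc)

lemma pair_sigma_finite_time_space: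
  assumes "prob_space M"
  shows "pair_sigma_finite (restrict_space lborel {a..b::real}) M"
proof -
  interpret prob_space M by fact
  interpret L: finite_measure "restrict_space lborel {a..b::real}" by (rule finite_measure_restrict_Icc)
  show ?thesis ..
qed

lemma finite_measure_time_space:
  assumes "prob_space M"
  shows "finite_measure (time_space M a b)"
proof -
  interpret prob_space M by fact
  interpret L: finite_measure "restrict_space lborel {a..b::real}" by (rule finite_measure_restrict_Icc)
  show ?thesis
    by (rule finite_measureI)
      (simp only: space_pair_measure emeasure_pair_measure_Times sets.top L.emeasure_eq_measure
        emeasure_eq_measure ennreal_mult[symmetric], simp flip: ennreal_mult')
qed

lemma nn_integral_time_space:
  assumes "prob_space M" "f \<in> borel_measurable (time_space M a b)"
  shows "(\<integral>\<^sup>+z. f z \<partial>time_space M a b) = (\<integral>\<^sup>+s. (\<integral>\<^sup>+\<omega>. f (s, \<omega>) \<partial>M) * indicator {a..b} s \<partial>lborel)"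
proof -
  interpret prob_space M by fact
  show ?thesis using nn_integral_fst[OF assms(2)] by (simp add: nn_integral_restrict_Icc)
qed

lemma measurable_time_space_mono:
  assumes "{c..d} \<subseteq> {a..b::real}"
  shows "(\<lambda>z. z) \<in> measurable (time_space M c d) (time_space M a b)"
proof -
  have "(\<lambda>x. x) \<in> measurable (restrict_space lborel {c..d}) (restrict_space lborel {a..b})"
    by (rule measurable_restrict_space3) (use assms in auto)
  then have "(\<lambda>z. (fst z, snd z)) \<in> measurable (time_space M c d) (time_space M a b)"
    by measurable
  then show ?thesis by simp
qed

lemma nn_integral_time_space_mono:
  assumes "prob_space M" "{c..d} \<subseteq> {a..b}" "f \<in> borel_measurable (time_space M a b)"
  shows "(\<integral>\<^sup>+z. f z \<partial>time_space M c d) = (\<integral>\<^sup>+z. f z * indicator {c..d} (fst z) \<partial>time_space M a b)"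
proof -
  have f': "f \<in> borel_measurable (time_space M c d)"
    using measurable_compose[OF measurable_time_space_mono[OF assms(2)] assms(3)] .
  have [measurable]: "fst \<in> measurable (time_space M a b) borel"
    by (rule measurable_compose[OF measurable_fst]) (simp add: measurable_restrict_space1)
  have f'': "(\<lambda>z. f z * indicator {c..d} (fst z)) \<in> borel_measurable (time_space M a b)"
    using assms(3) by measurable
  show ?thesis
    unfolding nn_integral_time_space[OF assms(1) f'] nn_integral_time_space[OF assms(1) f'']
    using assms(2) by (intro nn_integral_cong) (auto simp: indicator_def)
qed

lemma AE_time_space_mono:
  assumes M: "prob_space M" and sub: "{c..d} \<subseteq> {a..b}" and AE: "AE z in time_space M a b. Q z"
  shows "AE z in time_space M c d. Q z"
proof -
  obtain N where N: "N \<in> null_sets (time_space M a b)" "{z \<in> space (time_space M a b). \<not> Q z} \<subseteq> N"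
    using AE by (auto simp: eventually_ae_filter)
  have "AE z in time_space M a b. indicator N z = (0::ennreal)"
    using AE_not_in[OF N(1)] by eventually_elim simp
  then have "(\<integral>\<^sup>+z. indicator N z * indicator {c..d} (fst z) \<partial>time_space M a b) = (\<integral>\<^sup>+z. 0 \<partial>time_space M a b)"
    by (intro nn_integral_cong_AE) (auto elim: eventually_mono)
  then have "(\<integral>\<^sup>+z. indicator N z \<partial>time_space M c d) = (0::ennreal)"
    using nn_integral_time_space_mono[OF M sub, of "indicator N"] N(1) by auto
  moreover have "(\<lambda>z. indicator N z) \<in> borel_measurable (time_space M c d)"
    by (rule measurable_compose[OF measurable_time_space_mono[OF sub]]) (use N(1) in auto)
  ultimately have "AE z in time_space M c d. indicator N z = (0::ennreal)"
    by (subst (asm) nn_integral_0_iff_AE) auto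
  with AE_space show ?thesis
  proof eventually_elim
    case (elim z)
    then have "z \<in> space (time_space M a b)"
      using sub by (auto simp: space_pair_measure space_restrict_space)
    with elim(2) N(2) show ?case by (auto simp: indicator_def split: if_splits)
  qed
qed

text \<open>Fubini for the completed product. For almost every \<omega> the section of
  \<open>f\<close> agrees almost everywhere with that of a product measurable version; completeness
  of \<open>M\<close> then makes the inner integral measurable in \<omega>.\<close>

lemma integral_iterated:
  fixes f :: "real \<times> 'w \<Rightarrow> real"
  assumes M: "prob_space M" "complete_measure M" and f: "integrable (completion (time_space M a b)) f"
  shows "integrable M (\<lambda>\<omega>. (LINT s:{a..b}|lebesgue. f (s, \<omega>)))"
    and "(LINT \<omega>|M. (LINT s:{a..b}|lebesgue. f (s, \<omega>))) = (LINT z|completion (time_space M a b). f z)"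
proof -
  interpret pair_sigma_finite "restrict_space lborel {a..b}" M by (rule pair_sigma_finite_time_space[OF M(1)])
  obtain f' where f'm[measurable]: "f' \<in> borel_measurable (time_space M a b)"
    and eq: "AE z in time_space M a b. f z = f' z"
    using completion_ex_borel_measurable_real[OF borel_measurable_integrable[OF f]] by (elim bexE)
  have eqc: "AE z in completion (time_space M a b). f z = f' z" using eq by (rule AE_completion)
  have "integrable (completion (time_space M a b)) f'"
    using f integrable_cong_AE[OF borel_measurable_integrable[OF f] measurable_completion[OF f'm] eqc]
    by simp
  then have f': "integrable (time_space M a b) f'" using f'm by (simp add: integrable_completion)
  have "AE \<omega> in M. integrable (restrict_space lborel {a..b}) (\<lambda>s. f' (s, \<omega>))"
    using AE_integrable_snd[of "\<lambda>s \<omega>. f' (s, \<omega>)"] f' by simp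
  moreover have "AE \<omega> in M. AE s in restrict_space lborel {a..b}. f (s, \<omega>) = f' (s, \<omega>)"
    using eq by (intro AE_pair_swap) simp
  ultimately have ae: "AE \<omega> in M. (LINT s:{a..b}|lebesgue. f (s, \<omega>))
      = (LINT s|restrict_space lborel {a..b}. f' (s, \<omega>))"
    by eventually_elim (rule set_lebesgue_integral_cong_restrict(2))
  have i: "integrable M (\<lambda>\<omega>. LINT s|restrict_space lborel {a..b}. f' (s, \<omega>))"
    using integrable_snd[of "\<lambda>s \<omega>. f' (s, \<omega>)"] f' by simp
  have m: "(\<lambda>\<omega>. (LINT s:{a..b}|lebesgue. f (s, \<omega>))) \<in> borel_measurable M"
    by (rule complete_measure.borel_measurable_cong_AE[OF M(2) borel_measurable_integrable[OF i] ae])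
  show "integrable M (\<lambda>\<omega>. (LINT s:{a..b}|lebesgue. f (s, \<omega>)))"
    using integrable_cong_AE[OF m borel_measurable_integrable[OF i] ae] i by simp
  have "(LINT \<omega>|M. (LINT s:{a..b}|lebesgue. f (s, \<omega>))) = (LINT \<omega>|M. (LINT s|restrict_space lborel {a..b}. f' (s, \<omega>)))"
    by (rule integral_cong_AE[OF m borel_measurable_integrable[OF i] ae])
  also have "\<dots> = (LINT z|time_space M a b. f' z)"
    using integral_snd[of "\<lambda>s \<omega>. f' (s, \<omega>)"] f' by simp
  also have "\<dots> = (LINT z|completion (time_space M a b). f' z)"
    by (simp add: integral_completion)
  also have "\<dots> = (LINT z|completion (time_space M a b). f z)"
    by (rule integral_cong_AE[symmetric, OF borel_measurable_integrable[OF f] measurable_completion[OF f'm] eqc])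
  finally show "(LINT \<omega>|M. (LINT s:{a..b}|lebesgue. f (s, \<omega>))) = (LINT z|completion (time_space M a b). f z)" .
qed

section \<open>The mean square functional\<close>

text \<open>Values in \<open>ennreal\<close> free the estimates from integrability side conditions;
  finiteness is checked only where it is used.\<close>

definition msq :: "'z measure \<Rightarrow> ('z \<Rightarrow> 'x::real_normed_vector) \<Rightarrow> ennreal" where
  "msq M f = (\<integral>\<^sup>+z. ennreal ((norm (f z))\<^sup>2) \<partial>M)"

lemma msq_cong_AE: "AE z in M. norm (f z) = norm (g z) \<Longrightarrow> msq M f = msq M g"
  unfolding msq_def by (rule nn_integral_cong_AE) (auto elim: eventually_mono)

lemma msq_mono_AE: "AE z in M. norm (f z) \<le> norm (g z) \<Longrightarrow> msq M f \<le> msq M g"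
  unfolding msq_def
  by (rule nn_integral_mono_AE) (auto elim!: eventually_mono intro!: ennreal_leI power_mono)

lemma msq_scale_le:
  fixes f :: "'z \<Rightarrow> 'x::real_normed_vector" and g :: "'z \<Rightarrow> 'y::{real_normed_vector, second_countable_topology}"
  assumes "g \<in> borel_measurable M" "0 \<le> c" "AE z in M. norm (f z) \<le> c * norm (g z)"
  shows "msq M f \<le> ennreal (c\<^sup>2) * msq M g"
proof -
  have "msq M f \<le> (\<integral>\<^sup>+z. ennreal (c\<^sup>2) * ennreal ((norm (g z))\<^sup>2) \<partial>M)"
    unfolding msq_def
  proof (rule nn_integral_mono_AE)
    show "AE z in M. ennreal ((norm (f z))\<^sup>2) \<le> ennreal (c\<^sup>2) * ennreal ((norm (g z))\<^sup>2)"
      using assms(3)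
    proof eventually_elim
      case (elim z)
      then have "(norm (f z))\<^sup>2 \<le> (c * norm (g z))\<^sup>2" by (intro power_mono) auto
      then show ?case by (simp add: ennreal_mult'[symmetric] power_mult_distrib ennreal_leI)
    qed
  qed
  also have "\<dots> = ennreal (c\<^sup>2) * msq M g"
    unfolding msq_def by (rule nn_integral_cmult) (use assms(1) in measurable)
  finally show ?thesis .
qed

text \<open>Squared norms obey the triangle inequality up to a factor 2. This quasi-metric form
  takes the place of the Minkowski inequality in all mean square estimates below.\<close>

lemma norm_add_sq_le: "(norm (x + y))\<^sup>2 \<le> 2 * (norm x)\<^sup>2 + 2 * (norm (y::'x::real_normed_vector))\<^sup>2"
proof -
  have "(norm (x + y))\<^sup>2 \<le> (norm x + norm y)\<^sup>2" by (intro power_mono norm_triangle_ineq) auto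
  moreover have "0 \<le> (norm x - norm y)\<^sup>2" by simp
  ultimately show ?thesis by (simp add: power2_sum power2_diff)
qed

lemma msq_add_le:
  fixes f g :: "'z \<Rightarrow> 'x::{real_normed_vector, second_countable_topology}"
  assumes [measurable]: "f \<in> borel_measurable M" "g \<in> borel_measurable M"
  shows "msq M (\<lambda>z. f z + g z) \<le> 2 * msq M f + 2 * msq M g"
proof -
  have "msq M (\<lambda>z. f z + g z) \<le> (\<integral>\<^sup>+z. 2 * ennreal ((norm (f z))\<^sup>2) + 2 * ennreal ((norm (g z))\<^sup>2) \<partial>M)"
    unfolding msq_def
  proof (rule nn_integral_mono)
    fix z
    have "ennreal ((norm (f z + g z))\<^sup>2) \<le> ennreal (2 * (norm (f z))\<^sup>2 + 2 * (norm (g z))\<^sup>2)"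
      by (intro ennreal_leI norm_add_sq_le)
    then show "ennreal ((norm (f z + g z))\<^sup>2) \<le> 2 * ennreal ((norm (f z))\<^sup>2) + 2 * ennreal ((norm (g z))\<^sup>2)"
      by (simp add: ennreal_mult)
  qed
  also have "\<dots> = 2 * msq M f + 2 * msq M g"
    unfolding msq_def by (simp add: nn_integral_add nn_integral_cmult)
  finally show ?thesis .
qed

lemma msq_minus: "msq M (\<lambda>z. - f z) = msq M f"
  by (simp add: msq_def)

lemma msq_commute: "msq M (\<lambda>z. f z - g z) = msq M (\<lambda>z. g z - f z)"
  by (simp add: msq_def norm_minus_commute)

lemma msq_diff_le:
  fixes f g :: "'z \<Rightarrow> 'x::{real_normed_vector, second_countable_topology}"
  assumes [measurable]: "f \<in> borel_measurable M" "g \<in> borel_measurable M"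
  shows "msq M (\<lambda>z. f z - g z) \<le> 2 * msq M f + 2 * msq M g"
  using msq_add_le[of f M "\<lambda>z. - g z"] by (simp add: msq_minus)

lemma msq_triangle:
  fixes f g h :: "'z \<Rightarrow> 'x::{real_normed_vector, second_countable_topology}"
  assumes [measurable]: "f \<in> borel_measurable M" "g \<in> borel_measurable M" "h \<in> borel_measurable M"
  shows "msq M (\<lambda>z. f z - h z) \<le> 2 * msq M (\<lambda>z. f z - g z) + 2 * msq M (\<lambda>z. g z - h z)"
  using msq_add_le[of "\<lambda>z. f z - g z" M "\<lambda>z. g z - h z"] by simp

lemma msq_eq_integral:
  assumes "integrable M (\<lambda>z. (norm (f z))\<^sup>2)"
  shows "msq M f = ennreal (LINT z|M. (norm (f z))\<^sup>2)"
  unfolding msq_def by (rule nn_integral_eq_integral[OF assms]) auto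

lemma integrable_sq_iff:
  fixes f :: "'z \<Rightarrow> 'x::{real_normed_vector, second_countable_topology}"
  assumes [measurable]: "f \<in> borel_measurable M"
  shows "integrable M (\<lambda>z. (norm (f z))\<^sup>2) \<longleftrightarrow> msq M f < \<infinity>"
  unfolding msq_def integrable_iff_bounded by simp

lemma integral_sq_enn2real:
  fixes f :: "'z \<Rightarrow> 'x::{real_normed_vector, second_countable_topology}"
  assumes [measurable]: "f \<in> borel_measurable M"
  shows "(LINT z|M. (norm (f z))\<^sup>2) = enn2real (msq M f)"
  unfolding msq_def by (rule integral_eq_nn_integral) auto

lemma L2_rv_iff:
  fixes \<xi> :: "'w \<Rightarrow> 'x::{real_normed_vector, second_countable_topology}"
  assumes "subalgebra M G"
  shows "\<xi> \<in> L2_rv M G \<longleftrightarrow> \<xi> \<in> borel_measurable G \<and> msq M \<xi> < \<infinity>"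
proof -
  have "\<xi> \<in> borel_measurable M" if "\<xi> \<in> borel_measurable G"
    using that by (rule measurable_from_subalg[OF assms])
  then show ?thesis unfolding L2_rv_def mem_Collect_eq using integrable_sq_iff by blast
qed

lemma msq_lborel_Icc_integral_le:
  fixes f :: "real \<Rightarrow> 'x::{banach, second_countable_topology}"
  assumes [measurable]: "f \<in> borel_measurable (restrict_space lborel {a..b})" and "a \<le> b"
  shows "ennreal ((norm (LINT s|restrict_space lborel {a..b}. f s))\<^sup>2)
    \<le> ennreal (b - a) * msq (restrict_space lborel {a..b}) f"
proof (cases "integrable (restrict_space lborel {a..b}) f")
  case True
  let ?L = "restrict_space lborel {a..b}"
  have "ennreal ((norm (LINT s|?L. f s))\<^sup>2) = (ennreal (norm (LINT s|?L. f s)))\<^sup>2"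
    by (simp add: ennreal_power)
  also have "\<dots> \<le> (\<integral>\<^sup>+s. ennreal (norm (f s)) * 1 \<partial>?L)\<^sup>2"
    using integral_norm_bound_ennreal[OF True] by (intro power_mono) auto
  also have "\<dots> \<le> (\<integral>\<^sup>+s. (ennreal (norm (f s)))\<^sup>2 \<partial>?L) * (\<integral>\<^sup>+s. 1\<^sup>2 \<partial>?L)"
    by (rule Cauchy_Schwarz_nn_integral) auto
  also have "(\<integral>\<^sup>+s. 1\<^sup>2 \<partial>?L) = ennreal (b - a)"
    using \<open>a \<le> b\<close> by (simp add: space_restrict_space emeasure_restrict_space)
  finally show ?thesis by (simp add: msq_def ennreal_power mult.commute)
next
  case False
  \<comment> \<open>The Bochner integral of a function that is not integrable is 0 by
    convention.\<close>
  then show ?thesis by (simp add: not_integrable_integral_eq)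
qed

text \<open>The factor 2 is the sum of the geometric tail with ratio 1/2.\<close>

lemma geometric_increments:
  fixes x :: "nat \<Rightarrow> 'x::banach"
  assumes d: "\<And>i. norm (x (Suc i) - x i) \<le> c * (1/2) ^ i"
  shows "convergent x" and "norm (x k - lim x) \<le> 2 * c * (1/2) ^ k"
proof -
  have c: "0 \<le> c" using order_trans[OF norm_ge_zero d[of 0]] by simp
  have far: "norm (x (k + j) - x k) \<le> 2 * c * (1/2)^k * (1 - (1/2)^j)" for k j
  proof (induction j)
    case (Suc j)
    have "norm (x (k + Suc j) - x k) \<le> norm (x (Suc (k + j)) - x (k + j)) + norm (x (k + j) - x k)"
      using norm_triangle_ineq[of "x (Suc (k+j)) - x (k+j)" "x (k+j) - x k"] by simp
    also have "\<dots> \<le> c * (1/2) ^ (k + j) + 2 * c * (1/2)^k * (1 - (1/2)^j)"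
      by (intro add_mono d Suc)
    also have "\<dots> = 2 * c * (1/2)^k * (1 - (1/2)^Suc j)" by (simp add: power_add algebra_simps)
    finally show ?case .
  qed simp
  have far': "norm (x j - x k) \<le> 2 * c * (1/2)^k" if "k \<le> j" for j k
  proof -
    have "2 * c * (1/2)^k * (1 - (1/2)^(j-k)) \<le> 2 * c * (1/2)^k * 1"
      using c by (intro mult_left_mono) auto
    moreover have "k + (j - k) = j" using that by simp
    ultimately show ?thesis using far[of k "j - k"] by simp
  qed
  have "Cauchy x"
  proof (rule metric_CauchyI)
    fix e :: real assume "0 < e"
    then obtain N where N: "(1/2) ^ N < e / (4 * c + 1)"
      using real_arch_pow_inv[of "e / (4 * c + 1)" "1/2"] c by auto
    have "4 * c * (1/2)^N \<le> (4 * c + 1) * (1/2)^N" by (intro mult_right_mono) auto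
    also have "\<dots> < e" using N c by (simp add: field_simps)
    finally have e: "4 * c * (1/2)^N < e" .
    have "dist (x i) (x j) < e" if "N \<le> i" "N \<le> j" for i j
      using far'[OF that(1)] far'[OF that(2)] e dist_triangle2[of "x i" "x j" "x N"]
      by (simp add: dist_norm norm_minus_commute)
    then show "\<exists>N. \<forall>m\<ge>N. \<forall>n\<ge>N. dist (x m) (x n) < e" by blast
  qed
  then show conv: "convergent x" by (simp add: Cauchy_convergent)
  then have "(\<lambda>j. norm (x k - x j)) \<longlonglongrightarrow> norm (x k - lim x)"
    by (intro tendsto_intros) (simp add: convergent_LIMSEQ_iff)
  then show "norm (x k - lim x) \<le> 2 * c * (1/2) ^ k"
    by (rule LIMSEQ_le_const2) (use far' in \<open>auto simp: norm_minus_commute[of "x k"]\<close>)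
qed

text \<open>Turns fast convergence in mean square into pointwise convergence almost everywhere. The
  limit is the concrete function \<open>lim\<close>, which is measurable for every sigma-field for
  which the \<open>J k\<close> are; adaptedness of stochastic integrals, of continuous versions and
  of Picard limits is obtained in this way.\<close>

lemma msq_fast_limit:
  fixes J :: "nat \<Rightarrow> 'z \<Rightarrow> 'x::{banach, second_countable_topology}"
  assumes J[measurable]: "\<And>k. J k \<in> borel_measurable M"
    and d: "\<And>k. msq M (\<lambda>z. J (Suc k) z - J k z) \<le> ennreal (C * (1/16)^k)" and C: "0 \<le> C"
  shows "AE z in M. convergent (\<lambda>k. J k z)"
    and "msq M (\<lambda>z. J k z - lim (\<lambda>k. J k z)) \<le> ennreal (8 * C * (1/4)^k)"
proof -
  define D where "D i z = ennreal ((norm (J (Suc i) z - J i z))\<^sup>2)" for i z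
  \<comment> \<open>The weight 4^i splits the decay 16^(-i) in two: one factor 4^(-i) keeps
    \<open>g\<close> integrable, the other forces increments of order 2^(-i) wherever
    \<open>g\<close> is finite.\<close>
  define g where "g z = (\<Sum>i. ennreal (4^i) * D i z)" for z
  have [measurable]: "D i \<in> borel_measurable M" for i unfolding D_def by measurable
  have [measurable]: "g \<in> borel_measurable M" unfolding g_def by measurable
  have "(\<integral>\<^sup>+z. g z \<partial>M) = (\<Sum>i. \<integral>\<^sup>+z. ennreal (4^i) * D i z \<partial>M)"
    unfolding g_def by (rule nn_integral_suminf) measurable
  also have "\<dots> = (\<Sum>i. ennreal (4^i) * (\<integral>\<^sup>+z. D i z \<partial>M))"
    by (intro suminf_cong nn_integral_cmult) measurable
  also have "\<dots> \<le> (\<Sum>i. ennreal (C * (1/4)^i))"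
  proof (rule suminf_le)
    fix i
    have "ennreal (4^i) * (\<integral>\<^sup>+z. D i z \<partial>M) \<le> ennreal (4^i) * ennreal (C * (1/16)^i)"
      using d[of i] by (intro mult_left_mono) (auto simp: msq_def D_def)
    also have "\<dots> = ennreal (4^i * (C * (1/16)^i))" using C by (subst ennreal_mult) auto
    also have "4^i * (C * (1/16)^i) = C * (4 * (1/16))^i" by (simp only: power_mult_distrib mult_ac)
    finally show "ennreal (4^i) * (\<integral>\<^sup>+z. D i z \<partial>M) \<le> ennreal (C * (1/4)^i)" by simp
  qed auto
  also have "\<dots> = ennreal (C * (4/3))"
  proof -
    have "(\<lambda>i. (1/4::real)^i) sums (1 / (1 - 1/4))" by (rule geometric_sums) simp
    then have "(\<lambda>i. C * (1/4)^i) sums (C * (4/3))" by (intro sums_mult) simp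
    then show ?thesis using C by (intro suminf_ennreal_eq) auto
  qed
  finally have Ig: "(\<integral>\<^sup>+z. g z \<partial>M) \<le> ennreal (C * (4/3))" .
  then have "(\<integral>\<^sup>+z. g z \<partial>M) \<noteq> \<infinity>" by (auto simp: top_unique)
  then have gfin: "AE z in M. g z \<noteq> \<infinity>" by (intro nn_integral_PInf_AE) auto
  have key: "norm (J (Suc i) z - J i z) \<le> sqrt (enn2real (g z)) * (1/2)^i" if "g z \<noteq> \<infinity>" for i z
  proof -
    have "ennreal (4^i) * D i z \<le> g z"
      unfolding g_def using sum_le_suminf[of "\<lambda>i. ennreal (4^i) * D i z" "{i}"] by simp
    also have "g z = ennreal (enn2real (g z))" using that by (simp add: less_top)
    finally have "4^i * (norm (J (Suc i) z - J i z))\<^sup>2 \<le> enn2real (g z)"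
      unfolding D_def by (simp add: ennreal_mult'[symmetric] del: ennreal_enn2real)
    moreover have "(2^i)\<^sup>2 = (4::real)^i" by (simp only: power2_eq_square flip: power_mult_distrib) simp
    ultimately have "(2^i * norm (J (Suc i) z - J i z))\<^sup>2 \<le> enn2real (g z)"
      by (simp only: power_mult_distrib)
    then have "2^i * norm (J (Suc i) z - J i z) \<le> sqrt (enn2real (g z))"
      by (rule real_le_rsqrt)
    then show ?thesis by (simp add: field_simps power_one_over)
  qed
  show "AE z in M. convergent (\<lambda>k. J k z)"
    using gfin by eventually_elim (rule geometric_increments(1), rule key)
  have "msq M (\<lambda>z. J k z - lim (\<lambda>k. J k z)) \<le> (\<integral>\<^sup>+z. ennreal (4 * (1/4)^k) * g z \<partial>M)"
    unfolding msq_def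
  proof (rule nn_integral_mono_AE)
    show "AE z in M. ennreal ((norm (J k z - lim (\<lambda>k. J k z)))\<^sup>2) \<le> ennreal (4 * (1/4)^k) * g z"
      using gfin
    proof eventually_elim
      case (elim z)
      have "norm (J k z - lim (\<lambda>k. J k z)) \<le> 2 * sqrt (enn2real (g z)) * (1/2)^k"
        by (rule geometric_increments(2)[of "\<lambda>k. J k z"]) (rule key[OF elim])
      then have "(norm (J k z - lim (\<lambda>k. J k z)))\<^sup>2 \<le> (2 * sqrt (enn2real (g z)) * (1/2)^k)\<^sup>2"
        by (intro power_mono) auto
      also have "\<dots> = 4 * (1/4)^k * enn2real (g z)"
      proof -
        have "((1/2)^k)\<^sup>2 = (1/4::real)^k" by (simp only: power2_eq_square flip: power_mult_distrib) simp
        then show ?thesis by (simp add: power_mult_distrib)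
      qed
      finally have "ennreal ((norm (J k z - lim (\<lambda>k. J k z)))\<^sup>2) \<le> ennreal (4 * (1/4)^k * enn2real (g z))"
        by (rule ennreal_leI)
      also have "\<dots> = ennreal (4 * (1/4)^k) * g z"
        using elim by (simp add: ennreal_mult less_top)
      finally show ?case .
    qed
  qed
  also have "\<dots> = ennreal (4 * (1/4)^k) * (\<integral>\<^sup>+z. g z \<partial>M)" by (rule nn_integral_cmult) measurable
  also have "\<dots> \<le> ennreal (4 * (1/4)^k) * ennreal (C * (4/3))" using Ig by (rule mult_left_mono) simp
  also have "\<dots> = ennreal (4 * (1/4)^k * (C * (4/3)))" using C by (subst ennreal_mult) auto
  also have "\<dots> \<le> ennreal (8 * C * (1/4)^k)"
    using C by (intro ennreal_leI) (simp add: mult_ac)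
  finally show "msq M (\<lambda>z. J k z - lim (\<lambda>k. J k z)) \<le> ennreal (8 * C * (1/4)^k)" .
qed

section \<open>Consequences of the compactness of the time interval\<close>

text \<open>The Heine-Cantor argument for the quasi-metric that compares two random variables by the
  second moment of their difference. The factors 2 of the triangle inequality are absorbed by
  working with e/4.\<close>

lemma uniformly_continuous_quasimetric:
  fixes d :: "real \<Rightarrow> real \<Rightarrow> real"
  assumes tri: "\<And>r s t. \<lbrakk>r \<in> {a..b}; s \<in> {a..b}; t \<in> {a..b}\<rbrakk> \<Longrightarrow> d s t \<le> 2 * d s r + 2 * d t r"
    and lim: "\<And>t. t \<in> {a..b} \<Longrightarrow> ((\<lambda>s. d s t) \<longlongrightarrow> 0) (at t within {a..b})"
    and refl: "\<And>t. t \<in> {a..b} \<Longrightarrow> d t t = 0" and e: "0 < e"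
  shows "\<exists>\<delta>>0. \<forall>s\<in>{a..b}. \<forall>t\<in>{a..b}. \<bar>s - t\<bar> < \<delta> \<longrightarrow> d s t < e"
proof -
  have "\<exists>\<delta>>0. \<forall>s\<in>{a..b}. \<bar>s - t\<bar> < \<delta> \<longrightarrow> d s t < e / 4" if t: "t \<in> {a..b}" for t
  proof -
    have "eventually (\<lambda>s. d s t < e / 4) (at t within {a..b})"
      using lim[OF t] e by (intro order_tendstoD) auto
    then obtain \<delta> where "\<delta> > 0" "\<And>s. s \<in> {a..b} \<Longrightarrow> s \<noteq> t \<Longrightarrow> dist s t < \<delta> \<Longrightarrow> d s t < e / 4"
      unfolding eventually_at by blast
    then show ?thesis
      using refl[OF t] e by (intro exI[of _ \<delta>]) (metis divide_pos_pos dist_real_def zero_less_numeral)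
  qed
  then obtain \<delta> where \<delta>: "\<And>t. t \<in> {a..b} \<Longrightarrow> \<delta> t > 0"
    "\<And>s t. t \<in> {a..b} \<Longrightarrow> s \<in> {a..b} \<Longrightarrow> \<bar>s - t\<bar> < \<delta> t \<Longrightarrow> d s t < e / 4"
    by metis
  obtain \<epsilon> where \<epsilon>: "0 < \<epsilon>" "\<And>x. x \<in> {a..b} \<Longrightarrow> \<exists>G \<in> (\<lambda>t. ball t (\<delta> t)) ` {a..b}. ball x \<epsilon> \<subseteq> G"
    by (rule Heine_Borel_lemma[of "{a..b}" "(\<lambda>t. ball t (\<delta> t)) ` {a..b}"]) (use \<delta>(1) in auto)
  have "d s t < e" if st: "s \<in> {a..b}" "t \<in> {a..b}" "\<bar>s - t\<bar> < \<epsilon>" for s t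
  proof -
    obtain r where r: "r \<in> {a..b}" "ball s \<epsilon> \<subseteq> ball r (\<delta> r)" using \<epsilon>(2)[OF st(1)] by auto
    have "s \<in> ball s \<epsilon>" "t \<in> ball s \<epsilon>" using st(3) \<epsilon>(1) by (auto simp: dist_real_def)
    then have "s \<in> ball r (\<delta> r)" "t \<in> ball r (\<delta> r)" using r(2) by blast+
    then have "d s r < e / 4" "d t r < e / 4"
      using \<delta>(2)[OF r(1)] st by (auto simp: dist_real_def abs_minus_commute)
    then show ?thesis using tri[OF r(1) st(1,2)] by simp
  qed
  then show ?thesis using \<epsilon>(1) by blast
qed

lemma locally_bounded_imp_bounded:
  fixes q :: "real \<Rightarrow> real"
  assumes loc: "\<And>t. t \<in> {a..b} \<Longrightarrow> \<exists>\<delta>>0. \<exists>B. \<forall>s\<in>{a..b}. \<bar>s - t\<bar> < \<delta> \<longrightarrow> q s \<le> B"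
  shows "\<exists>B. \<forall>s\<in>{a..b}. q s \<le> B"
proof -
  obtain \<delta> B where \<delta>: "\<And>t. t \<in> {a..b} \<Longrightarrow> \<delta> t > 0"
    "\<And>t s. t \<in> {a..b} \<Longrightarrow> s \<in> {a..b} \<Longrightarrow> \<bar>s - t\<bar> < \<delta> t \<Longrightarrow> q s \<le> B t"
    using loc by metis
  obtain N where N: "N \<subseteq> {a..b}" "finite N" "{a..b} \<subseteq> (\<Union>t\<in>N. ball t (\<delta> t))"
    by (rule compactE_image[of "{a..b}" "{a..b}" "\<lambda>t. ball t (\<delta> t)"]) (use \<delta>(1) in \<open>auto intro!: exI[of _ "_::real"]\<close>)
  have "q s \<le> Max (insert 0 (B ` N))" if s: "s \<in> {a..b}" for s
  proof -
    obtain t where "t \<in> N" "s \<in> ball t (\<delta> t)" using N(3) s by blast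
    then have "q s \<le> B t" using \<delta>(2)[of t s] N(1) s by (auto simp: dist_real_def abs_minus_commute)
    also have "B t \<le> Max (insert 0 (B ` N))" using N(2) \<open>t \<in> N\<close> by (intro Max_ge) auto
    finally show ?thesis .
  qed
  then show ?thesis by blast
qed

section \<open>Step processes\<close>

text \<open>A step process at time \<open>t\<close> is the step integral against the deterministic
  integrator that jumps by 1 at \<open>t\<close>. An identity between step integrals that holds for
  all integrators \<open>w\<close> therefore contains the same identity between the
  processes.\<close>

lemma step_process_eq_step_integral:
  assumes "step_data F a b n \<tau> \<xi>"
  shows "step_process n \<tau> \<xi> t \<omega> = step_integral (\<lambda>x _. of_bool (t \<le> x)) n \<tau> \<xi> \<omega>"
  unfolding step_process_def step_integral_def
proof (rule sum.cong[OF refl])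
  fix i assume "i \<in> {..<n}"
  then have "\<tau> i \<le> \<tau> (Suc i)" using assms by (auto simp: step_data_def)
  then show "indicat_real {\<tau> i<..\<tau> (Suc i)} t *\<^sub>R \<xi> i \<omega>
      = (of_bool (t \<le> \<tau> (Suc i)) - of_bool (t \<le> \<tau> i)) *\<^sub>R \<xi> i \<omega>"
    by (auto simp: indicator_def)
qed

lemma step_data_le:
  assumes "step_data F a b n \<tau> \<xi>" "i \<le> j" "j \<le> n"
  shows "\<tau> i \<le> \<tau> j"
  using assms(2,3)
proof (induction j rule: dec_induct)
  case (step j)
  then show ?case using assms(1) unfolding step_data_def by (metis Suc_le_eq Suc_leD order_trans)
qed simp

lemma step_data_Icc:
  assumes "step_data F a b n \<tau> \<xi>" "i \<le> n"
  shows "\<tau> i \<in> {a..b}"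
  using step_data_le[OF assms(1), of 0 i] step_data_le[OF assms(1), of i n] assms
  by (auto simp: step_data_def)

lemma step_data_zero: "a \<le> b \<Longrightarrow> step_data F a b 1 (\<lambda>i. if i = 0 then a else b) (\<lambda>_ _. 0)"
  by (auto simp: step_data_def)

lemma sum_lessThan_split: "(\<Sum>k<p + m. f k) = (\<Sum>k<p. f k) + (\<Sum>j<m. f (p + j))"
  for f :: "nat \<Rightarrow> 'x::comm_monoid_add"
  by (induction m) (simp_all add: add.assoc)

text \<open>Refining the grid splits one increment of the integrator into two with the same value,
  for whatever integrator. Common grids for two step processes are built by such insertions.\<close>

lemma step_data_insert:
  assumes D: "step_data F a b n \<tau> \<xi>" and n: "0 < n" and c: "c \<in> {a..b}"
    and mono: "\<And>s t. a \<le> s \<Longrightarrow> s \<le> t \<Longrightarrow> t \<le> b \<Longrightarrow> sets (F s) \<subseteq> sets (F t) \<and> space (F s) = space (F t)"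
  shows "\<exists>\<tau>' \<xi>'. step_data F a b (Suc n) \<tau>' \<xi>' \<and>
    (\<forall>w \<omega>. step_integral w (Suc n) \<tau>' \<xi>' \<omega> = step_integral w n \<tau> \<xi> \<omega>) \<and>
    insert c (\<tau> ` {..n}) \<subseteq> \<tau>' ` {..Suc n}"
proof -
  \<comment> \<open>The index of the cell containing \<open>c\<close>; its value is kept on both
    halves. On the right half the value has to be measurable at the later time \<open>c\<close>,
    which is where monotonicity of the filtration enters.\<close>
  define i where "i = Max {i. i < n \<and> \<tau> i \<le> c}"
  have fin: "finite {i. i < n \<and> \<tau> i \<le> c}" by simp
  have "0 \<in> {i. i < n \<and> \<tau> i \<le> c}" using n c D by (auto simp: step_data_def)
  then have "i \<in> {i. i < n \<and> \<tau> i \<le> c}" unfolding i_def using Max_in[OF fin] by blast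
  then have i: "i < n" "\<tau> i \<le> c" by auto
  have ci: "c \<le> \<tau> (Suc i)"
  proof (cases "Suc i < n")
    case True
    have "Suc i \<notin> {i. i < n \<and> \<tau> i \<le> c}" using Max_ge[OF fin, of "Suc i", folded i_def] by (metis Suc_n_not_le_n)
    then show ?thesis using True by auto
  next
    case False
    then have "Suc i = n" using i by simp
    then show ?thesis using D c by (auto simp: step_data_def)
  qed
  define \<tau>' where "\<tau>' k = (if k \<le> i then \<tau> k else if k = Suc i then c else \<tau> (k - 1))" for k
  define \<xi>' where "\<xi>' k = (if k \<le> i then \<xi> k else \<xi> (k - 1))" for k
  obtain m where m: "n = Suc i + m" using i(1) by (metis Suc_leI le_Suc_ex)
  have int: "step_integral w (Suc n) \<tau>' \<xi>' \<omega> = step_integral w n \<tau> \<xi> \<omega>" for w \<omega>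
  proof -
    have Sn: "Suc n = i + (2 + m)" using m by simp
    have "step_integral w (Suc n) \<tau>' \<xi>' \<omega>
       = (\<Sum>k<i. (w (\<tau> (Suc k)) \<omega> - w (\<tau> k) \<omega>) *\<^sub>R \<xi> k \<omega>)
        + ((w c \<omega> - w (\<tau> i) \<omega>) *\<^sub>R \<xi> i \<omega> + (w (\<tau> (Suc i)) \<omega> - w c \<omega>) *\<^sub>R \<xi> i \<omega>
        + (\<Sum>j<m. (w (\<tau> (Suc (Suc i + j))) \<omega> - w (\<tau> (Suc i + j)) \<omega>) *\<^sub>R \<xi> (Suc i + j) \<omega>))"
      unfolding step_integral_def Sn sum_lessThan_split
      by (intro arg_cong2[where f="(+)"] sum.cong) (auto simp: \<tau>'_def \<xi>'_def numeral_2_eq_2)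
    also have "(w c \<omega> - w (\<tau> i) \<omega>) *\<^sub>R \<xi> i \<omega> + (w (\<tau> (Suc i)) \<omega> - w c \<omega>) *\<^sub>R \<xi> i \<omega>
        = (w (\<tau> (Suc i)) \<omega> - w (\<tau> i) \<omega>) *\<^sub>R \<xi> i \<omega>"
      by (simp flip: scaleR_left_distrib)
    finally show ?thesis
      unfolding step_integral_def m sum_lessThan_split[of _ "Suc i" m] by (simp add: add.assoc)
  qed
  have "step_data F a b (Suc n) \<tau>' \<xi>'"
    unfolding step_data_def
  proof (intro conjI allI impI)
    show "\<tau>' 0 = a" "\<tau>' (Suc n) = b" using D i by (auto simp: step_data_def \<tau>'_def)
  next
    fix k assume k: "k < Suc n"
    consider "k < i" | "k = i" | "k = Suc i" | j where "k = Suc j" "i < j" "j < n"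
      using k by (cases k) (auto, linarith)
    note cs = this
    have DD: "\<And>k. k < n \<Longrightarrow> \<tau> k \<le> \<tau> (Suc k) \<and> \<xi> k \<in> borel_measurable (F (\<tau> k)) \<and>
        (\<exists>B. \<forall>\<omega>\<in>space (F (\<tau> k)). norm (\<xi> k \<omega>) \<le> B)"
      using D by (auto simp: step_data_def)
    have Fc: "sets (F (\<tau> i)) \<subseteq> sets (F c)" "space (F (\<tau> i)) = space (F c)"
      using mono[of "\<tau> i" c] step_data_Icc[OF D, of i] i c by auto
    have meas: "\<xi> i \<in> borel_measurable (F c)"
      using DD[OF i(1)] Fc by (auto simp: measurable_def)
    have bd: "\<exists>B. \<forall>\<omega>\<in>space (F c). norm (\<xi> i \<omega>) \<le> B" using DD[OF i(1)] Fc(2) by simp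
    from cs show "\<tau>' k \<le> \<tau>' (Suc k)"
      by cases (use DD i ci in \<open>auto simp: \<tau>'_def\<close>)
    from cs show "\<xi>' k \<in> borel_measurable (F (\<tau>' k))"
      by cases (use DD i meas in \<open>auto simp: \<tau>'_def \<xi>'_def\<close>)
    from cs show "\<exists>B. \<forall>\<omega>\<in>space (F (\<tau>' k)). norm (\<xi>' k \<omega>) \<le> B"
      by cases (use DD i bd in \<open>auto simp: \<tau>'_def \<xi>'_def\<close>)
  qed
  moreover have "insert c (\<tau> ` {..n}) \<subseteq> \<tau>' ` {..Suc n}"
  proof
    fix x assume "x \<in> insert c (\<tau> ` {..n})"
    then consider "x = c" | k where "k \<le> i" "x = \<tau> k" | k where "i < k" "k \<le> n" "x = \<tau> k"
      by (auto, metis not_le)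
    then show "x \<in> \<tau>' ` {..Suc n}"
    proof cases
      case 1
      then show ?thesis using i by (intro image_eqI[of _ _ "Suc i"]) (auto simp: \<tau>'_def)
    next
      case 2
      then show ?thesis using i by (intro image_eqI[of _ _ k]) (auto simp: \<tau>'_def)
    next
      case 3
      then show ?thesis by (intro image_eqI[of _ _ "Suc k"]) (auto simp: \<tau>'_def)
    qed
  qed
  ultimately show ?thesis using int by blast
qed

text \<open>Once \<open>s\<close> and \<open>t\<close> are grid points, adding a value on the
  interval between them only changes the values on whole cells.\<close>

lemma step_data_add_piece:
  assumes D: "step_data F a b n \<tau> \<xi>" and st: "a \<le> s" "s \<le> t" "t \<le> b"
    and \<eta>: "\<eta> \<in> borel_measurable (F s)" "\<exists>B. \<forall>\<omega>\<in>space (F s). norm (\<eta> \<omega>) \<le> B"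
    and mono: "\<And>s t. a \<le> s \<Longrightarrow> s \<le> t \<Longrightarrow> t \<le> b \<Longrightarrow> sets (F s) \<subseteq> sets (F t) \<and> space (F s) = space (F t)"
  shows "\<exists>n' \<tau>' \<xi>'. step_data F a b n' \<tau>' (\<xi>' :: nat \<Rightarrow> 'w \<Rightarrow> 'x::{real_normed_vector, second_countable_topology}) \<and>
    (\<forall>w \<omega>. step_integral w n' \<tau>' \<xi>' \<omega> = step_integral w n \<tau> \<xi> \<omega> + (w t \<omega> - w s \<omega>) *\<^sub>R \<eta> \<omega>)"
proof -
  have ab: "a \<le> b" using st by simp
  obtain n0 \<tau>0 \<xi>0 where D0: "step_data F a b n0 \<tau>0 \<xi>0" "0 < n0"
    "\<And>w \<omega>. step_integral w n0 \<tau>0 \<xi>0 \<omega> = step_integral w n \<tau> \<xi> \<omega>"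
  \<comment> \<open>A grid without cells forces a = b; it is replaced by a single cell with value 0,
    since points can be inserted only into an existing cell.\<close>
  proof (cases "n = 0")
    case True
    then show ?thesis using that[OF step_data_zero[OF ab]] by (simp add: step_integral_def)
  qed (use D that in auto)
  obtain \<tau>1 \<xi>1 where D1: "step_data F a b (Suc n0) \<tau>1 \<xi>1"
    "\<And>w \<omega>. step_integral w (Suc n0) \<tau>1 \<xi>1 \<omega> = step_integral w n0 \<tau>0 \<xi>0 \<omega>" "s \<in> \<tau>1 ` {..Suc n0}"
    using step_data_insert[OF D0(1,2) _ mono, of s] st by auto
  obtain \<tau>2 \<xi>2 where D2: "step_data F a b (Suc (Suc n0)) \<tau>2 \<xi>2"
    "\<And>w \<omega>. step_integral w (Suc (Suc n0)) \<tau>2 \<xi>2 \<omega> = step_integral w (Suc n0) \<tau>1 \<xi>1 \<omega>"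
    "insert t (\<tau>1 ` {..Suc n0}) \<subseteq> \<tau>2 ` {..Suc (Suc n0)}"
    using step_data_insert[OF D1(1) zero_less_Suc _ mono, of t] st by auto
  define m where "m = Suc (Suc n0)"
  note D2 = D2[folded m_def]
  obtain i j where i: "i \<le> m" "s = \<tau>2 i" and j: "j \<le> m" "t = \<tau>2 j"
    using D2(3) D1(3) by blast
  define \<xi>3 where "\<xi>3 k \<omega> = \<xi>2 k \<omega> + (if s \<le> \<tau>2 k \<and> \<tau>2 (Suc k) \<le> t then \<eta> \<omega> else 0)" for k \<omega>
  have DD: "\<And>k. k < m \<Longrightarrow> \<tau>2 k \<le> \<tau>2 (Suc k) \<and> \<xi>2 k \<in> borel_measurable (F (\<tau>2 k)) \<and>
        (\<exists>B. \<forall>\<omega>\<in>space (F (\<tau>2 k)). norm (\<xi>2 k \<omega>) \<le> B)"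
      using D2(1) by (auto simp: step_data_def)
  have "step_data F a b m \<tau>2 \<xi>3"
    unfolding step_data_def
  proof (intro conjI allI impI)
    show "\<tau>2 0 = a" "\<tau>2 m = b" using D2(1) by (auto simp: step_data_def)
    fix k assume k: "k < m"
    show "\<tau>2 k \<le> \<tau>2 (Suc k)" using DD[OF k] by simp
    obtain B where B: "\<And>\<omega>. \<omega> \<in> space (F (\<tau>2 k)) \<Longrightarrow> norm (\<xi>2 k \<omega>) \<le> B" using DD[OF k] by blast
    obtain B' where B': "\<And>\<omega>. \<omega> \<in> space (F s) \<Longrightarrow> norm (\<eta> \<omega>) \<le> B'" using \<eta>(2) by blast
    note [measurable] = conjunct1[OF conjunct2[OF DD[OF k]]]
    have Fs: "sets (F s) \<subseteq> sets (F (\<tau>2 k))" "space (F s) = space (F (\<tau>2 k))" if "s \<le> \<tau>2 k"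
      using mono[OF st(1) that] step_data_Icc[OF D2(1), of k] k by auto
    show "\<xi>3 k \<in> borel_measurable (F (\<tau>2 k))"
    proof (cases "s \<le> \<tau>2 k \<and> \<tau>2 (Suc k) \<le> t")
      case True
      then have [measurable]: "\<eta> \<in> borel_measurable (F (\<tau>2 k))"
        using \<eta>(1) Fs by (auto simp: measurable_def)
      show ?thesis unfolding \<xi>3_def using True by simp
    qed (auto simp: \<xi>3_def[abs_def])
    have "norm (\<xi>3 k \<omega>) \<le> B + \<bar>B'\<bar>" if \<omega>: "\<omega> \<in> space (F (\<tau>2 k))" for \<omega>
    proof (cases "s \<le> \<tau>2 k \<and> \<tau>2 (Suc k) \<le> t")
      case True
      then have "norm (\<eta> \<omega>) \<le> B'" using B'[of \<omega>] Fs \<omega> by auto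
      then show ?thesis using True B[OF \<omega>] norm_triangle_ineq[of "\<xi>2 k \<omega>" "\<eta> \<omega>"] by (simp add: \<xi>3_def)
    next
      case False
      then have "\<xi>3 k \<omega> = \<xi>2 k \<omega>" by (auto simp: \<xi>3_def)
      then show ?thesis using B[OF \<omega>] by simp
    qed
    then show "\<exists>B. \<forall>\<omega>\<in>space (F (\<tau>2 k)). norm (\<xi>3 k \<omega>) \<le> B" by blast
  qed
  moreover have "step_integral w m \<tau>2 \<xi>3 \<omega> = step_integral w n \<tau> \<xi> \<omega> + (w t \<omega> - w s \<omega>) *\<^sub>R \<eta> \<omega>" for w \<omega>
  proof -
    \<comment> \<open>Clamping the grid points to the interval from \<open>s\<close> to
      \<open>t\<close> turns the sum over the cells inside it into a telescoping sum over all cells: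
      the other cells collapse.\<close>
    define cl where "cl x = max s (min t x)" for x
    have le: "\<tau>2 k \<le> \<tau>2 l" if "k \<le> l" "l \<le> m" for k l using step_data_le[OF D2(1) that] .
    have piece: "(w (\<tau>2 (Suc k)) \<omega> - w (\<tau>2 k) \<omega>) *\<^sub>R (if s \<le> \<tau>2 k \<and> \<tau>2 (Suc k) \<le> t then \<eta> \<omega> else 0)
        = (w (cl (\<tau>2 (Suc k))) \<omega> - w (cl (\<tau>2 k)) \<omega>) *\<^sub>R \<eta> \<omega>" if k: "k < m" for k
    proof (cases "s \<le> \<tau>2 k \<and> \<tau>2 (Suc k) \<le> t")
      case True
      then show ?thesis using le[of k "Suc k"] k by (auto simp: cl_def min_def max_def)
    next
      case False
      have "cl (\<tau>2 (Suc k)) = cl (\<tau>2 k)"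
      proof (cases "s \<le> \<tau>2 k")
        case True
        then have "t < \<tau>2 (Suc k)" using False by simp
        then have "j \<le> k" using le[of "Suc k" j] j by (metis not_le not_less_eq_eq)
        then have "t \<le> \<tau>2 k" using le[of j k] j k by simp
        then show ?thesis using \<open>t < \<tau>2 (Suc k)\<close> by (simp add: cl_def min_def)
      next
        case False
        then have "k < i" using le[of i k] i k by (metis less_imp_le not_le)
        then have "\<tau>2 (Suc k) \<le> s" using le[of "Suc k" i] i by simp
        then show ?thesis using False st by (simp add: cl_def min_def max_def)
      qed
      then show ?thesis using False by auto
    qed
    have "step_integral w m \<tau>2 \<xi>3 \<omega> = step_integral w m \<tau>2 \<xi>2 \<omega> +
      (\<Sum>k<m. (w (\<tau>2 (Suc k)) \<omega> - w (\<tau>2 k) \<omega>) *\<^sub>R (if s \<le> \<tau>2 k \<and> \<tau>2 (Suc k) \<le> t then \<eta> \<omega> else 0))"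
      by (simp only: step_integral_def \<xi>3_def scaleR_add_right sum.distrib)
    also have "(\<Sum>k<m. (w (\<tau>2 (Suc k)) \<omega> - w (\<tau>2 k) \<omega>) *\<^sub>R (if s \<le> \<tau>2 k \<and> \<tau>2 (Suc k) \<le> t then \<eta> \<omega> else 0))
        = (\<Sum>k<m. (w (cl (\<tau>2 (Suc k))) \<omega> - w (cl (\<tau>2 k)) \<omega>) *\<^sub>R \<eta> \<omega>)"
      by (intro sum.cong refl piece) simp
    also have "\<dots> = (w (cl (\<tau>2 m)) \<omega> - w (cl (\<tau>2 0)) \<omega>) *\<^sub>R \<eta> \<omega>"
      by (simp flip: scaleR_sum_left add: sum_lessThan_telescope[of "\<lambda>k. w (cl (\<tau>2 k)) \<omega>"])
    also have "cl (\<tau>2 m) = t"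
      using D2(1) st by (auto simp: cl_def step_data_def)
    also have "cl (\<tau>2 0) = s"
      using D2(1) st by (auto simp: cl_def step_data_def)
    finally show ?thesis using D2(2) D1(2) D0(3) by simp
  qed
  ultimately show ?thesis by blast
qed

text \<open>The second process is subtracted cell by cell. The induction is about integrals against
  arbitrary integrators, so the statement about the processes comes for free from
  \<open>step_process_eq_step_integral\<close>.\<close>

lemma step_data_diff:
  assumes D: "step_data F a b n \<tau> \<xi>" and D': "step_data F a b n' \<tau>' \<xi>'"
    and mono: "\<And>s t. a \<le> s \<Longrightarrow> s \<le> t \<Longrightarrow> t \<le> b \<Longrightarrow> sets (F s) \<subseteq> sets (F t) \<and> space (F s) = space (F t)"
  shows "\<exists>m \<sigma> \<eta>. step_data F a b m \<sigma> (\<eta> :: nat \<Rightarrow> 'w \<Rightarrow> 'x::{real_normed_vector, second_countable_topology}) \<and>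
    (\<forall>w \<omega>. step_integral w m \<sigma> \<eta> \<omega> = step_integral w n \<tau> \<xi> \<omega> - step_integral w n' \<tau>' \<xi>' \<omega>) \<and>
    (\<forall>t \<omega>. step_process m \<sigma> \<eta> t \<omega> = step_process n \<tau> \<xi> t \<omega> - step_process n' \<tau>' \<xi>' t \<omega>)"
proof -
  have "\<exists>m \<sigma> \<eta>. step_data F a b m \<sigma> (\<eta> :: nat \<Rightarrow> 'w \<Rightarrow> 'x) \<and>
    (\<forall>w \<omega>. step_integral w m \<sigma> \<eta> \<omega> = step_integral w n \<tau> \<xi> \<omega>
      - (\<Sum>i<k. (w (\<tau>' (Suc i)) \<omega> - w (\<tau>' i) \<omega>) *\<^sub>R \<xi>' i \<omega>))" if "k \<le> n'" for k
    using that
  proof (induction k)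
    case 0
    then show ?case using D by auto
  next
    case (Suc k)
    then obtain m \<sigma> and \<eta> :: "nat \<Rightarrow> 'w \<Rightarrow> 'x" where IH: "step_data F a b m \<sigma> \<eta>"
      "\<And>w \<omega>. step_integral w m \<sigma> \<eta> \<omega> = step_integral w n \<tau> \<xi> \<omega>
      - (\<Sum>i<k. (w (\<tau>' (Suc i)) \<omega> - w (\<tau>' i) \<omega>) *\<^sub>R \<xi>' i \<omega>)" by auto
    have k: "k < n'" using Suc by simp
    have \<xi>': "\<xi>' k \<in> borel_measurable (F (\<tau>' k))" "\<exists>B. \<forall>\<omega>\<in>space (F (\<tau>' k)). norm (\<xi>' k \<omega>) \<le> B"
      "\<tau>' k \<le> \<tau>' (Suc k)"
      using D' k by (auto simp: step_data_def)
    have "(\<lambda>\<omega>. - \<xi>' k \<omega>) \<in> borel_measurable (F (\<tau>' k))" using \<xi>'(1) by simp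
    from step_data_add_piece[OF IH(1) _ \<xi>'(3) _ this _ mono]
    obtain m' \<sigma>' and \<eta>' :: "nat \<Rightarrow> 'w \<Rightarrow> 'x" where "step_data F a b m' \<sigma>' \<eta>'"
      "\<And>w \<omega>. step_integral w m' \<sigma>' \<eta>' \<omega> = step_integral w m \<sigma> \<eta> \<omega> +
        (w (\<tau>' (Suc k)) \<omega> - w (\<tau>' k) \<omega>) *\<^sub>R (- \<xi>' k \<omega>)"
      using step_data_Icc[OF D', of k] step_data_Icc[OF D', of "Suc k"] \<xi>'(2) k by auto
    then show ?case by (intro exI[of _ m'] exI[of _ \<sigma>'] exI[of _ \<eta>']) (simp add: IH(2))
  qed
  from this[of n'] obtain m \<sigma> and \<eta> :: "nat \<Rightarrow> 'w \<Rightarrow> 'x" where *: "step_data F a b m \<sigma> \<eta>"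
    "\<And>w \<omega>. step_integral w m \<sigma> \<eta> \<omega> = step_integral w n \<tau> \<xi> \<omega> - step_integral w n' \<tau>' \<xi>' \<omega>"
    unfolding step_integral_def by auto
  then show ?thesis
    by (intro exI[of _ m] exI[of _ \<sigma>] exI[of _ \<eta>])
      (simp add: step_process_eq_step_integral[OF D] step_process_eq_step_integral[OF D']
        step_process_eq_step_integral[OF *(1)])
qed

lemma step_data_extend:
  assumes "step_data F a b n \<tau> \<xi>" "b \<le> c"
  shows "step_data F a c (Suc n) (\<tau>(Suc n := c)) (\<xi>(n := \<lambda>_. 0))"
    and "step_integral w (Suc n) (\<tau>(Suc n := c)) (\<xi>(n := \<lambda>_. 0)) \<omega> = step_integral w n \<tau> \<xi> \<omega>"
    and "step_process (Suc n) (\<tau>(Suc n := c)) (\<xi>(n := \<lambda>_. 0)) t \<omega> = step_process n \<tau> \<xi> t \<omega>"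
  using assms by (auto simp: step_data_def less_Suc_eq step_integral_def step_process_def intro!: sum.cong)

lemma norm_add_scaleR_sq:
  "(norm (x + c *\<^sub>R y))\<^sup>2 = (norm x)\<^sup>2 + 2 * (x \<bullet> y * c) + (norm y)\<^sup>2 * c\<^sup>2"
  for x y :: "'x::real_inner"
proof -
  have "(norm (x + c *\<^sub>R y))\<^sup>2 = x \<bullet> x + c * (x \<bullet> y) + (c * (y \<bullet> x) + c * (c * (y \<bullet> y)))"
    by (simp only: power2_norm_eq_inner inner_add_left inner_add_right inner_scaleR_left inner_scaleR_right distrib_left)
  also have "y \<bullet> x = x \<bullet> y" by (rule inner_commute)
  finally show ?thesis by (simp add: power2_norm_eq_inner power2_eq_square[of c])
qed

section \<open>Brownian increments and the isometry for step processes\<close>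

context brownian_basis
begin

lemma space_F: "t \<in> {0..T} \<Longrightarrow> space (F t) = space M"
  using subalg by (auto simp: subalgebra_def)

lemma F_mono: "0 \<le> s \<Longrightarrow> s \<le> t \<Longrightarrow> t \<le> T \<Longrightarrow> sets (F s) \<subseteq> sets (F t) \<and> space (F s) = space (F t)"
  using mono[of s t] space_F[of s] space_F[of t] by auto

lemma measurable_F_mono:
  "\<xi> \<in> borel_measurable (F s) \<Longrightarrow> 0 \<le> s \<Longrightarrow> s \<le> t \<Longrightarrow> t \<le> T \<Longrightarrow> \<xi> \<in> borel_measurable (F t)"
  using F_mono[of s t] by (auto simp: measurable_def)

lemma measurable_F_M: "\<xi> \<in> borel_measurable (F s) \<Longrightarrow> s \<in> {0..T} \<Longrightarrow> \<xi> \<in> borel_measurable M"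
  by (rule measurable_from_subalg[OF subalg])

lemma W_measurable: "t \<in> {0..T} \<Longrightarrow> W t \<in> borel_measurable M"
  using measurable_F_M[OF W_adapted] by blast

text \<open>Passes from the independence of set systems in the locale to that of random variables,
  the form in which expectations of products factorize. It is used with the identity and the square
  as \<open>\<phi>\<close>.\<close>

lemma increment_indep:
  assumes st: "0 \<le> s" "s < t" "t \<le> T" and R: "R \<in> borel_measurable (F s)"
    and \<phi>: "\<phi> \<in> borel_measurable (borel :: real measure)"
  shows "indep_var borel (R :: 'w \<Rightarrow> real) borel (\<lambda>\<omega>. \<phi> (W t \<omega> - W s \<omega>) :: real)"
proof -
  let ?D = "\<lambda>\<omega>. W t \<omega> - W s \<omega>"
  let ?A = "sigma_sets (space M) {R -` A \<inter> space M |A. A \<in> sets borel}"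
  let ?B = "sigma_sets (space M) {(\<lambda>\<omega>. \<phi> (?D \<omega>)) -` A \<inter> space M |A. A \<in> sets borel}"
  let ?V = "{?D -` B \<inter> space M | B. B \<in> sets borel}"
  have D: "?D \<in> borel_measurable M"
    using W_measurable[of s] W_measurable[of t] st by auto
  have sp: "space (F s) = space M" using space_F[of s] st by simp
  have A: "?A \<subseteq> sets (F s)"
    unfolding sp[symmetric]
    by (rule sets.sigma_sets_subset) (use R in \<open>auto intro: measurable_sets\<close>)
  have V: "?V = sets (vimage_algebra (space M) ?D borel)"
    by (rule sets_vimage_algebra2[symmetric]) auto
  have "{(\<lambda>\<omega>. \<phi> (?D \<omega>)) -` A \<inter> space M |A. A \<in> sets borel} \<subseteq> ?V"
  proof safe
    fix A :: "real set" assume "A \<in> sets borel"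
    then have "\<phi> -` A \<in> sets borel" using measurable_sets[OF \<phi>, of A] by simp
    then show "\<exists>B. (\<lambda>\<omega>. \<phi> (?D \<omega>)) -` A \<inter> space M = ?D -` B \<inter> space M \<and> B \<in> sets borel"
      by (intro exI[of _ "\<phi> -` A"]) auto
  qed
  then have "?B \<subseteq> sets (vimage_algebra (space M) ?D borel)"
    using sets.sigma_sets_subset[of _ "vimage_algebra (space M) ?D borel"] unfolding V by simp
  then have B: "?B \<subseteq> ?V" unfolding V .
  have "indep_set (sets (F s)) ?V" using W_indep[OF st] .
  then have "indep_set ?A ?B"
    unfolding indep_sets2_eq using A B by (meson subset_iff)
  moreover have "R \<in> borel_measurable M" using measurable_F_M[OF R] st by auto
  moreover have "(\<lambda>\<omega>. \<phi> (?D \<omega>)) \<in> borel_measurable M" using measurable_compose[OF D \<phi>] .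
  ultimately show ?thesis unfolding indep_var_eq by blast
qed

lemma increment_moments:
  assumes st: "0 \<le> s" "s < t" "t \<le> T"
  shows "integrable M (\<lambda>\<omega>. W t \<omega> - W s \<omega>)" "(LINT \<omega>|M. W t \<omega> - W s \<omega>) = 0"
    "integrable M (\<lambda>\<omega>. (W t \<omega> - W s \<omega>)\<^sup>2)" "(LINT \<omega>|M. (W t \<omega> - W s \<omega>)\<^sup>2) = t - s"
proof -
  let ?\<sigma> = "sqrt (t - s)" and ?D = "\<lambda>\<omega>. W t \<omega> - W s \<omega>"
  have \<sigma>: "0 < ?\<sigma>" using st by simp
  have D: "distributed M lborel ?D (\<lambda>x. ennreal (normal_density 0 ?\<sigma> x))" using W_normal[OF st] .
  have 1: "integrable lborel (\<lambda>x. normal_density 0 ?\<sigma> x * x)"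
    using integrable_normal_moment[OF \<sigma>, of 0 1] by simp
  have 2: "integrable lborel (\<lambda>x. normal_density 0 ?\<sigma> x * x\<^sup>2)"
    using integrable_normal_moment[OF \<sigma>, of 0 2] by simp
  show "integrable M ?D" using distributed_integrable[OF D, of "\<lambda>x. x"] 1 by simp
  show "integrable M (\<lambda>\<omega>. (?D \<omega>)\<^sup>2)" using distributed_integrable[OF D, of "\<lambda>x. x\<^sup>2"] 2 by simp
  have "(LINT x|lborel. normal_density 0 ?\<sigma> x * x) = 0"
    using integral_normal_moment_odd[OF \<sigma>, of 0 0] by simp
  then show "(LINT \<omega>|M. ?D \<omega>) = 0" using distributed_integral[OF D, of "\<lambda>x. x"] by simp
  have "(LINT x|lborel. normal_density 0 ?\<sigma> x * x\<^sup>2) = t - s"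
    using integral_normal_moment_even[OF \<sigma>, of 0 1] st by (simp add: fact_2)
  then show "(LINT \<omega>|M. (?D \<omega>)\<^sup>2) = t - s" using distributed_integral[OF D, of "\<lambda>x. x\<^sup>2"] by simp
qed

text \<open>One induction step of the Ito isometry: the cross term is an
  \<open>F s\<close>-measurable variable times an increment that is independent of it and centred,
  and the square of the increment has mean t - s. Boundedness of \<open>\<xi>\<close> gives the
  integrability of the factors.\<close>

lemma increment_isometry:
  fixes Z \<xi> :: "'w \<Rightarrow> 'x::{real_inner, banach, second_countable_topology}"
  assumes st: "0 \<le> s" "s \<le> t" "t \<le> T" and Z: "Z \<in> borel_measurable (F s)" "msq M Z < \<infinity>"
    and \<xi>: "\<xi> \<in> borel_measurable (F s)" "\<And>\<omega>. \<omega> \<in> space M \<Longrightarrow> norm (\<xi> \<omega>) \<le> B"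
  shows "msq M (\<lambda>\<omega>. Z \<omega> + (W t \<omega> - W s \<omega>) *\<^sub>R \<xi> \<omega>) = msq M Z + ennreal (t - s) * msq M \<xi>"
proof (cases "s = t")
  case False
  then have st': "s < t" using st by simp
  let ?D = "\<lambda>\<omega>. W t \<omega> - W s \<omega>"
  have [measurable]: "Z \<in> borel_measurable M" "\<xi> \<in> borel_measurable M"
    using measurable_F_M[OF Z(1)] measurable_F_M[OF \<xi>(1)] st by auto
  have iZ: "integrable M (\<lambda>\<omega>. (norm (Z \<omega>))\<^sup>2)" using Z(2) by (simp add: integrable_sq_iff)
  have i\<xi>: "integrable M (\<lambda>\<omega>. (norm (\<xi> \<omega>))\<^sup>2)"
  proof (rule integrable_const_bound[of _ "B\<^sup>2"])
    show "AE \<omega> in M. norm ((norm (\<xi> \<omega>))\<^sup>2) \<le> B\<^sup>2" using \<xi>(2) by (intro AE_I2) (simp add: power_mono)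
  qed measurable
  have iR: "integrable M (\<lambda>\<omega>. Z \<omega> \<bullet> \<xi> \<omega>)"
  proof (rule Bochner_Integration.integrable_bound[OF Bochner_Integration.integrable_add[OF iZ i\<xi>]])
    show "AE \<omega> in M. norm (Z \<omega> \<bullet> \<xi> \<omega>) \<le> norm ((norm (Z \<omega>))\<^sup>2 + (norm (\<xi> \<omega>))\<^sup>2)"
    proof (rule AE_I2)
      fix \<omega>
      have "\<bar>Z \<omega> \<bullet> \<xi> \<omega>\<bar> \<le> norm (Z \<omega>) * norm (\<xi> \<omega>)" by (rule Cauchy_Schwarz_ineq2)
      moreover have "0 \<le> (norm (Z \<omega>) - norm (\<xi> \<omega>))\<^sup>2" by simp
      then have "2 * (norm (Z \<omega>) * norm (\<xi> \<omega>)) \<le> (norm (Z \<omega>))\<^sup>2 + (norm (\<xi> \<omega>))\<^sup>2"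
        by (simp add: power2_diff)
      moreover have "0 \<le> norm (Z \<omega>) * norm (\<xi> \<omega>)" by simp
      ultimately show "norm (Z \<omega> \<bullet> \<xi> \<omega>) \<le> norm ((norm (Z \<omega>))\<^sup>2 + (norm (\<xi> \<omega>))\<^sup>2)"
        unfolding real_norm_def by linarith
    qed
  qed measurable
  have Rm: "(\<lambda>\<omega>. Z \<omega> \<bullet> \<xi> \<omega>) \<in> borel_measurable (F s)" "(\<lambda>\<omega>. (norm (\<xi> \<omega>))\<^sup>2) \<in> borel_measurable (F s)"
    using Z(1) \<xi>(1) by measurable
  note mom = increment_moments[OF st(1) st' st(3)]
  have ind1: "indep_var borel (\<lambda>\<omega>. Z \<omega> \<bullet> \<xi> \<omega>) borel ?D"
    using increment_indep[OF st(1) st' st(3) Rm(1), of "\<lambda>x. x"] by simp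
  have ind2: "indep_var borel (\<lambda>\<omega>. (norm (\<xi> \<omega>))\<^sup>2) borel (\<lambda>\<omega>. (?D \<omega>)\<^sup>2)"
    using increment_indep[OF st(1) st' st(3) Rm(2), of "\<lambda>x. x\<^sup>2"] by simp
  note i1 = indep_var_integrable[OF ind1 iR mom(1)] indep_var_lebesgue_integral[OF ind1 iR mom(1)]
  note i2 = indep_var_integrable[OF ind2 i\<xi> mom(3)] indep_var_lebesgue_integral[OF ind2 i\<xi> mom(3)]
  have eq: "(norm (Z \<omega> + ?D \<omega> *\<^sub>R \<xi> \<omega>))\<^sup>2
      = (norm (Z \<omega>))\<^sup>2 + 2 * (Z \<omega> \<bullet> \<xi> \<omega> * ?D \<omega>) + (norm (\<xi> \<omega>))\<^sup>2 * (?D \<omega>)\<^sup>2" for \<omega>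
    by (rule norm_add_scaleR_sq)
  have int: "integrable M (\<lambda>\<omega>. (norm (Z \<omega> + ?D \<omega> *\<^sub>R \<xi> \<omega>))\<^sup>2)"
    unfolding eq using iZ i1(1) i2(1) by auto
  have "(LINT \<omega>|M. (norm (Z \<omega> + ?D \<omega> *\<^sub>R \<xi> \<omega>))\<^sup>2)
     = (LINT \<omega>|M. (norm (Z \<omega>))\<^sup>2) + (t - s) * (LINT \<omega>|M. (norm (\<xi> \<omega>))\<^sup>2)"
    unfolding eq using iZ i1 i2 mom(2,4) by simp
  then show ?thesis
    unfolding msq_eq_integral[OF int] msq_eq_integral[OF iZ] msq_eq_integral[OF i\<xi>]
    using st by (simp add: ennreal_mult)
qed simp

text \<open>Measurability at the current grid point and finiteness go through the induction together
  with the formula, since \<open>increment_isometry\<close> asks for both at the next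
  increment.\<close>

lemma step_integral_msq:
  fixes \<xi> :: "nat \<Rightarrow> 'w \<Rightarrow> 'x::{real_inner, banach, second_countable_topology}"
  assumes D: "step_data F a b n \<tau> \<xi>" and ab: "0 \<le> a" "b \<le> T"
  shows "msq M (step_integral W n \<tau> \<xi>) = (\<Sum>i<n. ennreal (\<tau> (Suc i) - \<tau> i) * msq M (\<xi> i))"
    and "step_integral W n \<tau> \<xi> \<in> borel_measurable (F b)"
    and "msq M (step_integral W n \<tau> \<xi>) < \<infinity>"
proof -
  have \<tau>: "\<tau> i \<in> {0..T}" if "i \<le> n" for i using step_data_Icc[OF D that] ab by auto
  have \<xi>: "\<tau> i \<le> \<tau> (Suc i)" "\<xi> i \<in> borel_measurable (F (\<tau> i))"
    "\<exists>B. \<forall>\<omega>\<in>space M. norm (\<xi> i \<omega>) \<le> B" if "i < n" for i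
  proof -
    have sp: "space (F (\<tau> i)) = space M" using space_F[OF \<tau>, of i] that by simp
    show "\<tau> i \<le> \<tau> (Suc i)" "\<xi> i \<in> borel_measurable (F (\<tau> i))" "\<exists>B. \<forall>\<omega>\<in>space M. norm (\<xi> i \<omega>) \<le> B"
      using D that unfolding step_data_def sp[symmetric] by blast+
  qed
  have main: "msq M (step_integral W k \<tau> \<xi>) = (\<Sum>i<k. ennreal (\<tau> (Suc i) - \<tau> i) * msq M (\<xi> i)) \<and>
    step_integral W k \<tau> \<xi> \<in> borel_measurable (F (\<tau> k)) \<and> msq M (step_integral W k \<tau> \<xi>) < \<infinity>"
    if "k \<le> n" for k
    using that
  proof (induction k)
    case 0
    then show ?case by (simp add: step_integral_def[abs_def] msq_def)
  next
    case (Suc k)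
    then have k: "k < n" by simp
    obtain B where B: "\<And>\<omega>. \<omega> \<in> space M \<Longrightarrow> norm (\<xi> k \<omega>) \<le> B" using \<xi>(3)[OF k] by blast
    have IH: "msq M (step_integral W k \<tau> \<xi>) = (\<Sum>i<k. ennreal (\<tau> (Suc i) - \<tau> i) * msq M (\<xi> i))"
      "step_integral W k \<tau> \<xi> \<in> borel_measurable (F (\<tau> k))" "msq M (step_integral W k \<tau> \<xi>) < \<infinity>"
      using Suc by auto
    have \<tau>k: "0 \<le> \<tau> k" "\<tau> k \<le> \<tau> (Suc k)" "\<tau> (Suc k) \<le> T"
      using \<tau>[of k] \<tau>[of "Suc k"] k \<xi>(1)[OF k] by auto
    have e: "step_integral W (Suc k) \<tau> \<xi> =
      (\<lambda>\<omega>. step_integral W k \<tau> \<xi> \<omega> + (W (\<tau> (Suc k)) \<omega> - W (\<tau> k) \<omega>) *\<^sub>R \<xi> k \<omega>)"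
      by (simp add: step_integral_def fun_eq_iff)
    have [measurable]: "W (\<tau> (Suc k)) \<in> borel_measurable (F (\<tau> (Suc k)))"
      "W (\<tau> k) \<in> borel_measurable (F (\<tau> (Suc k)))"
      "\<xi> k \<in> borel_measurable (F (\<tau> (Suc k)))"
      "step_integral W k \<tau> \<xi> \<in> borel_measurable (F (\<tau> (Suc k)))"
      using W_adapted[of "\<tau> (Suc k)"] W_adapted[of "\<tau> k"] \<tau>k measurable_F_mono[OF _ \<tau>k] \<xi>(2)[OF k] IH(2)
      by auto
    have m: "step_integral W (Suc k) \<tau> \<xi> \<in> borel_measurable (F (\<tau> (Suc k)))" unfolding e by measurable
    have q: "msq M (step_integral W (Suc k) \<tau> \<xi>) = (\<Sum>i<Suc k. ennreal (\<tau> (Suc i) - \<tau> i) * msq M (\<xi> i))"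
      unfolding e using increment_isometry[OF \<tau>k IH(2,3) \<xi>(2)[OF k] B] IH(1) by simp
    have "msq M (\<xi> k) \<le> (\<integral>\<^sup>+\<omega>. ennreal (B\<^sup>2) \<partial>M)"
      unfolding msq_def by (intro nn_integral_mono ennreal_leI power_mono B) auto
    also have "\<dots> < \<infinity>" by (simp add: emeasure_space_1)
    finally have "msq M (step_integral W (Suc k) \<tau> \<xi>) < \<infinity>"
      using q IH(1,3) by (simp add: ennreal_mult_less_top)
    then show ?case using m q by blast
  qed
  show "msq M (step_integral W n \<tau> \<xi>) = (\<Sum>i<n. ennreal (\<tau> (Suc i) - \<tau> i) * msq M (\<xi> i))"
    "step_integral W n \<tau> \<xi> \<in> borel_measurable (F b)" "msq M (step_integral W n \<tau> \<xi>) < \<infinity>"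
    using main[of n] D by (auto simp: step_data_def)
qed

lemma measurable_fst_time_space [measurable]: "fst \<in> borel_measurable (time_space M a b)"
  by (rule measurable_compose[OF measurable_fst]) (simp add: measurable_restrict_space1)

lemma step_process_measurable:
  fixes \<xi> :: "nat \<Rightarrow> 'w \<Rightarrow> 'x::{real_inner, banach, second_countable_topology}"
  assumes D: "step_data F a b n \<tau> \<xi>" and ab: "0 \<le> a" "b \<le> T"
  shows "(\<lambda>z. step_process n \<tau> \<xi> (fst z) (snd z)) \<in> borel_measurable (time_space M a b)"
proof -
  have "(\<lambda>z. indicat_real {\<tau> i<..\<tau> (Suc i)} (fst z) *\<^sub>R \<xi> i (snd z)) \<in> borel_measurable (time_space M a b)"
    if "i < n" for i
  proof -
    have "\<tau> i \<in> {0..T}" using step_data_Icc[OF D, of i] that ab by auto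
    then have [measurable]: "\<xi> i \<in> borel_measurable M"
      using measurable_F_M D that by (auto simp: step_data_def)
    show ?thesis by measurable
  qed
  then show ?thesis unfolding step_process_def by (intro borel_measurable_sum) auto
qed

text \<open>At each time at most one cell is active, so the squared norm of the sum is the sum of
  the squared norms.\<close>

lemma step_process_msq:
  fixes \<xi> :: "nat \<Rightarrow> 'w \<Rightarrow> 'x::{real_inner, banach, second_countable_topology}"
  assumes D: "step_data F a b n \<tau> \<xi>" and ab: "0 \<le> a" "b \<le> T"
  shows "msq (time_space M a b) (\<lambda>z. step_process n \<tau> \<xi> (fst z) (snd z))
    = (\<Sum>i<n. ennreal (\<tau> (Suc i) - \<tau> i) * msq M (\<xi> i))"
proof -
  have \<xi>m: "\<xi> i \<in> borel_measurable M" if "i < n" for i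
  proof -
    have "\<tau> i \<in> {0..T}" using step_data_Icc[OF D, of i] that ab by auto
    then show ?thesis using measurable_F_M D that by (auto simp: step_data_def)
  qed
  have pw: "ennreal ((norm (step_process k \<tau> \<xi> t \<omega>))\<^sup>2)
      = (\<Sum>i<k. ennreal ((norm (\<xi> i \<omega>))\<^sup>2) * indicator {\<tau> i<..\<tau> (Suc i)} t)" if "k \<le> n" for k t \<omega>
    using that
  proof (induction k)
    case 0
    then show ?case by (simp add: step_process_def)
  next
    case (Suc k)
    show ?case
    proof (cases "t \<in> {\<tau> k<..\<tau> (Suc k)}")
      case True
      have "t \<notin> {\<tau> i<..\<tau> (Suc i)}" if "i < k" for i
        using step_data_le[OF D, of "Suc i" k] that Suc.prems True by auto
      then show ?thesis using True by (simp add: step_process_def)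
    next
      case False
      then show ?thesis using Suc by (simp add: step_process_def)
    qed
  qed
  have "msq (time_space M a b) (\<lambda>z. step_process n \<tau> \<xi> (fst z) (snd z))
      = (\<integral>\<^sup>+z. (\<Sum>i<n. ennreal ((norm (\<xi> i (snd z)))\<^sup>2) * indicator {\<tau> i<..\<tau> (Suc i)} (fst z)) \<partial>time_space M a b)"
    unfolding msq_def pw[OF order_refl] ..
  also have "\<dots> = (\<Sum>i<n. (\<integral>\<^sup>+z. ennreal ((norm (\<xi> i (snd z)))\<^sup>2) * indicator {\<tau> i<..\<tau> (Suc i)} (fst z) \<partial>time_space M a b))"
  proof (rule nn_integral_sum)
    fix i assume "i \<in> {..<n}"
    then have [measurable]: "\<xi> i \<in> borel_measurable M" using \<xi>m by auto
    show "(\<lambda>z. ennreal ((norm (\<xi> i (snd z)))\<^sup>2) * indicator {\<tau> i<..\<tau> (Suc i)} (fst z)) \<in> borel_measurable (time_space M a b)"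
      by measurable
  qed
  also have "\<dots> = (\<Sum>i<n. ennreal (\<tau> (Suc i) - \<tau> i) * msq M (\<xi> i))"
  proof (rule sum.cong[OF refl])
    fix i assume "i \<in> {..<n}"
    then have i: "i < n" by simp
    note [measurable] = \<xi>m[OF i]
    have \<tau>: "a \<le> \<tau> i" "\<tau> i \<le> \<tau> (Suc i)" "\<tau> (Suc i) \<le> b"
      using step_data_Icc[OF D, of i] step_data_Icc[OF D, of "Suc i"] i step_data_le[OF D, of i "Suc i"] by auto
    have "(\<lambda>z. ennreal ((norm (\<xi> i (snd z)))\<^sup>2) * indicator {\<tau> i<..\<tau> (Suc i)} (fst z)) \<in> borel_measurable (time_space M a b)"
      by measurable
    then have "(\<integral>\<^sup>+z. ennreal ((norm (\<xi> i (snd z)))\<^sup>2) * indicator {\<tau> i<..\<tau> (Suc i)} (fst z) \<partial>time_space M a b)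
      = (\<integral>\<^sup>+s. (\<integral>\<^sup>+\<omega>. ennreal ((norm (\<xi> i \<omega>))\<^sup>2) * indicator {\<tau> i<..\<tau> (Suc i)} s \<partial>M) * indicator {a..b} s \<partial>lborel)"
      by (subst nn_integral_time_space[OF prob_space_axioms]) simp_all
    also have "\<dots> = (\<integral>\<^sup>+s. msq M (\<xi> i) * indicator {\<tau> i<..\<tau> (Suc i)} s \<partial>lborel)"
      unfolding msq_def using \<tau>
      by (intro nn_integral_cong) (auto simp: nn_integral_multc indicator_def)
    also have "\<dots> = ennreal (\<tau> (Suc i) - \<tau> i) * msq M (\<xi> i)"
      using \<tau> by (simp add: nn_integral_cmult mult.commute)
    finally show "(\<integral>\<^sup>+z. ennreal ((norm (\<xi> i (snd z)))\<^sup>2) * indicator {\<tau> i<..\<tau> (Suc i)} (fst z) \<partial>time_space M a b)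
      = ennreal (\<tau> (Suc i) - \<tau> i) * msq M (\<xi> i)" .
  qed
  finally show ?thesis .
qed

lemma step_isometry:
  fixes \<xi> :: "nat \<Rightarrow> 'w \<Rightarrow> 'x::{real_inner, banach, second_countable_topology}"
  assumes "step_data F a b n \<tau> \<xi>" "0 \<le> a" "b \<le> T"
  shows "msq M (step_integral W n \<tau> \<xi>) = msq (time_space M a b) (\<lambda>z. step_process n \<tau> \<xi> (fst z) (snd z))"
  using step_integral_msq(1)[OF assms] step_process_msq[OF assms] by simp

text \<open>The two grids may differ; the difference is first rewritten as one step process on a
  common refinement. This is what makes the integrals of an approximating sequence a Cauchy
  sequence.\<close>

lemma step_isometry_diff:
  fixes \<xi> :: "nat \<Rightarrow> 'w \<Rightarrow> 'x::{real_inner, banach, second_countable_topology}"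
  assumes D: "step_data F a b n \<tau> \<xi>" "step_data F a b n' \<tau>' \<xi>'" and ab: "0 \<le> a" "b \<le> T"
  shows "msq M (\<lambda>\<omega>. step_integral W n \<tau> \<xi> \<omega> - step_integral W n' \<tau>' \<xi>' \<omega>)
    = msq (time_space M a b) (\<lambda>z. step_process n \<tau> \<xi> (fst z) (snd z) - step_process n' \<tau>' \<xi>' (fst z) (snd z))"
proof -
  obtain m \<sigma> and \<eta> :: "nat \<Rightarrow> 'w \<Rightarrow> 'x" where *: "step_data F a b m \<sigma> \<eta>"
    "\<And>w \<omega>. step_integral w m \<sigma> \<eta> \<omega> = step_integral w n \<tau> \<xi> \<omega> - step_integral w n' \<tau>' \<xi>' \<omega>"
    "\<And>t \<omega>. step_process m \<sigma> \<eta> t \<omega> = step_process n \<tau> \<xi> t \<omega> - step_process n' \<tau>' \<xi>' t \<omega>"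
    using step_data_diff[OF D F_mono] ab by force
  show ?thesis using step_isometry[OF *(1) ab] unfolding *(2,3)[symmetric] by simp
qed

end

lemma step_data_cover:
  assumes D: "step_data F a b n \<tau> \<xi>" and t: "a < t" "t \<le> b"
  shows "\<exists>i<n. \<tau> i < t \<and> t \<le> \<tau> (Suc i)"
proof -
  have "t \<le> \<tau> n" using D t by (simp add: step_data_def)
  define j where "j = (LEAST j. t \<le> \<tau> j)"
  have j: "t \<le> \<tau> j" unfolding j_def using \<open>t \<le> \<tau> n\<close> by (rule LeastI)
  have "j \<le> n" unfolding j_def using \<open>t \<le> \<tau> n\<close> by (rule Least_le)
  have "j \<noteq> 0" using j D t by (intro notI) (simp add: step_data_def)
  then obtain i where i: "j = Suc i" by (cases j) auto
  have "\<not> t \<le> \<tau> i" unfolding j_def using not_less_Least[of i "\<lambda>j. t \<le> \<tau> j"] i j_def by simp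
  then show ?thesis using i j \<open>j \<le> n\<close> by (intro exI[of _ i]) auto
qed

lemma step_process_at:
  assumes D: "step_data F a b n \<tau> \<xi>" and i: "i < n" "\<tau> i < t" "t \<le> \<tau> (Suc i)"
  shows "step_process n \<tau> \<xi> t \<omega> = \<xi> i \<omega>"
proof -
  have "t \<notin> {\<tau> k<..\<tau> (Suc k)}" if "k < n" "k \<noteq> i" for k
  proof (cases "k < i")
    case True
    then show ?thesis using step_data_le[OF D, of "Suc k" i] i by auto
  next
    case False
    then show ?thesis using step_data_le[OF D, of "Suc i" k] i that by auto
  qed
  then have "step_process n \<tau> \<xi> t \<omega> = (\<Sum>k<n. if k = i then \<xi> i \<omega> else 0)"
    unfolding step_process_def using i by (intro sum.cong) auto
  then show ?thesis using i by simp
qed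

section \<open>Approximation by step processes\<close>

text \<open>The differentiation theorem used next averages over intervals to the right of a point.
  Reflection turns them into intervals to the left, which look only into the past.\<close>

lemma AE_lborel_reflect_negligible:
  assumes "negligible (N :: real set)"
  shows "AE t in lborel. - t \<notin> N"
proof -
  have "AE t in lebesgue. t \<notin> N"
    using assms by (intro AE_not_in) (simp add: negligible_iff_null_sets)
  then have "AE t in lborel. t \<notin> N" by (simp add: AE_completion_iff)
  then obtain N' where N': "N' \<in> null_sets lborel" "N \<subseteq> N'"
    by (auto simp: eventually_ae_filter)
  have "AE t in distr lborel borel uminus. t \<notin> N'"
    unfolding lborel_distr_uminus by (rule AE_not_in[OF N'(1)])
  then have "AE t in lborel. - t \<notin> N'"
    by (subst (asm) AE_distr_iff) (use N'(1) in \<open>auto simp: null_sets_def\<close>)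
  then show ?thesis by eventually_elim (use N'(2) in auto)
qed

text \<open>Lebesgue differentiation of the reflected function. Only the upper bound is recorded,
  because it will be applied to the nonnegative functions \<open>norm (q s - c)\<close>.\<close>

lemma lebesgue_points_left_real:
  fixes r :: "real \<Rightarrow> real"
  assumes r[measurable]: "r \<in> borel_measurable borel" and B: "\<And>s. 0 \<le> r s \<and> r s \<le> B"
  shows "AE t in lborel. \<forall>e>0. \<exists>d>0. \<forall>h. 0 < h \<and> h < d \<longrightarrow>
    (\<integral>\<^sup>+s. ennreal (r s) * indicator {t - h..t} s \<partial>lborel) \<le> ennreal ((r t + e) * h)"
proof -
  define r' where "r' s = r (- s)" for s
  have [measurable]: "r' \<in> borel_measurable borel" unfolding r'_def by measurable
  have si: "set_integrable lborel {x..y} r'" for x y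
    unfolding set_integrable_def
  proof (rule integrableI_bounded_set[where A="{x..y}" and B=B])
    show "AE s in lborel. s \<in> {x..y} \<longrightarrow> norm (indicator {x..y} s *\<^sub>R r' s) \<le> B"
      using B by (intro AE_I2) (auto simp: r'_def indicator_def)
  qed (auto simp: emeasure_lborel_Icc_eq)
  have ion: "r' integrable_on cbox x y" for x y
    using set_borel_integral_eq_integral(1)[OF si[of x y]] by simp
  obtain N where N: "negligible N"
    "\<And>x e. \<lbrakk>x \<notin> N; 0 < e\<rbrakk> \<Longrightarrow> \<exists>d>0. \<forall>h. 0 < h \<and> h < d \<longrightarrow>
        norm (integral (cbox x (x + h *\<^sub>R One)) r' /\<^sub>R h ^ DIM(real) - r' x) < e"
    by (rule integrable_ccontinuous_explicit[of r', OF ion]) (rule that)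
  have nn: "(\<integral>\<^sup>+s. ennreal (r s) * indicator {t - h..t} s \<partial>lborel) = ennreal (integral {- t..- t + h} r')"
    if "0 < h" for t h
  proof -
    have "(\<integral>\<^sup>+s. ennreal (r s) * indicator {t - h..t} s \<partial>lborel)
      = (\<integral>\<^sup>+s. ennreal (r (0 + (-1) * s)) * indicator {t - h..t} (0 + (-1) * s) \<partial>lborel)"
      using nn_integral_real_affine[of "\<lambda>s. ennreal (r s) * indicator {t - h..t} s" "-1" 0] by simp
    also have "\<dots> = (\<integral>\<^sup>+s. ennreal (indicator {- t..- t + h} s *\<^sub>R r' s) \<partial>lborel)"
      by (intro nn_integral_cong) (auto simp: r'_def indicator_def)
    also have "\<dots> = ennreal (LINT s:{- t..- t + h}|lborel. r' s)"
      unfolding set_lebesgue_integral_def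
      by (rule nn_integral_eq_integral) (use si[of "-t" "-t + h"] B in \<open>auto simp: set_integrable_def r'_def indicator_def\<close>)
    also have "(LINT s:{- t..- t + h}|lborel. r' s) = integral {- t..- t + h} r'"
      by (rule set_borel_integral_eq_integral(2)[OF si])
    finally show ?thesis .
  qed
  from AE_lborel_reflect_negligible[OF N(1)] show ?thesis
  proof eventually_elim
    case (elim t)
    show ?case
    proof (intro allI impI)
      fix e :: real assume "0 < e"
      from N(2)[OF elim this] obtain d where d: "d > 0"
        "\<And>h. 0 < h \<Longrightarrow> h < d \<Longrightarrow> norm (integral (cbox (- t) (- t + h *\<^sub>R One)) r' /\<^sub>R h ^ DIM(real) - r' (- t)) < e"
        by blast
      show "\<exists>d>0. \<forall>h. 0 < h \<and> h < d \<longrightarrow>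
        (\<integral>\<^sup>+s. ennreal (r s) * indicator {t - h..t} s \<partial>lborel) \<le> ennreal ((r t + e) * h)"
      proof (intro exI[of _ d] conjI allI impI d(1))
        fix h assume h: "0 < h \<and> h < d"
        have "\<bar>integral {- t..- t + h} r' / h - r t\<bar> < e"
          using d(2)[of h] h by (simp add: r'_def divide_inverse_commute)
        then have "integral {- t..- t + h} r' / h \<le> r t + e" by linarith
        then have "integral {- t..- t + h} r' \<le> (r t + e) * h" using h by (simp add: divide_le_eq)
        then show "(\<integral>\<^sup>+s. ennreal (r s) * indicator {t - h..t} s \<partial>lborel) \<le> ennreal ((r t + e) * h)"
          using h by (simp add: nn ennreal_leI)
      qed
    qed
  qed
qed

text \<open>Reduction to the real functions \<open>norm (q - c)\<close> for \<open>c\<close> in a countable dense set.\<close>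

lemma lebesgue_points_left:
  fixes q :: "real \<Rightarrow> 'x::{real_normed_vector, second_countable_topology}"
  assumes q[measurable]: "q \<in> borel_measurable borel" and B: "\<And>s. norm (q s) \<le> B"
  shows "AE t in lborel. \<forall>e>0. \<exists>d>0. \<forall>h. 0 < h \<and> h < d \<longrightarrow>
    (\<integral>\<^sup>+s. ennreal (norm (q s - q t)) * indicator {t - h..t} s \<partial>lborel) \<le> ennreal (e * h)"
proof -
  obtain D :: "'x set" where D: "countable D" "\<And>p e. 0 < e \<Longrightarrow> \<exists>c\<in>D. dist c p < e"
    by (rule separable_metric[of UNIV]) auto
  have "AE t in lborel. \<forall>e>0. \<exists>d>0. \<forall>h. 0 < h \<and> h < d \<longrightarrow>
    (\<integral>\<^sup>+s. ennreal (norm (q s - c)) * indicator {t - h..t} s \<partial>lborel) \<le> ennreal ((norm (q t - c) + e) * h)" for c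
    by (rule lebesgue_points_left_real[where B="B + norm c"])
      (use B in \<open>auto intro: order_trans[OF norm_triangle_ineq4 add_right_mono]\<close>)
  then have "AE t in lborel. \<forall>c\<in>D. \<forall>e>0. \<exists>d>0. \<forall>h. 0 < h \<and> h < d \<longrightarrow>
    (\<integral>\<^sup>+s. ennreal (norm (q s - c)) * indicator {t - h..t} s \<partial>lborel) \<le> ennreal ((norm (q t - c) + e) * h)"
    using D(1) by (subst AE_ball_countable) auto
  then show ?thesis
  proof eventually_elim
    case (elim t)
    show ?case
    proof (intro allI impI)
      fix e :: real assume e: "0 < e"
      \<comment> \<open>The error splits into three parts below e/3: twice the distance from
        \<open>q t\<close> to \<open>c\<close>, and the differentiation error for this
        \<open>c\<close>.\<close>
      then obtain c where c: "c \<in> D" "norm (q t - c) < e / 3"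
        using D(2)[of "e / 3" "q t"] by (auto simp: dist_norm norm_minus_commute)
      have "e / 3 > 0" using e by simp
      with elim c(1) obtain d where d: "d > 0" "\<And>h. 0 < h \<and> h < d \<Longrightarrow>
        (\<integral>\<^sup>+s. ennreal (norm (q s - c)) * indicator {t - h..t} s \<partial>lborel) \<le> ennreal ((norm (q t - c) + e / 3) * h)"
        by blast
      show "\<exists>d>0. \<forall>h. 0 < h \<and> h < d \<longrightarrow>
        (\<integral>\<^sup>+s. ennreal (norm (q s - q t)) * indicator {t - h..t} s \<partial>lborel) \<le> ennreal (e * h)"
      proof (intro exI[of _ d] conjI allI impI d(1))
        fix h assume h: "0 < h \<and> h < d"
        have "(\<integral>\<^sup>+s. ennreal (norm (q s - q t)) * indicator {t - h..t} s \<partial>lborel)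
          \<le> (\<integral>\<^sup>+s. ennreal (norm (q s - c)) * indicator {t - h..t} s + ennreal (norm (q t - c)) * indicator {t - h..t} s \<partial>lborel)"
        proof (rule nn_integral_mono)
          fix s
          have "norm (q s - q t) \<le> norm (q s - c) + norm (q t - c)"
            using norm_triangle_ineq4[of "q s - c" "q t - c"] by simp
          then have "ennreal (norm (q s - q t)) \<le> ennreal (norm (q s - c)) + ennreal (norm (q t - c))"
            by (simp add: ennreal_plus[symmetric] del: ennreal_plus)
          then show "ennreal (norm (q s - q t)) * indicator {t - h..t} s \<le>
            ennreal (norm (q s - c)) * indicator {t - h..t} s + ennreal (norm (q t - c)) * indicator {t - h..t} s"
            by (auto simp: indicator_def)
        qed
        also have "\<dots> = (\<integral>\<^sup>+s. ennreal (norm (q s - c)) * indicator {t - h..t} s \<partial>lborel)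
            + (\<integral>\<^sup>+s. ennreal (norm (q t - c)) * indicator {t - h..t} s \<partial>lborel)"
          by (rule nn_integral_add) measurable
        also have "(\<integral>\<^sup>+s. ennreal (norm (q t - c)) * indicator {t - h..t} s \<partial>lborel) = ennreal (norm (q t - c) * h)"
          using h by (simp add: nn_integral_cmult ennreal_mult)
        also have "(\<integral>\<^sup>+s. ennreal (norm (q s - c)) * indicator {t - h..t} s \<partial>lborel) + ennreal (norm (q t - c) * h)
          \<le> ennreal ((norm (q t - c) + e / 3) * h) + ennreal (norm (q t - c) * h)"
          using d(2)[OF h] by (rule add_right_mono)
        also have "\<dots> = ennreal ((norm (q t - c) + e / 3) * h + norm (q t - c) * h)"
          using h e by (intro ennreal_plus[symmetric]) auto
        also have "\<dots> \<le> ennreal (e * h)"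
        proof (rule ennreal_leI)
          have "(norm (q t - c) + e / 3 + norm (q t - c)) * h \<le> e * h"
            using c(2) h by (intro mult_right_mono) auto
          then show "(norm (q t - c) + e / 3) * h + norm (q t - c) * h \<le> e * h"
            by (simp add: algebra_simps)
        qed
        finally show "(\<integral>\<^sup>+s. ennreal (norm (q s - q t)) * indicator {t - h..t} s \<partial>lborel) \<le> ennreal (e * h)" .
      qed
    qed
  qed
qed

lemma nn_integral_restrict_Icc_mono:
  assumes "{c..d} \<subseteq> {t - h..t::real}"
  shows "(\<integral>\<^sup>+s. f s \<partial>restrict_space lborel {c..d}) \<le> (\<integral>\<^sup>+s. f s * indicator {t - h..t} s \<partial>lborel)"
  unfolding nn_integral_restrict_Icc
  by (intro nn_integral_mono) (use assms in \<open>auto simp: indicator_def\<close>)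

lemma norm_average_diff_le:
  fixes q :: "real \<Rightarrow> 'x::{banach, second_countable_topology}"
  assumes q[measurable]: "q \<in> borel_measurable borel" and B: "\<And>s. norm (q s) \<le> B" and cd: "c < d"
  shows "ennreal ((d - c) * norm ((LINT s|restrict_space lborel {c..d}. q s) /\<^sub>R (d - c) - p))
    \<le> (\<integral>\<^sup>+s. ennreal (norm (q s - p)) \<partial>restrict_space lborel {c..d})"
proof -
  let ?L = "restrict_space lborel {c..d}"
  interpret L: finite_measure ?L by (rule finite_measure_restrict_Icc)
  have [measurable]: "q \<in> borel_measurable ?L" by (simp add: measurable_restrict_space1)
  have i: "integrable ?L q" by (rule L.integrable_const_bound[of _ B]) (use B in auto)
  have m: "measure ?L (space ?L) = d - c"
    using cd by (simp add: space_restrict_space measure_restrict_space)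
  have "(LINT s|?L. q s - p) = (LINT s|?L. q s) - (d - c) *\<^sub>R p"
    using i m by (subst Bochner_Integration.integral_diff) auto
  then have "(d - c) * norm ((LINT s|?L. q s) /\<^sub>R (d - c) - p) = norm (LINT s|?L. q s - p)"
  proof -
    have "(d - c) *\<^sub>R ((LINT s|?L. q s) /\<^sub>R (d - c) - p) = (LINT s|?L. q s) - (d - c) *\<^sub>R p"
      using cd by (simp add: scaleR_diff_right)
    then show ?thesis using cd \<open>(LINT s|?L. q s - p) = _\<close> by (metis abs_of_pos diff_gt_0_iff_gt norm_scaleR)
  qed
  also have "ennreal (norm (LINT s|?L. q s - p)) \<le> (\<integral>\<^sup>+s. ennreal (norm (q s - p)) \<partial>?L)"
    by (rule integral_norm_bound_ennreal) (use i in auto)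
  finally show ?thesis .
qed

lemma norm_average_le:
  fixes q :: "real \<Rightarrow> 'x::{banach, second_countable_topology}"
  assumes q: "q \<in> borel_measurable borel" and B: "\<And>s. norm (q s) \<le> B" and cd: "c < d"
  shows "norm ((LINT s|restrict_space lborel {c..d}. q s) /\<^sub>R (d - c)) \<le> B"
proof -
  let ?L = "restrict_space lborel {c..d}"
  have B0: "0 \<le> B" using B[of 0] norm_ge_zero order_trans by blast
  have "ennreal ((d - c) * norm ((LINT s|?L. q s) /\<^sub>R (d - c) - 0)) \<le> (\<integral>\<^sup>+s. ennreal (norm (q s - 0)) \<partial>?L)"
    by (rule norm_average_diff_le[OF q B cd])
  also have "\<dots> \<le> (\<integral>\<^sup>+s. ennreal B \<partial>?L)" using B by (intro nn_integral_mono ennreal_leI) simp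
  also have "\<dots> = ennreal (B * (d - c))"
    using cd B0 by (simp add: space_restrict_space emeasure_restrict_space ennreal_mult)
  finally have "(d - c) * norm ((LINT s|?L. q s) /\<^sub>R (d - c)) \<le> B * (d - c)"
    using cd B0 by (simp add: ennreal_le_iff)
  then show ?thesis using cd by (simp add: mult.commute)
qed

section \<open>Density of step processes among square integrable adapted processes\<close>

context brownian_basis
begin

lemma adapted_measurable_at:
  assumes "0 \<le> a" "a \<le> b" "b \<le> T" "adapted F a b f" "t \<in> {a..b}"
  shows "(\<lambda>z. f (fst z) (snd z)) \<in> borel_measurable (time_space (F t) a t)"
proof -
  have "(\<lambda>(s, \<omega>). f s \<omega>) \<in> borel_measurable (restrict_space borel {a..t} \<Otimes>\<^sub>M F t)"
    using adapted_iff_progressively_measurable[OF assms(1-3)] assms(4,5) by blast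
  moreover have "sets (time_space (F t) a t) = sets (restrict_space borel {a..t} \<Otimes>\<^sub>M F t)"
    by (intro sets_pair_measure_cong sets_restrict_space_cong) auto
  ultimately show ?thesis by (simp add: case_prod_unfold cong: measurable_cong_sets)
qed

lemma measurable_time_space_F:
  assumes "t \<in> {0..T}" "f \<in> borel_measurable (time_space (F t) a b)"
  shows "f \<in> borel_measurable (time_space M a b)"
proof -
  have "(\<lambda>x. x) \<in> measurable M (F t)"
    using subalg[OF assms(1)] by (auto simp: subalgebra_def measurable_def)
  then have "(\<lambda>z. (fst z, snd z)) \<in> measurable (time_space M a b) (time_space (F t) a b)"
    by measurable
  from measurable_compose[OF this assms(2)] show ?thesis by simp
qed

lemma adapted_measurable:
  assumes "0 \<le> a" "a \<le> b" "b \<le> T" "adapted F a b f"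
  shows "(\<lambda>z. f (fst z) (snd z)) \<in> borel_measurable (time_space M a b)"
  by (rule measurable_time_space_F[of b]) (use adapted_measurable_at[OF assms, of b] assms in auto)

lemma adapted_mono:
  assumes "0 \<le> a" "a \<le> b'" "b' \<le> b" "b \<le> T" "adapted F a b f"
  shows "adapted F a b' f"
  using assms adapted_iff_progressively_measurable[of a b f] adapted_iff_progressively_measurable[of a b' f]
  by auto

text \<open>On each cell the step process takes the average of \<open>f\<close> over the preceding
  cell. This average is known at the left end point of the cell, so the approximation does not
  anticipate, and at left Lebesgue points of a path it converges.\<close>

lemma step_approximation_bounded:
  fixes f :: "real \<Rightarrow> 'w \<Rightarrow> 'x::{real_inner, banach, second_countable_topology}"
  assumes ab: "0 \<le> a" "a \<le> b" "b \<le> T" and f: "adapted F a b f"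
    and B: "\<And>t \<omega>. t \<in> {a..b} \<Longrightarrow> \<omega> \<in> space M \<Longrightarrow> norm (f t \<omega>) \<le> B" and e: "(0::ennreal) < e"
  shows "\<exists>n \<tau> \<xi>. step_data F a b n \<tau> \<xi> \<and>
    msq (time_space M a b) (\<lambda>z. step_process n \<tau> \<xi> (fst z) (snd z) - f (fst z) (snd z)) < e"
\<comment> \<open>The time strip then has measure zero, and any step process will do.\<close>
proof (cases "a = b")
  case True
  obtain n \<tau> and \<xi> :: "nat \<Rightarrow> 'w \<Rightarrow> 'x" where D: "step_data F a b n \<tau> \<xi>"
    using step_data_zero[OF ab(2)] by blast
  note [measurable] = adapted_measurable[OF ab f] step_process_measurable[OF D ab(1,3)]
  have "msq (time_space M a b) (\<lambda>z. step_process n \<tau> \<xi> (fst z) (snd z) - f (fst z) (snd z))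
    = (\<integral>\<^sup>+s. (\<integral>\<^sup>+\<omega>. ennreal ((norm (step_process n \<tau> \<xi> s \<omega> - f s \<omega>))\<^sup>2) \<partial>M) * indicator {a..b} s \<partial>lborel)"
    unfolding msq_def by (subst nn_integral_time_space[OF prob_space_axioms]) simp_all
  also have "\<dots> = (\<integral>\<^sup>+s. 0 \<partial>(lborel :: real measure))"
    using AE_lborel_singleton[of b] True by (intro nn_integral_cong_AE) (auto elim!: eventually_mono)
  finally show ?thesis using D e by (intro exI) auto
next
  case False
  then have ab': "a < b" using ab by simp
  let ?L = "restrict_space lborel {a..b}"
  define h where "h n = (b - a) / real (Suc n)" for n
  define \<tau> where "\<tau> n i = a + real i * h n" for n i
  \<comment> \<open>The first cell has no predecessor; its value is 0, and its length tends to 0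
    with the mesh.\<close>
  define \<xi> where "\<xi> n i \<omega> = (if i = 0 then 0 else
    (LINT s|restrict_space lborel {\<tau> n (i - 1)..\<tau> n i}. f s \<omega>) /\<^sub>R h n)" for n i \<omega>
  \<comment> \<open>The path extended by 0 to the whole line, the setting of
    \<open>lebesgue_points_left\<close>.\<close>
  define q where "q \<omega> s = indicator {a..b} s *\<^sub>R f s \<omega>" for \<omega> s
  define X where "X n t \<omega> = step_process (Suc n) (\<tau> n) (\<xi> n) t \<omega>" for n t \<omega>
  have h: "h n > 0" for n using ab' by (simp add: h_def)
  have h0: "h \<longlonglongrightarrow> 0" unfolding h_def using LIMSEQ_Suc[OF lim_const_over_n[of "b - a"]] by simp
  have \<tau>0: "\<tau> n 0 = a" and \<tau>n: "\<tau> n (Suc n) = b" for n by (simp_all add: \<tau>_def h_def)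
  have \<tau>S: "\<tau> n (Suc i) = \<tau> n i + h n" for n i by (simp add: \<tau>_def algebra_simps)
  have \<tau>le: "\<tau> n i \<le> \<tau> n j" if "i \<le> j" for n i j
    using that h[of n] by (simp add: \<tau>_def mult_right_mono)
  have \<tau>ab: "\<tau> n i \<in> {a..b}" if "i \<le> Suc n" for n i
    using \<tau>le[of 0 i n] \<tau>le[OF that, of n] \<tau>0 \<tau>n by auto
  note fm = adapted_measurable[OF ab f]
  have B0: "0 \<le> B" 
    using B[of a] ab not_empty by (metis all_not_in_conv atLeastAtMost_iff norm_ge_zero order_refl order_trans)
  have qm: "q \<omega> \<in> borel_measurable borel" if "\<omega> \<in> space M" for \<omega>
  proof -
    have "(\<lambda>s. f s \<omega>) \<in> borel_measurable ?L"
      using measurable_compose[OF measurable_Pair2'[OF that, of ?L] fm] by simp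
    then have "(\<lambda>s. indicator {a..b} s *\<^sub>R f s \<omega>) \<in> borel_measurable lborel"
      by (subst (asm) borel_measurable_restrict_space_iff) auto
    then show ?thesis by (simp add: q_def[abs_def])
  qed
  have qB: "norm (q \<omega> s) \<le> B" if "\<omega> \<in> space M" for \<omega> s
    using B[of s \<omega>] that B0 by (auto simp: q_def indicator_def)
  have \<xi>q: "\<xi> n (Suc i) \<omega> = (LINT s|restrict_space lborel {\<tau> n i..\<tau> n (Suc i)}. q \<omega> s) /\<^sub>R (\<tau> n (Suc i) - \<tau> n i)"
    if "i \<le> n" for n i \<omega>
  proof -
    have "(LINT s|restrict_space lborel {\<tau> n i..\<tau> n (Suc i)}. f s \<omega>) = (LINT s|restrict_space lborel {\<tau> n i..\<tau> n (Suc i)}. q \<omega> s)"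
      using \<tau>ab[of i n] \<tau>ab[of "Suc i" n] that
      by (intro Bochner_Integration.integral_cong) (auto simp: q_def space_restrict_space)
    then show ?thesis by (simp add: \<xi>_def \<tau>S)
  qed
  have \<xi>B: "norm (\<xi> n i \<omega>) \<le> B" if "i \<le> Suc n" "\<omega> \<in> space M" for n i \<omega>
  proof (cases i)
    case 0
    then show ?thesis using B0 by (simp add: \<xi>_def)
  next
    case (Suc j)
    then show ?thesis using norm_average_le[OF qm[OF that(2)] qB[OF that(2)], of "\<tau> n j" "\<tau> n (Suc j)"] that \<xi>q[of j n \<omega>] h[of n]
      by (simp add: \<tau>S)
  qed
  have \<xi>m: "\<xi> n i \<in> borel_measurable (F (\<tau> n i))" if "i \<le> Suc n" for n i
  proof (cases i)
    case 0
    then show ?thesis by (simp add: \<xi>_def[abs_def])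
  next
    case (Suc j)
    let ?t = "\<tau> n i" and ?K = "restrict_space lborel {\<tau> n j..\<tau> n i}"
    interpret K: finite_measure ?K by (rule finite_measure_restrict_Icc)
    have "(\<lambda>z. f (fst z) (snd z)) \<in> borel_measurable (time_space (F ?t) a ?t)"
      by (rule adapted_measurable_at[OF ab f \<tau>ab[OF that]])
    then have "(\<lambda>z. f (fst z) (snd z)) \<in> borel_measurable (time_space (F ?t) (\<tau> n j) ?t)"
      by (rule measurable_compose[OF measurable_time_space_mono, rotated]) (use \<tau>ab[of j n] that Suc in auto)
    from measurable_pair_swap[OF this]
    have "(\<lambda>(\<omega>, s). f s \<omega>) \<in> borel_measurable (F ?t \<Otimes>\<^sub>M ?K)" by simp
    then have "(\<lambda>\<omega>. LINT s|?K. f s \<omega>) \<in> borel_measurable (F ?t)"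
      by (rule K.borel_measurable_lebesgue_integral)
    then show ?thesis using Suc by (simp add: \<xi>_def[abs_def])
  qed
  have D: "step_data F a b (Suc n) (\<tau> n) (\<xi> n)" for n
    unfolding step_data_def
  proof (intro conjI allI impI)
    fix i assume i: "i < Suc n"
    show "\<tau> n i \<le> \<tau> n (Suc i)" by (rule \<tau>le) simp
    show "\<xi> n i \<in> borel_measurable (F (\<tau> n i))" using i by (intro \<xi>m) simp
    have "space (F (\<tau> n i)) = space M" using \<tau>ab[of i n] i ab by (intro space_F) auto
    then show "\<exists>B. \<forall>\<omega>\<in>space (F (\<tau> n i)). norm (\<xi> n i \<omega>) \<le> B" using \<xi>B[of i n] i by auto
  qed (use \<tau>0 \<tau>n in auto)
  have XB: "norm (X n t \<omega>) \<le> B" if "t \<in> {a..b}" "\<omega> \<in> space M" for n t \<omega>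
  proof (cases "t = a")
    case True
    have "X n t \<omega> = 0" unfolding X_def step_process_def
    proof (intro sum.neutral ballI)
      fix i assume "i \<in> {..<Suc n}"
      then show "indicat_real {\<tau> n i<..\<tau> n (Suc i)} t *\<^sub>R \<xi> n i \<omega> = 0" using True \<tau>ab[of i n] by auto
    qed
    then show ?thesis using B0 by simp
  next
    case False
    then have "a < t" "t \<le> b" using that(1) by auto
    then obtain i where "i < Suc n" "\<tau> n i < t" "t \<le> \<tau> n (Suc i)"
      using step_data_cover[OF D[of n]] by blast
    then show ?thesis using step_process_at[OF D] \<xi>B[of i n \<omega>] that(2) by (simp add: X_def)
  qed
  have conv: "(\<lambda>n. norm (X n t \<omega> - f t \<omega>)) \<longlonglongrightarrow> 0"
    if \<omega>: "\<omega> \<in> space M" and t: "a < t" "t \<le> b"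
      and lp: "\<forall>e>0. \<exists>d>0. \<forall>h. 0 < h \<and> h < d \<longrightarrow>
        (\<integral>\<^sup>+s. ennreal (norm (q \<omega> s - q \<omega> t)) * indicator {t - h..t} s \<partial>lborel) \<le> ennreal (e * h)"
    for t \<omega>
  proof (rule LIMSEQ_I)
    fix r :: real assume r: "0 < r"
    then have "r / 4 > 0" by simp
    with lp obtain d where d: "d > 0" "\<And>h. 0 < h \<and> h < d \<Longrightarrow>
        (\<integral>\<^sup>+s. ennreal (norm (q \<omega> s - q \<omega> t)) * indicator {t - h..t} s \<partial>lborel) \<le> ennreal (r / 4 * h)"
      by blast
    have "eventually (\<lambda>n. h n < min (d / 2) (t - a)) sequentially"
      using h0 d(1) t by (intro order_tendstoD) auto
    then obtain N where N: "\<And>n. n \<ge> N \<Longrightarrow> h n < min (d / 2) (t - a)"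
      by (auto simp: eventually_sequentially)
    have "norm (norm (X n t \<omega> - f t \<omega>) - 0) < r" if "n \<ge> N" for n
    proof -
      obtain i where i: "i < Suc n" "\<tau> n i < t" "t \<le> \<tau> n (Suc i)"
        using step_data_cover[OF D[of n] t] by blast
      \<comment> \<open>By the choice of \<open>N\<close> the mesh is smaller than t - a, so
        \<open>t\<close> lies beyond the first cell.\<close>
      have "i \<noteq> 0" using i N[OF that] \<tau>S[of n 0] \<tau>0[of n] by (intro notI) auto
      then obtain j where j: "i = Suc j" by (cases i) auto
      have Xi: "X n t \<omega> = (LINT s|restrict_space lborel {\<tau> n j..\<tau> n i}. q \<omega> s) /\<^sub>R (\<tau> n i - \<tau> n j)"
        using step_process_at[OF D i] \<xi>q[of j n] i j by (simp add: X_def)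
      have "ennreal ((\<tau> n i - \<tau> n j) * norm (X n t \<omega> - q \<omega> t))
        \<le> (\<integral>\<^sup>+s. ennreal (norm (q \<omega> s - q \<omega> t)) \<partial>restrict_space lborel {\<tau> n j..\<tau> n i})"
        unfolding Xi by (rule norm_average_diff_le[OF qm[OF \<omega>] qB[OF \<omega>]]) (use h[of n] j \<tau>S in simp)
      \<comment> \<open>The preceding cell begins at most two mesh sizes before \<open>t\<close>.
        Enlarging its average to this interval costs a factor 2, which the choice of r/4 allows
        for.\<close>
      also have "\<dots> \<le> (\<integral>\<^sup>+s. ennreal (norm (q \<omega> s - q \<omega> t)) * indicator {t - 2 * h n..t} s \<partial>lborel)"
        by (rule nn_integral_restrict_Icc_mono) (use i j \<tau>S in auto)
      also have "\<dots> \<le> ennreal (r / 4 * (2 * h n))"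
        by (rule d(2)) (use h[of n] N[OF that] in auto)
      finally have "h n * norm (X n t \<omega> - q \<omega> t) \<le> r / 4 * (2 * h n)"
        using h[of n] r j \<tau>S by (simp add: ennreal_le_iff)
      then have "norm (X n t \<omega> - q \<omega> t) \<le> r / 2" using h[of n] by (simp add: field_simps)
      moreover have "q \<omega> t = f t \<omega>" using t by (simp add: q_def)
      ultimately show ?thesis using r by simp
    qed
    then show "\<exists>no. \<forall>n\<ge>no. norm (norm (X n t \<omega> - f t \<omega>) - 0) < r" by blast
  qed
  define u where "u n z = ennreal ((norm (X n (fst z) (snd z) - f (fst z) (snd z)))\<^sup>2)" for n z
  have um[measurable]: "u n \<in> borel_measurable (time_space M a b)" for n
    unfolding u_def X_def using step_process_measurable[OF D ab(1,3)] fm by measurable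
  have uB: "u n (t, \<omega>) \<le> ennreal ((2 * B)\<^sup>2)" if "t \<in> {a..b}" "\<omega> \<in> space M" for n t \<omega>
  proof -
    have "norm (X n t \<omega> - f t \<omega>) \<le> 2 * B"
      using norm_triangle_ineq4[of "X n t \<omega>" "f t \<omega>"] XB[OF that, of n] B[OF that] by simp
    then show ?thesis unfolding u_def by (intro ennreal_leI power_mono) auto
  qed
  interpret P: pair_sigma_finite ?L M by (rule pair_sigma_finite_time_space[OF prob_space_axioms])
  interpret L: finite_measure ?L by (rule finite_measure_restrict_Icc)
  \<comment> \<open>The null set of bad times depends on \<omega>, so dominated convergence is used
    in time for fixed \<omega> first and over \<omega> afterwards.\<close>
  have inner: "(\<lambda>n. \<integral>\<^sup>+t. u n (t, \<omega>) \<partial>?L) \<longlonglongrightarrow> (\<integral>\<^sup>+t. 0 \<partial>?L)" if \<omega>: "\<omega> \<in> space M" for \<omega>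
  proof (rule nn_integral_dominated_convergence[where w="\<lambda>_. ennreal ((2 * B)\<^sup>2)"])
    show "(\<lambda>t. u n (t, \<omega>)) \<in> borel_measurable ?L" for n
      using measurable_compose[OF measurable_Pair2'[OF \<omega>, of ?L] um] by simp
    show "AE t in ?L. u n (t, \<omega>) \<le> ennreal ((2 * B)\<^sup>2)" for n
      by (rule AE_I2) (use uB \<omega> in \<open>auto simp: space_restrict_space\<close>)
    show "(\<integral>\<^sup>+t. ennreal ((2 * B)\<^sup>2) \<partial>?L) < \<infinity>"
      by (simp add: ennreal_mult_less_top L.emeasure_eq_measure)
    have "AE t in lborel. t \<in> {a..b} \<longrightarrow> (\<lambda>n. u n (t, \<omega>)) \<longlonglongrightarrow> 0"
      using lebesgue_points_left[OF qm[OF \<omega>] qB[OF \<omega>]] AE_lborel_singleton[of a]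
    proof eventually_elim
      case (elim t)
      show ?case
      proof
        assume "t \<in> {a..b}"
        then have "(\<lambda>n. norm (X n t \<omega> - f t \<omega>)) \<longlonglongrightarrow> 0"
          using elim by (intro conv[OF \<omega>]) auto
        then have "(\<lambda>n. ennreal ((norm (X n t \<omega> - f t \<omega>))\<^sup>2)) \<longlonglongrightarrow> ennreal (0\<^sup>2)"
          by (intro tendsto_intros)
        then show "(\<lambda>n. u n (t, \<omega>)) \<longlonglongrightarrow> 0" by (simp add: u_def)
      qed
    qed
    then show "AE t in ?L. (\<lambda>n. u n (t, \<omega>)) \<longlonglongrightarrow> 0"
      by (simp add: AE_restrict_space_iff)
  qed auto
  have "(\<lambda>n. \<integral>\<^sup>+\<omega>. (\<integral>\<^sup>+t. u n (t, \<omega>) \<partial>?L) \<partial>M) \<longlonglongrightarrow> (\<integral>\<^sup>+\<omega>. 0 \<partial>M)"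
  proof (rule nn_integral_dominated_convergence[where w="\<lambda>_. ennreal ((2 * B)\<^sup>2) * emeasure ?L (space ?L)"])
    show "(\<lambda>\<omega>. \<integral>\<^sup>+t. u n (t, \<omega>) \<partial>?L) \<in> borel_measurable M" for n
      using P.M1.borel_measurable_nn_integral_fst[OF measurable_pair_swap[OF um]] by simp
    show "AE \<omega> in M. (\<integral>\<^sup>+t. u n (t, \<omega>) \<partial>?L) \<le> ennreal ((2 * B)\<^sup>2) * emeasure ?L (space ?L)" for n
    proof (rule AE_I2)
      fix \<omega> assume "\<omega> \<in> space M"
      then have "(\<integral>\<^sup>+t. u n (t, \<omega>) \<partial>?L) \<le> (\<integral>\<^sup>+t. ennreal ((2 * B)\<^sup>2) \<partial>?L)"
        by (intro nn_integral_mono) (use uB in \<open>auto simp: space_restrict_space\<close>)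
      then show "(\<integral>\<^sup>+t. u n (t, \<omega>) \<partial>?L) \<le> ennreal ((2 * B)\<^sup>2) * emeasure ?L (space ?L)" by simp
    qed
    show "(\<integral>\<^sup>+\<omega>. ennreal ((2 * B)\<^sup>2) * emeasure ?L (space ?L) \<partial>M) < \<infinity>"
      by (simp add: ennreal_mult_less_top L.emeasure_eq_measure emeasure_space_1)
    show "AE \<omega> in M. (\<lambda>n. \<integral>\<^sup>+t. u n (t, \<omega>) \<partial>?L) \<longlonglongrightarrow> 0"
      by (rule AE_I2) (use inner in simp)
  qed auto
  then have "(\<lambda>n. \<integral>\<^sup>+z. u n z \<partial>time_space M a b) \<longlonglongrightarrow> 0"
    by (simp add: P.nn_integral_snd)
  then have "eventually (\<lambda>n. (\<integral>\<^sup>+z. u n z \<partial>time_space M a b) < e) sequentially"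
    using e by (rule order_tendstoD)
  then obtain n where "(\<integral>\<^sup>+z. u n z \<partial>time_space M a b) < e"
    by (auto simp: eventually_sequentially)
  then show ?thesis using D[of n] by (intro exI) (auto simp: msq_def u_def[abs_def] X_def)
qed

text \<open>Values of norm above m are replaced by 0. The truncated process is bounded and still
  adapted, and the error is dominated by \<open>f\<close> itself.\<close>

lemma step_approximation:
  fixes f :: "real \<Rightarrow> 'w \<Rightarrow> 'x::{real_inner, banach, second_countable_topology}"
  assumes ab: "0 \<le> a" "a \<le> b" "b \<le> T" and f: "adapted F a b f"
    and fin: "msq (time_space M a b) (\<lambda>z. f (fst z) (snd z)) < \<infinity>" and e: "(0::real) < e"
  shows "\<exists>n \<tau> \<xi>. step_data F a b n \<tau> \<xi> \<and>
    msq (time_space M a b) (\<lambda>z. step_process n \<tau> \<xi> (fst z) (snd z) - f (fst z) (snd z)) \<le> ennreal e"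
proof -
  let ?P = "time_space M a b"
  define g where "g m t \<omega> = (if norm (f t \<omega>) \<le> real m then f t \<omega> else 0)" for m t \<omega>
  note fm[measurable] = adapted_measurable[OF ab f]
  have ga: "adapted F a b (g m)" for m
  proof -
    have [measurable]: "(\<lambda>z. f (fst z) (snd z)) \<in> borel_measurable (progressive_field F a b)"
      using f by (simp add: adapted_def case_prod_unfold)
    show ?thesis unfolding adapted_def case_prod_unfold g_def by measurable
  qed
  note gm[measurable] = adapted_measurable[OF ab ga]
  have "(\<lambda>m. \<integral>\<^sup>+z. ennreal ((norm (g m (fst z) (snd z) - f (fst z) (snd z)))\<^sup>2) \<partial>?P) \<longlonglongrightarrow> (\<integral>\<^sup>+z. 0 \<partial>?P)"
  proof (rule nn_integral_dominated_convergence[where w="\<lambda>z. ennreal ((norm (f (fst z) (snd z)))\<^sup>2)"])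
    show "AE z in ?P. ennreal ((norm (g m (fst z) (snd z) - f (fst z) (snd z)))\<^sup>2) \<le> ennreal ((norm (f (fst z) (snd z)))\<^sup>2)" for m
      by (rule AE_I2) (auto simp: g_def)
    show "(\<integral>\<^sup>+z. ennreal ((norm (f (fst z) (snd z)))\<^sup>2) \<partial>?P) < \<infinity>" using fin by (simp add: msq_def)
    show "AE z in ?P. (\<lambda>m. ennreal ((norm (g m (fst z) (snd z) - f (fst z) (snd z)))\<^sup>2)) \<longlonglongrightarrow> 0"
    proof (rule AE_I2)
      fix z :: "real \<times> 'w"
      obtain N :: nat where N: "norm (f (fst z) (snd z)) \<le> N" using real_arch_simple by blast
      have "eventually (\<lambda>m. ennreal ((norm (g m (fst z) (snd z) - f (fst z) (snd z)))\<^sup>2) = 0) sequentially"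
        using eventually_ge_at_top[of N] by eventually_elim (use N in \<open>auto simp: g_def\<close>)
      then show "(\<lambda>m. ennreal ((norm (g m (fst z) (snd z) - f (fst z) (snd z)))\<^sup>2)) \<longlonglongrightarrow> 0"
        by (rule tendsto_eventually)
    qed
  qed measurable
  then have "eventually (\<lambda>m. (\<integral>\<^sup>+z. ennreal ((norm (g m (fst z) (snd z) - f (fst z) (snd z)))\<^sup>2) \<partial>?P) < ennreal (e / 4)) sequentially"
    using e by (intro order_tendstoD) auto
  then obtain m where m: "msq ?P (\<lambda>z. g m (fst z) (snd z) - f (fst z) (snd z)) < ennreal (e / 4)"
    by (auto simp: eventually_sequentially msq_def)
  obtain n \<tau> \<xi> where D: "step_data F a b n \<tau> \<xi>"
    "msq ?P (\<lambda>z. step_process n \<tau> \<xi> (fst z) (snd z) - g m (fst z) (snd z)) < ennreal (e / 4)"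
  proof -
    have "norm (g m t \<omega>) \<le> real m" for t \<omega> by (simp add: g_def)
    moreover have "0 < ennreal (e / 4)" using e by simp
    ultimately show ?thesis using step_approximation_bounded[OF ab ga, of m "real m"] that by blast
  qed
  have "msq ?P (\<lambda>z. step_process n \<tau> \<xi> (fst z) (snd z) - f (fst z) (snd z))
     \<le> 2 * msq ?P (\<lambda>z. step_process n \<tau> \<xi> (fst z) (snd z) - g m (fst z) (snd z))
      + 2 * msq ?P (\<lambda>z. g m (fst z) (snd z) - f (fst z) (snd z))"
    by (rule msq_triangle[OF step_process_measurable[OF D(1) ab(1,3)] gm fm])
  also have "\<dots> \<le> 2 * ennreal (e / 4) + 2 * ennreal (e / 4)"
    using m D(2) by (intro add_mono mult_left_mono) auto
  also have "\<dots> = ennreal e"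
  proof -
    have "(2::ennreal) * ennreal (e / 4) = ennreal (e / 2)"
      using e ennreal_mult[of 2 "e / 4"] by simp
    then show ?thesis using e ennreal_plus[of "e / 2" "e / 2"] by simp
  qed
  finally show ?thesis using D(1) by blast
qed

end

section \<open>The Ito integral\<close>

lemma msq_triangle_ae:
  fixes f g h :: "'z \<Rightarrow> 'x::{real_normed_vector, second_countable_topology}"
  assumes "ae_measurable N N f" "ae_measurable N N g"
  shows "msq N (\<lambda>z. f z - g z) \<le> 2 * msq N f + 2 * msq N g"
    and "msq N (\<lambda>z. f z + g z) \<le> 2 * msq N f + 2 * msq N g"
proof -
  obtain f' g' where m: "f' \<in> borel_measurable N" "g' \<in> borel_measurable N"
    and eq: "AE z in N. f z = f' z" "AE z in N. g z = g' z"
    using assms by (auto simp: ae_measurable_def)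
  have "msq N (\<lambda>z. f z - g z) = msq N (\<lambda>z. f' z - g' z)" "msq N (\<lambda>z. f z + g z) = msq N (\<lambda>z. f' z + g' z)"
    "msq N f = msq N f'" "msq N g = msq N g'"
    by (rule msq_cong_AE; use eq in eventually_elim; simp)+
  then show "msq N (\<lambda>z. f z - g z) \<le> 2 * msq N f + 2 * msq N g"
    "msq N (\<lambda>z. f z + g z) \<le> 2 * msq N f + 2 * msq N g"
    using msq_diff_le[OF m] msq_add_le[OF m] by simp_all
qed

lemma choice3: "\<forall>k. \<exists>x y z. P k x y z \<Longrightarrow> \<exists>x y z. \<forall>k. P k (x k) (y k) (z k)"
  by metis

lemma has_ito_integral_iff:
  "has_ito_integral M F W a b f J \<longleftrightarrow>
     f \<in> L2_proc M F a b \<and> J \<in> L2_rv M (F b) \<and>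
     (\<exists>n \<tau> \<xi>. (\<forall>k. step_data F a b (n k) (\<tau> k) (\<xi> k)) \<and>
       (\<lambda>k. msq (time_space M a b) (\<lambda>z. step_process (n k) (\<tau> k) (\<xi> k) (fst z) (snd z) - f (fst z) (snd z))) \<longlonglongrightarrow> 0 \<and>
       (\<lambda>k. msq M (\<lambda>\<omega>. step_integral W (n k) (\<tau> k) (\<xi> k) \<omega> - J \<omega>)) \<longlonglongrightarrow> 0)"
  by (simp add: has_ito_integral_def msq_def case_prod_unfold)

lemma ennreal_tendsto_0_le:
  fixes x y :: "nat \<Rightarrow> ennreal"
  assumes "\<And>k. y k \<le> 2 * x k + 2 * x' k" "x \<longlonglongrightarrow> 0" "x' \<longlonglongrightarrow> 0"
  shows "y \<longlonglongrightarrow> 0"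
proof (rule tendsto_sandwich[OF _ _ tendsto_const])
  have "(\<lambda>k. 2 * x k + 2 * x' k) \<longlonglongrightarrow> 2 * 0 + 2 * 0"
    by (intro tendsto_add ennreal_tendsto_cmult assms) auto
  then show "(\<lambda>k. 2 * x k + 2 * x' k) \<longlonglongrightarrow> 0" by simp
qed (use assms(1) in auto)

context brownian_basis
begin

lemma L2_proc_iff:
  fixes f :: "real \<Rightarrow> 'w \<Rightarrow> 'x::{real_normed_vector, second_countable_topology}"
  assumes "0 \<le> a" "a \<le> b" "b \<le> T"
  shows "f \<in> L2_proc M F a b \<longleftrightarrow> (\<exists>f'. adapted F a b f' \<and>
    (AE z in time_space M a b. f (fst z) (snd z) = f' (fst z) (snd z)) \<and>
    msq (time_space M a b) (\<lambda>z. f' (fst z) (snd z)) < \<infinity>)"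
  unfolding L2_proc_def mem_Collect_eq case_prod_unfold
  using integrable_sq_iff[OF adapted_measurable[OF assms]] by (intro iff_exI) blast

text \<open>The indicator of a progressive set is an adapted process, so
  \<open>adapted_measurable\<close> applies to it.\<close>

lemma sets_progressive_field:
  assumes "0 \<le> a" "a \<le> b" "b \<le> T"
  shows "sets (progressive_field F a b) \<subseteq> sets (time_space M a b)"
    and "space (progressive_field F a b) = space (time_space M a b)"
proof -
  have b: "b \<in> {0..T}" using assms by simp
  show sp: "space (progressive_field F a b) = space (time_space M a b)"
    using space_F[OF b] by (simp add: sets_progressive_subset_space space_pair_measure space_restrict_space)
  show "sets (progressive_field F a b) \<subseteq> sets (time_space M a b)"
  proof
    fix B assume B: "B \<in> sets (progressive_field F a b)"
    have "adapted F a b (\<lambda>t \<omega>. indicator B (t, \<omega>) :: real)"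
      unfolding adapted_def using B by (simp add: case_prod_unfold)
    from adapted_measurable[OF assms this]
    have m: "(\<lambda>z. indicator B z :: real) \<in> borel_measurable (time_space M a b)" by simp
    have "(\<lambda>z. indicator B z :: real) -` {1} \<inter> space (time_space M a b) \<in> sets (time_space M a b)"
      by (rule measurable_sets[OF m]) simp
    also have "(\<lambda>z. indicator B z :: real) -` {1} \<inter> space (time_space M a b) = B"
      using sets.sets_into_space[OF B] sp by (auto simp: indicator_def split: if_splits)
    finally show "B \<in> sets (time_space M a b)" .
  qed
qed

lemma ae_progressive_imp_ae_measurable:
  assumes "0 \<le> a" "a \<le> b" "b \<le> T" and "ae_measurable (progressive_field F a b) N f"
  shows "ae_measurable (time_space M a b) N f"
  using assms(4) sets_progressive_field[OF assms(1-3)] by (auto simp: ae_measurable_def measurable_def)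

lemma L2_procD:
  fixes f :: "real \<Rightarrow> 'w \<Rightarrow> 'x::{real_normed_vector, second_countable_topology}"
  assumes "0 \<le> a" "a \<le> b" "b \<le> T" and f: "f \<in> L2_proc M F a b"
  shows "ae_measurable (progressive_field F a b) (time_space M a b) (\<lambda>z. f (fst z) (snd z))"
    and "msq (time_space M a b) (\<lambda>z. f (fst z) (snd z)) < \<infinity>"
    and "ae_measurable (time_space M a b) (time_space M a b) (\<lambda>z. f (fst z) (snd z))"
proof -
  obtain f' where f': "adapted F a b f'" "AE z in time_space M a b. f (fst z) (snd z) = f' (fst z) (snd z)"
    "msq (time_space M a b) (\<lambda>z. f' (fst z) (snd z)) < \<infinity>"
    using f unfolding L2_proc_iff[OF assms(1-3)] by blast
  show 1: "ae_measurable (progressive_field F a b) (time_space M a b) (\<lambda>z. f (fst z) (snd z))"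
    using f'(1) by (intro ae_measurableI_AE[OF _ f'(2)]) (simp add: adapted_def case_prod_unfold)
  show "ae_measurable (time_space M a b) (time_space M a b) (\<lambda>z. f (fst z) (snd z))"
    by (rule ae_progressive_imp_ae_measurable[OF assms(1-3) 1])
  have "msq (time_space M a b) (\<lambda>z. f (fst z) (snd z)) = msq (time_space M a b) (\<lambda>z. f' (fst z) (snd z))"
    by (rule msq_cong_AE) (use f'(2) in eventually_elim, simp)
  then show "msq (time_space M a b) (\<lambda>z. f (fst z) (snd z)) < \<infinity>" using f'(3) by simp
qed

lemma L2_procI:
  fixes f :: "real \<Rightarrow> 'w \<Rightarrow> 'x::{real_normed_vector, second_countable_topology}"
  assumes "0 \<le> a" "a \<le> b" "b \<le> T"
    and ae: "ae_measurable (progressive_field F a b) (time_space M a b) (\<lambda>z. f (fst z) (snd z))"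
    and fin: "msq (time_space M a b) (\<lambda>z. f (fst z) (snd z)) < \<infinity>"
  shows "f \<in> L2_proc M F a b"
proof -
  obtain f' where f': "f' \<in> borel_measurable (progressive_field F a b)"
    "AE z in time_space M a b. f (fst z) (snd z) = f' z"
    using ae by (auto simp: ae_measurable_def)
  have "msq (time_space M a b) (\<lambda>z. f (fst z) (snd z)) = msq (time_space M a b) f'"
    by (rule msq_cong_AE) (use f'(2) in eventually_elim, simp)
  with f' fin show ?thesis unfolding L2_proc_iff[OF assms(1-3)]
    by (intro exI[of _ "\<lambda>t \<omega>. f' (t, \<omega>)"]) (simp add: adapted_def)
qed

lemma L2_proc_diff:
  fixes f g :: "real \<Rightarrow> 'w \<Rightarrow> 'x::{real_normed_vector, second_countable_topology}"
  assumes ab: "0 \<le> a" "a \<le> b" "b \<le> T" and "f \<in> L2_proc M F a b" "g \<in> L2_proc M F a b"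
  shows "(\<lambda>t \<omega>. f t \<omega> - g t \<omega>) \<in> L2_proc M F a b"
proof (rule L2_procI[OF ab])
  note f = L2_procD[OF ab assms(4)] and g = L2_procD[OF ab assms(5)]
  show "ae_measurable (progressive_field F a b) (time_space M a b) (\<lambda>z. f (fst z) (snd z) - g (fst z) (snd z))"
    by (rule ae_measurable_diff[OF f(1) g(1)])
  have "msq (time_space M a b) (\<lambda>z. f (fst z) (snd z) - g (fst z) (snd z))
    \<le> 2 * msq (time_space M a b) (\<lambda>z. f (fst z) (snd z)) + 2 * msq (time_space M a b) (\<lambda>z. g (fst z) (snd z))"
    by (rule msq_triangle_ae(1)[OF f(3) g(3)])
  also have "\<dots> < \<infinity>" using f(2) g(2) by (simp add: ennreal_mult_less_top)
  finally show "msq (time_space M a b) (\<lambda>z. f (fst z) (snd z) - g (fst z) (snd z)) < \<infinity>" .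
qed

lemma L2_rv_diff:
  fixes J K :: "'w \<Rightarrow> 'x::{real_normed_vector, second_countable_topology}"
  assumes t: "t \<in> {0..T}" and "J \<in> L2_rv M (F t)" "K \<in> L2_rv M (F t)"
  shows "(\<lambda>\<omega>. J \<omega> - K \<omega>) \<in> L2_rv M (F t)"
proof -
  have *: "J \<in> borel_measurable (F t)" "K \<in> borel_measurable (F t)" "msq M J < \<infinity>" "msq M K < \<infinity>"
    using assms(2,3) unfolding L2_rv_iff[OF subalg[OF t]] by auto
  have "msq M (\<lambda>\<omega>. J \<omega> - K \<omega>) \<le> 2 * msq M J + 2 * msq M K"
    by (rule msq_diff_le) (use * measurable_F_M t in auto)
  also have "\<dots> < \<infinity>" using * by (simp add: ennreal_mult_less_top)
  finally show ?thesis using * unfolding L2_rv_iff[OF subalg[OF t]] by auto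
qed

lemma ito_measurable:
  fixes J :: "'w \<Rightarrow> 'x::{real_normed_vector, second_countable_topology}"
  assumes "0 \<le> a" "a \<le> b" "b \<le> T" "has_ito_integral M F W a b f J"
  shows "J \<in> borel_measurable M" "J \<in> borel_measurable (F b)" "msq M J < \<infinity>"
proof -
  have b: "b \<in> {0..T}" using assms by simp
  have "J \<in> L2_rv M (F b)" using assms(4) by (simp add: has_ito_integral_iff)
  then show "J \<in> borel_measurable (F b)" "msq M J < \<infinity>" "J \<in> borel_measurable M"
    unfolding L2_rv_iff[OF subalg[OF b]] using measurable_F_M[OF _ b] by auto
qed

text \<open>Step processes are chosen with errors (1/16)^k, so the isometry makes their integrals
  converge fast enough for \<open>msq_fast_limit\<close>. The pointwise limit of
  \<open>F b\<close>-measurable integrals is an \<open>F b\<close>-measurable version of the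
  stochastic integral.\<close>

lemma ito_exists:
  fixes f :: "real \<Rightarrow> 'w \<Rightarrow> 'x::{real_inner, banach, second_countable_topology}"
  assumes ab: "0 \<le> a" "a \<le> b" "b \<le> T" and f: "f \<in> L2_proc M F a b"
  shows "\<exists>J. has_ito_integral M F W a b f J"
proof -
  let ?P = "time_space M a b"
  obtain f' where f': "adapted F a b f'" "AE z in ?P. f (fst z) (snd z) = f' (fst z) (snd z)"
    "msq ?P (\<lambda>z. f' (fst z) (snd z)) < \<infinity>"
    using f unfolding L2_proc_iff[OF ab] by blast
  have "\<exists>n \<tau> \<xi>. step_data F a b n \<tau> \<xi> \<and>
    msq ?P (\<lambda>z. step_process n \<tau> \<xi> (fst z) (snd z) - f' (fst z) (snd z)) \<le> ennreal ((1/16)^k)" for k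
    by (rule step_approximation[OF ab f'(1,3)]) simp
  then have "\<exists>n \<tau> \<xi>. \<forall>k. step_data F a b (n k) (\<tau> k) (\<xi> k) \<and>
    msq ?P (\<lambda>z. step_process (n k) (\<tau> k) (\<xi> k) (fst z) (snd z) - f' (fst z) (snd z)) \<le> ennreal ((1/16)^k)"
    by (intro choice3 allI)
  then obtain n \<tau> and \<xi> :: "nat \<Rightarrow> nat \<Rightarrow> 'w \<Rightarrow> 'x" where D: "\<And>k. step_data F a b (n k) (\<tau> k) (\<xi> k)"
    and app: "\<And>k. msq ?P (\<lambda>z. step_process (n k) (\<tau> k) (\<xi> k) (fst z) (snd z) - f' (fst z) (snd z)) \<le> ennreal ((1/16)^k)"
    by blast
  define I where "I k = step_integral W (n k) (\<tau> k) (\<xi> k)" for k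
  have b: "b \<in> {0..T}" using ab by simp
  have IF[measurable]: "I k \<in> borel_measurable (F b)" for k
    unfolding I_def by (rule step_integral_msq(2)[OF D ab(1,3)])
  have IM: "I k \<in> borel_measurable M" for k by (rule measurable_F_M[OF IF b])
  note sm = step_process_measurable[OF D ab(1,3)] and fm = adapted_measurable[OF ab f'(1)]
  have inc: "msq M (\<lambda>\<omega>. I (Suc k) \<omega> - I k \<omega>) \<le> ennreal (4 * (1/16)^k)" for k
  proof -
    have "msq M (\<lambda>\<omega>. I (Suc k) \<omega> - I k \<omega>) = msq ?P (\<lambda>z. step_process (n (Suc k)) (\<tau> (Suc k)) (\<xi> (Suc k)) (fst z) (snd z)
        - step_process (n k) (\<tau> k) (\<xi> k) (fst z) (snd z))"
      unfolding I_def by (rule step_isometry_diff[OF D D ab(1,3)])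
    also have "\<dots> \<le> 2 * msq ?P (\<lambda>z. step_process (n (Suc k)) (\<tau> (Suc k)) (\<xi> (Suc k)) (fst z) (snd z) - f' (fst z) (snd z))
       + 2 * msq ?P (\<lambda>z. f' (fst z) (snd z) - step_process (n k) (\<tau> k) (\<xi> k) (fst z) (snd z))"
      by (rule msq_triangle[OF sm fm sm])
    also have "\<dots> \<le> 2 * ennreal ((1/16)^Suc k) + 2 * ennreal ((1/16)^k)"
      unfolding msq_commute[of ?P "\<lambda>z. f' (fst z) (snd z)"]
      by (intro add_mono mult_left_mono app) auto
    also have "\<dots> = ennreal (2 * (1/16)^Suc k + 2 * (1/16)^k)"
      by (subst ennreal_plus) (auto simp: ennreal_mult simp del: power_Suc)
    also have "\<dots> \<le> ennreal (4 * (1/16)^k)" by (intro ennreal_leI) simp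
    finally show ?thesis .
  qed
  define J where "J \<omega> = lim (\<lambda>k. I k \<omega>)" for \<omega>
  have JF: "J \<in> borel_measurable (F b)" unfolding J_def by measurable
  have lim: "msq M (\<lambda>\<omega>. I k \<omega> - J \<omega>) \<le> ennreal (8 * 4 * (1/4)^k)" for k
    unfolding J_def using msq_fast_limit(2)[OF IM inc] by simp
  have "msq M (\<lambda>\<omega>. J \<omega>) \<le> 2 * msq M (\<lambda>\<omega>. J \<omega> - I 0 \<omega>) + 2 * msq M (I 0)"
    using msq_triangle[of J M "I 0" "\<lambda>_. 0"] measurable_F_M[OF JF b] IM by simp
  also have "\<dots> < \<infinity>"
    using lim[of 0] step_integral_msq(3)[OF D ab(1,3), of 0]
    by (auto simp: msq_commute[of M J] I_def ennreal_mult_less_top intro: le_less_trans)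
  finally have J2: "J \<in> L2_rv M (F b)"
    using JF unfolding L2_rv_iff[OF subalg[OF b]] by simp
  have geo: "(\<lambda>k. ennreal (c * r ^ k)) \<longlonglongrightarrow> 0" if "0 \<le> r" "r < 1" for c r :: real
  proof -
    have "(\<lambda>k. ennreal (c * r ^ k)) \<longlonglongrightarrow> ennreal (c * 0)"
      by (intro tendsto_ennrealI tendsto_mult_left LIMSEQ_realpow_zero that)
    then show ?thesis by simp
  qed
  have l1: "(\<lambda>k. msq M (\<lambda>\<omega>. step_integral W (n k) (\<tau> k) (\<xi> k) \<omega> - J \<omega>)) \<longlonglongrightarrow> 0"
    by (rule tendsto_sandwich[OF _ _ tendsto_const geo[of "1/4" 32]]) (use lim in \<open>auto simp: I_def\<close>)
  have e: "msq ?P (\<lambda>z. step_process (n k) (\<tau> k) (\<xi> k) (fst z) (snd z) - f (fst z) (snd z))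
      = msq ?P (\<lambda>z. step_process (n k) (\<tau> k) (\<xi> k) (fst z) (snd z) - f' (fst z) (snd z))" for k
    by (rule msq_cong_AE) (use f'(2) in eventually_elim, simp)
  have l2: "(\<lambda>k. msq ?P (\<lambda>z. step_process (n k) (\<tau> k) (\<xi> k) (fst z) (snd z) - f (fst z) (snd z))) \<longlonglongrightarrow> 0"
    unfolding e by (rule tendsto_sandwich[OF _ _ tendsto_const geo[of "1/16" 1]]) (use app in auto)
  show ?thesis unfolding has_ito_integral_iff using f J2 D l1 l2 by blast
qed

text \<open>The approximating sequences of the two integrands live on unrelated grids;
  \<open>step_data_diff\<close> combines them for each k.\<close>

lemma ito_diff:
  fixes f g :: "real \<Rightarrow> 'w \<Rightarrow> 'x::{real_inner, banach, second_countable_topology}"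
  assumes ab: "0 \<le> a" "a \<le> b" "b \<le> T"
    and f: "has_ito_integral M F W a b f J" and g: "has_ito_integral M F W a b g K"
  shows "has_ito_integral M F W a b (\<lambda>t \<omega>. f t \<omega> - g t \<omega>) (\<lambda>\<omega>. J \<omega> - K \<omega>)"
proof -
  let ?P = "time_space M a b"
  have b: "b \<in> {0..T}" using ab by simp
  obtain n \<tau> and \<xi> :: "nat \<Rightarrow> nat \<Rightarrow> 'w \<Rightarrow> 'x" where D: "\<And>k. step_data F a b (n k) (\<tau> k) (\<xi> k)"
    "(\<lambda>k. msq ?P (\<lambda>z. step_process (n k) (\<tau> k) (\<xi> k) (fst z) (snd z) - f (fst z) (snd z))) \<longlonglongrightarrow> 0"
    "(\<lambda>k. msq M (\<lambda>\<omega>. step_integral W (n k) (\<tau> k) (\<xi> k) \<omega> - J \<omega>)) \<longlonglongrightarrow> 0"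
    using f unfolding has_ito_integral_iff by blast
  obtain n' \<tau>' and \<xi>' :: "nat \<Rightarrow> nat \<Rightarrow> 'w \<Rightarrow> 'x" where D': "\<And>k. step_data F a b (n' k) (\<tau>' k) (\<xi>' k)"
    "(\<lambda>k. msq ?P (\<lambda>z. step_process (n' k) (\<tau>' k) (\<xi>' k) (fst z) (snd z) - g (fst z) (snd z))) \<longlonglongrightarrow> 0"
    "(\<lambda>k. msq M (\<lambda>\<omega>. step_integral W (n' k) (\<tau>' k) (\<xi>' k) \<omega> - K \<omega>)) \<longlonglongrightarrow> 0"
    using g unfolding has_ito_integral_iff by blast
  have "\<forall>k. \<exists>m \<sigma> \<eta>. step_data F a b m \<sigma> (\<eta> :: nat \<Rightarrow> 'w \<Rightarrow> 'x) \<and>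
    (\<forall>w \<omega>. step_integral w m \<sigma> \<eta> \<omega> = step_integral w (n k) (\<tau> k) (\<xi> k) \<omega> - step_integral w (n' k) (\<tau>' k) (\<xi>' k) \<omega>) \<and>
    (\<forall>t \<omega>. step_process m \<sigma> \<eta> t \<omega> = step_process (n k) (\<tau> k) (\<xi> k) t \<omega> - step_process (n' k) (\<tau>' k) (\<xi>' k) t \<omega>)"
    by (intro allI step_data_diff[OF D(1) D'(1) F_mono]) (use ab in auto)
  from choice3[OF this]
  obtain m \<sigma> and \<eta> :: "nat \<Rightarrow> nat \<Rightarrow> 'w \<Rightarrow> 'x" where E0: "\<forall>k. step_data F a b (m k) (\<sigma> k) (\<eta> k) \<and>
    (\<forall>w \<omega>. step_integral w (m k) (\<sigma> k) (\<eta> k) \<omega> = step_integral w (n k) (\<tau> k) (\<xi> k) \<omega> - step_integral w (n' k) (\<tau>' k) (\<xi>' k) \<omega>) \<and>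
    (\<forall>t \<omega>. step_process (m k) (\<sigma> k) (\<eta> k) t \<omega> = step_process (n k) (\<tau> k) (\<xi> k) t \<omega> - step_process (n' k) (\<tau>' k) (\<xi>' k) t \<omega>)"
    by (elim exE)
  then have E: "\<And>k. step_data F a b (m k) (\<sigma> k) (\<eta> k)"
    "\<And>k w \<omega>. step_integral w (m k) (\<sigma> k) (\<eta> k) \<omega> = step_integral w (n k) (\<tau> k) (\<xi> k) \<omega> - step_integral w (n' k) (\<tau>' k) (\<xi>' k) \<omega>"
    "\<And>k t \<omega>. step_process (m k) (\<sigma> k) (\<eta> k) t \<omega> = step_process (n k) (\<tau> k) (\<xi> k) t \<omega> - step_process (n' k) (\<tau>' k) (\<xi>' k) t \<omega>"
    by simp_all
  have fL: "f \<in> L2_proc M F a b" "J \<in> L2_rv M (F b)" and gL: "g \<in> L2_proc M F a b" "K \<in> L2_rv M (F b)"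
    using f g by (auto simp: has_ito_integral_iff)
  note fm = L2_procD(3)[OF ab fL(1)] and gm = L2_procD(3)[OF ab gL(1)]
  note sm = ae_measurableI[OF step_process_measurable[OF D(1) ab(1,3)]]
    and sm' = ae_measurableI[OF step_process_measurable[OF D'(1) ab(1,3)]]
  have "(\<lambda>k. msq ?P (\<lambda>z. step_process (m k) (\<sigma> k) (\<eta> k) (fst z) (snd z) - (f (fst z) (snd z) - g (fst z) (snd z)))) \<longlonglongrightarrow> 0"
  proof (rule ennreal_tendsto_0_le[OF _ D(2) D'(2)])
    fix k
    show "msq ?P (\<lambda>z. step_process (m k) (\<sigma> k) (\<eta> k) (fst z) (snd z) - (f (fst z) (snd z) - g (fst z) (snd z)))
      \<le> 2 * msq ?P (\<lambda>z. step_process (n k) (\<tau> k) (\<xi> k) (fst z) (snd z) - f (fst z) (snd z))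
      + 2 * msq ?P (\<lambda>z. step_process (n' k) (\<tau>' k) (\<xi>' k) (fst z) (snd z) - g (fst z) (snd z))"
      using msq_triangle_ae(1)[OF ae_measurable_diff[OF sm fm] ae_measurable_diff[OF sm' gm], of k k]
      by (simp add: E(3) algebra_simps)
  qed
  moreover have "(\<lambda>k. msq M (\<lambda>\<omega>. step_integral W (m k) (\<sigma> k) (\<eta> k) \<omega> - (J \<omega> - K \<omega>))) \<longlonglongrightarrow> 0"
  proof (rule ennreal_tendsto_0_le[OF _ D(3) D'(3)])
    fix k
    have [measurable]: "step_integral W (n k) (\<tau> k) (\<xi> k) \<in> borel_measurable M"
      "step_integral W (n' k) (\<tau>' k) (\<xi>' k) \<in> borel_measurable M"
      using step_integral_msq(2)[OF D(1) ab(1,3)] step_integral_msq(2)[OF D'(1) ab(1,3)] measurable_F_M b by blast+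
    note [measurable] = ito_measurable(1)[OF ab f] ito_measurable(1)[OF ab g]
    show "msq M (\<lambda>\<omega>. step_integral W (m k) (\<sigma> k) (\<eta> k) \<omega> - (J \<omega> - K \<omega>))
      \<le> 2 * msq M (\<lambda>\<omega>. step_integral W (n k) (\<tau> k) (\<xi> k) \<omega> - J \<omega>)
      + 2 * msq M (\<lambda>\<omega>. step_integral W (n' k) (\<tau>' k) (\<xi>' k) \<omega> - K \<omega>)"
      using msq_diff_le[of "\<lambda>\<omega>. step_integral W (n k) (\<tau> k) (\<xi> k) \<omega> - J \<omega>" M
        "\<lambda>\<omega>. step_integral W (n' k) (\<tau>' k) (\<xi>' k) \<omega> - K \<omega>"]
      by (simp add: E(2) algebra_simps)
  qed
  ultimately show ?thesis
    unfolding has_ito_integral_iff using L2_proc_diff[OF ab fL(1) gL(1)] L2_rv_diff[OF b fL(2) gL(2)] E(1) by blast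
qed

text \<open>The isometry of the step processes is carried to the limit by two applications of the
  quasi-triangle inequality, each of which costs a factor 2. A fixed constant is all that the later
  estimates require.\<close>

lemma ito_msq_le:
  fixes f :: "real \<Rightarrow> 'w \<Rightarrow> 'x::{real_inner, banach, second_countable_topology}"
  assumes ab: "0 \<le> a" "a \<le> b" "b \<le> T" and f: "has_ito_integral M F W a b f J"
  shows "msq M J \<le> 4 * msq (time_space M a b) (\<lambda>z. f (fst z) (snd z))"
proof -
  let ?P = "time_space M a b"
  have b: "b \<in> {0..T}" using ab by simp
  obtain n \<tau> and \<xi> :: "nat \<Rightarrow> nat \<Rightarrow> 'w \<Rightarrow> 'x" where D: "\<And>k. step_data F a b (n k) (\<tau> k) (\<xi> k)"
    "(\<lambda>k. msq ?P (\<lambda>z. step_process (n k) (\<tau> k) (\<xi> k) (fst z) (snd z) - f (fst z) (snd z))) \<longlonglongrightarrow> 0"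
    "(\<lambda>k. msq M (\<lambda>\<omega>. step_integral W (n k) (\<tau> k) (\<xi> k) \<omega> - J \<omega>)) \<longlonglongrightarrow> 0"
    using f unfolding has_ito_integral_iff by blast
  have fL: "f \<in> L2_proc M F a b" using f by (simp add: has_ito_integral_iff)
  define x where "x k = msq M (\<lambda>\<omega>. step_integral W (n k) (\<tau> k) (\<xi> k) \<omega> - J \<omega>)" for k
  define y where "y k = msq ?P (\<lambda>z. step_process (n k) (\<tau> k) (\<xi> k) (fst z) (snd z) - f (fst z) (snd z))" for k
  define c where "c = msq ?P (\<lambda>z. f (fst z) (snd z))"
  note fm = L2_procD(3)[OF ab fL]
  have le: "msq M J \<le> 2 * x k + 2 * (2 * y k + 2 * c)" for k
  proof -
    have Im: "step_integral W (n k) (\<tau> k) (\<xi> k) \<in> borel_measurable M"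
      using step_integral_msq(2)[OF D(1) ab(1,3)] measurable_F_M b by blast
    have "msq M J \<le> 2 * msq M (\<lambda>\<omega>. J \<omega> - step_integral W (n k) (\<tau> k) (\<xi> k) \<omega>) + 2 * msq M (step_integral W (n k) (\<tau> k) (\<xi> k))"
      using msq_triangle[OF ito_measurable(1)[OF ab f] Im, of "\<lambda>_. 0"] by simp
    also have "msq M (\<lambda>\<omega>. J \<omega> - step_integral W (n k) (\<tau> k) (\<xi> k) \<omega>) = x k"
      unfolding x_def by (rule msq_commute)
    also have "msq M (step_integral W (n k) (\<tau> k) (\<xi> k)) = msq ?P (\<lambda>z. step_process (n k) (\<tau> k) (\<xi> k) (fst z) (snd z))"
      by (rule step_isometry[OF D(1) ab(1,3)])
    also have "\<dots> = msq ?P (\<lambda>z. (step_process (n k) (\<tau> k) (\<xi> k) (fst z) (snd z) - f (fst z) (snd z)) + f (fst z) (snd z))"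
      by simp
    also have "\<dots> \<le> 2 * y k + 2 * c"
      unfolding y_def c_def
      by (rule msq_triangle_ae(2)[OF ae_measurable_diff[OF ae_measurableI[OF step_process_measurable[OF D(1) ab(1,3)]] fm] fm])
    finally show ?thesis by (simp add: add_left_mono mult_left_mono)
  qed
  have "(\<lambda>k. 2 * x k + 2 * (2 * y k + 2 * c)) \<longlonglongrightarrow> 2 * 0 + 2 * (2 * 0 + 2 * c)"
    using D(2,3) unfolding x_def[symmetric] y_def[symmetric]
    by (intro tendsto_add ennreal_tendsto_cmult tendsto_const) auto
  then have "msq M J \<le> 2 * 0 + 2 * (2 * 0 + 2 * c)"
    by (rule LIMSEQ_le_const) (use le in auto)
  then show ?thesis by (simp add: c_def mult.assoc[symmetric])
qed

lemma ito_cong: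
  fixes f g :: "real \<Rightarrow> 'w \<Rightarrow> 'x::{real_inner, banach, second_countable_topology}"
  assumes ab: "0 \<le> a" "a \<le> b" "b \<le> T" and f: "has_ito_integral M F W a b f J"
    and eq: "AE z in time_space M a b. f (fst z) (snd z) = g (fst z) (snd z)"
    and J': "AE \<omega> in M. J \<omega> = J' \<omega>" "J' \<in> borel_measurable (F b)"
  shows "has_ito_integral M F W a b g J'"
proof -
  let ?P = "time_space M a b"
  have b: "b \<in> {0..T}" using ab by simp
  have "f \<in> L2_proc M F a b" using f by (simp add: has_ito_integral_iff)
  note fL = L2_procD[OF ab this]
  have eq': "AE z in ?P. g (fst z) (snd z) = f (fst z) (snd z)" using eq by eventually_elim simp
  have "msq ?P (\<lambda>z. g (fst z) (snd z)) = msq ?P (\<lambda>z. f (fst z) (snd z))"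
    by (rule msq_cong_AE) (use eq in eventually_elim, simp)
  then have g: "g \<in> L2_proc M F a b"
    using fL(2) by (intro L2_procI[OF ab] ae_measurable_cong_AE[OF fL(1) eq']) simp
  have "msq M J' = msq M J" by (rule msq_cong_AE) (use J'(1) in eventually_elim, simp)
  then have J: "J' \<in> L2_rv M (F b)"
    unfolding L2_rv_iff[OF subalg[OF b]] using ito_measurable(3)[OF ab f] J'(2) by simp
  have "msq ?P (\<lambda>z. s z - g (fst z) (snd z)) = msq ?P (\<lambda>z. s z - f (fst z) (snd z))"
    "msq M (\<lambda>\<omega>. i \<omega> - J' \<omega>) = msq M (\<lambda>\<omega>. i \<omega> - J \<omega>)" for s :: "real \<times> 'w \<Rightarrow> 'x" and i :: "'w \<Rightarrow> 'x"
    by (rule msq_cong_AE, use eq in eventually_elim, simp) (rule msq_cong_AE, use J'(1) in eventually_elim, simp)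
  then show ?thesis using f g J unfolding has_ito_integral_iff by simp
qed

text \<open>Lets integrals with different upper limits be read over one common interval, so that
  increments in t of a stochastic convolution become single stochastic integrals.\<close>

lemma ito_extend:
  fixes f :: "real \<Rightarrow> 'w \<Rightarrow> 'x::{real_inner, banach, second_countable_topology}"
  assumes abc: "0 \<le> a" "a \<le> b" "b \<le> c" "c \<le> T" and f: "has_ito_integral M F W a b f J"
    and fc: "f \<in> L2_proc M F a c" and zero: "\<And>s \<omega>. b < s \<Longrightarrow> f s \<omega> = 0"
  shows "has_ito_integral M F W a c f J"
proof -
  have ac: "0 \<le> a" "a \<le> c" "c \<le> T" and ab: "0 \<le> a" "a \<le> b" "b \<le> T" and c: "c \<in> {0..T}" using abc by auto
  obtain n \<tau> and \<xi> :: "nat \<Rightarrow> nat \<Rightarrow> 'w \<Rightarrow> 'x" where D: "\<And>k. step_data F a b (n k) (\<tau> k) (\<xi> k)"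
    "(\<lambda>k. msq (time_space M a b) (\<lambda>z. step_process (n k) (\<tau> k) (\<xi> k) (fst z) (snd z) - f (fst z) (snd z))) \<longlonglongrightarrow> 0"
    "(\<lambda>k. msq M (\<lambda>\<omega>. step_integral W (n k) (\<tau> k) (\<xi> k) \<omega> - J \<omega>)) \<longlonglongrightarrow> 0"
    using f unfolding has_ito_integral_iff by blast
  let ?\<tau> = "\<lambda>k. (\<tau> k)(Suc (n k) := c)" and ?\<xi> = "\<lambda>k. (\<xi> k)(n k := (\<lambda>_. 0))"
  note ext = step_data_extend[OF D(1) abc(3)]
  have "J \<in> borel_measurable (F c)"
    by (rule measurable_F_mono[OF ito_measurable(2)[OF ab f]]) (use abc in auto)
  then have J: "J \<in> L2_rv M (F c)"
    unfolding L2_rv_iff[OF subalg[OF c]] using ito_measurable(3)[OF ab f] by simp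
  obtain f' where f': "adapted F a c f'" "AE z in time_space M a c. f (fst z) (snd z) = f' (fst z) (snd z)"
    using fc unfolding L2_proc_iff[OF ac] by blast
  note fm = adapted_measurable[OF ac f'(1)]
  have "msq (time_space M a c) (\<lambda>z. step_process (Suc (n k)) (?\<tau> k) (?\<xi> k) (fst z) (snd z) - f (fst z) (snd z))
    = msq (time_space M a b) (\<lambda>z. step_process (n k) (\<tau> k) (\<xi> k) (fst z) (snd z) - f (fst z) (snd z))" for k
  proof -
    have sm: "(\<lambda>z. step_process (n k) (\<tau> k) (\<xi> k) (fst z) (snd z)) \<in> borel_measurable (time_space M a c)"
      using step_process_measurable[OF ext(1) ac(1,3), of k] by (simp add: ext(3))
    have m: "(\<lambda>z. ennreal ((norm (step_process (n k) (\<tau> k) (\<xi> k) (fst z) (snd z) - f' (fst z) (snd z)))\<^sup>2))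
        \<in> borel_measurable (time_space M a c)" using sm fm by measurable
    have "msq (time_space M a c) (\<lambda>z. step_process (Suc (n k)) (?\<tau> k) (?\<xi> k) (fst z) (snd z) - f (fst z) (snd z))
      = (\<integral>\<^sup>+z. ennreal ((norm (step_process (n k) (\<tau> k) (\<xi> k) (fst z) (snd z) - f' (fst z) (snd z)))\<^sup>2) * indicator {a..b} (fst z) \<partial>time_space M a c)"
      unfolding msq_def ext(3)
    proof (rule nn_integral_cong_AE)
      show "AE z in time_space M a c. ennreal ((norm (step_process (n k) (\<tau> k) (\<xi> k) (fst z) (snd z) - f (fst z) (snd z)))\<^sup>2)
        = ennreal ((norm (step_process (n k) (\<tau> k) (\<xi> k) (fst z) (snd z) - f' (fst z) (snd z)))\<^sup>2) * indicator {a..b} (fst z)"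
        using f'(2) AE_space
      proof eventually_elim
        case (elim z)
        have az: "a \<le> fst z" using elim(2) by (auto simp: space_pair_measure space_restrict_space)
        show ?case
        proof (cases "fst z \<le> b")
          case True
          then show ?thesis using elim az by simp
        next
          case False
          have "step_process (n k) (\<tau> k) (\<xi> k) (fst z) (snd z) = 0"
            unfolding step_process_def
          proof (intro sum.neutral ballI)
            fix i assume "i \<in> {..<n k}"
            then show "indicat_real {\<tau> k i<..\<tau> k (Suc i)} (fst z) *\<^sub>R \<xi> k i (snd z) = 0"
              using False step_data_Icc[OF D(1), of "Suc i" k] by auto
          qed
          then show ?thesis using zero[of "fst z" "snd z"] False by simp
        qed
      qed
    qed
    also have "\<dots> = (\<integral>\<^sup>+z. ennreal ((norm (step_process (n k) (\<tau> k) (\<xi> k) (fst z) (snd z) - f' (fst z) (snd z)))\<^sup>2) \<partial>time_space M a b)"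
      by (rule nn_integral_time_space_mono[symmetric, OF prob_space_axioms _ m]) (use abc in auto)
    also have "\<dots> = msq (time_space M a b) (\<lambda>z. step_process (n k) (\<tau> k) (\<xi> k) (fst z) (snd z) - f' (fst z) (snd z))"
      by (simp add: msq_def)
    also have "\<dots> = msq (time_space M a b) (\<lambda>z. step_process (n k) (\<tau> k) (\<xi> k) (fst z) (snd z) - f (fst z) (snd z))"
    proof (rule msq_cong_AE)
      have "AE z in time_space M a b. f (fst z) (snd z) = f' (fst z) (snd z)"
        by (rule AE_time_space_mono[OF prob_space_axioms _ f'(2)]) (use abc in auto)
      then show "AE z in time_space M a b. norm (step_process (n k) (\<tau> k) (\<xi> k) (fst z) (snd z) - f' (fst z) (snd z))
        = norm (step_process (n k) (\<tau> k) (\<xi> k) (fst z) (snd z) - f (fst z) (snd z))"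
        by eventually_elim simp
    qed
    finally show ?thesis .
  qed
  then have l1: "(\<lambda>k. msq (time_space M a c) (\<lambda>z. step_process (Suc (n k)) (?\<tau> k) (?\<xi> k) (fst z) (snd z) - f (fst z) (snd z))) \<longlonglongrightarrow> 0"
    using D(2) by simp
  have l2: "(\<lambda>k. msq M (\<lambda>\<omega>. step_integral W (Suc (n k)) (?\<tau> k) (?\<xi> k) \<omega> - J \<omega>)) \<longlonglongrightarrow> 0"
    using D(3) by (simp add: ext(2))
  show ?thesis
    unfolding has_ito_integral_iff
    using fc J ext(1) l1 l2 by (intro conjI exI[of _ "\<lambda>k. Suc (n k)"] exI[of _ ?\<tau>] exI[of _ ?\<xi>]) auto
qed

end

section \<open>Mean square continuous processes\<close>

context brownian_basis
begin

text \<open>Before time \<open>c\<close> the process vanishes, and from \<open>c\<close> on the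
  variable \<open>\<xi>\<close> is known; so each restriction to an initial strip is
  measurable.\<close>

lemma adapted_indicator_after:
  fixes \<xi> :: "'w \<Rightarrow> 'x::{real_normed_vector, second_countable_topology}"
  assumes c: "c \<in> {0..T}" and \<xi>: "\<xi> \<in> borel_measurable (F c)" and B: "B \<in> sets borel" "B \<subseteq> {c..}"
  shows "adapted F 0 T (\<lambda>t \<omega>. indicator B t *\<^sub>R \<xi> \<omega>)"
  unfolding adapted_iff_progressively_measurable[OF order_refl less_imp_le[OF T_pos] order_refl] case_prod_unfold
proof
  fix t assume t: "t \<in> {0..T}"
  let ?P = "restrict_space borel {0..t} \<Otimes>\<^sub>M F t"
  show "(\<lambda>z. indicator B (fst z) *\<^sub>R \<xi> (snd z)) \<in> borel_measurable ?P"
  proof (cases "c \<le> t")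
    case True
    have [measurable]: "\<xi> \<in> borel_measurable (F t)" by (rule measurable_F_mono[OF \<xi>]) (use c t True in auto)
    have [measurable]: "fst \<in> borel_measurable ?P"
      by (rule measurable_compose[OF measurable_fst]) (simp add: measurable_restrict_space1)
    note [measurable] = B(1)
    show ?thesis by measurable
  next
    case False
    have "(\<lambda>z. indicator B (fst z) *\<^sub>R \<xi> (snd z)) \<in> borel_measurable ?P \<longleftrightarrow> (\<lambda>z. 0 :: 'x) \<in> borel_measurable ?P"
      by (rule measurable_cong) (use False B(2) in \<open>auto simp: space_pair_measure space_restrict_space indicator_def\<close>)
    then show ?thesis by simp
  qed
qed

lemma adapted_fst: "(\<lambda>z. fst z) \<in> borel_measurable (progressive_field F 0 T)"
proof -
  have "adapted F 0 T (\<lambda>t \<omega>. t)"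
    unfolding adapted_iff_progressively_measurable[OF order_refl less_imp_le[OF T_pos] order_refl] case_prod_unfold
    by (intro ballI measurable_compose[OF measurable_fst]) (simp add: measurable_restrict_space1)
  then show ?thesis by (simp add: adapted_def case_prod_unfold)
qed

lemma adapted_section:
  assumes X: "adapted F 0 T X" and t: "t \<in> {0..T}"
  shows "X t \<in> borel_measurable (F t)"
proof -
  have "(\<lambda>z. X (fst z) (snd z)) \<in> borel_measurable (time_space (F t) 0 t)"
    by (rule adapted_measurable_at[OF order_refl _ order_refl X t]) (use T_pos in simp)
  moreover have "(\<lambda>\<omega>. (t, \<omega>)) \<in> measurable (F t) (time_space (F t) 0 t)"
    by (rule measurable_Pair1') (use t in \<open>simp add: space_restrict_space\<close>)
  ultimately show ?thesis by (auto dest: measurable_compose[rotated])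
qed

text \<open>The \<open>R t\<close> are unrelated random variables, one for each time, whereas
  \<open>C_proc\<close> asks for one progressively measurable process. Piecewise constant
  interpolation from left grid points is progressive, and its error is of order (1/16)^k by uniform
  continuity, so its pointwise limit agrees with \<open>R t\<close> almost surely for every
  t.\<close>

lemma mean_square_continuous_version:
  fixes R :: "real \<Rightarrow> 'w \<Rightarrow> 'x::{real_normed_vector, banach, second_countable_topology}"
  assumes R: "\<And>t. t \<in> {0..T} \<Longrightarrow> R t \<in> L2_rv M (F t)"
    and lim: "\<And>t. t \<in> {0..T} \<Longrightarrow> ((\<lambda>s. msq M (\<lambda>\<omega>. R s \<omega> - R t \<omega>)) \<longlongrightarrow> 0) (at t within {0..T})"
  shows "\<exists>X\<in>C_proc M F 0 T. \<forall>t\<in>{0..T}. AE \<omega> in M. X t \<omega> = R t \<omega>"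
proof -
  have RF: "R t \<in> borel_measurable (F t)" and R2: "msq M (R t) < \<infinity>" and RM: "R t \<in> borel_measurable M"
    if "t \<in> {0..T}" for t
    using R[OF that] measurable_F_M that unfolding L2_rv_iff[OF subalg[OF that]] by auto
  have fin: "msq M (\<lambda>\<omega>. R s \<omega> - R t \<omega>) < \<infinity>" if "s \<in> {0..T}" "t \<in> {0..T}" for s t
    using msq_diff_le[OF RM RM, of s t] R2[of s] R2[of t] that
    by (auto simp: ennreal_mult_less_top intro: le_less_trans)
  define d where "d s t = enn2real (msq M (\<lambda>\<omega>. R s \<omega> - R t \<omega>))" for s t
  have dm: "msq M (\<lambda>\<omega>. R s \<omega> - R t \<omega>) = ennreal (d s t)" if "s \<in> {0..T}" "t \<in> {0..T}" for s t
    using fin[OF that] by (simp add: d_def)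
  have d0: "0 \<le> d s t" for s t by (simp add: d_def)
  have "\<exists>\<delta>>0. \<forall>s\<in>{0..T}. \<forall>t\<in>{0..T}. \<bar>s - t\<bar> < \<delta> \<longrightarrow> d s t < e" if e: "0 < e" for e
  proof (rule uniformly_continuous_quasimetric[OF _ _ _ e])
    fix r s t assume rst: "r \<in> {0..T}" "s \<in> {0..T}" "t \<in> {0..T}"
    have "msq M (\<lambda>\<omega>. R s \<omega> - R t \<omega>) \<le> 2 * msq M (\<lambda>\<omega>. R s \<omega> - R r \<omega>) + 2 * msq M (\<lambda>\<omega>. R r \<omega> - R t \<omega>)"
      by (intro msq_triangle RM rst)
    also have "\<dots> = ennreal (2 * d s r + 2 * d t r)"
      unfolding msq_commute[of M "R r" "R t"] dm[OF rst(2,1)] dm[OF rst(3,1)]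
      by (subst ennreal_plus) (auto simp: d0 ennreal_mult)
    finally show "d s t \<le> 2 * d s r + 2 * d t r"
      unfolding dm[OF rst(2,3)] by (subst (asm) ennreal_le_iff) (simp_all add: d0)
  next
    fix t assume t: "t \<in> {0..T}"
    have "((\<lambda>s. enn2real (msq M (\<lambda>\<omega>. R s \<omega> - R t \<omega>))) \<longlongrightarrow> 0) (at t within {0..T})"
      by (rule tendsto_enn2real) (use lim[OF t] in simp_all)
    then show "((\<lambda>s. d s t) \<longlongrightarrow> 0) (at t within {0..T})" by (simp add: d_def)
    show "d t t = 0" by (simp add: d_def msq_def)
  qed
  then have "\<forall>k. \<exists>\<delta>>0. \<forall>s\<in>{0..T}. \<forall>t\<in>{0..T}. \<bar>s - t\<bar> < \<delta> \<longrightarrow> d s t < (1/16)^k" by simp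
  then obtain \<delta> :: "nat \<Rightarrow> real" where \<delta>: "\<And>k. \<delta> k > 0"
    "\<And>k s t. s \<in> {0..T} \<Longrightarrow> t \<in> {0..T} \<Longrightarrow> \<bar>s - t\<bar> < \<delta> k \<Longrightarrow> d s t < (1/16)^k"
    by metis
  have "\<exists>N::nat. T / \<delta> k < N" for k using reals_Archimedean2 by blast
  then obtain N :: "nat \<Rightarrow> nat" where N: "\<And>k. T / \<delta> k < N k" by metis
  have N0: "0 < N k" for k
  proof -
    have "0 < T / \<delta> k" using \<delta>(1)[of k] T_pos by simp
    then have "0 < real (N k)" using N[of k] by linarith
    then show ?thesis by simp
  qed
  define h where "h k = T / N k" for k
  have h: "0 < h k" "h k < \<delta> k" for k
    using N0[of k] N[of k] \<delta>(1)[of k] T_pos by (auto simp: h_def field_simps)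
  have Nh: "real (N k) * h k = T" for k using N0[of k] by (simp add: h_def)
  define c where "c k i = real i * h k" for k i
  have cT: "c k i \<in> {0..T}" if "i \<le> N k" for k i
  proof -
    have "c k i \<le> real (N k) * h k" unfolding c_def using that h(1)[of k] by (intro mult_right_mono) auto
    then show ?thesis using h(1)[of k] Nh[of k] by (simp add: c_def)
  qed
  define B where "B k i = {c k i..<c k (Suc i)}" for k i
  \<comment> \<open>The index \<open>N k\<close> is included: its cell begins at \<open>T\<close>
    and covers the right end point, which half-open cells would otherwise miss.\<close>
  define X where "X k t \<omega> = (\<Sum>i\<le>N k. indicator (B k i) t *\<^sub>R R (c k i) \<omega>)" for k t \<omega>
  have Xa: "adapted F 0 T (X k)" for k
  proof -
    have "(\<lambda>z. indicator (B k i) (fst z) *\<^sub>R R (c k i) (snd z)) \<in> borel_measurable (progressive_field F 0 T)"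
      if "i \<le> N k" for i
    proof -
      have "B k i \<in> sets borel" "B k i \<subseteq> {c k i..}" by (auto simp: B_def)
      from adapted_indicator_after[OF cT[OF that] RF[OF cT[OF that]] this]
      show ?thesis by (simp only: adapted_def case_prod_unfold)
    qed
    then show ?thesis unfolding adapted_def case_prod_unfold X_def by (intro borel_measurable_sum) auto
  qed
  have Xg: "\<exists>s\<in>{0..T}. \<bar>s - t\<bar> < \<delta> k \<and> (\<forall>\<omega>. X k t \<omega> = R s \<omega>)" if t: "t \<in> {0..T}" for k t
  proof -
    define j where "j = nat \<lfloor>t / h k\<rfloor>"
    have fl: "0 \<le> \<lfloor>t / h k\<rfloor>" using t h(1)[of k] by simp
    have j1: "real j \<le> t / h k" "t / h k < real j + 1"
      using fl by (simp_all add: j_def)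
    have "t / h k \<le> N k" using t Nh[of k] h(1)[of k] by (simp add: divide_le_eq)
    then have jN: "j \<le> N k" using j1 by linarith
    have cj: "c k j \<le> t" "t < c k (Suc j)" using j1 h(1)[of k] by (simp_all add: c_def field_simps)
    have iff: "t \<in> B k i \<longleftrightarrow> i = j" for i
    proof
      assume "t \<in> B k i"
      then have "real i \<le> t / h k" "t / h k < real i + 1" using h(1)[of k] by (simp_all add: B_def c_def field_simps)
      then show "i = j" using j1 by linarith
    qed (use cj in \<open>auto simp: B_def\<close>)
    have "X k t \<omega> = (\<Sum>i\<le>N k. if i = j then R (c k j) \<omega> else 0)" for \<omega>
      unfolding X_def by (intro sum.cong) (auto simp: iff indicator_def)
    then have "\<forall>\<omega>. X k t \<omega> = R (c k j) \<omega>" using jN by simp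
    moreover have "\<bar>c k j - t\<bar> < \<delta> k" using cj h(2)[of k] by (simp add: c_def algebra_simps)
    ultimately show ?thesis using cT[OF jN] by blast
  qed
  have close: "msq M (\<lambda>\<omega>. X k t \<omega> - R t \<omega>) \<le> ennreal ((1/16)^k)" if t: "t \<in> {0..T}" for k t
  proof -
    obtain s where s: "s \<in> {0..T}" "\<bar>s - t\<bar> < \<delta> k" "\<And>\<omega>. X k t \<omega> = R s \<omega>" using Xg[OF t] by blast
    show ?thesis using \<delta>(2)[OF s(1) t s(2)] unfolding s(3) dm[OF s(1) t] by (intro ennreal_leI) simp
  qed
  have XM: "X k t \<in> borel_measurable M" if t: "t \<in> {0..T}" for k t
  proof -
    obtain s where s: "s \<in> {0..T}" "\<And>\<omega>. X k t \<omega> = R s \<omega>" using Xg[OF t] by blast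
    have "X k t = R s" using s(2) by auto
    then show ?thesis using RM[OF s(1)] by simp
  qed
  have inc: "msq M (\<lambda>\<omega>. X (Suc k) t \<omega> - X k t \<omega>) \<le> ennreal (4 * (1/16)^k)" if t: "t \<in> {0..T}" for k t
  proof -
    have "msq M (\<lambda>\<omega>. X (Suc k) t \<omega> - X k t \<omega>) \<le>
      2 * msq M (\<lambda>\<omega>. X (Suc k) t \<omega> - R t \<omega>) + 2 * msq M (\<lambda>\<omega>. R t \<omega> - X k t \<omega>)"
      by (rule msq_triangle[OF XM[OF t] RM[OF t] XM[OF t]])
    also have "\<dots> \<le> 2 * ennreal ((1/16)^Suc k) + 2 * ennreal ((1/16)^k)"
      unfolding msq_commute[of M "R t"] by (intro add_mono mult_left_mono close t) auto
    also have "\<dots> = ennreal (2 * (1/16)^Suc k + 2 * (1/16)^k)"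
      by (subst ennreal_plus) (auto simp: ennreal_mult simp del: power_Suc)
    also have "\<dots> \<le> ennreal (4 * (1/16)^k)" by (intro ennreal_leI) simp
    finally show ?thesis .
  qed
  define Y where "Y t \<omega> = lim (\<lambda>k. X k t \<omega>)" for t \<omega>
  have Ya: "adapted F 0 T Y"
  proof -
    have "(\<lambda>z. X k (fst z) (snd z)) \<in> borel_measurable (progressive_field F 0 T)" for k
      using Xa[of k] by (simp add: adapted_def case_prod_unfold)
    then show ?thesis unfolding adapted_def case_prod_unfold Y_def by (rule borel_measurable_lim_metric)
  qed
  have YF: "Y t \<in> borel_measurable (F t)" if "t \<in> {0..T}" for t by (rule adapted_section[OF Ya that])
  have eq: "AE \<omega> in M. Y t \<omega> = R t \<omega>" if t: "t \<in> {0..T}" for t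
  proof -
    note Ym = measurable_F_M[OF YF[OF t] t]
    have "msq M (\<lambda>\<omega>. Y t \<omega> - R t \<omega>) \<le> ennreal (2 * (32 * (1/4)^k) + 2 * (1/16)^k)" for k
    proof -
      have "msq M (\<lambda>\<omega>. Y t \<omega> - R t \<omega>) \<le> 2 * msq M (\<lambda>\<omega>. Y t \<omega> - X k t \<omega>) + 2 * msq M (\<lambda>\<omega>. X k t \<omega> - R t \<omega>)"
        by (rule msq_triangle[OF Ym XM[OF t] RM[OF t]])
      also have "\<dots> \<le> 2 * ennreal (8 * 4 * (1/4)^k) + 2 * ennreal ((1/16)^k)"
      proof (intro add_mono mult_left_mono close t)
        show "msq M (\<lambda>\<omega>. Y t \<omega> - X k t \<omega>) \<le> ennreal (8 * 4 * (1/4)^k)"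
          unfolding Y_def by (subst msq_commute) (rule msq_fast_limit(2)[OF XM[OF t] inc[OF t]], simp)
      qed auto
      also have "\<dots> = ennreal (2 * (32 * (1/4)^k) + 2 * (1/16)^k)"
        by (subst ennreal_plus) (auto simp: ennreal_mult)
      finally show ?thesis .
    qed
    moreover have "(\<lambda>k. ennreal (2 * (32 * (1/4)^k) + 2 * (1/16)^k)) \<longlonglongrightarrow> ennreal (2 * (32 * 0) + 2 * 0)"
      by (intro tendsto_ennrealI tendsto_intros LIMSEQ_realpow_zero) auto
    ultimately have "msq M (\<lambda>\<omega>. Y t \<omega> - R t \<omega>) \<le> ennreal (2 * (32 * 0) + 2 * 0)"
      by (intro LIMSEQ_le_const) auto
    then have "(\<integral>\<^sup>+\<omega>. ennreal ((norm (Y t \<omega> - R t \<omega>))\<^sup>2) \<partial>M) = 0" by (simp add: msq_def)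
    then have "AE \<omega> in M. ennreal ((norm (Y t \<omega> - R t \<omega>))\<^sup>2) = 0"
      by (subst (asm) nn_integral_0_iff_AE) (use Ym RM[OF t] in auto)
    then show ?thesis by eventually_elim (simp add: ennreal_eq_0_iff)
  qed
  have "Y \<in> C_proc M F 0 T"
    unfolding C_proc_def mem_Collect_eq
  proof (intro conjI ballI Ya)
    fix t assume t: "t \<in> {0..T}"
    have TT: "T \<in> {0..T}" using T_pos by simp
    have "msq M (Y t) = msq M (R t)" by (rule msq_cong_AE) (use eq[OF t] in eventually_elim, simp)
    moreover have "Y t \<in> borel_measurable (F T)" by (rule measurable_F_mono[OF YF[OF t]]) (use t in auto)
    ultimately show "Y t \<in> L2_rv M (F T)" unfolding L2_rv_iff[OF subalg[OF TT]] using R2[OF t] by simp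
    have "((\<lambda>s. enn2real (msq M (\<lambda>\<omega>. R s \<omega> - R t \<omega>))) \<longlongrightarrow> 0) (at t within {0..T})"
      by (rule tendsto_enn2real) (use lim[OF t] in simp_all)
    moreover have "(LINT \<omega>|M. (norm (Y s \<omega> - Y t \<omega>))\<^sup>2) = enn2real (msq M (\<lambda>\<omega>. R s \<omega> - R t \<omega>))"
      if s: "s \<in> {0..T}" for s
    proof -
      have "msq M (\<lambda>\<omega>. R s \<omega> - R t \<omega>) = msq M (\<lambda>\<omega>. Y s \<omega> - Y t \<omega>)"
        by (rule msq_cong_AE) (use eq[OF t] eq[OF s] in eventually_elim, simp)
      moreover have "(\<lambda>\<omega>. Y s \<omega> - Y t \<omega>) \<in> borel_measurable M"
        using measurable_F_M[OF YF[OF t] t] measurable_F_M[OF YF[OF s] s] by measurable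
      ultimately show ?thesis by (simp add: integral_sq_enn2real)
    qed
    then have "eventually (\<lambda>s. enn2real (msq M (\<lambda>\<omega>. R s \<omega> - R t \<omega>)) = (LINT \<omega>|M. (norm (Y s \<omega> - Y t \<omega>))\<^sup>2)) (at t within {0..T})"
      by (simp add: eventually_at_filter)
    ultimately show "((\<lambda>s. LINT \<omega>|M. (norm (Y s \<omega> - Y t \<omega>))\<^sup>2) \<longlongrightarrow> 0) (at t within {0..T})"
      by (rule Lim_transform_eventually)
  qed
  then show ?thesis using eq by blast
qed

text \<open>A one-sided limit in mean square bounds the second moment on that side of each time, and
  compactness makes the bound uniform. It puts states and the adjoint process \<open>Y\<close> into
  \<open>L2_proc\<close>.\<close>

lemma D_proc_bounded:
  fixes X :: "real \<Rightarrow> 'w \<Rightarrow> 'x::{real_normed_vector, second_countable_topology}"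
  assumes X: "X \<in> D_proc M F 0 T"
  shows "\<exists>B. \<forall>t\<in>{0..T}. msq M (X t) \<le> ennreal B"
proof -
  define q where "q t = (LINT \<omega>|M. (norm (X t \<omega>))\<^sup>2)" for t
  have TT: "T \<in> {0..T}" using T_pos by simp
  have L2: "\<xi> \<in> borel_measurable M" "msq M \<xi> < \<infinity>" "msq M \<xi> = ennreal (LINT \<omega>|M. (norm (\<xi> \<omega>))\<^sup>2)"
    if "\<xi> \<in> L2_rv M (F T)" for \<xi> :: "'w \<Rightarrow> 'x"
  proof -
    show m: "\<xi> \<in> borel_measurable M" and f: "msq M \<xi> < \<infinity>"
      using that measurable_F_M[OF _ TT] unfolding L2_rv_iff[OF subalg[OF TT]] by blast+
    show "msq M \<xi> = ennreal (LINT \<omega>|M. (norm (\<xi> \<omega>))\<^sup>2)"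
      by (rule msq_eq_integral) (use m f integrable_sq_iff in blast)
  qed
  have XL: "X t \<in> L2_rv M (F T)" if "t \<in> {0..T}" for t using X that by (simp add: D_proc_def)
  have near: "q s \<le> 2 * (LINT \<omega>|M. (norm (X s \<omega> - \<eta> \<omega>))\<^sup>2) + 2 * (LINT \<omega>|M. (norm (\<eta> \<omega>))\<^sup>2)"
    if s: "s \<in> {0..T}" and \<eta>: "\<eta> \<in> L2_rv M (F T)" for s \<eta>
  proof -
    note a = L2[OF XL[OF s]] and b = L2[OF \<eta>] and c = L2[OF L2_rv_diff[OF TT XL[OF s] \<eta>]]
    have "msq M (X s) \<le> 2 * msq M (\<lambda>\<omega>. X s \<omega> - \<eta> \<omega>) + 2 * msq M \<eta>"
      using msq_triangle[OF a(1) b(1), of "\<lambda>_. 0"] by simp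
    also have "\<dots> = ennreal (2 * (LINT \<omega>|M. (norm (X s \<omega> - \<eta> \<omega>))\<^sup>2) + 2 * (LINT \<omega>|M. (norm (\<eta> \<omega>))\<^sup>2))"
      unfolding b(3) c(3) by (subst ennreal_plus) (auto simp: ennreal_mult)
    finally show ?thesis unfolding a(3) q_def by (subst (asm) ennreal_le_iff) simp_all
  qed
  have "\<exists>B. \<forall>s\<in>{0..T}. q s \<le> B"
  proof (rule locally_bounded_imp_bounded)
    fix t assume t: "t \<in> {0..T}"
    have right: "\<exists>\<delta>>0. \<exists>B. \<forall>s\<in>{t<..T}. s - t < \<delta> \<longrightarrow> q s \<le> B"
    proof (cases "t < T")
      case True
      then have "((\<lambda>s. LINT \<omega>|M. (norm (X s \<omega> - X t \<omega>))\<^sup>2) \<longlongrightarrow> 0) (at t within {t<..T})"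
        using X t by (simp add: D_proc_def)
      then have "eventually (\<lambda>s. (LINT \<omega>|M. (norm (X s \<omega> - X t \<omega>))\<^sup>2) < 1) (at t within {t<..T})"
        by (rule order_tendstoD) simp
      then obtain \<delta> where \<delta>: "\<delta> > 0" "\<And>s. s \<in> {t<..T} \<Longrightarrow> s \<noteq> t \<Longrightarrow> dist s t < \<delta> \<Longrightarrow> (LINT \<omega>|M. (norm (X s \<omega> - X t \<omega>))\<^sup>2) < 1"
        unfolding eventually_at by blast
      have "q s \<le> 2 * 1 + 2 * q t" if "s \<in> {t<..T}" "s - t < \<delta>" for s
        using near[of s "X t"] \<delta>(2)[of s] that t XL[OF t] by (auto simp: q_def dist_real_def)
      then show ?thesis using \<delta>(1) by blast
    qed (use t in \<open>auto intro!: exI[of _ 1]\<close>)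
    have left: "\<exists>\<delta>>0. \<exists>B. \<forall>s\<in>{0..<t}. t - s < \<delta> \<longrightarrow> q s \<le> B"
    proof (cases "0 < t")
      case True
      then have "t \<in> {0<..T}" using t by simp
      then obtain \<eta> where \<eta>: "\<eta> \<in> L2_rv M (F T)"
        "((\<lambda>s. LINT \<omega>|M. (norm (X s \<omega> - \<eta> \<omega>))\<^sup>2) \<longlongrightarrow> 0) (at t within {0..<t})"
        using X unfolding D_proc_def by blast
      then have "eventually (\<lambda>s. (LINT \<omega>|M. (norm (X s \<omega> - \<eta> \<omega>))\<^sup>2) < 1) (at t within {0..<t})"
        by (intro order_tendstoD) auto
      then obtain \<delta> where \<delta>: "\<delta> > 0" "\<And>s. s \<in> {0..<t} \<Longrightarrow> s \<noteq> t \<Longrightarrow> dist s t < \<delta> \<Longrightarrow> (LINT \<omega>|M. (norm (X s \<omega> - \<eta> \<omega>))\<^sup>2) < 1"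
        unfolding eventually_at by blast
      have "q s \<le> 2 * 1 + 2 * (LINT \<omega>|M. (norm (\<eta> \<omega>))\<^sup>2)" if "s \<in> {0..<t}" "t - s < \<delta>" for s
        using near[of s \<eta>] \<delta>(2)[of s] that t \<eta>(1) by (auto simp: q_def dist_real_def)
      then show ?thesis using \<delta>(1) by blast
    qed (use t in \<open>auto intro!: exI[of _ 1]\<close>)
    obtain \<delta>1 B1 where 1: "\<delta>1 > 0" "\<And>s. s \<in> {t<..T} \<Longrightarrow> s - t < \<delta>1 \<Longrightarrow> q s \<le> B1" using right by blast
    obtain \<delta>2 B2 where 2: "\<delta>2 > 0" "\<And>s. s \<in> {0..<t} \<Longrightarrow> t - s < \<delta>2 \<Longrightarrow> q s \<le> B2" using left by blast
    have "q s \<le> max (q t) (max B1 B2)" if s: "s \<in> {0..T}" "\<bar>s - t\<bar> < min \<delta>1 \<delta>2" for s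
    proof (cases s t rule: linorder_cases)
      case less
      then show ?thesis using 2(2)[of s] s by auto
    next
      case greater
      then show ?thesis using 1(2)[of s] s by auto
    qed auto
    then show "\<exists>\<delta>>0. \<exists>B. \<forall>s\<in>{0..T}. \<bar>s - t\<bar> < \<delta> \<longrightarrow> q s \<le> B"
      using 1(1) 2(1) by (intro exI[of _ "min \<delta>1 \<delta>2"] conjI exI[of _ "max (q t) (max B1 B2)"]) auto
  qed
  then obtain B where "\<And>s. s \<in> {0..T} \<Longrightarrow> q s \<le> B" by blast
  then show ?thesis using L2(3)[OF XL] by (intro exI[of _ B]) (auto simp: q_def intro!: ennreal_leI)
qed

lemma C_proc_imp_D_proc:
  fixes X :: "real \<Rightarrow> 'w \<Rightarrow> 'x::real_normed_vector"
  assumes X: "X \<in> C_proc M F 0 T"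
  shows "X \<in> D_proc M F 0 T"
proof -
  have lim: "((\<lambda>s. LINT \<omega>|M. (norm (X s \<omega> - X t \<omega>))\<^sup>2) \<longlongrightarrow> 0) (at t within A)"
    if "t \<in> {0..T}" "A \<subseteq> {0..T}" for t A
    using X that tendsto_within_subset unfolding C_proc_def by blast
  show "X \<in> D_proc M F 0 T"
    unfolding D_proc_def mem_Collect_eq
  proof (intro conjI ballI)
    show "adapted F 0 T X" using X by (simp add: C_proc_def)
    show "X t \<in> L2_rv M (F T)" if "t \<in> {0..T}" for t using X that by (simp add: C_proc_def)
    show "((\<lambda>s. LINT \<omega>|M. (norm (X s \<omega> - X t \<omega>))\<^sup>2) \<longlongrightarrow> 0) (at t within {t<..T})" if "t \<in> {0..<T}" for t
      by (rule lim) (use that in auto)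
    show "\<exists>\<eta>\<in>L2_rv M (F T). ((\<lambda>s. LINT \<omega>|M. (norm (X s \<omega> - \<eta> \<omega>))\<^sup>2) \<longlongrightarrow> 0) (at t within {0..<t})"
      if "t \<in> {0<..T}" for t
      by (rule bexI[of _ "X t"], rule lim) (use that X in \<open>auto simp: C_proc_def\<close>)
  qed
qed

lemma D_proc_adapted_L2:
  fixes X :: "real \<Rightarrow> 'w \<Rightarrow> 'x::{real_normed_vector, second_countable_topology}"
  assumes X: "X \<in> D_proc M F 0 T"
  shows "X \<in> L2_proc M F 0 T"
proof -
  have horizon: "(0::real) \<le> 0" "0 \<le> T" "T \<le> T" using T_pos by auto
  obtain B where B: "\<And>t. t \<in> {0..T} \<Longrightarrow> msq M (X t) \<le> ennreal B" using D_proc_bounded[OF X] by blast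
  have Xa: "adapted F 0 T X" using X by (simp add: D_proc_def)
  have m: "(\<lambda>z. ennreal ((norm (X (fst z) (snd z)))\<^sup>2)) \<in> borel_measurable (time_space M 0 T)"
    using adapted_measurable[OF horizon Xa] by measurable
  have "msq (time_space M 0 T) (\<lambda>z. X (fst z) (snd z)) = (\<integral>\<^sup>+s. msq M (X s) * indicator {0..T} s \<partial>lborel)"
    unfolding msq_def by (subst nn_integral_time_space[OF prob_space_axioms m]) simp
  also have "\<dots> \<le> (\<integral>\<^sup>+s. ennreal B * indicator {0..T} s \<partial>lborel)"
    by (intro nn_integral_mono) (auto simp: indicator_def B)
  also have "\<dots> < \<infinity>" using T_pos by (simp add: nn_integral_cmult ennreal_mult_less_top)
  finally have fin: "msq (time_space M 0 T) (\<lambda>z. X (fst z) (snd z)) < \<infinity>" .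
  show ?thesis
    using Xa fin by (intro L2_procI[OF horizon] ae_measurableI) (simp_all add: adapted_def case_prod_unfold)
qed

end

section \<open>Linear mild solutions\<close>

text \<open>The convolution kernel at time \<open>t\<close>, cut off after \<open>t\<close>. With it
  the convolutions at all times are integrals over the fixed interval from 0 to \<open>T\<close>,
  and their continuity in \<open>t\<close> is that of the integrand in mean square.\<close>

definition semigroup_shift ::
  "(real \<Rightarrow> 'h::real_normed_vector \<Rightarrow>\<^sub>L 'h) \<Rightarrow> real \<Rightarrow> (real \<Rightarrow> 'w \<Rightarrow> 'h) \<Rightarrow> real \<Rightarrow> 'w \<Rightarrow> 'h" where
  "semigroup_shift S t f s \<omega> = (if s \<le> t then S (t - s) (f s \<omega>) else 0)"

lemma semigroup_shift_borel:
  fixes S :: "real \<Rightarrow> 'h::{banach, second_countable_topology} \<Rightarrow>\<^sub>L 'h"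
  assumes S: "C0_semigroup S"
  shows "(\<lambda>p. if fst p \<le> t then S (t - fst p) (snd p) else 0) \<in> borel_measurable (borel :: (real \<times> 'h) measure)"
proof -
  have c: "continuous_on {p :: real \<times> 'h. fst p \<le> t} (\<lambda>p. S (t - fst p) (snd p))"
  proof -
    have "continuous_on {p :: real \<times> 'h. fst p \<le> t} (\<lambda>p. (\<lambda>(r, x). S r x) (t - fst p, snd p))"
      by (rule continuous_on_compose2[OF C0_semigroup_continuous[OF S]]) (auto intro!: continuous_intros)
    then show ?thesis by simp
  qed
  have cl: "closed {p :: real \<times> 'h. fst p \<le> t}"
    by (intro closed_Collect_le continuous_intros)
  then have "{p :: real \<times> 'h. fst p \<le> t} \<in> sets borel" by simp
  from borel_measurable_continuous_on_if[OF this c, of "\<lambda>_. 0"] show ?thesis by simp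
qed

lemma semigroup_shift_ae_measurable:
  fixes S :: "real \<Rightarrow> 'h::{banach, second_countable_topology} \<Rightarrow>\<^sub>L 'h"
  assumes S: "C0_semigroup S" and "fst \<in> borel_measurable G"
    and "ae_measurable G N (\<lambda>z. f (fst z) (snd z))"
  shows "ae_measurable G N (\<lambda>z. semigroup_shift S t f (fst z) (snd z))"
  unfolding semigroup_shift_def
  by (rule ae_measurable_comp2[OF ae_measurableI[OF assms(2)] assms(3), of "\<lambda>s x. if s \<le> t then S (t - s) x else 0"])
    (use semigroup_shift_borel[OF S] in simp)

text \<open>The cut-off jumps from the identity to 0 at s = t. This diagonal, a null set by
  \<open>AE_time_space_fst_neq\<close>, is the only exception.\<close>

lemma semigroup_shift_tendsto:
  fixes S :: "real \<Rightarrow> 'h::banach \<Rightarrow>\<^sub>L 'h"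
  assumes S: "C0_semigroup S" and "x \<longlonglongrightarrow> t" and "s \<noteq> t"
  shows "(\<lambda>k. semigroup_shift S (x k) f s \<omega>) \<longlonglongrightarrow> semigroup_shift S t f s \<omega>"
proof (cases "s < t")
  case True
  have ev: "eventually (\<lambda>k. s < x k) sequentially"
    using order_tendstoD(1)[OF assms(2) True] .
  \<comment> \<open>The maximum with 0 keeps early time arguments in the half-line where the
    semigroup is continuous; for large k it changes nothing.\<close>
  have "(\<lambda>k. (\<lambda>(r, y). S r y) (max 0 (x k - s), f s \<omega>)) \<longlonglongrightarrow> (\<lambda>(r, y). S r y) (max 0 (t - s), f s \<omega>)"
  proof (rule continuous_on_tendsto_compose[OF C0_semigroup_continuous[OF S]])
    show "(\<lambda>k. (max 0 (x k - s), f s \<omega>)) \<longlonglongrightarrow> (max 0 (t - s), f s \<omega>)"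
      by (intro tendsto_intros assms(2))
  qed auto
  then have "(\<lambda>k. S (max 0 (x k - s)) (f s \<omega>)) \<longlonglongrightarrow> semigroup_shift S t f s \<omega>"
    using True by (simp add: semigroup_shift_def)
  moreover have "eventually (\<lambda>k. S (max 0 (x k - s)) (f s \<omega>) = semigroup_shift S (x k) f s \<omega>) sequentially"
    using ev by eventually_elim (auto simp: semigroup_shift_def max_def)
  ultimately show ?thesis by (rule Lim_transform_eventually)
next
  case False
  then have "t < s" using assms(3) by simp
  have "eventually (\<lambda>k. x k < s) sequentially"
    using order_tendstoD(2)[OF assms(2) \<open>t < s\<close>] .
  then have "eventually (\<lambda>k. semigroup_shift S (x k) f s \<omega> = 0) sequentially"
    by eventually_elim (simp add: semigroup_shift_def)
  then show ?thesis using \<open>t < s\<close> by (simp add: semigroup_shift_def tendsto_eventually)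
qed

section \<open>Deterministic and stochastic convolutions with the semigroup\<close>

context brownian_basis
begin

lemma horizon: "(0::real) \<le> 0" "0 \<le> T" "T \<le> T"
  using T_pos by auto

lemma AE_time_space_fst_neq: "AE z in time_space M a b. fst z \<noteq> t"
proof -
  interpret P: pair_sigma_finite "restrict_space lborel {a..b}" M
    by (rule pair_sigma_finite_time_space[OF prob_space_axioms])
  have "AE s in restrict_space lborel {a..b}. s \<noteq> t"
    using AE_lborel_singleton[of t] by (simp add: AE_restrict_space_iff) (auto elim: eventually_mono)
  then have "AE s in restrict_space lborel {a..b}. AE \<omega> in M. fst (s, \<omega>) \<noteq> t" by eventually_elim simp
  moreover have "{z \<in> space (time_space M a b). fst z \<noteq> t} \<in> sets (time_space M a b)"
    by measurable
  ultimately show ?thesis by (intro P.AE_pair_measure)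
qed

lemma semigroup_shift_L2:
  fixes S :: "real \<Rightarrow> 'h::{banach, second_countable_topology} \<Rightarrow>\<^sub>L 'h"
  assumes S: "C0_semigroup S" and K: "0 \<le> K" "\<And>t. t \<in> {0..T} \<Longrightarrow> norm (S t) \<le> K"
    and f: "f \<in> L2_proc M F 0 T" and t: "t \<in> {0..T}"
  shows "semigroup_shift S t f \<in> L2_proc M F 0 T"
    and "b \<in> {0..T} \<Longrightarrow> msq (time_space M 0 b) (\<lambda>z. semigroup_shift S t f (fst z) (snd z))
      \<le> ennreal (K\<^sup>2) * msq (time_space M 0 b) (\<lambda>z. f (fst z) (snd z))"
proof -
  note fm = L2_procD[OF horizon f]
  have le: "norm (semigroup_shift S t f s \<omega>) \<le> K * norm (f s \<omega>)" if "0 \<le> s" for s \<omega>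
  proof (cases "s \<le> t")
    case True
    have "norm (S (t - s) (f s \<omega>)) \<le> norm (S (t - s)) * norm (f s \<omega>)" by (rule norm_blinfun)
    also have "\<dots> \<le> K * norm (f s \<omega>)" using K(2)[of "t - s"] that True t by (intro mult_right_mono) auto
    finally show ?thesis using True by (simp add: semigroup_shift_def)
  qed (use K in \<open>simp add: semigroup_shift_def\<close>)
  have bd: "msq (time_space M 0 b) (\<lambda>z. semigroup_shift S t f (fst z) (snd z))
      \<le> ennreal (K\<^sup>2) * msq (time_space M 0 b) (\<lambda>z. f (fst z) (snd z))" if b: "b \<in> {0..T}" for b
  proof -
    obtain f' where f': "f' \<in> borel_measurable (time_space M 0 T)" "AE z in time_space M 0 T. f (fst z) (snd z) = f' z"
      using fm(3) by (auto simp: ae_measurable_def)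
    have f'b: "f' \<in> borel_measurable (time_space M 0 b)"
      by (rule measurable_compose[OF measurable_time_space_mono f'(1)]) (use b in auto)
    have eq: "AE z in time_space M 0 b. f (fst z) (snd z) = f' z"
      by (rule AE_time_space_mono[OF prob_space_axioms _ f'(2)]) (use b in auto)
    have "msq (time_space M 0 b) (\<lambda>z. semigroup_shift S t f (fst z) (snd z)) \<le> ennreal (K\<^sup>2) * msq (time_space M 0 b) f'"
    proof (rule msq_scale_le[OF f'b K(1)])
      show "AE z in time_space M 0 b. norm (semigroup_shift S t f (fst z) (snd z)) \<le> K * norm (f' z)"
        using eq AE_space
      proof eventually_elim
        case (elim z)
        then show ?case using le[of "fst z" "snd z"] by (auto simp: space_pair_measure space_restrict_space)
      qed
    qed
    also have "msq (time_space M 0 b) f' = msq (time_space M 0 b) (\<lambda>z. f (fst z) (snd z))"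
      by (rule msq_cong_AE) (use eq in eventually_elim, simp)
    finally show ?thesis .
  qed
  then show "b \<in> {0..T} \<Longrightarrow> msq (time_space M 0 b) (\<lambda>z. semigroup_shift S t f (fst z) (snd z))
      \<le> ennreal (K\<^sup>2) * msq (time_space M 0 b) (\<lambda>z. f (fst z) (snd z))" .
  have "msq (time_space M 0 T) (\<lambda>z. semigroup_shift S t f (fst z) (snd z)) < \<infinity>"
    by (rule le_less_trans[OF bd]) (use fm(2) horizon in \<open>auto simp: ennreal_mult_less_top\<close>)
  then show "semigroup_shift S t f \<in> L2_proc M F 0 T"
    by (intro L2_procI[OF horizon] semigroup_shift_ae_measurable[OF S adapted_fst fm(1)])
qed

text \<open>Dominated convergence with majorant \<open>(2 * K)\<^sup>2\<close> times the squared
  norm of an adapted version of \<open>f\<close>. Both convolutions owe their mean square continuity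
  to this one fact.\<close>

lemma semigroup_shift_continuous:
  fixes S :: "real \<Rightarrow> 'h::{banach, second_countable_topology} \<Rightarrow>\<^sub>L 'h"
  assumes S: "C0_semigroup S" and f: "f \<in> L2_proc M F 0 T" and t: "t \<in> {0..T}"
  shows "((\<lambda>r. msq (time_space M 0 T) (\<lambda>z. semigroup_shift S r f (fst z) (snd z) - semigroup_shift S t f (fst z) (snd z)))
    \<longlongrightarrow> 0) (at t within {0..T})"
  unfolding tendsto_at_iff_sequentially o_def
proof (intro allI impI)
  fix x assume x: "\<forall>i. x i \<in> {0..T} - {t}" "x \<longlonglongrightarrow> t"
  let ?P = "time_space M 0 T"
  obtain K where K: "K \<ge> 1" "\<And>t. t \<in> {0..T} \<Longrightarrow> norm (S t) \<le> K" using C0_semigroup_bounded[OF S] by blast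
  obtain f' where f': "adapted F 0 T f'" "AE z in ?P. f (fst z) (snd z) = f' (fst z) (snd z)"
    "msq ?P (\<lambda>z. f' (fst z) (snd z)) < \<infinity>"
    using f unfolding L2_proc_iff[OF horizon] by blast
  note [measurable] = adapted_measurable[OF horizon f'(1)]
  have shm[measurable]: "(\<lambda>z. semigroup_shift S r f' (fst z) (snd z)) \<in> borel_measurable ?P" for r
    unfolding semigroup_shift_def
    using measurable_compose[OF borel_measurable_Pair[of fst ?P "\<lambda>z. f' (fst z) (snd z)"] semigroup_shift_borel[OF S, of r]]
    unfolding fst_conv snd_conv by simp
  have "(\<lambda>k. \<integral>\<^sup>+z. ennreal ((norm (semigroup_shift S (x k) f' (fst z) (snd z) - semigroup_shift S t f' (fst z) (snd z)))\<^sup>2) \<partial>?P)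
    \<longlonglongrightarrow> (\<integral>\<^sup>+z. 0 \<partial>?P)"
  proof (rule nn_integral_dominated_convergence[where w="\<lambda>z. ennreal ((2 * K)\<^sup>2) * ennreal ((norm (f' (fst z) (snd z)))\<^sup>2)"])
    show "AE z in ?P. ennreal ((norm (semigroup_shift S (x k) f' (fst z) (snd z) - semigroup_shift S t f' (fst z) (snd z)))\<^sup>2)
      \<le> ennreal ((2 * K)\<^sup>2) * ennreal ((norm (f' (fst z) (snd z)))\<^sup>2)" for k
    proof (rule AE_I2)
      fix z assume "z \<in> space ?P"
      then have z: "0 \<le> fst z" by (auto simp: space_pair_measure space_restrict_space)
      have le: "norm (semigroup_shift S r f' (fst z) (snd z)) \<le> K * norm (f' (fst z) (snd z))" if "r \<in> {0..T}" for r
      proof (cases "fst z \<le> r")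
        case True
        have "norm (S (r - fst z) (f' (fst z) (snd z))) \<le> norm (S (r - fst z)) * norm (f' (fst z) (snd z))" by (rule norm_blinfun)
        also have "\<dots> \<le> K * norm (f' (fst z) (snd z))" using K(2)[of "r - fst z"] that True z by (intro mult_right_mono) auto
        finally show ?thesis using True by (simp add: semigroup_shift_def)
      qed (use K in \<open>simp add: semigroup_shift_def\<close>)
      have "norm (semigroup_shift S (x k) f' (fst z) (snd z) - semigroup_shift S t f' (fst z) (snd z)) \<le> (2 * K) * norm (f' (fst z) (snd z))"
        using norm_triangle_ineq4[of "semigroup_shift S (x k) f' (fst z) (snd z)" "semigroup_shift S t f' (fst z) (snd z)"]
          le[of "x k"] le[of t] x(1) t by auto
      then have "(norm (semigroup_shift S (x k) f' (fst z) (snd z) - semigroup_shift S t f' (fst z) (snd z)))\<^sup>2 \<le> ((2 * K) * norm (f' (fst z) (snd z)))\<^sup>2"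
        by (intro power_mono) auto
      then have "ennreal ((norm (semigroup_shift S (x k) f' (fst z) (snd z) - semigroup_shift S t f' (fst z) (snd z)))\<^sup>2)
        \<le> ennreal (((2 * K) * norm (f' (fst z) (snd z)))\<^sup>2)" by (rule ennreal_leI)
      also have "((2 * K) * norm (f' (fst z) (snd z)))\<^sup>2 = (2 * K)\<^sup>2 * (norm (f' (fst z) (snd z)))\<^sup>2"
        by (rule power_mult_distrib)
      also have "ennreal \<dots> = ennreal ((2 * K)\<^sup>2) * ennreal ((norm (f' (fst z) (snd z)))\<^sup>2)"
        by (rule ennreal_mult) auto
      finally show "ennreal ((norm (semigroup_shift S (x k) f' (fst z) (snd z) - semigroup_shift S t f' (fst z) (snd z)))\<^sup>2)
        \<le> ennreal ((2 * K)\<^sup>2) * ennreal ((norm (f' (fst z) (snd z)))\<^sup>2)" .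
    qed
    show "(\<integral>\<^sup>+z. ennreal ((2 * K)\<^sup>2) * ennreal ((norm (f' (fst z) (snd z)))\<^sup>2) \<partial>?P) < \<infinity>"
      using f'(3) by (subst nn_integral_cmult) (auto simp: msq_def ennreal_mult_less_top)
    show "AE z in ?P. (\<lambda>k. ennreal ((norm (semigroup_shift S (x k) f' (fst z) (snd z) - semigroup_shift S t f' (fst z) (snd z)))\<^sup>2)) \<longlonglongrightarrow> 0"
      using AE_time_space_fst_neq[where a=0 and b=T and t=t]
    proof eventually_elim
      case (elim z)
      have "(\<lambda>k. ennreal ((norm (semigroup_shift S (x k) f' (fst z) (snd z) - semigroup_shift S t f' (fst z) (snd z)))\<^sup>2))
        \<longlonglongrightarrow> ennreal ((norm (semigroup_shift S t f' (fst z) (snd z) - semigroup_shift S t f' (fst z) (snd z)))\<^sup>2)"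
        by (intro tendsto_ennrealI tendsto_power tendsto_norm tendsto_diff tendsto_const semigroup_shift_tendsto[OF S x(2) elim])
      then show ?case by simp
    qed
  qed measurable
  moreover have "msq ?P (\<lambda>z. semigroup_shift S (x k) f (fst z) (snd z) - semigroup_shift S t f (fst z) (snd z))
    = (\<integral>\<^sup>+z. ennreal ((norm (semigroup_shift S (x k) f' (fst z) (snd z) - semigroup_shift S t f' (fst z) (snd z)))\<^sup>2) \<partial>?P)" for k
    unfolding msq_def by (rule nn_integral_cong_AE) (use f'(2) in eventually_elim, simp add: semigroup_shift_def)
  ultimately show "(\<lambda>k. msq ?P (\<lambda>z. semigroup_shift S (x k) f (fst z) (snd z) - semigroup_shift S t f (fst z) (snd z))) \<longlonglongrightarrow> 0"
    by simp
qed

lemma L2_proc_mono: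
  fixes f :: "real \<Rightarrow> 'w \<Rightarrow> 'x::{real_normed_vector, second_countable_topology}"
  assumes f: "f \<in> L2_proc M F 0 T" and t: "t \<in> {0..T}"
  shows "f \<in> L2_proc M F 0 t"
proof -
  obtain f' where f': "adapted F 0 T f'" "AE z in time_space M 0 T. f (fst z) (snd z) = f' (fst z) (snd z)"
    "msq (time_space M 0 T) (\<lambda>z. f' (fst z) (snd z)) < \<infinity>"
    using f unfolding L2_proc_iff[OF horizon] by blast
  have t': "(0::real) \<le> 0" "0 \<le> t" "t \<le> T" using t by auto
  have m: "(\<lambda>z. ennreal ((norm (f' (fst z) (snd z)))\<^sup>2)) \<in> borel_measurable (time_space M 0 T)"
    using adapted_measurable[OF horizon f'(1)] by measurable
  have "msq (time_space M 0 t) (\<lambda>z. f' (fst z) (snd z)) \<le> msq (time_space M 0 T) (\<lambda>z. f' (fst z) (snd z))"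
    unfolding msq_def
    by (subst nn_integral_time_space_mono[OF prob_space_axioms _ m])
      (use t in \<open>auto intro!: nn_integral_mono simp: indicator_def\<close>)
  moreover have "AE z in time_space M 0 t. f (fst z) (snd z) = f' (fst z) (snd z)"
    by (rule AE_time_space_mono[OF prob_space_axioms _ f'(2)]) (use t in auto)
  moreover have "adapted F 0 t f'" by (rule adapted_mono[OF _ _ _ _ f'(1)]) (use t in auto)
  ultimately show ?thesis unfolding L2_proc_iff[OF t'] using f'(3) by (intro exI[of _ f']) (auto intro: le_less_trans)
qed

text \<open>Cauchy-Schwarz in time for each \<omega>, followed by Tonelli.\<close>

lemma time_integral_msq_le:
  fixes g :: "real \<times> 'w \<Rightarrow> 'x::{banach, second_countable_topology}"
  assumes g: "g \<in> borel_measurable (time_space M 0 t)" and t: "0 \<le> t"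
  shows "msq M (\<lambda>\<omega>. LINT s|restrict_space lborel {0..t}. g (s, \<omega>)) \<le> ennreal t * msq (time_space M 0 t) g"
proof -
  let ?L = "restrict_space lborel {0..t}"
  interpret P: pair_sigma_finite ?L M by (rule pair_sigma_finite_time_space[OF prob_space_axioms])
  have m: "(\<lambda>z. ennreal ((norm (g z))\<^sup>2)) \<in> borel_measurable (time_space M 0 t)" using g by measurable
  have "msq M (\<lambda>\<omega>. LINT s|?L. g (s, \<omega>)) \<le> (\<integral>\<^sup>+\<omega>. ennreal t * (\<integral>\<^sup>+s. ennreal ((norm (g (s, \<omega>)))\<^sup>2) \<partial>?L) \<partial>M)"
    unfolding msq_def
  proof (rule nn_integral_mono)
    fix \<omega> assume "\<omega> \<in> space M"
    then have "(\<lambda>s. g (s, \<omega>)) \<in> borel_measurable ?L" using measurable_compose[OF measurable_Pair2' g] by simp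
    from msq_lborel_Icc_integral_le[OF this t]
    show "ennreal ((norm (LINT s|?L. g (s, \<omega>)))\<^sup>2) \<le> ennreal t * (\<integral>\<^sup>+s. ennreal ((norm (g (s, \<omega>)))\<^sup>2) \<partial>?L)"
      by (simp add: msq_def)
  qed
  also have "\<dots> = ennreal t * (\<integral>\<^sup>+\<omega>. (\<integral>\<^sup>+s. ennreal ((norm (g (s, \<omega>)))\<^sup>2) \<partial>?L) \<partial>M)"
  proof (rule nn_integral_cmult)
    show "(\<lambda>\<omega>. \<integral>\<^sup>+s. ennreal ((norm (g (s, \<omega>)))\<^sup>2) \<partial>?L) \<in> borel_measurable M"
      using P.M1.borel_measurable_nn_integral_fst[OF measurable_pair_swap[OF m]] by simp
  qed
  also have "(\<integral>\<^sup>+\<omega>. (\<integral>\<^sup>+s. ennreal ((norm (g (s, \<omega>)))\<^sup>2) \<partial>?L) \<partial>M) = msq (time_space M 0 t) g"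
    unfolding msq_def by (rule P.nn_integral_snd[OF m])
  finally show ?thesis .
qed

lemma AE_integrable_section:
  fixes g :: "real \<times> 'w \<Rightarrow> 'x::{banach, second_countable_topology}"
  assumes g: "g \<in> borel_measurable (time_space M 0 t)" and fin: "msq (time_space M 0 t) g < \<infinity>"
  shows "AE \<omega> in M. integrable (restrict_space lborel {0..t}) (\<lambda>s. g (s, \<omega>))"
proof -
  interpret P: pair_sigma_finite "restrict_space lborel {0..t}" M by (rule pair_sigma_finite_time_space[OF prob_space_axioms])
  interpret fm: finite_measure "time_space M 0 t" by (rule finite_measure_time_space[OF prob_space_axioms])
  have "integrable (time_space M 0 t) (\<lambda>z. (norm (g z))\<^sup>2)" using integrable_sq_iff[OF g] fin by blast
  then have "integrable (time_space M 0 t) (\<lambda>z. norm (g z))"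
    by (rule fm.square_integrable_imp_integrable[rotated]) (use g in measurable)
  then have "integrable (time_space M 0 t) g" by (simp only: integrable_norm_iff[OF g])
  then show ?thesis using P.AE_integrable_snd[of "\<lambda>s \<omega>. g (s, \<omega>)"] by simp
qed

text \<open>Supplies, for almost every \<omega>, the integrability demanded inside
  \<open>mild_solution\<close> for a driver that is measurable only up to a null set of the
  strip.\<close>

lemma set_integral_ae_version:
  fixes f :: "real \<Rightarrow> 'w \<Rightarrow> 'x::{banach, second_countable_topology}"
  assumes g: "g \<in> borel_measurable (time_space M 0 t)" "msq (time_space M 0 t) g < \<infinity>"
    and eq: "AE z in time_space M 0 t. f (fst z) (snd z) = g z"
  shows "AE \<omega> in M. set_integrable lebesgue {0..t} (\<lambda>s. f s \<omega>) \<and>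
    (LINT s:{0..t}|lebesgue. f s \<omega>) = (LINT s|restrict_space lborel {0..t}. g (s, \<omega>))"
proof -
  interpret P: pair_sigma_finite "restrict_space lborel {0..t}" M by (rule pair_sigma_finite_time_space[OF prob_space_axioms])
  have "AE \<omega> in M. AE s in restrict_space lborel {0..t}. f s \<omega> = g (s, \<omega>)"
    using P.AE_pair_swap[of "\<lambda>s \<omega>. f s \<omega> = g (s, \<omega>)"] eq by simp
  with AE_integrable_section[OF g] show ?thesis
  proof eventually_elim
    case (elim \<omega>)
    show ?case using set_lebesgue_integral_cong_restrict[OF elim] by (rule conjI)
  qed
qed


lemma L2_proc_shift_on_Icc:
  fixes S :: "real \<Rightarrow> 'h::{banach, second_countable_topology} \<Rightarrow>\<^sub>L 'h"
  assumes S: "C0_semigroup S" and f: "f \<in> L2_proc M F 0 T" and t: "t \<in> {0..T}"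
  shows "semigroup_shift S t f \<in> L2_proc M F 0 T" "semigroup_shift S t f \<in> L2_proc M F 0 t"
proof -
  obtain K where K: "K \<ge> 1" "\<And>t. t \<in> {0..T} \<Longrightarrow> norm (S t) \<le> K" using C0_semigroup_bounded[OF S] by blast
  then have "0 \<le> K" by simp
  from semigroup_shift_L2(1)[OF S this K(2) f t] show "semigroup_shift S t f \<in> L2_proc M F 0 T" .
  from L2_proc_mono[OF this t] show "semigroup_shift S t f \<in> L2_proc M F 0 t" .
qed

lemma AE_semigroup_shift:
  "AE z in time_space M 0 t. semigroup_shift S t f (fst z) (snd z) = S (t - fst z) (f (fst z) (snd z))"
  by (rule AE_I2) (auto simp: semigroup_shift_def space_pair_measure space_restrict_space)

lemma has_ito_integral_shift_iff:
  fixes S :: "real \<Rightarrow> 'h::{real_inner, banach, second_countable_topology} \<Rightarrow>\<^sub>L 'h"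
  assumes t: "t \<in> {0..T}"
  shows "has_ito_integral M F W 0 t (semigroup_shift S t f) J \<longleftrightarrow> has_ito_integral M F W 0 t (\<lambda>s \<omega>. S (t - s) (f s \<omega>)) J"
proof -
  have t': "(0::real) \<le> 0" "0 \<le> t" "t \<le> T" using t by auto
  have 1: "AE z in time_space M 0 t. S (t - fst z) (f (fst z) (snd z)) = semigroup_shift S t f (fst z) (snd z)"
    using AE_semigroup_shift[where t=t and S=S and f=f] by eventually_elim simp
  have 2: "AE z in time_space M 0 t. semigroup_shift S t f (fst z) (snd z) = S (t - fst z) (f (fst z) (snd z))"
    by (rule AE_semigroup_shift)
  show ?thesis
  proof
    assume J: "has_ito_integral M F W 0 t (semigroup_shift S t f) J"
    show "has_ito_integral M F W 0 t (\<lambda>s \<omega>. S (t - s) (f s \<omega>)) J"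
      by (rule ito_cong[OF t' J 2 _ ito_measurable(2)[OF t' J]]) simp
  next
    assume J: "has_ito_integral M F W 0 t (\<lambda>s \<omega>. S (t - s) (f s \<omega>)) J"
    show "has_ito_integral M F W 0 t (semigroup_shift S t f) J"
      by (rule ito_cong[OF t' J 1 _ ito_measurable(2)[OF t' J]]) simp
  qed
qed

text \<open>The version \<open>D\<close> has to be adapted and at the same time comparable at
  different times. The integral up to \<open>t\<close> shows the first, the integral of the cut-off
  kernel up to \<open>T\<close> the second.\<close>

lemma deterministic_convolution:
  fixes S :: "real \<Rightarrow> 'h::{banach, second_countable_topology} \<Rightarrow>\<^sub>L 'h"
  assumes S: "C0_semigroup S" and f: "f \<in> L2_proc M F 0 T"
  shows "\<exists>D. (\<forall>t\<in>{0..T}. D t \<in> borel_measurable (F t) \<and> msq M (D t) < \<infinity> \<and>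
      (AE \<omega> in M. set_integrable lebesgue {0..t} (\<lambda>s. S (t - s) (f s \<omega>)) \<and>
        (LINT s:{0..t}|lebesgue. S (t - s) (f s \<omega>)) = D t \<omega>) \<and>
      (\<forall>r\<in>{0..T}. msq M (\<lambda>\<omega>. D r \<omega> - D t \<omega>) \<le> ennreal T *
        msq (time_space M 0 T) (\<lambda>z. semigroup_shift S r f (fst z) (snd z) - semigroup_shift S t f (fst z) (snd z))))"
proof -
  let ?P = "time_space M 0 T" and ?L = "\<lambda>t. restrict_space lborel {0..t::real}"
  obtain f' where f': "adapted F 0 T f'" "AE z in ?P. f (fst z) (snd z) = f' (fst z) (snd z)"
    "msq ?P (\<lambda>z. f' (fst z) (snd z)) < \<infinity>"
    using f unfolding L2_proc_iff[OF horizon] by blast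
  have f'L: "f' \<in> L2_proc M F 0 T" unfolding L2_proc_iff[OF horizon] using f'(1,3) by (intro exI[of _ f']) auto
  have shm: "(\<lambda>z. semigroup_shift S t f' (fst z) (snd z)) \<in> borel_measurable N"
    if [measurable]: "(\<lambda>z. f' (fst z) (snd z)) \<in> borel_measurable N" "fst \<in> borel_measurable N" for t N
    using measurable_compose[OF borel_measurable_Pair[OF that(2,1)] semigroup_shift_borel[OF S, of t]]
    unfolding semigroup_shift_def fst_conv snd_conv .
  have fm: "(\<lambda>z. semigroup_shift S t f' (fst z) (snd z)) \<in> borel_measurable ?P" for t
    by (rule shm[OF adapted_measurable[OF horizon f'(1)]]) measurable
  define D where "D t \<omega> = (LINT s|?L T. semigroup_shift S t f' s \<omega>)" for t \<omega>
  have Dt: "D t \<omega> = (LINT s|?L t. semigroup_shift S t f' s \<omega>)" if "t \<in> {0..T}" for t \<omega>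
    unfolding D_def integral_restrict_space[of "{0..T}" lborel, simplified] integral_restrict_space[of "{0..t}" lborel, simplified]
    by (intro Bochner_Integration.integral_cong) (use that in \<open>auto simp: semigroup_shift_def indicator_def\<close>)
  have DF: "D t \<in> borel_measurable (F t)" if t: "t \<in> {0..T}" for t
  proof -
    interpret L: finite_measure "?L t" by (rule finite_measure_restrict_Icc)
    have fst': "fst \<in> borel_measurable (time_space (F t) 0 t)"
      by (rule measurable_compose[OF measurable_fst]) (simp add: measurable_restrict_space1)
    have "(\<lambda>z. semigroup_shift S t f' (fst z) (snd z)) \<in> borel_measurable (time_space (F t) 0 t)"
      by (rule shm[OF adapted_measurable_at[OF horizon f'(1) t] fst'])
    from measurable_pair_swap[OF this]
    have "(\<lambda>(\<omega>, s). semigroup_shift S t f' s \<omega>) \<in> borel_measurable (F t \<Otimes>\<^sub>M ?L t)" by simp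
    then have "(\<lambda>\<omega>. LINT s|?L t. semigroup_shift S t f' s \<omega>) \<in> borel_measurable (F t)"
      by (rule L.borel_measurable_lebesgue_integral)
    then show ?thesis using Dt[OF t] by (simp add: fun_eq_iff[symmetric] cong: measurable_cong)
  qed
  have fin: "msq ?P (\<lambda>z. semigroup_shift S t f' (fst z) (snd z)) < \<infinity>" if "t \<in> {0..T}" for t
    using L2_procD(2)[OF horizon L2_proc_shift_on_Icc(1)[OF S f'L that]] .
  have Dfin: "msq M (D t) < \<infinity>" if t: "t \<in> {0..T}" for t
  proof -
    have "msq M (D t) \<le> ennreal T * msq ?P (\<lambda>z. semigroup_shift S t f' (fst z) (snd z))"
      using time_integral_msq_le[OF fm horizon(2), of t] by (simp add: D_def[abs_def])
    also have "\<dots> < \<infinity>" using fin[OF t] by (simp add: ennreal_mult_less_top)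
    finally show ?thesis .
  qed
  have ver: "AE \<omega> in M. set_integrable lebesgue {0..t} (\<lambda>s. S (t - s) (f s \<omega>)) \<and>
        (LINT s:{0..t}|lebesgue. S (t - s) (f s \<omega>)) = D t \<omega>" if t: "t \<in> {0..T}" for t
  proof -
    have m: "(\<lambda>z. semigroup_shift S t f' (fst z) (snd z)) \<in> borel_measurable (time_space M 0 t)"
      by (rule measurable_compose[OF measurable_time_space_mono fm]) (use t in auto)
    have "AE z in time_space M 0 t. f (fst z) (snd z) = f' (fst z) (snd z)"
      by (rule AE_time_space_mono[OF prob_space_axioms _ f'(2)]) (use t in auto)
    with AE_semigroup_shift[where t=t and S=S and f=f']
    have eq: "AE z in time_space M 0 t. S (t - fst z) (f (fst z) (snd z)) = semigroup_shift S t f' (fst z) (snd z)"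
      by eventually_elim simp
    have fin': "msq (time_space M 0 t) (\<lambda>z. semigroup_shift S t f' (fst z) (snd z)) < \<infinity>"
      by (rule L2_procD(2)[OF _ _ _ L2_proc_shift_on_Icc(2)[OF S f'L t]]) (use t in auto)
    from set_integral_ae_version[OF m fin' eq] show ?thesis by (simp add: Dt[OF t])
  qed
  have cont: "msq M (\<lambda>\<omega>. D r \<omega> - D t \<omega>) \<le> ennreal T *
      msq ?P (\<lambda>z. semigroup_shift S r f (fst z) (snd z) - semigroup_shift S t f (fst z) (snd z))"
    if r: "r \<in> {0..T}" and t: "t \<in> {0..T}" for r t
  proof -
    have "AE \<omega> in M. D r \<omega> - D t \<omega> = (LINT s|?L T. semigroup_shift S r f' s \<omega> - semigroup_shift S t f' s \<omega>)"
      using AE_integrable_section[OF fm fin[OF r]] AE_integrable_section[OF fm fin[OF t]]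
      by eventually_elim (simp add: D_def)
    then have "msq M (\<lambda>\<omega>. D r \<omega> - D t \<omega>) = msq M (\<lambda>\<omega>. LINT s|?L T. semigroup_shift S r f' s \<omega> - semigroup_shift S t f' s \<omega>)"
      by (intro msq_cong_AE) (auto elim: eventually_mono)
    also have "\<dots> \<le> ennreal T * msq ?P (\<lambda>z. semigroup_shift S r f' (fst z) (snd z) - semigroup_shift S t f' (fst z) (snd z))"
      using time_integral_msq_le[OF borel_measurable_diff[OF fm fm] horizon(2), of r t] by simp
    also have "msq ?P (\<lambda>z. semigroup_shift S r f' (fst z) (snd z) - semigroup_shift S t f' (fst z) (snd z))
      = msq ?P (\<lambda>z. semigroup_shift S r f (fst z) (snd z) - semigroup_shift S t f (fst z) (snd z))"
      by (rule msq_cong_AE) (use f'(2) in eventually_elim, simp add: semigroup_shift_def)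
    finally show ?thesis .
  qed
  show ?thesis using DF Dfin ver cont by (intro exI[of _ D]) blast
qed

text \<open>The integral is taken up to \<open>t\<close>, which makes it adapted, and then extended
  to \<open>T\<close>. There the increments are stochastic integrals of increments of the
  kernel.\<close>

lemma stochastic_convolution:
  fixes S :: "real \<Rightarrow> 'h::{real_inner, banach, second_countable_topology} \<Rightarrow>\<^sub>L 'h"
  assumes S: "C0_semigroup S" and g: "g \<in> L2_proc M F 0 T"
  shows "\<exists>J. (\<forall>t\<in>{0..T}. has_ito_integral M F W 0 t (\<lambda>s \<omega>. S (t - s) (g s \<omega>)) (J t) \<and>
      (\<forall>r\<in>{0..T}. msq M (\<lambda>\<omega>. J r \<omega> - J t \<omega>) \<le> 4 *
        msq (time_space M 0 T) (\<lambda>z. semigroup_shift S r g (fst z) (snd z) - semigroup_shift S t g (fst z) (snd z))))"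
proof -
  have "\<forall>t\<in>{0..T}. \<exists>J. has_ito_integral M F W 0 t (semigroup_shift S t g) J"
    by (intro ballI ito_exists L2_proc_shift_on_Icc(2)[OF S g]) auto
  then obtain J where J: "\<And>t. t \<in> {0..T} \<Longrightarrow> has_ito_integral M F W 0 t (semigroup_shift S t g) (J t)"
    by (metis bchoice)
  have ext: "has_ito_integral M F W 0 T (semigroup_shift S t g) (J t)" if t: "t \<in> {0..T}" for t
    by (rule ito_extend[OF _ _ _ _ J[OF t] L2_proc_shift_on_Icc(1)[OF S g t]])
      (use t in \<open>auto simp: semigroup_shift_def\<close>)
  show ?thesis
  proof (intro exI[of _ J] ballI conjI)
    fix t assume t: "t \<in> {0..T}"
    show "has_ito_integral M F W 0 t (\<lambda>s \<omega>. S (t - s) (g s \<omega>)) (J t)"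
      using J[OF t] has_ito_integral_shift_iff[OF t] by blast
    fix r assume r: "r \<in> {0..T}"
    show "msq M (\<lambda>\<omega>. J r \<omega> - J t \<omega>) \<le> 4 *
        msq (time_space M 0 T) (\<lambda>z. semigroup_shift S r g (fst z) (snd z) - semigroup_shift S t g (fst z) (snd z))"
      by (rule ito_msq_le[OF horizon ito_diff[OF horizon ext[OF r] ext[OF t]]])
  qed
qed

text \<open>With drivers that do not involve the state, the mild formula is itself the solution; the
  work lies in giving its right-hand side a progressive mean square continuous version.\<close>

lemma mild_solution_exists:
  fixes S :: "real \<Rightarrow> 'h::{real_inner, banach, second_countable_topology} \<Rightarrow>\<^sub>L 'h"
  assumes S: "C0_semigroup S" and f: "f \<in> L2_proc M F 0 T" and g: "g \<in> L2_proc M F 0 T"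
  shows "\<exists>X. mild_solution M F W S 0 T (\<lambda>_. x0) f g X"
proof -
  let ?P = "time_space M 0 T"
  obtain D where D: "\<And>t. t \<in> {0..T} \<Longrightarrow> D t \<in> borel_measurable (F t)" "\<And>t. t \<in> {0..T} \<Longrightarrow> msq M (D t) < \<infinity>"
    "\<And>t. t \<in> {0..T} \<Longrightarrow> AE \<omega> in M. set_integrable lebesgue {0..t} (\<lambda>s. S (t - s) (f s \<omega>)) \<and>
        (LINT s:{0..t}|lebesgue. S (t - s) (f s \<omega>)) = D t \<omega>"
    "\<And>r t. r \<in> {0..T} \<Longrightarrow> t \<in> {0..T} \<Longrightarrow> msq M (\<lambda>\<omega>. D r \<omega> - D t \<omega>) \<le> ennreal T *
        msq ?P (\<lambda>z. semigroup_shift S r f (fst z) (snd z) - semigroup_shift S t f (fst z) (snd z))"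
    using deterministic_convolution[OF S f] by blast
  obtain J where J: "\<And>t. t \<in> {0..T} \<Longrightarrow> has_ito_integral M F W 0 t (\<lambda>s \<omega>. S (t - s) (g s \<omega>)) (J t)"
    "\<And>r t. r \<in> {0..T} \<Longrightarrow> t \<in> {0..T} \<Longrightarrow> msq M (\<lambda>\<omega>. J r \<omega> - J t \<omega>) \<le> 4 *
        msq ?P (\<lambda>z. semigroup_shift S r g (fst z) (snd z) - semigroup_shift S t g (fst z) (snd z))"
    using stochastic_convolution[OF S g] by blast
  have JF: "J t \<in> borel_measurable (F t)" "msq M (J t) < \<infinity>" if "t \<in> {0..T}" for t
    using ito_measurable[OF _ _ _ J(1)[OF that]] that by auto
  define R where "R t \<omega> = S t x0 + (D t \<omega> + J t \<omega>)" for t \<omega>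
  have DM: "D t \<in> borel_measurable M" and JM: "J t \<in> borel_measurable M" if "t \<in> {0..T}" for t
    using measurable_F_M[OF D(1)[OF that] that] measurable_F_M[OF JF(1)[OF that] that] by auto
  have R2: "R t \<in> L2_rv M (F t)" if t: "t \<in> {0..T}" for t
  proof -
    note [measurable] = D(1)[OF t] JF(1)[OF t]
    have "msq M (R t) \<le> 2 * msq M (\<lambda>_. S t x0) + 2 * msq M (\<lambda>\<omega>. D t \<omega> + J t \<omega>)"
      unfolding R_def by (rule msq_add_le) (use DM[OF t] JM[OF t] in measurable)
    also have "\<dots> \<le> 2 * msq M (\<lambda>_. S t x0) + 2 * (2 * msq M (D t) + 2 * msq M (J t))"
      by (intro add_left_mono mult_left_mono msq_add_le DM JM t) simp
    also have "\<dots> < \<infinity>"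
      using D(2)[OF t] JF(2)[OF t] by (simp add: ennreal_mult_less_top msq_def emeasure_space_1)
    finally show ?thesis unfolding L2_rv_iff[OF subalg[OF t]] R_def by simp
  qed
  have lim: "((\<lambda>s. msq M (\<lambda>\<omega>. R s \<omega> - R t \<omega>)) \<longlongrightarrow> 0) (at t within {0..T})" if t: "t \<in> {0..T}" for t
  proof -
    define A where "A s = ennreal ((norm (S s x0 - S t x0))\<^sup>2)" for s
    define B where "B s = msq ?P (\<lambda>z. semigroup_shift S s f (fst z) (snd z) - semigroup_shift S t f (fst z) (snd z))" for s
    define C where "C s = msq ?P (\<lambda>z. semigroup_shift S s g (fst z) (snd z) - semigroup_shift S t g (fst z) (snd z))" for s
    have le: "msq M (\<lambda>\<omega>. R s \<omega> - R t \<omega>) \<le> 2 * A s + 2 * (2 * (ennreal T * B s) + 2 * (4 * C s))" if s: "s \<in> {0..T}" for s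
    proof -
      note [measurable] = DM[OF t] DM[OF s] JM[OF t] JM[OF s]
      have e: "R s \<omega> - R t \<omega> = (S s x0 - S t x0) + ((D s \<omega> - D t \<omega>) + (J s \<omega> - J t \<omega>))" for \<omega>
        by (simp add: R_def algebra_simps)
      have "msq M (\<lambda>\<omega>. R s \<omega> - R t \<omega>) \<le> 2 * msq M (\<lambda>_. S s x0 - S t x0) + 2 * msq M (\<lambda>\<omega>. (D s \<omega> - D t \<omega>) + (J s \<omega> - J t \<omega>))"
        unfolding e by (rule msq_add_le) measurable
      also have "msq M (\<lambda>_. S s x0 - S t x0) = A s" by (simp add: msq_def A_def emeasure_space_1)
      also have "2 * A s + 2 * msq M (\<lambda>\<omega>. (D s \<omega> - D t \<omega>) + (J s \<omega> - J t \<omega>))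
        \<le> 2 * A s + 2 * (2 * msq M (\<lambda>\<omega>. D s \<omega> - D t \<omega>) + 2 * msq M (\<lambda>\<omega>. J s \<omega> - J t \<omega>))"
        by (intro add_left_mono mult_left_mono msq_add_le) measurable
      also have "\<dots> \<le> 2 * A s + 2 * (2 * (ennreal T * B s) + 2 * (4 * C s))"
        unfolding B_def C_def by (intro add_left_mono mult_left_mono add_mono D(4) J(2) s t) auto
      finally show ?thesis .
    qed
    have "((\<lambda>s. S s x0) \<longlongrightarrow> S t x0) (at t within {0..T})"
    proof -
      have "continuous_on {0..T} (\<lambda>s. (\<lambda>(r, x). S r x) (s, x0))"
        by (rule continuous_on_compose2[OF C0_semigroup_continuous[OF S]]) (auto intro!: continuous_intros)
      then show ?thesis using t by (simp add: continuous_on_def)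
    qed
    then have "((\<lambda>s. ennreal ((norm (S s x0 - S t x0))\<^sup>2)) \<longlongrightarrow> ennreal ((norm (S t x0 - S t x0))\<^sup>2)) (at t within {0..T})"
      by (intro tendsto_ennrealI tendsto_power tendsto_norm tendsto_diff tendsto_const)
    then have A: "(A \<longlongrightarrow> 0) (at t within {0..T})" by (simp add: A_def[abs_def])
    have B: "(B \<longlongrightarrow> 0) (at t within {0..T})" and C: "(C \<longlongrightarrow> 0) (at t within {0..T})"
      unfolding B_def C_def by (rule semigroup_shift_continuous[OF S f t], rule semigroup_shift_continuous[OF S g t])
    have "((\<lambda>s. 2 * A s + 2 * (2 * (ennreal T * B s) + 2 * (4 * C s))) \<longlongrightarrow> 2 * 0 + 2 * (2 * (ennreal T * 0) + 2 * (4 * 0))) (at t within {0..T})"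
      by (intro tendsto_add ennreal_tendsto_cmult A B C) auto
    then have U: "((\<lambda>s. 2 * A s + 2 * (2 * (ennreal T * B s) + 2 * (4 * C s))) \<longlongrightarrow> 0) (at t within {0..T})" by simp
    show ?thesis
      by (rule tendsto_sandwich[OF _ _ tendsto_const U]) (use le in \<open>auto simp: eventually_at_filter\<close>)
  qed
  obtain X where X: "X \<in> C_proc M F 0 T" "\<And>t. t \<in> {0..T} \<Longrightarrow> AE \<omega> in M. X t \<omega> = R t \<omega>"
    using mean_square_continuous_version[OF R2 lim] by blast
  have "mild_solution M F W S 0 T (\<lambda>_. x0) f g X"
    unfolding mild_solution_def
  proof (intro conjI ballI X(1))
    fix t assume t: "t \<in> {0..T}"
    show "\<exists>J. has_ito_integral M F W 0 t (\<lambda>s \<omega>. S (t - s) (g s \<omega>)) J \<and>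
      (AE \<omega> in M. set_integrable lebesgue {0..t} (\<lambda>s. S (t - s) (f s \<omega>)) \<and>
        X t \<omega> = S (t - 0) x0 + (LINT s:{0..t}|lebesgue. S (t - s) (f s \<omega>)) + J \<omega>)"
    proof (intro exI[of _ "J t"] conjI J(1)[OF t])
      show "AE \<omega> in M. set_integrable lebesgue {0..t} (\<lambda>s. S (t - s) (f s \<omega>)) \<and>
        X t \<omega> = S (t - 0) x0 + (LINT s:{0..t}|lebesgue. S (t - s) (f s \<omega>)) + J t \<omega>"
        using X(2)[OF t] D(3)[OF t] by eventually_elim (simp add: R_def add.assoc)
    qed
  qed
  then show ?thesis by blast
qed

lemma C_proc_diff:
  fixes X Y :: "real \<Rightarrow> 'w \<Rightarrow> 'x::{real_normed_vector, second_countable_topology}"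
  assumes X: "X \<in> C_proc M F 0 T" and Y: "Y \<in> C_proc M F 0 T"
  shows "(\<lambda>t \<omega>. X t \<omega> - Y t \<omega>) \<in> C_proc M F 0 T"
proof -
  have TT: "T \<in> {0..T}" using T_pos by simp
  have XL: "X t \<in> L2_rv M (F T)" and YL: "Y t \<in> L2_rv M (F T)" if "t \<in> {0..T}" for t
    using X Y that by (auto simp: C_proc_def)
  have a: "adapted F 0 T (\<lambda>t \<omega>. X t \<omega> - Y t \<omega>)"
    using X Y unfolding C_proc_def adapted_def case_prod_unfold by auto
  have "((\<lambda>s. LINT \<omega>|M. (norm (X s \<omega> - Y s \<omega> - (X t \<omega> - Y t \<omega>)))\<^sup>2) \<longlongrightarrow> 0) (at t within {0..T})"
    if t: "t \<in> {0..T}" for t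
  proof (rule tendsto_sandwich[OF _ _ tendsto_const])
    define p where "p s = (LINT \<omega>|M. (norm (X s \<omega> - X t \<omega>))\<^sup>2)" for s
    define q where "q s = (LINT \<omega>|M. (norm (Y s \<omega> - Y t \<omega>))\<^sup>2)" for s
    have "(p \<longlongrightarrow> 0) (at t within {0..T})" "(q \<longlongrightarrow> 0) (at t within {0..T})"
      using X Y t unfolding C_proc_def p_def q_def by auto
    then have "((\<lambda>s. 2 * p s + 2 * q s) \<longlongrightarrow> 2 * 0 + 2 * 0) (at t within {0..T})"
      by (intro tendsto_intros)
    then show "((\<lambda>s. 2 * p s + 2 * q s) \<longlongrightarrow> 0) (at t within {0..T})" by simp
    have "(LINT \<omega>|M. (norm (X s \<omega> - Y s \<omega> - (X t \<omega> - Y t \<omega>)))\<^sup>2) \<le> 2 * p s + 2 * q s" if s: "s \<in> {0..T}" for s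
    proof -
      have i: "integrable M (\<lambda>\<omega>. (norm (X s \<omega> - X t \<omega>))\<^sup>2)" "integrable M (\<lambda>\<omega>. (norm (Y s \<omega> - Y t \<omega>))\<^sup>2)"
        "integrable M (\<lambda>\<omega>. (norm (X s \<omega> - Y s \<omega> - (X t \<omega> - Y t \<omega>)))\<^sup>2)"
        using L2_rv_diff[OF TT XL[OF s] XL[OF t]] L2_rv_diff[OF TT YL[OF s] YL[OF t]]
          L2_rv_diff[OF TT L2_rv_diff[OF TT XL[OF s] YL[OF s]] L2_rv_diff[OF TT XL[OF t] YL[OF t]]]
        by (simp_all add: L2_rv_def)
      have "(LINT \<omega>|M. (norm (X s \<omega> - Y s \<omega> - (X t \<omega> - Y t \<omega>)))\<^sup>2)
        \<le> (LINT \<omega>|M. 2 * (norm (X s \<omega> - X t \<omega>))\<^sup>2 + 2 * (norm (Y s \<omega> - Y t \<omega>))\<^sup>2)"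
      proof (rule integral_mono)
        fix \<omega>
        show "(norm (X s \<omega> - Y s \<omega> - (X t \<omega> - Y t \<omega>)))\<^sup>2 \<le> 2 * (norm (X s \<omega> - X t \<omega>))\<^sup>2 + 2 * (norm (Y s \<omega> - Y t \<omega>))\<^sup>2"
          using norm_add_sq_le[of "X s \<omega> - X t \<omega>" "- (Y s \<omega> - Y t \<omega>)"]
          by (simp only: norm_minus_cancel) (simp add: algebra_simps)
      qed (use i in auto)
      also have "\<dots> = 2 * p s + 2 * q s" using i(1,2) by (simp add: p_def q_def)
      finally show ?thesis .
    qed
    then show "eventually (\<lambda>s. (LINT \<omega>|M. (norm (X s \<omega> - Y s \<omega> - (X t \<omega> - Y t \<omega>)))\<^sup>2) \<le> 2 * p s + 2 * q s) (at t within {0..T})"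
      by (simp add: eventually_at_filter)
  qed simp
  then show ?thesis unfolding C_proc_def using a L2_rv_diff[OF TT XL YL] by simp
qed

lemma mild_solution_diff:
  fixes S :: "real \<Rightarrow> 'h::{real_inner, banach, second_countable_topology} \<Rightarrow>\<^sub>L 'h"
  assumes X: "mild_solution M F W S 0 T \<zeta> f g X" and X': "mild_solution M F W S 0 T \<zeta>' f' g' X'"
  shows "mild_solution M F W S 0 T (\<lambda>\<omega>. \<zeta> \<omega> - \<zeta>' \<omega>) (\<lambda>t \<omega>. f t \<omega> - f' t \<omega>) (\<lambda>t \<omega>. g t \<omega> - g' t \<omega>) (\<lambda>t \<omega>. X t \<omega> - X' t \<omega>)"
  unfolding mild_solution_def
proof (intro conjI ballI)
  show "(\<lambda>t \<omega>. X t \<omega> - X' t \<omega>) \<in> C_proc M F 0 T"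
    using X X' by (intro C_proc_diff) (simp_all add: mild_solution_def)
  fix t assume t: "t \<in> {0..T}"
  have t': "(0::real) \<le> 0" "0 \<le> t" "t \<le> T" using t by auto
  obtain J where J: "has_ito_integral M F W 0 t (\<lambda>s \<omega>. S (t - s) (g s \<omega>)) J"
    "AE \<omega> in M. set_integrable lebesgue {0..t} (\<lambda>s. S (t - s) (f s \<omega>)) \<and>
          X t \<omega> = S (t - 0) (\<zeta> \<omega>) + (LINT s:{0..t}|lebesgue. S (t - s) (f s \<omega>)) + J \<omega>"
    using X t unfolding mild_solution_def by blast
  obtain J' where J': "has_ito_integral M F W 0 t (\<lambda>s \<omega>. S (t - s) (g' s \<omega>)) J'"
    "AE \<omega> in M. set_integrable lebesgue {0..t} (\<lambda>s. S (t - s) (f' s \<omega>)) \<and>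
          X' t \<omega> = S (t - 0) (\<zeta>' \<omega>) + (LINT s:{0..t}|lebesgue. S (t - s) (f' s \<omega>)) + J' \<omega>"
    using X' t unfolding mild_solution_def by blast
  show "\<exists>J. has_ito_integral M F W 0 t (\<lambda>s \<omega>. S (t - s) (g s \<omega> - g' s \<omega>)) J \<and>
      (AE \<omega> in M. set_integrable lebesgue {0..t} (\<lambda>s. S (t - s) (f s \<omega> - f' s \<omega>)) \<and>
        X t \<omega> - X' t \<omega> = S (t - 0) (\<zeta> \<omega> - \<zeta>' \<omega>) + (LINT s:{0..t}|lebesgue. S (t - s) (f s \<omega> - f' s \<omega>)) + J \<omega>)"
  proof (intro exI[of _ "\<lambda>\<omega>. J \<omega> - J' \<omega>"] conjI)
    show "has_ito_integral M F W 0 t (\<lambda>s \<omega>. S (t - s) (g s \<omega> - g' s \<omega>)) (\<lambda>\<omega>. J \<omega> - J' \<omega>)"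
      using ito_diff[OF t' J(1) J'(1)] by (simp add: blinfun.diff_right)
    show "AE \<omega> in M. set_integrable lebesgue {0..t} (\<lambda>s. S (t - s) (f s \<omega> - f' s \<omega>)) \<and>
        X t \<omega> - X' t \<omega> = S (t - 0) (\<zeta> \<omega> - \<zeta>' \<omega>) + (LINT s:{0..t}|lebesgue. S (t - s) (f s \<omega> - f' s \<omega>)) + (J \<omega> - J' \<omega>)"
      using J(2) J'(2)
    proof eventually_elim
      case (elim \<omega>)
      then show ?case
        using set_integral_diff[of lebesgue "{0..t}" "\<lambda>s. S (t - s) (f s \<omega>)" "\<lambda>s. S (t - s) (f' s \<omega>)"]
        by (simp add: blinfun.diff_right)
    qed
  qed
qed

text \<open>Drivers matter only up to null sets of the strip. The Picard limit is first driven by a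
  process that merely agrees with it almost everywhere, and this lemma closes the loop.\<close>

lemma mild_solution_cong:
  fixes S :: "real \<Rightarrow> 'h::{real_inner, banach, second_countable_topology} \<Rightarrow>\<^sub>L 'h"
  assumes S: "C0_semigroup S" and f: "f \<in> L2_proc M F 0 T" and X: "mild_solution M F W S 0 T \<zeta> f g X"
    and eq: "AE z in time_space M 0 T. f (fst z) (snd z) = f' (fst z) (snd z)"
      "AE z in time_space M 0 T. g (fst z) (snd z) = g' (fst z) (snd z)"
  shows "mild_solution M F W S 0 T \<zeta> f' g' X"
  unfolding mild_solution_def
proof (intro conjI ballI)
  show "X \<in> C_proc M F 0 T" using X by (simp add: mild_solution_def)
  fix t assume t: "t \<in> {0..T}"
  have t': "(0::real) \<le> 0" "0 \<le> t" "t \<le> T" using t by auto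
  obtain J where J: "has_ito_integral M F W 0 t (\<lambda>s \<omega>. S (t - s) (g s \<omega>)) J"
    "AE \<omega> in M. set_integrable lebesgue {0..t} (\<lambda>s. S (t - s) (f s \<omega>)) \<and>
          X t \<omega> = S (t - 0) (\<zeta> \<omega>) + (LINT s:{0..t}|lebesgue. S (t - s) (f s \<omega>)) + J \<omega>"
    using X t unfolding mild_solution_def by blast
  have sub: "{0..t} \<subseteq> {0..T}" using t by auto
  note shL = L2_proc_shift_on_Icc(2)[OF S f t]
  obtain v where v: "v \<in> borel_measurable (time_space M 0 t)"
    "AE z in time_space M 0 t. semigroup_shift S t f (fst z) (snd z) = v z"
    using L2_procD(3)[OF t' shL] by (auto simp: ae_measurable_def)
  have "msq (time_space M 0 t) v = msq (time_space M 0 t) (\<lambda>z. semigroup_shift S t f (fst z) (snd z))"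
    by (rule msq_cong_AE) (use v(2) in eventually_elim, simp)
  then have vfin: "msq (time_space M 0 t) v < \<infinity>" using L2_procD(2)[OF t' shL] by simp
  have eqf: "AE z in time_space M 0 t. S (t - fst z) (f (fst z) (snd z)) = v z"
    using v(2) AE_semigroup_shift[where t=t and S=S and f=f] by eventually_elim simp
  have eqf': "AE z in time_space M 0 t. S (t - fst z) (f' (fst z) (snd z)) = v z"
    using eqf AE_time_space_mono[OF prob_space_axioms sub eq(1)] by eventually_elim simp
  have eqg: "AE z in time_space M 0 t. S (t - fst z) (g (fst z) (snd z)) = S (t - fst z) (g' (fst z) (snd z))"
    using AE_time_space_mono[OF prob_space_axioms sub eq(2)] by eventually_elim simp
  show "\<exists>J. has_ito_integral M F W 0 t (\<lambda>s \<omega>. S (t - s) (g' s \<omega>)) J \<and>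
      (AE \<omega> in M. set_integrable lebesgue {0..t} (\<lambda>s. S (t - s) (f' s \<omega>)) \<and>
        X t \<omega> = S (t - 0) (\<zeta> \<omega>) + (LINT s:{0..t}|lebesgue. S (t - s) (f' s \<omega>)) + J \<omega>)"
  proof (intro exI[of _ J] conjI)
    show "has_ito_integral M F W 0 t (\<lambda>s \<omega>. S (t - s) (g' s \<omega>)) J"
      by (rule ito_cong[OF t' J(1) eqg _ ito_measurable(2)[OF t' J(1)]]) simp
    show "AE \<omega> in M. set_integrable lebesgue {0..t} (\<lambda>s. S (t - s) (f' s \<omega>)) \<and>
        X t \<omega> = S (t - 0) (\<zeta> \<omega>) + (LINT s:{0..t}|lebesgue. S (t - s) (f' s \<omega>)) + J \<omega>"
      using J(2) set_integral_ae_version[OF v(1) vfin eqf] set_integral_ae_version[OF v(1) vfin eqf']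
      by eventually_elim simp
  qed
qed

lemma msq_time_space_mono:
  fixes f :: "real \<Rightarrow> 'w \<Rightarrow> 'x::{real_normed_vector, second_countable_topology}"
  assumes f: "f \<in> L2_proc M F 0 T" and t: "t \<in> {0..T}"
  shows "msq (time_space M 0 t) (\<lambda>z. f (fst z) (snd z)) \<le> msq (time_space M 0 T) (\<lambda>z. f (fst z) (snd z))"
proof -
  obtain f' where f': "adapted F 0 T f'" "AE z in time_space M 0 T. f (fst z) (snd z) = f' (fst z) (snd z)"
    using f unfolding L2_proc_iff[OF horizon] by blast
  have sub: "{0..t} \<subseteq> {0..T}" using t by auto
  have m: "(\<lambda>z. ennreal ((norm (f' (fst z) (snd z)))\<^sup>2)) \<in> borel_measurable (time_space M 0 T)"
    using adapted_measurable[OF horizon f'(1)] by measurable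
  have "msq (time_space M 0 t) (\<lambda>z. f (fst z) (snd z)) = msq (time_space M 0 t) (\<lambda>z. f' (fst z) (snd z))"
    by (rule msq_cong_AE) (use AE_time_space_mono[OF prob_space_axioms sub f'(2)] in eventually_elim, simp)
  also have "\<dots> = (\<integral>\<^sup>+z. ennreal ((norm (f' (fst z) (snd z)))\<^sup>2) * indicator {0..t} (fst z) \<partial>time_space M 0 T)"
    unfolding msq_def by (rule nn_integral_time_space_mono[OF prob_space_axioms sub m])
  also have "\<dots> \<le> msq (time_space M 0 T) (\<lambda>z. f' (fst z) (snd z))"
    unfolding msq_def by (intro nn_integral_mono) (auto simp: indicator_def)
  also have "\<dots> = msq (time_space M 0 T) (\<lambda>z. f (fst z) (snd z))"
    by (rule msq_cong_AE) (use f'(2) in eventually_elim, simp)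
  finally show ?thesis .
qed

text \<open>The factor 2 splits the two convolutions, T comes from Cauchy-Schwarz in time, 4 from
  \<open>ito_msq_le\<close>, and the square of \<open>K\<close> from the semigroup. The right-hand
  side involves the drivers up to \<open>t\<close> only; this is what lets the estimate be iterated
  to factorial decay.\<close>

lemma mild_solution_msq_le:
  fixes S :: "real \<Rightarrow> 'h::{real_inner, banach, second_countable_topology} \<Rightarrow>\<^sub>L 'h"
  assumes S: "C0_semigroup S" and K: "0 \<le> K" "\<And>t. t \<in> {0..T} \<Longrightarrow> norm (S t) \<le> K"
    and X: "mild_solution M F W S 0 T (\<lambda>_. 0) f g X"
    and f: "f \<in> L2_proc M F 0 T" and g: "g \<in> L2_proc M F 0 T" and t: "t \<in> {0..T}"
  shows "msq M (X t) \<le> ennreal (2 * T * K\<^sup>2 + 8 * K\<^sup>2) *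
    (msq (time_space M 0 t) (\<lambda>z. f (fst z) (snd z)) + msq (time_space M 0 t) (\<lambda>z. g (fst z) (snd z)))"
proof -
  let ?P = "time_space M 0 t"
  have t': "(0::real) \<le> 0" "0 \<le> t" "t \<le> T" using t by auto
  obtain J where J: "has_ito_integral M F W 0 t (\<lambda>s \<omega>. S (t - s) (g s \<omega>)) J"
    "AE \<omega> in M. set_integrable lebesgue {0..t} (\<lambda>s. S (t - s) (f s \<omega>)) \<and>
          X t \<omega> = S (t - 0) 0 + (LINT s:{0..t}|lebesgue. S (t - s) (f s \<omega>)) + J \<omega>"
    using X t unfolding mild_solution_def by blast
  note shL = L2_proc_shift_on_Icc(2)[OF S f t]
  obtain v where v: "v \<in> borel_measurable ?P" "AE z in ?P. semigroup_shift S t f (fst z) (snd z) = v z"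
    using L2_procD(3)[OF t' shL] by (auto simp: ae_measurable_def)
  have v2: "msq ?P v = msq ?P (\<lambda>z. semigroup_shift S t f (fst z) (snd z))"
    by (rule msq_cong_AE) (use v(2) in eventually_elim, simp)
  then have vfin: "msq ?P v < \<infinity>" using L2_procD(2)[OF t' shL] by simp
  have eqf: "AE z in ?P. S (t - fst z) (f (fst z) (snd z)) = v z"
    using v(2) AE_semigroup_shift[where t=t and S=S and f=f] by eventually_elim simp
  let ?D = "\<lambda>\<omega>. LINT s|restrict_space lborel {0..t}. v (s, \<omega>)"
  interpret L: finite_measure "restrict_space lborel {0..t}" by (rule finite_measure_restrict_Icc)
  have Dm: "?D \<in> borel_measurable M"
    by (rule L.borel_measurable_lebesgue_integral) (use measurable_pair_swap[OF v(1)] in simp)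
  have "AE \<omega> in M. X t \<omega> = ?D \<omega> + J \<omega>"
    using J(2) set_integral_ae_version[OF v(1) vfin eqf] by eventually_elim simp
  then have "msq M (X t) = msq M (\<lambda>\<omega>. ?D \<omega> + J \<omega>)" by (intro msq_cong_AE) (auto elim: eventually_mono)
  also have "\<dots> \<le> 2 * msq M ?D + 2 * msq M J" by (rule msq_add_le[OF Dm ito_measurable(1)[OF t' J(1)]])
  also have "\<dots> \<le> 2 * (ennreal T * (ennreal (K\<^sup>2) * msq ?P (\<lambda>z. f (fst z) (snd z))))
     + 2 * (4 * (ennreal (K\<^sup>2) * msq ?P (\<lambda>z. g (fst z) (snd z))))"
  proof (intro add_mono mult_left_mono)
    have "msq M ?D \<le> ennreal t * msq ?P v" by (rule time_integral_msq_le[OF v(1) t'(2)])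
    also have "\<dots> \<le> ennreal T * (ennreal (K\<^sup>2) * msq ?P (\<lambda>z. f (fst z) (snd z)))"
      unfolding v2 by (intro mult_mono ennreal_leI t' semigroup_shift_L2(2)[OF S K f t t]) auto
    finally show "msq M ?D \<le> ennreal T * (ennreal (K\<^sup>2) * msq ?P (\<lambda>z. f (fst z) (snd z)))" .
    have "msq M J \<le> 4 * msq ?P (\<lambda>z. semigroup_shift S t g (fst z) (snd z))"
      by (rule ito_msq_le[OF t']) (use J(1) has_ito_integral_shift_iff[OF t] in blast)
    also have "\<dots> \<le> 4 * (ennreal (K\<^sup>2) * msq ?P (\<lambda>z. g (fst z) (snd z)))"
      by (intro mult_left_mono semigroup_shift_L2(2)[OF S K g t t]) auto
    finally show "msq M J \<le> 4 * (ennreal (K\<^sup>2) * msq ?P (\<lambda>z. g (fst z) (snd z)))" .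
  qed auto
  also have "\<dots> = ennreal (2 * T * K\<^sup>2) * msq ?P (\<lambda>z. f (fst z) (snd z)) + ennreal (8 * K\<^sup>2) * msq ?P (\<lambda>z. g (fst z) (snd z))"
  proof -
    have "ennreal (2 * T * K\<^sup>2) = 2 * (ennreal T * ennreal (K\<^sup>2))" "ennreal (8 * K\<^sup>2) = 2 * (4 * ennreal (K\<^sup>2))"
      using T_pos by (simp_all add: ennreal_mult mult.assoc[symmetric])
    then show ?thesis by (simp only: mult.assoc)
  qed
  also have "\<dots> \<le> ennreal (2 * T * K\<^sup>2 + 8 * K\<^sup>2) * msq ?P (\<lambda>z. f (fst z) (snd z))
    + ennreal (2 * T * K\<^sup>2 + 8 * K\<^sup>2) * msq ?P (\<lambda>z. g (fst z) (snd z))"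
    using T_pos by (intro add_mono mult_right_mono ennreal_leI) auto
  finally show ?thesis by (simp only: distrib_left)
qed

end

section \<open>Nonlinear mild solutions\<close>

lemma two_ennreal_add: "0 \<le> x \<Longrightarrow> 0 \<le> y \<Longrightarrow> 2 * ennreal x + 2 * ennreal y = ennreal (2 * x + 2 * y)"
  by (simp add: ennreal_mult)

lemma nn_integral_power_Icc:
  assumes "0 \<le> A" "0 \<le> t"
  shows "(\<integral>\<^sup>+s. ennreal (A * s ^ n) * indicator {0..t} s \<partial>lborel) = ennreal (A * t ^ Suc n / Suc n)"
proof -
  have "(\<integral>\<^sup>+s. ennreal (A * s ^ n) * indicator {0..t} s \<partial>lborel)
    = ennreal ((\<lambda>s. A * s ^ Suc n / Suc n) t - (\<lambda>s. A * s ^ Suc n / Suc n) 0)"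
  proof (rule nn_integral_FTC_Icc)
    fix s assume "s \<in> {0..t}"
    show "((\<lambda>s. A * s ^ Suc n / Suc n) has_real_derivative A * s ^ n) (at s)"
    proof -
      have "((\<lambda>s. A / Suc n * s ^ Suc n) has_real_derivative A / Suc n * (real (Suc n) * s ^ n)) (at s)"
        by (rule DERIV_cmult) (use DERIV_pow[of "Suc n" s] in \<open>simp del: power_Suc of_nat_Suc\<close>)
      then show ?thesis by (simp del: power_Suc of_nat_Suc)
    qed
    show "0 \<le> A * s ^ n" using assms \<open>s \<in> {0..t}\<close> by simp
  qed (use assms in auto)
  then show ?thesis by simp
qed

lemma power_fact_le_exp:
  assumes "0 \<le> (x::real)"
  shows "x ^ n / fact n \<le> exp x"
proof -
  have "(\<Sum>k\<in>{n}. x ^ k /\<^sub>R fact k) \<le> (\<Sum>k. x ^ k /\<^sub>R fact k)"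
    by (rule sum_le_suminf[OF summable_exp_generic]) (use assms in auto)
  then show ?thesis by (simp add: exp_def divide_inverse mult.commute)
qed

context brownian_basis
begin

lemma C_proc_L2:
  fixes X :: "real \<Rightarrow> 'w \<Rightarrow> 'x::{real_normed_vector, second_countable_topology}"
  assumes "X \<in> C_proc M F 0 T"
  shows "X \<in> L2_proc M F 0 T" "adapted F 0 T X"
    "msq (time_space M 0 T) (\<lambda>z. X (fst z) (snd z)) < \<infinity>"
    "t \<in> {0..T} \<Longrightarrow> X t \<in> borel_measurable M" "t \<in> {0..T} \<Longrightarrow> msq M (X t) < \<infinity>"
proof -
  show X: "X \<in> L2_proc M F 0 T" by (rule D_proc_adapted_L2[OF C_proc_imp_D_proc[OF assms]])
  show a: "adapted F 0 T X" using assms by (simp add: C_proc_def)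
  show "msq (time_space M 0 T) (\<lambda>z. X (fst z) (snd z)) < \<infinity>" by (rule L2_procD(2)[OF horizon X])
  show "X t \<in> borel_measurable M" if t: "t \<in> {0..T}" by (rule measurable_F_M[OF adapted_section[OF a t] t])
  show "msq M (X t) < \<infinity>" if t: "t \<in> {0..T}"
  proof -
    have TT: "T \<in> {0..T}" using T_pos by simp
    have "X t \<in> L2_rv M (F T)" using assms t by (simp add: C_proc_def)
    then show ?thesis unfolding L2_rv_iff[OF subalg[OF TT]] by blast
  qed
qed

lemma msq_time_space_eq:
  fixes X :: "real \<Rightarrow> 'w \<Rightarrow> 'x::{real_normed_vector, second_countable_topology}"
  assumes X: "adapted F 0 T X" and t: "t \<in> {0..T}"
  shows "msq (time_space M 0 t) (\<lambda>z. X (fst z) (snd z)) = (\<integral>\<^sup>+s. msq M (X s) * indicator {0..t} s \<partial>lborel)"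
proof -
  have m: "(\<lambda>z. ennreal ((norm (X (fst z) (snd z)))\<^sup>2)) \<in> borel_measurable (time_space M 0 t)"
  proof (rule measurable_compose[OF measurable_time_space_mono])
    show "(\<lambda>z. ennreal ((norm (X (fst z) (snd z)))\<^sup>2)) \<in> borel_measurable (time_space M 0 T)"
      using adapted_measurable[OF horizon X] by measurable
  qed (use t in auto)
  show ?thesis unfolding msq_def by (subst nn_integral_time_space[OF prob_space_axioms m]) simp
qed

lemma adapted_diff:
  fixes X Y :: "real \<Rightarrow> 'w \<Rightarrow> 'x::{real_normed_vector, second_countable_topology}"
  assumes "adapted F a b X" "adapted F a b Y"
  shows "adapted F a b (\<lambda>t \<omega>. X t \<omega> - Y t \<omega>)"
  using assms unfolding adapted_def case_prod_unfold by measurable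

text \<open>Picard iteration started at the mild solution \<open>X0\<close>: \<open>E\<close> bounds its first step, and the factorial decay
  of the increments turns this into a bound on the distance of the limit from \<open>X0\<close>.\<close>

lemma mild_solution_nonlinear:
  fixes S :: "real \<Rightarrow> 'h::{real_inner, banach, second_countable_topology} \<Rightarrow>\<^sub>L 'h"
    and \<alpha> \<beta> :: "real \<Rightarrow> 'w \<Rightarrow> 'h \<Rightarrow> 'h"
  assumes S: "C0_semigroup S" and K: "0 \<le> K" "\<And>t. t \<in> {0..T} \<Longrightarrow> norm (S t) \<le> K" and C: "0 \<le> C"
    and nem: "\<And>X. X \<in> L2_proc M F 0 T \<Longrightarrow> adapted F 0 T X \<Longrightarrow> (\<lambda>t \<omega>. \<alpha> t \<omega> (X t \<omega>)) \<in> L2_proc M F 0 T"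
      "\<And>X. X \<in> L2_proc M F 0 T \<Longrightarrow> adapted F 0 T X \<Longrightarrow> (\<lambda>t \<omega>. \<beta> t \<omega> (X t \<omega>)) \<in> L2_proc M F 0 T"
    and lip: "AE z in time_space M 0 T. \<forall>x y. norm (\<alpha> (fst z) (snd z) x - \<alpha> (fst z) (snd z) y) \<le> C * norm (x - y) \<and>
      norm (\<beta> (fst z) (snd z) x - \<beta> (fst z) (snd z) y) \<le> C * norm (x - y)"
    and X0: "mild_solution M F W S 0 T (\<lambda>_. x0) f g X0" "f \<in> L2_proc M F 0 T" "g \<in> L2_proc M F 0 T"
    and E: "msq (time_space M 0 T) (\<lambda>z. \<alpha> (fst z) (snd z) (X0 (fst z) (snd z)) - f (fst z) (snd z)) +
      msq (time_space M 0 T) (\<lambda>z. \<beta> (fst z) (snd z) (X0 (fst z) (snd z)) - g (fst z) (snd z)) \<le> ennreal E" "0 \<le> E"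
    and c: "c = 2 * T * K\<^sup>2 + 8 * K\<^sup>2"
  shows "\<exists>X. mild_solution M F W S 0 T (\<lambda>_. x0) (\<lambda>t \<omega>. \<alpha> t \<omega> (X t \<omega>)) (\<lambda>t \<omega>. \<beta> t \<omega> (X t \<omega>)) X \<and>
    (\<forall>t\<in>{0..T}. msq M (\<lambda>\<omega>. X t \<omega> - X0 t \<omega>) \<le> ennreal (8 * (c * E * exp (16 * (2 * c * C\<^sup>2 * T)))))"
proof -
  let ?P = "\<lambda>t. time_space M 0 t"
  \<comment> \<open>Mild solutions are pinned down only up to modification, so the iteration map
    selects one.\<close>
  define \<Phi> where "\<Phi> X = (SOME Y. mild_solution M F W S 0 T (\<lambda>_. x0) (\<lambda>t \<omega>. \<alpha> t \<omega> (X t \<omega>)) (\<lambda>t \<omega>. \<beta> t \<omega> (X t \<omega>)) Y)" for X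
  have \<Phi>: "mild_solution M F W S 0 T (\<lambda>_. x0) (\<lambda>t \<omega>. \<alpha> t \<omega> (X t \<omega>)) (\<lambda>t \<omega>. \<beta> t \<omega> (X t \<omega>)) (\<Phi> X)"
    if "X \<in> L2_proc M F 0 T" "adapted F 0 T X" for X
    unfolding \<Phi>_def by (rule someI_ex[OF mild_solution_exists[OF S nem(1)[OF that] nem(2)[OF that]]])
  define X where "X n = (\<Phi> ^^ n) X0" for n
  have XC: "X n \<in> C_proc M F 0 T" for n
  proof (induction n)
    case 0
    then show ?case using X0(1) by (simp add: X_def mild_solution_def)
  next
    case (Suc n)
    then show ?case using \<Phi>[OF C_proc_L2(1,2)[OF Suc]] by (simp add: X_def mild_solution_def)
  qed
  note XL = C_proc_L2(1)[OF XC] and Xa = C_proc_L2(2)[OF XC] and XM = C_proc_L2(4)[OF XC]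
  have XS: "mild_solution M F W S 0 T (\<lambda>_. x0) (\<lambda>t \<omega>. \<alpha> t \<omega> (X n t \<omega>)) (\<lambda>t \<omega>. \<beta> t \<omega> (X n t \<omega>)) (X (Suc n))" for n
    using \<Phi>[OF XL Xa, of n] by (simp add: X_def)
  have c0: "0 \<le> c" using c T_pos by simp
  \<comment> \<open>The constant of one iteration in squared form: c from the linear estimate and
    the squared Lipschitz constant once for each of the two coefficients.\<close>
  define \<kappa> where "\<kappa> = 2 * c * C\<^sup>2"
  have \<kappa>0: "0 \<le> \<kappa>" using c0 by (simp add: \<kappa>_def)
  have lipsq: "msq (?P t) (\<lambda>z. \<alpha> (fst z) (snd z) (U (fst z) (snd z)) - \<alpha> (fst z) (snd z) (V (fst z) (snd z)))
      + msq (?P t) (\<lambda>z. \<beta> (fst z) (snd z) (U (fst z) (snd z)) - \<beta> (fst z) (snd z) (V (fst z) (snd z)))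
      \<le> ennreal (2 * C\<^sup>2) * msq (?P t) (\<lambda>z. U (fst z) (snd z) - V (fst z) (snd z))"
    if t: "t \<in> {0..T}" and UV: "adapted F 0 T U" "adapted F 0 T V" for U V t
  proof -
    have sub: "{0..t} \<subseteq> {0..T}" using t by auto
    have m: "(\<lambda>z. U (fst z) (snd z) - V (fst z) (snd z)) \<in> borel_measurable (?P t)"
      by (rule measurable_compose[OF measurable_time_space_mono[OF sub] adapted_measurable[OF horizon adapted_diff[OF UV]]])
    note L = AE_time_space_mono[OF prob_space_axioms sub lip]
    have "msq (?P t) (\<lambda>z. \<alpha> (fst z) (snd z) (U (fst z) (snd z)) - \<alpha> (fst z) (snd z) (V (fst z) (snd z)))
        \<le> ennreal (C\<^sup>2) * msq (?P t) (\<lambda>z. U (fst z) (snd z) - V (fst z) (snd z))"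
      by (rule msq_scale_le[OF m C]) (use L in eventually_elim, blast)
    moreover have "msq (?P t) (\<lambda>z. \<beta> (fst z) (snd z) (U (fst z) (snd z)) - \<beta> (fst z) (snd z) (V (fst z) (snd z)))
        \<le> ennreal (C\<^sup>2) * msq (?P t) (\<lambda>z. U (fst z) (snd z) - V (fst z) (snd z))"
      by (rule msq_scale_le[OF m C]) (use L in eventually_elim, blast)
    moreover have "ennreal (2 * C\<^sup>2) = ennreal (C\<^sup>2) + ennreal (C\<^sup>2)" by (simp flip: ennreal_plus)
    ultimately show ?thesis by (simp add: distrib_right add_mono)
  qed
  have est: "msq M (\<lambda>\<omega>. U' t \<omega> - V' t \<omega>) \<le> ennreal \<kappa> * msq (?P t) (\<lambda>z. U (fst z) (snd z) - V (fst z) (snd z))"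
    if t: "t \<in> {0..T}" and U: "U \<in> L2_proc M F 0 T" "adapted F 0 T U" and V: "V \<in> L2_proc M F 0 T" "adapted F 0 T V"
      and U': "mild_solution M F W S 0 T (\<lambda>_. x0) (\<lambda>t \<omega>. \<alpha> t \<omega> (U t \<omega>)) (\<lambda>t \<omega>. \<beta> t \<omega> (U t \<omega>)) U'"
      and V': "mild_solution M F W S 0 T (\<lambda>_. x0) (\<lambda>t \<omega>. \<alpha> t \<omega> (V t \<omega>)) (\<lambda>t \<omega>. \<beta> t \<omega> (V t \<omega>)) V'" for U V U' V' t
  proof -
    have D: "mild_solution M F W S 0 T (\<lambda>_. 0) (\<lambda>t \<omega>. \<alpha> t \<omega> (U t \<omega>) - \<alpha> t \<omega> (V t \<omega>))
      (\<lambda>t \<omega>. \<beta> t \<omega> (U t \<omega>) - \<beta> t \<omega> (V t \<omega>)) (\<lambda>t \<omega>. U' t \<omega> - V' t \<omega>)"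
      using mild_solution_diff[OF U' V'] by simp
    have "msq M (\<lambda>\<omega>. U' t \<omega> - V' t \<omega>) \<le> ennreal c *
      (msq (?P t) (\<lambda>z. \<alpha> (fst z) (snd z) (U (fst z) (snd z)) - \<alpha> (fst z) (snd z) (V (fst z) (snd z)))
      + msq (?P t) (\<lambda>z. \<beta> (fst z) (snd z) (U (fst z) (snd z)) - \<beta> (fst z) (snd z) (V (fst z) (snd z))))"
      unfolding c by (rule mild_solution_msq_le[OF S K D L2_proc_diff[OF horizon nem(1)[OF U] nem(1)[OF V]]
            L2_proc_diff[OF horizon nem(2)[OF U] nem(2)[OF V]] t])
    also have "\<dots> \<le> ennreal c * (ennreal (2 * C\<^sup>2) * msq (?P t) (\<lambda>z. U (fst z) (snd z) - V (fst z) (snd z)))"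
      by (intro mult_left_mono lipsq[OF t U(2) V(2)]) simp
    also have "\<dots> = ennreal \<kappa> * msq (?P t) (\<lambda>z. U (fst z) (snd z) - V (fst z) (snd z))"
    proof -
      have "ennreal \<kappa> = ennreal c * ennreal (2 * C\<^sup>2)" using c0 by (simp add: \<kappa>_def ennreal_mult[symmetric] mult_ac)
      then show ?thesis by (simp only: mult.assoc)
    qed
    finally show ?thesis .
  qed
  \<comment> \<open>Each iteration integrates a power of t once more and so produces the next factor
    of the factorial.\<close>
  have e: "msq M (\<lambda>\<omega>. X (Suc n) t \<omega> - X n t \<omega>) \<le> ennreal (c * E * \<kappa> ^ n / fact n * t ^ n)" if t: "t \<in> {0..T}" for n t
    using t
  proof (induction n arbitrary: t)
    case 0
    have X00: "X 0 = X0" by (simp add: X_def)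
    note n1 = L2_proc_diff[OF horizon nem(1)[OF XL Xa] X0(2), of 0] and n2 = L2_proc_diff[OF horizon nem(2)[OF XL Xa] X0(3), of 0]
    have D: "mild_solution M F W S 0 T (\<lambda>_. 0) (\<lambda>t \<omega>. \<alpha> t \<omega> (X 0 t \<omega>) - f t \<omega>)
      (\<lambda>t \<omega>. \<beta> t \<omega> (X 0 t \<omega>) - g t \<omega>) (\<lambda>t \<omega>. X (Suc 0) t \<omega> - X 0 t \<omega>)"
      using mild_solution_diff[OF XS[of 0] X0(1)] by (simp add: X00)
    have "msq M (\<lambda>\<omega>. X (Suc 0) t \<omega> - X 0 t \<omega>) \<le> ennreal c *
      (msq (?P t) (\<lambda>z. \<alpha> (fst z) (snd z) (X 0 (fst z) (snd z)) - f (fst z) (snd z))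
      + msq (?P t) (\<lambda>z. \<beta> (fst z) (snd z) (X 0 (fst z) (snd z)) - g (fst z) (snd z)))"
      unfolding c by (rule mild_solution_msq_le[OF S K D n1 n2 0])
    also have "\<dots> \<le> ennreal c * (msq (?P T) (\<lambda>z. \<alpha> (fst z) (snd z) (X 0 (fst z) (snd z)) - f (fst z) (snd z))
      + msq (?P T) (\<lambda>z. \<beta> (fst z) (snd z) (X 0 (fst z) (snd z)) - g (fst z) (snd z)))"
      by (intro mult_left_mono add_mono msq_time_space_mono[OF n1 0] msq_time_space_mono[OF n2 0]) simp
    also have "\<dots> \<le> ennreal c * ennreal E" using E(1) by (intro mult_left_mono) (simp_all add: X00)
    finally show ?case using c0 E(2) by (simp add: ennreal_mult)
  next
    case (Suc n)
    let ?A = "c * E * \<kappa> ^ n / fact n"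
    have A0: "0 \<le> ?A" using c0 E(2) \<kappa>0 by simp
    have "msq M (\<lambda>\<omega>. X (Suc (Suc n)) t \<omega> - X (Suc n) t \<omega>) \<le> ennreal \<kappa> * msq (?P t) (\<lambda>z. X (Suc n) (fst z) (snd z) - X n (fst z) (snd z))"
      by (rule est[OF Suc.prems XL Xa XL Xa XS XS])
    also have "msq (?P t) (\<lambda>z. X (Suc n) (fst z) (snd z) - X n (fst z) (snd z))
      = (\<integral>\<^sup>+s. msq M (\<lambda>\<omega>. X (Suc n) s \<omega> - X n s \<omega>) * indicator {0..t} s \<partial>lborel)"
      by (rule msq_time_space_eq[OF adapted_diff[OF Xa Xa] Suc.prems])
    also have "\<dots> \<le> (\<integral>\<^sup>+s. ennreal (?A * s ^ n) * indicator {0..t} s \<partial>lborel)"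
    proof (rule nn_integral_mono)
      fix s
      show "msq M (\<lambda>\<omega>. X (Suc n) s \<omega> - X n s \<omega>) * indicator {0..t} s \<le> ennreal (?A * s ^ n) * indicator {0..t} s"
      proof (cases "s \<in> {0..t}")
        case True
        then have "s \<in> {0..T}" using Suc.prems by simp
        from Suc.IH[OF this] show ?thesis by (intro mult_right_mono) simp_all
      qed simp
    qed
    also have "\<dots> = ennreal (?A * t ^ Suc n / Suc n)"
      by (rule nn_integral_power_Icc[OF A0]) (use Suc.prems in simp)
    also have "ennreal \<kappa> * ennreal (?A * t ^ Suc n / Suc n) = ennreal (c * E * \<kappa> ^ Suc n / fact (Suc n) * t ^ Suc n)"
    proof -
      have "0 \<le> ?A * t ^ Suc n / Suc n"
        using c0 E(2) \<kappa>0 Suc.prems by (intro divide_nonneg_nonneg mult_nonneg_nonneg zero_le_power) auto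
      then have "ennreal \<kappa> * ennreal (?A * t ^ Suc n / Suc n) = ennreal (\<kappa> * (?A * t ^ Suc n / Suc n))"
        using \<kappa>0 by (simp only: ennreal_mult)
      also have "\<kappa> * (?A * t ^ Suc n / Suc n) = c * E * \<kappa> ^ Suc n / fact (Suc n) * t ^ Suc n"
        by (simp add: field_simps)
      finally show ?thesis .
    qed
    finally show ?case by (simp add: mult_left_mono)
  qed
  \<comment> \<open>The factor 16^n is traded against the factorial inside an exponential; this
    leaves the rate (1/16)^n that \<open>msq_fast_limit\<close> expects and a constant linear in
    \<open>E\<close>.\<close>
  define A where "A = c * E * exp (16 * (\<kappa> * T))"
  have A0: "0 \<le> A" using c0 E(2) by (simp add: A_def)
  have geo: "msq M (\<lambda>\<omega>. X (Suc n) t \<omega> - X n t \<omega>) \<le> ennreal (A * (1/16) ^ n)" if t: "t \<in> {0..T}" for n t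
  proof -
    have "c * E * \<kappa> ^ n / fact n * t ^ n = c * E * ((\<kappa> * t) ^ n / fact n)" by (simp add: power_mult_distrib)
    also have "\<dots> \<le> c * E * ((\<kappa> * T) ^ n / fact n)"
      using t \<kappa>0 c0 E(2) by (intro mult_left_mono divide_right_mono power_mono) auto
    also have "\<dots> = c * E * ((16 * (\<kappa> * T)) ^ n / fact n) * (1/16) ^ n"
      by (simp add: power_mult_distrib power_one_over)
    also have "\<dots> \<le> c * E * exp (16 * (\<kappa> * T)) * (1/16) ^ n"
      using \<kappa>0 T_pos c0 E(2) by (intro mult_right_mono mult_left_mono power_fact_le_exp) auto
    finally show ?thesis using e[OF t, of n] unfolding A_def by (meson ennreal_leI order_trans)
  qed
  define Y where "Y t \<omega> = lim (\<lambda>n. X n t \<omega>)" for t \<omega>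
  have Ya: "adapted F 0 T Y"
  proof -
    have "(\<lambda>z. X n (fst z) (snd z)) \<in> borel_measurable (progressive_field F 0 T)" for n
      using Xa[of n] by (simp add: adapted_def case_prod_unfold)
    then show ?thesis unfolding adapted_def case_prod_unfold Y_def by (rule borel_measurable_lim_metric)
  qed
  have Ym: "Y t \<in> borel_measurable M" if t: "t \<in> {0..T}" for t by (rule measurable_F_M[OF adapted_section[OF Ya t] t])
  have XY: "msq M (\<lambda>\<omega>. X n t \<omega> - Y t \<omega>) \<le> ennreal (8 * A * (1/4) ^ n)" if t: "t \<in> {0..T}" for n t
    unfolding Y_def by (rule msq_fast_limit(2)[OF XM[OF t] geo[OF t] A0])
  have PXY: "msq (?P T) (\<lambda>z. Y (fst z) (snd z) - X n (fst z) (snd z)) \<le> ennreal (8 * A * T * (1/4) ^ n)" for n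
  proof -
    have "msq (?P T) (\<lambda>z. Y (fst z) (snd z) - X n (fst z) (snd z))
      = (\<integral>\<^sup>+s. msq M (\<lambda>\<omega>. Y s \<omega> - X n s \<omega>) * indicator {0..T} s \<partial>lborel)"
      using msq_time_space_eq[OF adapted_diff[OF Ya Xa]] T_pos by simp
    also have "\<dots> \<le> (\<integral>\<^sup>+s. ennreal (8 * A * (1/4) ^ n) * indicator {0..T} s \<partial>lborel)"
    proof (rule nn_integral_mono)
      fix s
      show "msq M (\<lambda>\<omega>. Y s \<omega> - X n s \<omega>) * indicator {0..T} s \<le> ennreal (8 * A * (1/4) ^ n) * indicator {0..T} s"
      proof (cases "s \<in> {0..T}")
        case True
        then have "msq M (\<lambda>\<omega>. Y s \<omega> - X n s \<omega>) \<le> ennreal (8 * A * (1/4) ^ n)"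
          by (subst msq_commute) (rule XY)
        then show ?thesis by (intro mult_right_mono) simp_all
      qed simp
    qed
    also have "\<dots> = ennreal (8 * A * (1/4) ^ n) * ennreal T"
      by (subst nn_integral_cmult) (use T_pos in auto)
    also have "\<dots> = ennreal (8 * A * (1/4) ^ n * T)"
      using A0 T_pos by (intro ennreal_mult[symmetric]) auto
    finally show ?thesis by (simp only: mult_ac)
  qed
  have YL: "Y \<in> L2_proc M F 0 T"
  proof (rule L2_procI[OF horizon])
    show "ae_measurable (progressive_field F 0 T) (?P T) (\<lambda>z. Y (fst z) (snd z))"
      using Ya by (intro ae_measurableI) (simp add: adapted_def case_prod_unfold)
    have "msq (?P T) (\<lambda>z. Y (fst z) (snd z)) \<le> 2 * msq (?P T) (\<lambda>z. Y (fst z) (snd z) - X 0 (fst z) (snd z)) + 2 * msq (?P T) (\<lambda>z. X 0 (fst z) (snd z))"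
      using msq_triangle[OF adapted_measurable[OF horizon Ya] adapted_measurable[OF horizon Xa[of 0]], of "\<lambda>_. 0"] by simp
    also have "\<dots> < \<infinity>"
      using le_less_trans[OF PXY[of 0], of \<infinity>] C_proc_L2(3)[OF XC[of 0]] by (simp add: ennreal_mult_less_top)
    finally show "msq (?P T) (\<lambda>z. Y (fst z) (snd z)) < \<infinity>" .
  qed
  \<comment> \<open>The pointwise limit \<open>Y\<close> is progressive but not known to be a mild
    solution. The solution \<open>Z\<close> driven by \<open>Y\<close> is close to each iterate of
    large index, hence equals \<open>Y\<close> almost surely at each time, and \<open>Y\<close> may
    be replaced by \<open>Z\<close> in the drivers.\<close>
  obtain Z where Z: "mild_solution M F W S 0 T (\<lambda>_. x0) (\<lambda>t \<omega>. \<alpha> t \<omega> (Y t \<omega>)) (\<lambda>t \<omega>. \<beta> t \<omega> (Y t \<omega>)) Z"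
    using mild_solution_exists[OF S nem(1)[OF YL Ya] nem(2)[OF YL Ya]] by blast
  have ZC: "Z \<in> C_proc M F 0 T" using Z by (simp add: mild_solution_def)
  note Za = C_proc_L2(2)[OF ZC] and ZM = C_proc_L2(4)[OF ZC]
  have ZY0: "msq M (\<lambda>\<omega>. Z t \<omega> - Y t \<omega>) = 0" if t: "t \<in> {0..T}" for t
  proof -
    have le: "msq M (\<lambda>\<omega>. Z t \<omega> - Y t \<omega>) \<le> ennreal (2 * (\<kappa> * (8 * A * T * (1/4) ^ n)) + 2 * (8 * A * (1/4) ^ Suc n))" for n
    proof -
      have "msq M (\<lambda>\<omega>. Z t \<omega> - X (Suc n) t \<omega>) \<le> ennreal \<kappa> * msq (?P t) (\<lambda>z. Y (fst z) (snd z) - X n (fst z) (snd z))"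
        by (rule est[OF t YL Ya XL Xa Z XS])
      also have "\<dots> \<le> ennreal \<kappa> * msq (?P T) (\<lambda>z. Y (fst z) (snd z) - X n (fst z) (snd z))"
        by (intro mult_left_mono msq_time_space_mono[OF L2_proc_diff[OF horizon YL XL] t]) simp
      also have "\<dots> \<le> ennreal \<kappa> * ennreal (8 * A * T * (1/4) ^ n)" by (intro mult_left_mono PXY) simp
      also have "\<dots> = ennreal (\<kappa> * (8 * A * T * (1/4) ^ n))" using \<kappa>0 A0 T_pos by (subst ennreal_mult) auto
      finally have 1: "msq M (\<lambda>\<omega>. Z t \<omega> - X (Suc n) t \<omega>) \<le> ennreal (\<kappa> * (8 * A * T * (1/4) ^ n))" .
      have "msq M (\<lambda>\<omega>. Z t \<omega> - Y t \<omega>) \<le> 2 * msq M (\<lambda>\<omega>. Z t \<omega> - X (Suc n) t \<omega>) + 2 * msq M (\<lambda>\<omega>. X (Suc n) t \<omega> - Y t \<omega>)"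
        by (rule msq_triangle[OF ZM[OF t] XM[OF t] Ym[OF t]])
      also have "\<dots> \<le> 2 * ennreal (\<kappa> * (8 * A * T * (1/4) ^ n)) + 2 * ennreal (8 * A * (1/4) ^ Suc n)"
        by (intro add_mono mult_left_mono 1 XY t) auto
      also have "\<dots> = ennreal (2 * (\<kappa> * (8 * A * T * (1/4) ^ n)) + 2 * (8 * A * (1/4) ^ Suc n))"
        by (rule two_ennreal_add) (use \<kappa>0 A0 T_pos in auto)
      finally show ?thesis .
    qed
    have "(\<lambda>n. ennreal (2 * (\<kappa> * (8 * A * T * (1/4) ^ n)) + 2 * (8 * A * (1/4) ^ Suc n))) \<longlonglongrightarrow>
      ennreal (2 * (\<kappa> * (8 * A * T * 0)) + 2 * (8 * A * 0))"
      by (intro tendsto_ennrealI tendsto_intros LIMSEQ_realpow_zero LIMSEQ_Suc) auto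
    then have "msq M (\<lambda>\<omega>. Z t \<omega> - Y t \<omega>) \<le> ennreal (2 * (\<kappa> * (8 * A * T * 0)) + 2 * (8 * A * 0))"
      by (rule LIMSEQ_le_const) (use le in blast)
    then show ?thesis by simp
  qed
  have "msq (?P T) (\<lambda>z. Z (fst z) (snd z) - Y (fst z) (snd z)) = (\<integral>\<^sup>+s. msq M (\<lambda>\<omega>. Z s \<omega> - Y s \<omega>) * indicator {0..T} s \<partial>lborel)"
    using msq_time_space_eq[OF adapted_diff[OF Za Ya]] T_pos by simp
  also have "\<dots> = (\<integral>\<^sup>+s. 0 \<partial>(lborel :: real measure))" by (intro nn_integral_cong) (auto simp: indicator_def ZY0)
  finally have "(\<integral>\<^sup>+z. ennreal ((norm (Z (fst z) (snd z) - Y (fst z) (snd z)))\<^sup>2) \<partial>?P T) = 0" by (simp add: msq_def)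
  then have "AE z in ?P T. ennreal ((norm (Z (fst z) (snd z) - Y (fst z) (snd z)))\<^sup>2) = 0"
    by (subst (asm) nn_integral_0_iff_AE) (use adapted_measurable[OF horizon adapted_diff[OF Za Ya]] in measurable)
  then have ZYae: "AE z in ?P T. Y (fst z) (snd z) = Z (fst z) (snd z)"
    by eventually_elim (simp add: ennreal_eq_0_iff)
  have "mild_solution M F W S 0 T (\<lambda>_. x0) (\<lambda>t \<omega>. \<alpha> t \<omega> (Z t \<omega>)) (\<lambda>t \<omega>. \<beta> t \<omega> (Z t \<omega>)) Z"
    by (rule mild_solution_cong[OF S nem(1)[OF YL Ya] Z]; use ZYae in eventually_elim; simp)
  moreover have "msq M (\<lambda>\<omega>. Z t \<omega> - X0 t \<omega>) \<le> ennreal (8 * (c * E * exp (16 * (2 * c * C\<^sup>2 * T))))" if t: "t \<in> {0..T}" for t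
  proof -
    have "(\<integral>\<^sup>+\<omega>. ennreal ((norm (Z t \<omega> - Y t \<omega>))\<^sup>2) \<partial>M) = 0" using ZY0[OF t] by (simp add: msq_def)
    then have "AE \<omega> in M. ennreal ((norm (Z t \<omega> - Y t \<omega>))\<^sup>2) = 0"
      by (subst (asm) nn_integral_0_iff_AE) (use ZM[OF t] Ym[OF t] in measurable)
    then have "AE \<omega> in M. norm (Z t \<omega> - X0 t \<omega>) = norm (X 0 t \<omega> - Y t \<omega>)"
      by eventually_elim (simp add: ennreal_eq_0_iff X_def norm_minus_commute)
    then have "msq M (\<lambda>\<omega>. Z t \<omega> - X0 t \<omega>) = msq M (\<lambda>\<omega>. X 0 t \<omega> - Y t \<omega>)" by (rule msq_cong_AE)
    then show ?thesis using XY[OF t, of 0] by (simp add: A_def \<kappa>_def)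
  qed
  ultimately show ?thesis by blast
qed

end

section \<open>First order expansions\<close>

lemma has_derivative_remainder_seq:
  fixes f :: "'e::real_normed_vector \<Rightarrow> 'y::real_normed_vector"
  assumes f: "(f has_derivative f') (at p within V)" and V: "\<And>k. p + d k \<in> V" and d: "d \<longlonglongrightarrow> 0"
  shows "(\<lambda>k. norm (f (p + d k) - f p - f' (d k)) / norm (d k)) \<longlonglongrightarrow> 0"
proof -
  \<comment> \<open>At y = p the quotient is 0 by the convention on division, so \<open>g\<close> is
    continuous there and sequences that hit \<open>p\<close> need no separate treatment.\<close>
  define g where "g y = (f y - f p - f' (y - p)) /\<^sub>R norm (y - p)" for y
  have "(g \<longlongrightarrow> 0) (at p within V)"
    using f unfolding has_derivative_within g_def by (simp add: diff_diff_eq inverse_eq_divide)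
  moreover have "g p = 0" by (simp add: g_def)
  ultimately have "continuous (at p within V) g" by (simp add: continuous_within)
  moreover have "(\<lambda>k. p + d k) \<longlonglongrightarrow> p" using tendsto_add[OF tendsto_const d, of p] by simp
  ultimately have "(\<lambda>k. g (p + d k)) \<longlonglongrightarrow> g p"
    unfolding continuous_within_sequentially using V by (auto simp: o_def)
  then have "(\<lambda>k. norm (g (p + d k))) \<longlonglongrightarrow> 0" using \<open>g p = 0\<close> tendsto_norm by fastforce
  then show ?thesis by (simp add: g_def divide_inverse_commute)
qed

text \<open>Convexity keeps the short steps towards \<open>p + d\<close> inside \<open>V\<close>.
  Writing a derivative value as a limit of function values is the source of its
  measurability.\<close>

lemma has_derivative_directional_seq:
  fixes f :: "'e::real_normed_vector \<Rightarrow> 'y::real_normed_vector"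
  assumes f: "(f has_derivative f') (at p within V)" and V: "convex V" "p \<in> V" "p + d \<in> V"
  shows "(\<lambda>n. real (Suc n) *\<^sub>R (f (p + (1 / real (Suc n)) *\<^sub>R d) - f p)) \<longlonglongrightarrow> f' d"
proof -
  interpret f': bounded_linear f' using f by (rule has_derivative_bounded_linear)
  define e where "e n = (1 / real (Suc n)) *\<^sub>R d" for n
  have e0: "e \<longlonglongrightarrow> 0"
    unfolding e_def using tendsto_scaleR[OF LIMSEQ_Suc[OF lim_1_over_n] tendsto_const, of d] by simp
  have eV: "p + e n \<in> V" for n
  proof -
    have "(1 - 1 / real (Suc n)) *\<^sub>R p + (1 / real (Suc n)) *\<^sub>R (p + d) \<in> V"
      by (rule convexD[OF V]) auto
    then show ?thesis by (simp add: e_def algebra_simps)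
  qed
  have "(\<lambda>n. norm (f (p + e n) - f p - f' (e n)) / norm (e n) * norm d) \<longlonglongrightarrow> 0 * norm d"
    by (intro tendsto_mult tendsto_const has_derivative_remainder_seq[OF f eV e0])
  moreover have "norm (f (p + e n) - f p - f' (e n)) / norm (e n) * norm d
      = norm (real (Suc n) *\<^sub>R (f (p + e n) - f p) - f' d)" for n
  proof (cases "d = 0")
    case True
    then show ?thesis by (simp add: e_def f'.zero)
  next
    case False
    have "real (Suc n) *\<^sub>R (f (p + e n) - f p) - f' d = real (Suc n) *\<^sub>R (f (p + e n) - f p - f' (e n))"
      by (simp add: e_def f'.scaleR scaleR_diff_right del: of_nat_Suc)
    then have "norm (real (Suc n) *\<^sub>R (f (p + e n) - f p) - f' d) = real (Suc n) * norm (f (p + e n) - f p - f' (e n))"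
      by (simp del: of_nat_Suc)
    moreover have "norm (e n) = norm d / real (Suc n)" by (simp add: e_def del: of_nat_Suc)
    ultimately show ?thesis using False by (simp del: of_nat_Suc)
  qed
  ultimately have "(\<lambda>n. norm (real (Suc n) *\<^sub>R (f (p + e n) - f p) - f' d)) \<longlonglongrightarrow> 0" by simp
  then have "(\<lambda>n. real (Suc n) *\<^sub>R (f (p + e n) - f p) - f' d) \<longlonglongrightarrow> 0"
    by (rule tendsto_norm_zero_cancel)
  then show ?thesis unfolding e_def by (rule LIM_zero_cancel)
qed

text \<open>By Tonelli the sum of the squared norms has a finite integral, so it converges almost
  everywhere and its terms tend to 0.\<close>

lemma AE_tendsto_0_of_msq:
  fixes d :: "nat \<Rightarrow> 'z \<Rightarrow> 'e::{real_normed_vector, second_countable_topology}"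
  assumes [measurable]: "\<And>k. d k \<in> borel_measurable N"
    and le: "\<And>k. msq N (d k) \<le> ennreal (E * (1/16) ^ k)" and E: "0 \<le> E"
  shows "AE z in N. (\<lambda>k. d k z) \<longlonglongrightarrow> 0"
proof -
  have "(\<integral>\<^sup>+z. (\<Sum>k. ennreal ((norm (d k z))\<^sup>2)) \<partial>N) = (\<Sum>k. msq N (d k))"
    unfolding msq_def by (rule nn_integral_suminf) measurable
  also have "\<dots> \<le> (\<Sum>k. ennreal (E * (1/16) ^ k))" by (intro suminf_le le) auto
  also have "\<dots> = ennreal (E * (1 / (1 - 1/16)))"
    using E by (intro suminf_ennreal_eq sums_mult geometric_sums) auto
  finally have "(\<integral>\<^sup>+z. (\<Sum>k. ennreal ((norm (d k z))\<^sup>2)) \<partial>N) \<noteq> \<infinity>"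
    by (auto simp: top_unique)
  then have "AE z in N. (\<Sum>k. ennreal ((norm (d k z))\<^sup>2)) \<noteq> \<infinity>"
    by (intro nn_integral_PInf_AE) measurable
  then show ?thesis
  proof eventually_elim
    case (elim z)
    then have "summable (\<lambda>k. (norm (d k z))\<^sup>2)" by (intro summable_suminf_not_top) (auto simp: top_ennreal_def)
    then have "(\<lambda>k. (norm (d k z))\<^sup>2) \<longlonglongrightarrow> 0" by (rule summable_LIMSEQ_zero)
    then have "(\<lambda>k. sqrt ((norm (d k z))\<^sup>2)) \<longlonglongrightarrow> sqrt 0" by (rule tendsto_real_sqrt)
    then have "(\<lambda>k. norm (d k z)) \<longlonglongrightarrow> 0" by simp
    then show ?case by (rule tendsto_norm_zero_cancel)
  qed
qed

lemma ennreal_tendsto_0_of_sq: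
  fixes x y :: "nat \<Rightarrow> ennreal"
  assumes le: "\<And>k. (x k)\<^sup>2 \<le> ennreal E * y k" and y: "y \<longlonglongrightarrow> 0"
  shows "x \<longlonglongrightarrow> 0"
proof -
  have "(\<lambda>k. ennreal E * y k) \<longlonglongrightarrow> ennreal E * 0" by (intro ennreal_tendsto_cmult y) simp
  then have lim: "(\<lambda>k. ennreal E * y k) \<longlonglongrightarrow> 0" by simp
  show ?thesis
  proof (rule order_tendstoI)
    fix e :: ennreal assume e: "0 < e"
    then have "eventually (\<lambda>k. ennreal E * y k < e\<^sup>2) sequentially"
      by (intro order_tendstoD(2)[OF lim]) (simp add: power2_eq_square ennreal_zero_less_mult_iff)
    then show "eventually (\<lambda>k. x k < e) sequentially"
    proof eventually_elim
      case (elim k)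
      show ?case
      proof (rule ccontr)
        assume "\<not> x k < e"
        then have "e\<^sup>2 \<le> (x k)\<^sup>2" by (intro power_mono) auto
        then show False using le[of k] elim by (meson leD le_less_trans order_trans)
      qed
    qed
  qed simp
qed

text \<open>The quotient of remainder and increment is bounded and tends to zero almost everywhere, because the
  geometric rate makes the increments \<open>d k\<close> converge almost everywhere and not only in mean square.\<close>

lemma remainder_nn_integral_tendsto_0:
  fixes f :: "'z \<Rightarrow> 'e::{real_normed_vector, second_countable_topology} \<Rightarrow> 'y::{real_normed_vector, second_countable_topology}"
    and w :: "'z \<Rightarrow> 'v::{real_normed_vector, second_countable_topology}"
  assumes d[measurable]: "\<And>k. d k \<in> borel_measurable N"
    and dE: "\<And>k. msq N (d k) \<le> ennreal (E * (1/16) ^ k)" and E: "0 \<le> E"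
    and V: "\<And>k z. z \<in> space N \<Longrightarrow> p z + d k z \<in> V"
    and der: "AE z in N. (f z has_derivative f' z) (at (p z) within V)"
    and lip: "\<And>k. AE z in N. norm (f z (p z + d k z) - f z (p z) - f' z (d k z)) \<le> L * norm (d k z)" and L: "0 \<le> L"
    and meas: "\<And>k. ae_measurable N N (\<lambda>z. f z (p z + d k z) - f z (p z) - f' z (d k z))"
    and w: "ae_measurable N N w" "msq N w < \<infinity>"
  shows "(\<lambda>k. \<integral>\<^sup>+z. ennreal (4 ^ k * (norm (f z (p z + d k z) - f z (p z) - f' z (d k z)) * norm (w z))) \<partial>N) \<longlonglongrightarrow> 0"
proof -
  define \<rho> where "\<rho> k z = f z (p z + d k z) - f z (p z) - f' z (d k z)" for k z
  have "\<exists>r. r \<in> borel_measurable N \<and> (AE z in N. norm (\<rho> k z) = r z)" for k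
    using ae_measurable_norm[OF meas[of k]] by (auto simp: ae_measurable_def \<rho>_def)
  then obtain r where r[measurable]: "\<And>k. r k \<in> borel_measurable N" "\<And>k. AE z in N. norm (\<rho> k z) = r k z" by metis
  obtain y where y[measurable]: "y \<in> borel_measurable N" "AE z in N. norm (w z) = y z"
    using ae_measurable_norm[OF w(1)] by (auto simp: ae_measurable_def)
  \<comment> \<open>The quotient is measurable because \<open>r\<close> and \<open>d\<close> are;
    where the increment vanishes it is 0, and so is the remainder by the bound
    \<open>lip\<close>.\<close>
  define q where "q k z = r k z / norm (d k z)" for k z
  have [measurable]: "q k \<in> borel_measurable N" for k unfolding q_def by measurable
  have qbd: "AE z in N. 0 \<le> q k z \<and> q k z \<le> L \<and> r k z = norm (d k z) * q k z" for k
    using r(2)[of k] lip[of k]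
  proof eventually_elim
    case (elim z)
    then have rL: "r k z \<le> L * norm (d k z)" and r0: "0 \<le> r k z" by (auto simp: \<rho>_def) (metis norm_ge_zero)
    show ?case
    proof (cases "d k z = 0")
      case True
      then show ?thesis using rL r0 L by (simp add: q_def)
    next
      case False
      then show ?thesis using rL r0 by (simp add: q_def divide_le_eq)
    qed
  qed
  have q0: "AE z in N. (\<lambda>k. q k z) \<longlonglongrightarrow> 0"
  proof -
    have "AE z in N. \<forall>k. norm (\<rho> k z) = r k z" using r(2) by (simp add: AE_all_countable)
    with AE_tendsto_0_of_msq[OF d dE E] der AE_space show ?thesis
    proof eventually_elim
      case (elim z)
      have "(\<lambda>k. norm (\<rho> k z) / norm (d k z)) \<longlonglongrightarrow> 0"
        unfolding \<rho>_def by (rule has_derivative_remainder_seq[OF elim(2) V[OF elim(3)] elim(1)])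
      then show ?case using elim(4) by (simp add: q_def)
    qed
  qed
  have lim: "(\<lambda>k. \<integral>\<^sup>+z. (ennreal (q k z * y z))\<^sup>2 \<partial>N) \<longlonglongrightarrow> (\<integral>\<^sup>+z. 0 \<partial>N)"
  proof (rule nn_integral_dominated_convergence[where w="\<lambda>z. ennreal (L\<^sup>2) * ennreal ((y z)\<^sup>2)"])
    have y0: "AE z in N. 0 \<le> y z" using y(2) by eventually_elim (metis norm_ge_zero)
    show "AE z in N. (ennreal (q k z * y z))\<^sup>2 \<le> ennreal (L\<^sup>2) * ennreal ((y z)\<^sup>2)" for k
      using qbd[of k] y0
    proof eventually_elim
      case (elim z)
      have "(ennreal (q k z * y z))\<^sup>2 = ennreal ((q k z * y z)\<^sup>2)" using elim by (simp add: ennreal_power)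
      also have "\<dots> \<le> ennreal ((L * y z)\<^sup>2)"
        using elim by (intro ennreal_leI power_mono mult_right_mono) auto
      also have "\<dots> = ennreal (L\<^sup>2) * ennreal ((y z)\<^sup>2)" by (simp add: power_mult_distrib ennreal_mult)
      finally show ?case .
    qed
    have "(\<integral>\<^sup>+z. ennreal ((y z)\<^sup>2) \<partial>N) = msq N w"
      unfolding msq_def by (rule nn_integral_cong_AE) (use y(2) in eventually_elim, simp)
    then show "(\<integral>\<^sup>+z. ennreal (L\<^sup>2) * ennreal ((y z)\<^sup>2) \<partial>N) < \<infinity>"
      using w(2) by (simp add: nn_integral_cmult ennreal_mult_less_top)
    show "AE z in N. (\<lambda>k. (ennreal (q k z * y z))\<^sup>2) \<longlonglongrightarrow> 0"
      using q0
    proof eventually_elim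
      case (elim z)
      have le: "(ennreal (q k z * y z))\<^sup>2 \<le> ennreal ((q k z * y z)\<^sup>2)" for k
        by (cases "0 \<le> q k z * y z") (auto simp: ennreal_power ennreal_neg)
      have "(\<lambda>k. ennreal ((q k z * y z)\<^sup>2)) \<longlonglongrightarrow> ennreal ((0 * y z)\<^sup>2)"
        by (intro tendsto_ennrealI tendsto_power tendsto_mult tendsto_const elim)
      then have lim: "(\<lambda>k. ennreal ((q k z * y z)\<^sup>2)) \<longlonglongrightarrow> 0" by simp
      show ?case by (rule tendsto_sandwich[OF _ _ tendsto_const lim]) (use le in simp_all)
    qed
  qed measurable
  \<comment> \<open>Cauchy-Schwarz on this splitting: 4^k times the increment has second moment at
    most E, as 16^k cancels the rate, while the other factor tends to 0 in mean square.\<close>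
  define I where "I k = (\<integral>\<^sup>+z. ennreal (4 ^ k * norm (d k z)) * ennreal (q k z * y z) \<partial>N)" for k
  have "I \<longlonglongrightarrow> 0"
  proof (rule ennreal_tendsto_0_of_sq)
    fix k
    have "(I k)\<^sup>2 \<le> (\<integral>\<^sup>+z. (ennreal (4 ^ k * norm (d k z)))\<^sup>2 \<partial>N) * (\<integral>\<^sup>+z. (ennreal (q k z * y z))\<^sup>2 \<partial>N)"
      unfolding I_def by (rule Cauchy_Schwarz_nn_integral) measurable
    also have "(\<integral>\<^sup>+z. (ennreal (4 ^ k * norm (d k z)))\<^sup>2 \<partial>N) \<le> ennreal E"
    proof -
      have p4: "((4::real) ^ k)\<^sup>2 = 16 ^ k" by (simp only: power2_eq_square flip: power_mult_distrib) simp
      have "(ennreal (4 ^ k * norm (d k z)))\<^sup>2 = ennreal (16 ^ k) * ennreal ((norm (d k z))\<^sup>2)" for z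
        by (simp add: ennreal_power power_mult_distrib p4 flip: ennreal_mult)
      then have "(\<integral>\<^sup>+z. (ennreal (4 ^ k * norm (d k z)))\<^sup>2 \<partial>N) = ennreal (16 ^ k) * msq N (d k)"
        by (simp add: nn_integral_cmult msq_def)
      also have "\<dots> \<le> ennreal (16 ^ k) * ennreal (E * (1/16) ^ k)" by (intro mult_left_mono dE) simp
      also have "\<dots> = ennreal (16 ^ k * (E * (1/16) ^ k))" using E by (subst ennreal_mult) auto
      also have "(16::real) ^ k * (E * (1/16) ^ k) = E" by (simp add: power_one_over)
      finally show ?thesis .
    qed
    finally show "(I k)\<^sup>2 \<le> ennreal E * (\<integral>\<^sup>+z. (ennreal (q k z * y z))\<^sup>2 \<partial>N)" by (simp add: mult_right_mono)
  qed (use lim in simp)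
  moreover have "(\<integral>\<^sup>+z. ennreal (4 ^ k * (norm (\<rho> k z) * norm (w z))) \<partial>N) = I k" for k
    unfolding I_def
  proof (rule nn_integral_cong_AE)
    show "AE z in N. ennreal (4 ^ k * (norm (\<rho> k z) * norm (w z))) = ennreal (4 ^ k * norm (d k z)) * ennreal (q k z * y z)"
      using qbd[of k] r(2)[of k] y(2)
    proof eventually_elim
      case (elim z)
      then have "0 \<le> y z" by (metis norm_ge_zero)
      then have "ennreal (4 ^ k * norm (d k z)) * ennreal (q k z * y z) = ennreal (4 ^ k * norm (d k z) * (q k z * y z))"
        using elim by (intro ennreal_mult[symmetric]) auto
      moreover have "4 ^ k * norm (d k z) * (q k z * y z) = 4 ^ k * (norm (\<rho> k z) * norm (w z))"
        using elim by (simp only: mult_ac)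
      ultimately show ?case by simp
    qed
  qed
  ultimately show ?thesis unfolding \<rho>_def by simp
qed

lemma integrable_completion_inner:
  fixes f w :: "'z \<Rightarrow> 'y::{real_inner, second_countable_topology}"
  assumes f: "ae_measurable N N f" "msq N f < \<infinity>" and w: "ae_measurable N N w" "msq N w < \<infinity>"
  shows "integrable (completion N) (\<lambda>z. f z \<bullet> w z)"
proof (rule integrableI_bounded)
  show "(\<lambda>z. f z \<bullet> w z) \<in> borel_measurable (completion N)"
    by (rule ae_measurable_completion[OF ae_measurable_inner[OF f(1) w(1)]]) auto
  obtain f' w' where m[measurable]: "f' \<in> borel_measurable N" "w' \<in> borel_measurable N"
    and eq: "AE z in N. f z = f' z" "AE z in N. w z = w' z"
    using f(1) w(1) by (auto simp: ae_measurable_def)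
  have "(\<integral>\<^sup>+z. ennreal (norm (f z \<bullet> w z)) \<partial>N) \<le> (\<integral>\<^sup>+z. ennreal ((norm (f' z))\<^sup>2) + ennreal ((norm (w' z))\<^sup>2) \<partial>N)"
  proof (rule nn_integral_mono_AE)
    show "AE z in N. ennreal (norm (f z \<bullet> w z)) \<le> ennreal ((norm (f' z))\<^sup>2) + ennreal ((norm (w' z))\<^sup>2)"
      using eq
    proof eventually_elim
      case (elim z)
      have "\<bar>f' z \<bullet> w' z\<bar> \<le> norm (f' z) * norm (w' z)" by (rule Cauchy_Schwarz_ineq2)
      moreover have "0 \<le> (norm (f' z) - norm (w' z))\<^sup>2" by simp
      then have "2 * (norm (f' z) * norm (w' z)) \<le> (norm (f' z))\<^sup>2 + (norm (w' z))\<^sup>2" by (simp add: power2_diff)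
      moreover have "0 \<le> norm (f' z) * norm (w' z)" by simp
      ultimately have "\<bar>f' z \<bullet> w' z\<bar> \<le> (norm (f' z))\<^sup>2 + (norm (w' z))\<^sup>2" by linarith
      then have "ennreal \<bar>f' z \<bullet> w' z\<bar> \<le> ennreal ((norm (f' z))\<^sup>2 + (norm (w' z))\<^sup>2)" by (rule ennreal_leI)
      then show ?case using elim by (simp add: ennreal_plus)
    qed
  qed
  also have "\<dots> = msq N f' + msq N w'" unfolding msq_def by (rule nn_integral_add) measurable
  also have "msq N f' = msq N f" by (rule msq_cong_AE) (use eq(1) in eventually_elim, simp)
  also have "msq N w' = msq N w" by (rule msq_cong_AE) (use eq(2) in eventually_elim, simp)
  also have "msq N f + msq N w < \<infinity>" using f(2) w(2) by simp
  finally show "(\<integral>\<^sup>+z. ennreal (norm (f z \<bullet> w z)) \<partial>completion N) < \<infinity>" by (simp add: nn_integral_completion)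
qed

lemma remainder_integral_tendsto_0:
  fixes f :: "'z \<Rightarrow> 'e::{real_normed_vector, second_countable_topology} \<Rightarrow> 'y::{real_inner, second_countable_topology}"
  assumes d: "\<And>k. d k \<in> borel_measurable N"
    and dE: "\<And>k. msq N (d k) \<le> ennreal (E * (1/16) ^ k)" and E: "0 \<le> E"
    and V: "\<And>k z. z \<in> space N \<Longrightarrow> p z + d k z \<in> V"
    and der: "AE z in N. (f z has_derivative f' z) (at (p z) within V)"
    and lip: "\<And>k. AE z in N. norm (f z (p z + d k z) - f z (p z) - f' z (d k z)) \<le> L * norm (d k z)" and L: "0 \<le> L"
    and meas: "\<And>k. ae_measurable N N (\<lambda>z. f z (p z + d k z) - f z (p z) - f' z (d k z))"
    and w: "ae_measurable N N w" "msq N w < \<infinity>"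
  shows "(\<lambda>k. 4 ^ k * (LINT z|completion N. (f z (p z + d k z) - f z (p z) - f' z (d k z)) \<bullet> w z)) \<longlonglongrightarrow> 0"
proof -
  define \<rho> where "\<rho> k z = f z (p z + d k z) - f z (p z) - f' z (d k z)" for k z
  have fin: "msq N (\<rho> k) < \<infinity>" for k
  proof -
    have "msq N (\<rho> k) \<le> ennreal (L\<^sup>2) * msq N (d k)"
      unfolding \<rho>_def by (rule msq_scale_le[OF d L lip])
    also have "\<dots> < \<infinity>" using le_less_trans[OF dE[of k], of \<infinity>] by (simp add: ennreal_mult_less_top)
    finally show ?thesis .
  qed
  have int: "integrable (completion N) (\<lambda>z. \<rho> k z \<bullet> w z)" for k
    by (rule integrable_completion_inner[OF _ fin w]) (use meas[of k] in \<open>unfold \<rho>_def\<close>)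
  define I where "I k = (\<integral>\<^sup>+z. ennreal (4 ^ k * (norm (\<rho> k z) * norm (w z))) \<partial>N)" for k
  have I0: "I \<longlonglongrightarrow> 0"
    unfolding I_def \<rho>_def by (rule remainder_nn_integral_tendsto_0[OF d dE E V der lip L meas w])
  have le: "ennreal \<bar>4 ^ k * (LINT z|completion N. \<rho> k z \<bullet> w z)\<bar> \<le> I k" for k
  proof -
    have "ennreal \<bar>LINT z|completion N. 4 ^ k * (\<rho> k z \<bullet> w z)\<bar> \<le> (\<integral>\<^sup>+z. ennreal (norm (4 ^ k * (\<rho> k z \<bullet> w z))) \<partial>completion N)"
      using integral_norm_bound_ennreal[OF integrable_mult_right[OF int[of k], of "4 ^ k"]] by simp
    also have "\<dots> \<le> I k"
      unfolding I_def nn_integral_completion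
      by (intro nn_integral_mono ennreal_leI) (simp add: abs_mult Cauchy_Schwarz_ineq2)
    finally show ?thesis by simp
  qed
  have "(\<lambda>k. ennreal \<bar>4 ^ k * (LINT z|completion N. \<rho> k z \<bullet> w z)\<bar>) \<longlonglongrightarrow> 0"
    by (rule tendsto_sandwich[OF _ _ tendsto_const I0]) (use le in simp_all)
  then have "(\<lambda>k. \<bar>4 ^ k * (LINT z|completion N. \<rho> k z \<bullet> w z)\<bar>) \<longlonglongrightarrow> 0"
    using tendsto_enn2real[of "\<lambda>k. ennreal \<bar>4 ^ k * (LINT z|completion N. \<rho> k z \<bullet> w z)\<bar>" 0 sequentially] by simp
  then show ?thesis unfolding \<rho>_def by (rule tendsto_rabs_zero_cancel)
qed

section \<open>Coefficients of class C1 along states and controls\<close>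

text \<open>The constant 2 C adds the bounds of the two partial derivatives. The Lipschitz estimate
  is the mean value inequality, for which convexity of the control set makes the product with H
  convex.\<close>

lemma C1_on_prodD:
  assumes C1: "C1_on_prod U f fx fu" and conv: "convex U"
    and bd: "\<And>x u. u \<in> U \<Longrightarrow> norm (fx x u) \<le> C \<and> norm (fu x u) \<le> C" and C: "0 \<le> C"
  shows "continuous_on (UNIV \<times> U) (\<lambda>p. f (fst p) (snd p))"
    and "p \<in> UNIV \<times> U \<Longrightarrow> ((\<lambda>p. f (fst p) (snd p)) has_derivative (\<lambda>d. fx (fst p) (snd p) (fst d) + fu (fst p) (snd p) (snd d))) (at p within UNIV \<times> U)"
    and "p \<in> UNIV \<times> U \<Longrightarrow> norm (fx (fst p) (snd p) (fst d) + fu (fst p) (snd p) (snd d)) \<le> 2 * C * norm d"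
    and "p \<in> UNIV \<times> U \<Longrightarrow> q \<in> UNIV \<times> U \<Longrightarrow> norm (f (fst p) (snd p) - f (fst q) (snd q)) \<le> 2 * C * norm (p - q)"
proof -
  show der: "((\<lambda>p. f (fst p) (snd p)) has_derivative (\<lambda>d. fx (fst p) (snd p) (fst d) + fu (fst p) (snd p) (snd d))) (at p within UNIV \<times> U)"
    if "p \<in> UNIV \<times> U" for p
    using C1 that unfolding C1_on_prod_def by (auto simp: case_prod_unfold)
  show "continuous_on (UNIV \<times> U) (\<lambda>p. f (fst p) (snd p))" by (rule has_derivative_continuous_on[OF der])
  show le: "norm (fx (fst p) (snd p) (fst d) + fu (fst p) (snd p) (snd d)) \<le> 2 * C * norm d"
    if p: "p \<in> UNIV \<times> U" for p d
  proof -
    have b: "norm (fx (fst p) (snd p)) \<le> C" "norm (fu (fst p) (snd p)) \<le> C" using bd p by auto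
    have "norm (fx (fst p) (snd p) (fst d)) \<le> C * norm d"
      by (rule order_trans[OF norm_blinfun mult_mono[OF b(1)]]) (use C norm_fst_le[of "fst d" "snd d"] in auto)
    moreover have "norm (fu (fst p) (snd p) (snd d)) \<le> C * norm d"
      by (rule order_trans[OF norm_blinfun mult_mono[OF b(2)]]) (use C norm_snd_le[of "snd d" "fst d"] in auto)
    ultimately show ?thesis
      using norm_triangle_ineq[of "fx (fst p) (snd p) (fst d)" "fu (fst p) (snd p) (snd d)"] by linarith
  qed
  show "norm (f (fst p) (snd p) - f (fst q) (snd q)) \<le> 2 * C * norm (p - q)" if "p \<in> UNIV \<times> U" "q \<in> UNIV \<times> U"
  proof (rule differentiable_bound[OF _ der _ that])
    show "convex (UNIV \<times> U)" by (rule convex_Times) (auto simp: conv)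
    show "onorm (\<lambda>d. fx (fst r) (snd r) (fst d) + fu (fst r) (snd r) (snd d)) \<le> 2 * C" if "r \<in> UNIV \<times> U" for r
      by (rule onorm_bound) (use C le[OF that] in auto)
  qed
qed

text \<open>Covers \<open>a\<close>, \<open>b\<close> (values in \<open>H\<close>) and the running cost \<open>g\<close> (real values) at once.\<close>

definition C1_coefficient ::
  "'w measure \<Rightarrow> (real \<Rightarrow> 'w measure) \<Rightarrow> real \<Rightarrow> 'k::real_normed_vector set \<Rightarrow>
    (real \<Rightarrow> 'w \<Rightarrow> 'h::real_normed_vector \<Rightarrow> 'k \<Rightarrow> 'y::real_normed_vector) \<Rightarrow>
    (real \<Rightarrow> 'w \<Rightarrow> 'h \<Rightarrow> 'k \<Rightarrow> 'h \<Rightarrow>\<^sub>L 'y) \<Rightarrow> (real \<Rightarrow> 'w \<Rightarrow> 'h \<Rightarrow> 'k \<Rightarrow> 'k \<Rightarrow>\<^sub>L 'y) \<Rightarrow> real \<Rightarrow> bool" where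
  "C1_coefficient M F T U \<psi> fx fu C \<longleftrightarrow> convex U \<and> 0 \<le> C \<and>
     (\<forall>x. \<forall>u\<in>U. adapted F 0 T (\<lambda>t \<omega>. \<psi> t \<omega> x u)) \<and>
     (AE z in time_space M 0 T. C1_on_prod U (\<psi> (fst z) (snd z)) (fx (fst z) (snd z)) (fu (fst z) (snd z))) \<and>
     (\<forall>x. \<forall>u\<in>U. AE z in time_space M 0 T. norm (fx (fst z) (snd z) x u) \<le> C \<and> norm (fu (fst z) (snd z) x u) \<le> C) \<and>
     (\<forall>u\<in>U. AE z in time_space M 0 T. norm (\<psi> (fst z) (snd z) 0 u) \<le> C)"

lemma msq_Pair: "msq N (\<lambda>z. (f z, g z)) \<le> msq N f + msq N g"
  if "f \<in> borel_measurable N" "g \<in> borel_measurable N"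
  for f :: "'z \<Rightarrow> 'x::{real_normed_vector, second_countable_topology}" and g :: "'z \<Rightarrow> 'y::{real_normed_vector, second_countable_topology}"
proof -
  note [measurable] = that
  have "msq N (\<lambda>z. (f z, g z)) = (\<integral>\<^sup>+z. ennreal ((norm (f z))\<^sup>2) + ennreal ((norm (g z))\<^sup>2) \<partial>N)"
    unfolding msq_def by (intro nn_integral_cong) (simp add: norm_Pair)
  also have "\<dots> = msq N f + msq N g" unfolding msq_def by (rule nn_integral_add) measurable
  finally show ?thesis by simp
qed

text \<open>The bounds are assumed for each (x,u) off a null set depending on it. The derivatives
  are continuous and the spaces separable, so one null set serves all (x,u), as is required before
  states and controls are inserted.\<close>

lemma C1_coefficient_AE:
  fixes \<psi> :: "real \<Rightarrow> 'w \<Rightarrow> 'h::{real_normed_vector, second_countable_topology} \<Rightarrow> 'k::{real_normed_vector, second_countable_topology} \<Rightarrow> 'y::real_normed_vector"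
  assumes c: "C1_coefficient M F T U \<psi> fx fu C"
  shows "AE z in time_space M 0 T. C1_on_prod U (\<psi> (fst z) (snd z)) (fx (fst z) (snd z)) (fu (fst z) (snd z)) \<and>
    (\<forall>x. \<forall>u\<in>U. norm (fx (fst z) (snd z) x u) \<le> C \<and> norm (fu (fst z) (snd z) x u) \<le> C) \<and>
    (\<forall>u\<in>U. norm (\<psi> (fst z) (snd z) 0 u) \<le> C)"
proof -
  have C1: "AE z in time_space M 0 T. C1_on_prod U (\<psi> (fst z) (snd z)) (fx (fst z) (snd z)) (fu (fst z) (snd z))"
    and conv: "convex U" and C: "0 \<le> C"
    using c by (auto simp: C1_coefficient_def)
  \<comment> \<open>The maximum packs both bounds into one continuous function of the pair, the
    shape that \<open>AE_ball_le_0\<close> handles.\<close>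
  have "AE z in time_space M 0 T. \<forall>p\<in>UNIV \<times> U. max (norm (fx (fst z) (snd z) (fst p) (snd p))) (norm (fu (fst z) (snd z) (fst p) (snd p))) - C \<le> 0"
  proof (rule AE_ball_le_0)
    show "AE z in time_space M 0 T. continuous_on (UNIV \<times> U) (\<lambda>p. max (norm (fx (fst z) (snd z) (fst p) (snd p))) (norm (fu (fst z) (snd z) (fst p) (snd p))) - C)"
      using C1 by eventually_elim (auto simp: C1_on_prod_def case_prod_unfold intro!: continuous_intros)
    fix p :: "'h \<times> 'k" assume "p \<in> UNIV \<times> U"
    then have "snd p \<in> U" by (simp add: mem_Times_iff)
    then have "AE z in time_space M 0 T. norm (fx (fst z) (snd z) (fst p) (snd p)) \<le> C \<and> norm (fu (fst z) (snd z) (fst p) (snd p)) \<le> C"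
      using c unfolding C1_coefficient_def by blast
    then show "AE z in time_space M 0 T. max (norm (fx (fst z) (snd z) (fst p) (snd p))) (norm (fu (fst z) (snd z) (fst p) (snd p))) - C \<le> 0"
      by eventually_elim simp
  qed
  then have bd: "AE z in time_space M 0 T. \<forall>x. \<forall>u\<in>U. norm (fx (fst z) (snd z) x u) \<le> C \<and> norm (fu (fst z) (snd z) x u) \<le> C"
    by eventually_elim auto
  have "AE z in time_space M 0 T. \<forall>u\<in>U. norm (\<psi> (fst z) (snd z) 0 u) - C \<le> 0"
  proof (rule AE_ball_le_0)
    show "AE z in time_space M 0 T. continuous_on U (\<lambda>u. norm (\<psi> (fst z) (snd z) 0 u) - C)"
      using C1 bd
    proof eventually_elim
      case (elim z)
      have "continuous_on (UNIV \<times> U) (\<lambda>p. \<psi> (fst z) (snd z) (fst p) (snd p))"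
        by (rule C1_on_prodD(1)[OF elim(1) conv _ C]) (use elim(2) in blast)
      then have "continuous_on U (\<lambda>u. (\<lambda>p. \<psi> (fst z) (snd z) (fst p) (snd p)) (0, u))"
        by (rule continuous_on_compose2) (auto intro!: continuous_intros)
      then show ?case by (auto intro!: continuous_intros)
    qed
    fix u assume "u \<in> U"
    then have "AE z in time_space M 0 T. norm (\<psi> (fst z) (snd z) 0 u) \<le> C" using c unfolding C1_coefficient_def by blast
    then show "AE z in time_space M 0 T. norm (\<psi> (fst z) (snd z) 0 u) - C \<le> 0" by eventually_elim simp
  qed
  then have "AE z in time_space M 0 T. \<forall>u\<in>U. norm (\<psi> (fst z) (snd z) 0 u) \<le> C" by eventually_elim simp
  with C1 bd show ?thesis by eventually_elim blast
qed

lemma C1_coefficient_AE_lipschitz: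
  fixes \<psi> :: "real \<Rightarrow> 'w \<Rightarrow> 'h::{real_normed_vector, second_countable_topology} \<Rightarrow> 'k::{real_normed_vector, second_countable_topology} \<Rightarrow> 'y::real_normed_vector"
  assumes c: "C1_coefficient M F T U \<psi> fx fu C"
  shows "AE z in time_space M 0 T. continuous_on (UNIV \<times> U) (\<lambda>p. \<psi> (fst z) (snd z) (fst p) (snd p)) \<and>
    (\<forall>p\<in>UNIV \<times> U. ((\<lambda>p. \<psi> (fst z) (snd z) (fst p) (snd p)) has_derivative
      (\<lambda>d. fx (fst z) (snd z) (fst p) (snd p) (fst d) + fu (fst z) (snd z) (fst p) (snd p) (snd d))) (at p within UNIV \<times> U) \<and>
      (\<forall>d. norm (fx (fst z) (snd z) (fst p) (snd p) (fst d) + fu (fst z) (snd z) (fst p) (snd p) (snd d)) \<le> 2 * C * norm d) \<and>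
      (\<forall>q\<in>UNIV \<times> U. norm (\<psi> (fst z) (snd z) (fst p) (snd p) - \<psi> (fst z) (snd z) (fst q) (snd q)) \<le> 2 * C * norm (p - q)))"
  using C1_coefficient_AE[OF c]
proof eventually_elim
  case (elim z)
  have conv: "convex U" and C: "0 \<le> C" using c by (auto simp: C1_coefficient_def)
  have bd: "norm (fx (fst z) (snd z) x u) \<le> C \<and> norm (fu (fst z) (snd z) x u) \<le> C" if "u \<in> U" for x u
    using elim that by blast
  note D = C1_on_prodD[OF conjunct1[OF elim] conv bd C]
  show ?case using D by blast
qed

context brownian_basis
begin

lemma admissible_in_U: "admissible_control M F T U u \<Longrightarrow> z \<in> space (time_space M 0 T) \<Longrightarrow> u (fst z) (snd z) \<in> U"
  by (auto simp: admissible_control_def space_pair_measure space_restrict_space)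

lemma adapted_prog: "adapted F 0 T X \<longleftrightarrow> (\<lambda>z. X (fst z) (snd z)) \<in> borel_measurable (progressive_field F 0 T)"
  by (simp add: adapted_def case_prod_unfold)

lemma coefficient_measurable:
  fixes \<psi> :: "real \<Rightarrow> 'w \<Rightarrow> 'h::{real_normed_vector, second_countable_topology} \<Rightarrow> 'k::{real_normed_vector, second_countable_topology} \<Rightarrow> 'y::{banach, second_countable_topology}"
  assumes c: "C1_coefficient M F T U \<psi> fx fu C" and X: "adapted F 0 T X" and u: "admissible_control M F T U u"
  shows "ae_measurable (progressive_field F 0 T) (time_space M 0 T) (\<lambda>z. \<psi> (fst z) (snd z) (X (fst z) (snd z)) (u (fst z) (snd z)))"
proof -
  have "ae_measurable (progressive_field F 0 T) (time_space M 0 T)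
    (\<lambda>z. (\<lambda>z p. \<psi> (fst z) (snd z) (fst p) (snd p)) z ((\<lambda>z. (X (fst z) (snd z), u (fst z) (snd z))) z))"
  proof (rule ae_measurable_caratheodory[where V="UNIV \<times> U"])
    note [measurable] = X[unfolded adapted_prog]
    have [measurable]: "(\<lambda>z. u (fst z) (snd z)) \<in> borel_measurable (progressive_field F 0 T)"
      using u by (simp add: admissible_control_def adapted_prog)
    show "(\<lambda>z. (X (fst z) (snd z), u (fst z) (snd z))) \<in> borel_measurable (progressive_field F 0 T)" by measurable
    show "(X (fst z) (snd z), u (fst z) (snd z)) \<in> UNIV \<times> U" if "z \<in> space (progressive_field F 0 T)" for z
      using admissible_in_U[OF u, of z] that sets_progressive_field(2)[OF horizon] by simp
    show "(\<lambda>z. \<psi> (fst z) (snd z) (fst e) (snd e)) \<in> borel_measurable (progressive_field F 0 T)" if "e \<in> UNIV \<times> U" for e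
      using c that by (auto simp: C1_coefficient_def adapted_prog)
    show "AE z in time_space M 0 T. continuous_on (UNIV \<times> U) (\<lambda>p. \<psi> (fst z) (snd z) (fst p) (snd p))"
      using C1_coefficient_AE_lipschitz[OF c] by eventually_elim blast
    show "space (time_space M 0 T) = space (progressive_field F 0 T)"
      using sets_progressive_field(2)[OF horizon] by simp
  qed
  then show ?thesis by simp
qed

text \<open>Linear growth: the bound at x = 0 plus the Lipschitz estimate in x at the same control
  value. Controls themselves need not be square integrable.\<close>

lemma coefficient_L2:
  fixes \<psi> :: "real \<Rightarrow> 'w \<Rightarrow> 'h::{real_normed_vector, second_countable_topology} \<Rightarrow> 'k::{real_normed_vector, second_countable_topology} \<Rightarrow> 'y::{banach, second_countable_topology}"
  assumes c: "C1_coefficient M F T U \<psi> fx fu C" and X: "X \<in> L2_proc M F 0 T" "adapted F 0 T X" and u: "admissible_control M F T U u"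
  shows "(\<lambda>t \<omega>. \<psi> t \<omega> (X t \<omega>) (u t \<omega>)) \<in> L2_proc M F 0 T"
proof (rule L2_procI[OF horizon coefficient_measurable[OF c X(2) u]])
  let ?P = "time_space M 0 T"
  have C: "0 \<le> C" using c by (auto simp: C1_coefficient_def)
  note m = adapted_measurable[OF horizon X(2)]
  interpret P: finite_measure ?P by (rule finite_measure_time_space[OF prob_space_axioms])
  have "AE z in ?P. norm (\<psi> (fst z) (snd z) (X (fst z) (snd z)) (u (fst z) (snd z))) \<le> norm (C + 2 * C * norm (X (fst z) (snd z)))"
    using C1_coefficient_AE[OF c] C1_coefficient_AE_lipschitz[OF c] AE_space
  proof eventually_elim
    case (elim z)
    let ?u = "u (fst z) (snd z)" and ?x = "X (fst z) (snd z)"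
    have u: "?u \<in> U" by (rule admissible_in_U[OF u elim(3)])
    have p: "(?x, ?u) \<in> UNIV \<times> U" "(0::'h, ?u) \<in> UNIV \<times> U" using u by auto
    have "norm (\<psi> (fst z) (snd z) (fst (?x, ?u)) (snd (?x, ?u)) - \<psi> (fst z) (snd z) (fst (0, ?u)) (snd (0::'h, ?u))) \<le> 2 * C * norm ((?x, ?u) - (0, ?u))"
      by (rule bspec[OF conjunct2[OF conjunct2[OF bspec[OF conjunct2[OF elim(2)] p(1)]]] p(2)])
    moreover have "norm (\<psi> (fst z) (snd z) 0 ?u) \<le> C" using elim(1) u by blast
    ultimately have "norm (\<psi> (fst z) (snd z) ?x ?u) \<le> C + 2 * C * norm ?x"
      using norm_triangle_ineq2[of "\<psi> (fst z) (snd z) ?x ?u" "\<psi> (fst z) (snd z) 0 ?u"] by (simp add: norm_Pair)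
    then show ?case using C by simp
  qed
  then have "msq ?P (\<lambda>z. \<psi> (fst z) (snd z) (X (fst z) (snd z)) (u (fst z) (snd z))) \<le> msq ?P (\<lambda>z. C + 2 * C * norm (X (fst z) (snd z)))"
    by (rule msq_mono_AE)
  also have "\<dots> \<le> 2 * msq ?P (\<lambda>z. C) + 2 * msq ?P (\<lambda>z. 2 * C * norm (X (fst z) (snd z)))"
    by (rule msq_add_le) (use m in measurable)
  also have "\<dots> \<le> 2 * msq ?P (\<lambda>z. C) + 2 * (ennreal ((2 * C)\<^sup>2) * msq ?P (\<lambda>z. X (fst z) (snd z)))"
    by (intro add_left_mono mult_left_mono msq_scale_le[OF m]) (use C in auto)
  also have "\<dots> < \<infinity>"
    using L2_procD(2)[OF horizon X(1)] by (simp add: msq_def ennreal_mult_less_top P.emeasure_eq_measure)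
  finally show "msq ?P (\<lambda>z. \<psi> (fst z) (snd z) (X (fst z) (snd z)) (u (fst z) (snd z))) < \<infinity>" .
qed

lemma admissible_convex:
  fixes u v :: "real \<Rightarrow> 'w \<Rightarrow> 'k::{real_normed_vector, second_countable_topology}"
  assumes U: "convex U" and u: "admissible_control M F T U u" and v: "adapted F 0 T v" "admissible_control M F T U (\<lambda>t \<omega>. u t \<omega> + v t \<omega>)"
    and r: "0 \<le> r" "r \<le> 1"
  shows "admissible_control M F T U (\<lambda>t \<omega>. u t \<omega> + r *\<^sub>R v t \<omega>)"
  unfolding admissible_control_def
proof (intro conjI ballI)
  note [measurable] = v(1)[unfolded adapted_prog]
  have [measurable]: "(\<lambda>z. u (fst z) (snd z)) \<in> borel_measurable (progressive_field F 0 T)"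
    using u by (simp add: admissible_control_def adapted_prog)
  show "adapted F 0 T (\<lambda>t \<omega>. u t \<omega> + r *\<^sub>R v t \<omega>)" unfolding adapted_prog by measurable
  fix t \<omega> assume "t \<in> {0..T}" "\<omega> \<in> space M"
  then have "u t \<omega> \<in> U" "u t \<omega> + v t \<omega> \<in> U" using u v(2) by (auto simp: admissible_control_def)
  then have "(1 - r) *\<^sub>R u t \<omega> + r *\<^sub>R (u t \<omega> + v t \<omega>) \<in> U" using r by (intro convexD[OF U]) auto
  then show "u t \<omega> + r *\<^sub>R v t \<omega> \<in> U" by (simp add: algebra_simps)
qed

text \<open>\<open>fx\<close> and \<open>fu\<close> carry no measurability assumption. The
  derivative in the joint direction is a limit of difference quotients between admissible arguments,
  each of which is measurable; setting one of the two directions to 0 isolates a partial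
  derivative.\<close>

lemma coefficient_derivative:
  fixes \<psi> :: "real \<Rightarrow> 'w \<Rightarrow> 'h::{real_normed_vector, second_countable_topology} \<Rightarrow> 'k::{real_normed_vector, second_countable_topology} \<Rightarrow> 'y::{banach, second_countable_topology}"
  assumes c: "C1_coefficient M F T U \<psi> fx fu C" and X: "adapted F 0 T X" and u: "admissible_control M F T U u"
    and \<phi>: "adapted F 0 T \<phi>" "msq (time_space M 0 T) (\<lambda>z. \<phi> (fst z) (snd z)) < \<infinity>"
    and v: "adapted F 0 T v" "msq (time_space M 0 T) (\<lambda>z. v (fst z) (snd z)) < \<infinity>"
      "admissible_control M F T U (\<lambda>t \<omega>. u t \<omega> + v t \<omega>)"
  shows "ae_measurable (progressive_field F 0 T) (time_space M 0 T) (\<lambda>z.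
      fx (fst z) (snd z) (X (fst z) (snd z)) (u (fst z) (snd z)) (\<phi> (fst z) (snd z)) +
      fu (fst z) (snd z) (X (fst z) (snd z)) (u (fst z) (snd z)) (v (fst z) (snd z)))"
    and "msq (time_space M 0 T) (\<lambda>z.
      fx (fst z) (snd z) (X (fst z) (snd z)) (u (fst z) (snd z)) (\<phi> (fst z) (snd z)) +
      fu (fst z) (snd z) (X (fst z) (snd z)) (u (fst z) (snd z)) (v (fst z) (snd z))) < \<infinity>"
proof -
  let ?P = "time_space M 0 T"
  have conv: "convex U" and C: "0 \<le> C" using c by (auto simp: C1_coefficient_def)
  note [measurable] = X[unfolded adapted_prog] \<phi>(1)[unfolded adapted_prog] v(1)[unfolded adapted_prog]
  define X' where "X' n t \<omega> = X t \<omega> + (1 / real (Suc n)) *\<^sub>R \<phi> t \<omega>" for n t \<omega>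
  define u' where "u' n t \<omega> = u t \<omega> + (1 / real (Suc n)) *\<^sub>R v t \<omega>" for n t \<omega>
  have X'a: "adapted F 0 T (X' n)" for n unfolding adapted_prog X'_def by measurable
  have u'a: "admissible_control M F T U (u' n)" for n
    unfolding u'_def by (rule admissible_convex[OF conv u v(1,3)]) auto
  have "ae_measurable (progressive_field F 0 T) ?P (\<lambda>z. real (Suc n) *\<^sub>R
     (\<psi> (fst z) (snd z) (X' n (fst z) (snd z)) (u' n (fst z) (snd z)) - \<psi> (fst z) (snd z) (X (fst z) (snd z)) (u (fst z) (snd z))))" for n
    by (intro ae_measurable_scaleR ae_measurable_diff coefficient_measurable[OF c] X'a u'a X u)
  then show "ae_measurable (progressive_field F 0 T) ?P (\<lambda>z.
      fx (fst z) (snd z) (X (fst z) (snd z)) (u (fst z) (snd z)) (\<phi> (fst z) (snd z)) +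
      fu (fst z) (snd z) (X (fst z) (snd z)) (u (fst z) (snd z)) (v (fst z) (snd z)))"
  proof (rule ae_measurable_LIMSEQ)
    show "AE z in ?P. (\<lambda>n. real (Suc n) *\<^sub>R
     (\<psi> (fst z) (snd z) (X' n (fst z) (snd z)) (u' n (fst z) (snd z)) - \<psi> (fst z) (snd z) (X (fst z) (snd z)) (u (fst z) (snd z))))
      \<longlonglongrightarrow> fx (fst z) (snd z) (X (fst z) (snd z)) (u (fst z) (snd z)) (\<phi> (fst z) (snd z)) +
      fu (fst z) (snd z) (X (fst z) (snd z)) (u (fst z) (snd z)) (v (fst z) (snd z))"
      using C1_coefficient_AE_lipschitz[OF c] AE_space
    proof eventually_elim
      case (elim z)
      let ?p = "(X (fst z) (snd z), u (fst z) (snd z))" and ?d = "(\<phi> (fst z) (snd z), v (fst z) (snd z))"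
      have p: "?p \<in> UNIV \<times> U" using admissible_in_U[OF u elim(2)] by simp
      have pd: "?p + ?d \<in> UNIV \<times> U" using admissible_in_U[OF v(3) elim(2)] by simp
      have der: "((\<lambda>p. \<psi> (fst z) (snd z) (fst p) (snd p)) has_derivative
        (\<lambda>d. fx (fst z) (snd z) (fst ?p) (snd ?p) (fst d) + fu (fst z) (snd z) (fst ?p) (snd ?p) (snd d))) (at ?p within UNIV \<times> U)"
        by (intro conjunct1[OF bspec[OF conjunct2[OF elim(1)] p]])
      have "convex (UNIV \<times> U :: ('h \<times> 'k) set)" by (rule convex_Times) (auto simp: conv)
      from has_derivative_directional_seq[OF der this p pd] show ?case
        by (simp add: X'_def u'_def del: of_nat_Suc)
    qed
  qed
  note [measurable] = adapted_measurable[OF horizon \<phi>(1)] adapted_measurable[OF horizon v(1)]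
  have "msq ?P (\<lambda>z.
      fx (fst z) (snd z) (X (fst z) (snd z)) (u (fst z) (snd z)) (\<phi> (fst z) (snd z)) +
      fu (fst z) (snd z) (X (fst z) (snd z)) (u (fst z) (snd z)) (v (fst z) (snd z)))
    \<le> ennreal ((2 * C)\<^sup>2) * msq ?P (\<lambda>z. (\<phi> (fst z) (snd z), v (fst z) (snd z)))"
  proof (rule msq_scale_le)
    show "AE z in ?P. norm (fx (fst z) (snd z) (X (fst z) (snd z)) (u (fst z) (snd z)) (\<phi> (fst z) (snd z)) +
      fu (fst z) (snd z) (X (fst z) (snd z)) (u (fst z) (snd z)) (v (fst z) (snd z))) \<le> 2 * C * norm (\<phi> (fst z) (snd z), v (fst z) (snd z))"
      using C1_coefficient_AE_lipschitz[OF c] AE_space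
    proof eventually_elim
      case (elim z)
      have p: "(X (fst z) (snd z), u (fst z) (snd z)) \<in> UNIV \<times> U" using admissible_in_U[OF u elim(2)] by simp
      have "norm (fx (fst z) (snd z) (fst (X (fst z) (snd z), u (fst z) (snd z))) (snd (X (fst z) (snd z), u (fst z) (snd z))) (fst d) +
        fu (fst z) (snd z) (fst (X (fst z) (snd z), u (fst z) (snd z))) (snd (X (fst z) (snd z), u (fst z) (snd z))) (snd d)) \<le> 2 * C * norm d" for d
        using conjunct1[OF conjunct2[OF bspec[OF conjunct2[OF elim(1)] p]]] by (rule spec)
      from this[of "(\<phi> (fst z) (snd z), v (fst z) (snd z))"] show ?case by simp
    qed
  qed (use C in \<open>simp_all, measurable\<close>)
  also have "\<dots> \<le> ennreal ((2 * C)\<^sup>2) * (msq ?P (\<lambda>z. \<phi> (fst z) (snd z)) + msq ?P (\<lambda>z. v (fst z) (snd z)))"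
    by (intro mult_left_mono msq_Pair) auto
  also have "\<dots> < \<infinity>" using \<phi>(2) v(2) by (simp add: ennreal_mult_less_top)
  finally show "msq ?P (\<lambda>z.
      fx (fst z) (snd z) (X (fst z) (snd z)) (u (fst z) (snd z)) (\<phi> (fst z) (snd z)) +
      fu (fst z) (snd z) (X (fst z) (snd z)) (u (fst z) (snd z)) (v (fst z) (snd z))) < \<infinity>" .
qed


text \<open>The increment of the argument is the pair of the state difference and (1/4)^k v, whose
  second moment decays like (1/16)^k. Hence the remainder is o((1/4)^k) after pairing with
  \<open>w\<close>, which will be \<open>Y\<close>, \<open>Z\<close> or the constant 1.\<close>

lemma coefficient_expansion:
  fixes \<psi> :: "real \<Rightarrow> 'w \<Rightarrow> 'h::{real_normed_vector, second_countable_topology} \<Rightarrow> 'k::{real_normed_vector, second_countable_topology} \<Rightarrow> 'y::{real_inner, banach, second_countable_topology}"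
  assumes c: "C1_coefficient M F T U \<psi> fx fu C" and X: "adapted F 0 T X" and u: "admissible_control M F T U u"
    and X': "\<And>k. adapted F 0 T (X' k)" and E: "0 \<le> E"
      "\<And>k. msq (time_space M 0 T) (\<lambda>z. X' k (fst z) (snd z) - X (fst z) (snd z)) \<le> ennreal (E * (1/16) ^ k)"
    and v: "adapted F 0 T v" "msq (time_space M 0 T) (\<lambda>z. v (fst z) (snd z)) < \<infinity>"
      "admissible_control M F T U (\<lambda>t \<omega>. u t \<omega> + v t \<omega>)"
    and w: "ae_measurable (time_space M 0 T) (time_space M 0 T) w" "msq (time_space M 0 T) w < \<infinity>"
  shows "integrable (completion (time_space M 0 T)) (\<lambda>z.
      (\<psi> (fst z) (snd z) (X' k (fst z) (snd z)) (u (fst z) (snd z) + (1/4) ^ k *\<^sub>R v (fst z) (snd z)) -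
       \<psi> (fst z) (snd z) (X (fst z) (snd z)) (u (fst z) (snd z))) \<bullet> w z)" (is "integrable ?Q (?\<Delta> k)")
    and "integrable (completion (time_space M 0 T)) (\<lambda>z.
      fx (fst z) (snd z) (X (fst z) (snd z)) (u (fst z) (snd z)) (X' k (fst z) (snd z) - X (fst z) (snd z)) \<bullet> w z)" (is "integrable ?Q (?x k)")
    and "integrable (completion (time_space M 0 T)) (\<lambda>z.
      fu (fst z) (snd z) (X (fst z) (snd z)) (u (fst z) (snd z)) (v (fst z) (snd z)) \<bullet> w z)" (is "integrable ?Q ?u")
    and "(\<lambda>k. 4 ^ k * ((LINT z|completion (time_space M 0 T).
        (\<psi> (fst z) (snd z) (X' k (fst z) (snd z)) (u (fst z) (snd z) + (1/4) ^ k *\<^sub>R v (fst z) (snd z)) -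
         \<psi> (fst z) (snd z) (X (fst z) (snd z)) (u (fst z) (snd z))) \<bullet> w z)
      - (LINT z|completion (time_space M 0 T).
        fx (fst z) (snd z) (X (fst z) (snd z)) (u (fst z) (snd z)) (X' k (fst z) (snd z) - X (fst z) (snd z)) \<bullet> w z)
      - (1/4) ^ k * (LINT z|completion (time_space M 0 T).
        fu (fst z) (snd z) (X (fst z) (snd z)) (u (fst z) (snd z)) (v (fst z) (snd z)) \<bullet> w z))) \<longlonglongrightarrow> 0"
proof -
  let ?P = "time_space M 0 T"
  have conv: "convex U" and C: "0 \<le> C" using c by (auto simp: C1_coefficient_def)
  note [measurable] = X[unfolded adapted_prog] v(1)[unfolded adapted_prog] X'[unfolded adapted_prog]
  define \<delta> where "\<delta> k t \<omega> = X' k t \<omega> - X t \<omega>" for k t \<omega>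
  define \<eta> where "\<eta> k t \<omega> = (1/4) ^ k *\<^sub>R v t \<omega>" for k :: nat and t \<omega>
  define d where "d k z = (\<delta> k (fst z) (snd z), \<eta> k (fst z) (snd z))" for k z
  define p where "p z = (X (fst z) (snd z), u (fst z) (snd z))" for z
  define f where "f z q = \<psi> (fst z) (snd z) (fst q) (snd q)" for z q
  define f' where "f' z q = fx (fst z) (snd z) (fst (p z)) (snd (p z)) (fst q) + fu (fst z) (snd z) (fst (p z)) (snd (p z)) (snd q)" for z q
  have \<delta>a: "adapted F 0 T (\<delta> k)" for k unfolding adapted_prog \<delta>_def by measurable
  have \<eta>a: "adapted F 0 T (\<eta> k)" for k unfolding adapted_prog \<eta>_def by measurable
  have \<eta>u: "admissible_control M F T U (\<lambda>t \<omega>. u t \<omega> + \<eta> k t \<omega>)" for k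
    unfolding \<eta>_def by (rule admissible_convex[OF conv u v(1,3)]) (auto simp: power_le_one)
  note mv[measurable] = adapted_measurable[OF horizon v(1)]
  note [measurable] = adapted_measurable[OF horizon \<delta>a] adapted_measurable[OF horizon \<eta>a]
  have dm[measurable]: "d k \<in> borel_measurable ?P" for k unfolding d_def by measurable
  define V where "V = enn2real (msq ?P (\<lambda>z. v (fst z) (snd z)))"
  have V: "msq ?P (\<lambda>z. v (fst z) (snd z)) = ennreal V" "0 \<le> V" using v(2) by (auto simp: V_def)
  have \<delta>E: "msq ?P (\<lambda>z. \<delta> k (fst z) (snd z)) \<le> ennreal (E * (1/16) ^ k)" for k using E(2)[of k] by (simp add: \<delta>_def)
  have \<eta>E: "msq ?P (\<lambda>z. \<eta> k (fst z) (snd z)) \<le> ennreal (V * (1/16) ^ k)" for k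
  proof -
    have "((1/4::real) ^ k)\<^sup>2 = (1/16) ^ k" by (simp only: power2_eq_square flip: power_mult_distrib) simp
    moreover have "msq ?P (\<lambda>z. \<eta> k (fst z) (snd z)) \<le> ennreal (((1/4) ^ k)\<^sup>2) * msq ?P (\<lambda>z. v (fst z) (snd z))"
      by (rule msq_scale_le[OF mv]) (auto simp: \<eta>_def)
    ultimately show ?thesis using V by (simp add: mult.commute flip: ennreal_mult)
  qed
  have dE: "msq ?P (d k) \<le> ennreal ((E + V) * (1/16) ^ k)" for k
  proof -
    have "msq ?P (d k) \<le> msq ?P (\<lambda>z. \<delta> k (fst z) (snd z)) + msq ?P (\<lambda>z. \<eta> k (fst z) (snd z))"
      unfolding d_def by (rule msq_Pair) measurable
    also have "\<dots> \<le> ennreal (E * (1/16) ^ k) + ennreal (V * (1/16) ^ k)" by (rule add_mono[OF \<delta>E \<eta>E])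
    also have "\<dots> = ennreal ((E + V) * (1/16) ^ k)" using E V by (simp add: distrib_right flip: ennreal_plus)
    finally show ?thesis .
  qed
  have EV: "0 \<le> E + V" using E V by simp
  have fin: "msq ?P (\<lambda>z. \<delta> k (fst z) (snd z)) < \<infinity>" "msq ?P (\<lambda>z. \<eta> k (fst z) (snd z)) < \<infinity>" for k
    using le_less_trans[OF \<delta>E[of k], of \<infinity>] le_less_trans[OF \<eta>E[of k], of \<infinity>] by auto
  have pV: "p z \<in> UNIV \<times> U" if "z \<in> space ?P" for z using admissible_in_U[OF u that] by (simp add: p_def)
  have pdV: "p z + d k z \<in> UNIV \<times> U" if "z \<in> space ?P" for z k
    using admissible_in_U[OF \<eta>u that] by (simp add: p_def d_def)
  have fpd: "f z (p z + d k z) = \<psi> (fst z) (snd z) (X' k (fst z) (snd z)) (u (fst z) (snd z) + (1/4) ^ k *\<^sub>R v (fst z) (snd z))" for z k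
    by (simp add: f_def p_def d_def \<delta>_def \<eta>_def)
  have fp: "f z (p z) = \<psi> (fst z) (snd z) (X (fst z) (snd z)) (u (fst z) (snd z))" for z by (simp add: f_def p_def)
  have f'd: "f' z (d k z) = fx (fst z) (snd z) (X (fst z) (snd z)) (u (fst z) (snd z)) (\<delta> k (fst z) (snd z)) +
      fu (fst z) (snd z) (X (fst z) (snd z)) (u (fst z) (snd z)) (\<eta> k (fst z) (snd z))" for z k
    by (simp add: f'_def p_def d_def)
  have fprops: "AE z in ?P. (f z has_derivative f' z) (at (p z) within UNIV \<times> U) \<and> (\<forall>d. norm (f' z d) \<le> 2 * C * norm d) \<and>
      (\<forall>k. norm (f z (p z + d k z) - f z (p z)) \<le> 2 * C * norm (d k z))"
    using C1_coefficient_AE_lipschitz[OF c] AE_space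
  proof eventually_elim
    case (elim z)
    note B = bspec[OF conjunct2[OF elim(1)] pV[OF elim(2)]]
    have "norm (f z (p z) - f z (p z + d k z)) \<le> 2 * C * norm (p z - (p z + d k z))" for k
      unfolding f_def by (rule bspec[OF conjunct2[OF conjunct2[OF B]] pdV[OF elim(2)]])
    then have "norm (f z (p z + d k z) - f z (p z)) \<le> 2 * C * norm (d k z)" for k
      by (simp add: norm_minus_commute)
    moreover have "(f z has_derivative f' z) (at (p z) within UNIV \<times> U)"
      unfolding f_def[abs_def] f'_def[abs_def] by (rule conjunct1[OF B])
    moreover have "norm (f' z d) \<le> 2 * C * norm d" for d
      unfolding f'_def by (rule spec[OF conjunct1[OF conjunct2[OF B]]])
    ultimately show ?case by blast
  qed
  have mf: "ae_measurable ?P ?P (\<lambda>z. f z (p z + d k z))" "ae_measurable ?P ?P (\<lambda>z. f z (p z))" for k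
  proof -
    show "ae_measurable ?P ?P (\<lambda>z. f z (p z + d k z))"
      unfolding fpd using \<eta>u[of k] unfolding \<eta>_def
      by (intro ae_progressive_imp_ae_measurable[OF horizon] coefficient_measurable[OF c X', where u="\<lambda>t \<omega>. u t \<omega> + (1/4) ^ k *\<^sub>R v t \<omega>"])
    show "ae_measurable ?P ?P (\<lambda>z. f z (p z))"
      unfolding fp by (rule ae_progressive_imp_ae_measurable[OF horizon coefficient_measurable[OF c X u]])
  qed
  have mf': "ae_measurable ?P ?P (\<lambda>z. f' z (d k z))" for k
    unfolding f'd
    by (rule ae_progressive_imp_ae_measurable[OF horizon coefficient_derivative(1)[OF c X u \<delta>a fin(1) \<eta>a fin(2) \<eta>u]])
  \<comment> \<open>Zero directions split the joint derivative into its state part and its control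
    part, so that each is measurable and integrable by itself.\<close>
  have z0: "adapted F 0 T (\<lambda>t \<omega>. 0::'h)" "adapted F 0 T (\<lambda>t \<omega>. 0::'k)" unfolding adapted_prog by measurable
  have z1: "msq ?P (\<lambda>z. 0::'h) < \<infinity>" "msq ?P (\<lambda>z. 0::'k) < \<infinity>" by (simp_all add: msq_def)
  have u0: "admissible_control M F T U (\<lambda>t \<omega>. u t \<omega> + 0)" using u by simp
  note Dx = coefficient_derivative[OF c X u \<delta>a fin(1) z0(2) z1(2) u0, unfolded blinfun.zero_right add_0_right]
  note Du = coefficient_derivative[OF c X u z0(1) z1(1) v, unfolded blinfun.zero_right add_0_left]
  show i1: "integrable ?Q (?\<Delta> k)" for k
    unfolding fpd[symmetric] fp[symmetric]
  proof (rule integrable_completion_inner[OF _ _ w])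
    show "ae_measurable ?P ?P (\<lambda>z. f z (p z + d k z) - f z (p z))" by (rule ae_measurable_diff[OF mf])
    have l: "AE z in ?P. norm (f z (p z + d k z) - f z (p z)) \<le> 2 * C * norm (d k z)"
      using fprops by eventually_elim blast
    have "msq ?P (\<lambda>z. f z (p z + d k z) - f z (p z)) \<le> ennreal ((2 * C)\<^sup>2) * msq ?P (d k)"
      by (rule msq_scale_le[OF dm _ l]) (use C in simp)
    also have "\<dots> < \<infinity>" using le_less_trans[OF dE[of k], of \<infinity>] by (simp add: ennreal_mult_less_top)
    finally show "msq ?P (\<lambda>z. f z (p z + d k z) - f z (p z)) < \<infinity>" .
  qed
  show i2: "integrable ?Q (?x k)" for k
    using integrable_completion_inner[OF ae_progressive_imp_ae_measurable[OF horizon Dx(1)[of k]] Dx(2) w] by (simp add: \<delta>_def)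
  show i3: "integrable ?Q ?u"
    by (rule integrable_completion_inner[OF ae_progressive_imp_ae_measurable[OF horizon Du(1)] Du(2) w])
  have "(\<lambda>k. 4 ^ k * (LINT z|?Q. (f z (p z + d k z) - f z (p z) - f' z (d k z)) \<bullet> w z)) \<longlonglongrightarrow> 0"
  \<comment> \<open>The constant 4 C adds 2 C for the increment of the coefficient and 2 C for its
    linear part.\<close>
  proof (rule remainder_integral_tendsto_0[OF dm dE EV pdV _ _ _ _ w, where L="4 * C"])
    show "AE z in ?P. (f z has_derivative f' z) (at (p z) within UNIV \<times> U)" using fprops by eventually_elim blast
    show "AE z in ?P. norm (f z (p z + d k z) - f z (p z) - f' z (d k z)) \<le> 4 * C * norm (d k z)" for k
      using fprops
    proof eventually_elim
      case (elim z)
      have "norm (f z (p z + d k z) - f z (p z)) \<le> 2 * C * norm (d k z)" "norm (f' z (d k z)) \<le> 2 * C * norm (d k z)"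
        using elim by blast+
      then show ?case using norm_triangle_ineq4[of "f z (p z + d k z) - f z (p z)" "f' z (d k z)"] by linarith
    qed
    show "ae_measurable ?P ?P (\<lambda>z. f z (p z + d k z) - f z (p z) - f' z (d k z))" for k
      by (intro ae_measurable_diff mf mf')
  qed (use C in auto)
  moreover have "(LINT z|?Q. (f z (p z + d k z) - f z (p z) - f' z (d k z)) \<bullet> w z)
    = (LINT z|?Q. ?\<Delta> k z) - (LINT z|?Q. ?x k z) - (1/4) ^ k * (LINT z|?Q. ?u z)" for k
  proof -
    have "(LINT z|?Q. (f z (p z + d k z) - f z (p z) - f' z (d k z)) \<bullet> w z) = (LINT z|?Q. ?\<Delta> k z - ?x k z - (1/4) ^ k * ?u z)"
      by (rule Bochner_Integration.integral_cong[OF refl])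
        (simp add: fpd fp f'd \<delta>_def \<eta>_def inner_diff_left inner_add_left blinfun.scaleR_right diff_diff_eq)
    also have "\<dots> = (LINT z|?Q. ?\<Delta> k z - ?x k z) - (LINT z|?Q. (1/4) ^ k * ?u z)"
      by (rule Bochner_Integration.integral_diff[OF Bochner_Integration.integrable_diff[OF i1 i2] integrable_mult_right[OF i3]])
    also have "(LINT z|?Q. ?\<Delta> k z - ?x k z) = (LINT z|?Q. ?\<Delta> k z) - (LINT z|?Q. ?x k z)"
      by (rule Bochner_Integration.integral_diff[OF i1 i2])
    finally show ?thesis by simp
  qed
  ultimately show "(\<lambda>k. 4 ^ k * ((LINT z|?Q. ?\<Delta> k z) - (LINT z|?Q. ?x k z) - (1/4) ^ k * (LINT z|?Q. ?u z))) \<longlonglongrightarrow> 0"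
    by simp
qed

end

section \<open>Variations of the optimal control\<close>

lemma C1_coefficient_lipschitz:
  fixes \<psi> :: "real \<Rightarrow> 'w \<Rightarrow> 'h::{real_normed_vector, second_countable_topology} \<Rightarrow> 'k::{real_normed_vector, second_countable_topology} \<Rightarrow> 'y::real_normed_vector"
  assumes c: "C1_coefficient M F T U \<psi> fx fu C"
  shows "AE z in time_space M 0 T. \<forall>x y. \<forall>u\<in>U. \<forall>v\<in>U.
    norm (\<psi> (fst z) (snd z) x u - \<psi> (fst z) (snd z) y v) \<le> 2 * C * norm (x - y, u - v)"
  using C1_coefficient_AE_lipschitz[OF c]
proof eventually_elim
  case (elim z)
  show ?case
  proof (intro allI ballI)
    fix x y :: 'h and u v :: 'k assume "u \<in> U" "v \<in> U"
    then have uv: "(x, u) \<in> UNIV \<times> U" "(y, v) \<in> UNIV \<times> U" by auto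
    show "norm (\<psi> (fst z) (snd z) x u - \<psi> (fst z) (snd z) y v) \<le> 2 * C * norm (x - y, u - v)"
      using bspec[OF conjunct2[OF conjunct2[OF bspec[OF conjunct2[OF elim] uv(1)]]] uv(2)] by simp
  qed
qed

context brownian_basis
begin

text \<open>With the perturbed control frozen into the coefficients, the optimal state is a mild
  solution with slightly wrong drivers. Their error is Lipschitz in the control, hence of second
  moment O((1/16)^k), and \<open>mild_solution_nonlinear\<close> passes this order on to the
  state.\<close>

lemma perturbed_state:
  fixes S :: "real \<Rightarrow> 'h::{real_inner, banach, second_countable_topology} \<Rightarrow>\<^sub>L 'h"
    and U :: "'k::{real_normed_vector, second_countable_topology} set"
  assumes S: "C0_semigroup S"
    and ca: "C1_coefficient M F T U a ax au C" and cb: "C1_coefficient M F T U b bx bu C"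
    and adm: "admissible_pair M F W T S U a b X0 X u"
    and v: "adapted F 0 T v" "msq (time_space M 0 T) (\<lambda>z. v (fst z) (snd z)) < \<infinity>"
      "admissible_control M F T U (\<lambda>t \<omega>. u t \<omega> + v t \<omega>)"
  shows "\<exists>E\<ge>0. \<forall>k. \<exists>X'. admissible_pair M F W T S U a b X0 X' (\<lambda>t \<omega>. u t \<omega> + (1/4) ^ k *\<^sub>R v t \<omega>) \<and>
    msq M (\<lambda>\<omega>. X' T \<omega> - X T \<omega>) \<le> ennreal (E * (1/16) ^ k) \<and>
    msq (time_space M 0 T) (\<lambda>z. X' (fst z) (snd z) - X (fst z) (snd z)) \<le> ennreal (E * (1/16) ^ k)"
proof -
  let ?P = "time_space M 0 T"
  have conv: "convex U" and C: "0 \<le> C" using ca by (auto simp: C1_coefficient_def)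
  have u: "admissible_control M F T U u"
    and X: "mild_solution M F W S 0 T (\<lambda>_. X0) (\<lambda>t \<omega>. a t \<omega> (X t \<omega>) (u t \<omega>)) (\<lambda>t \<omega>. b t \<omega> (X t \<omega>) (u t \<omega>)) X"
    using adm by (auto simp: admissible_pair_def)
  have XC: "X \<in> C_proc M F 0 T" using X by (simp add: mild_solution_def)
  obtain K where K: "1 \<le> K" "\<And>t. t \<in> {0..T} \<Longrightarrow> norm (S t) \<le> K" using C0_semigroup_bounded[OF S, of T] by blast
  define V where "V = enn2real (msq ?P (\<lambda>z. v (fst z) (snd z)))"
  have V: "msq ?P (\<lambda>z. v (fst z) (snd z)) = ennreal V" "0 \<le> V" using v(2) by (auto simp: V_def)
  define c where "c = 2 * T * K\<^sup>2 + 8 * K\<^sup>2"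
  \<comment> \<open>The bound of \<open>mild_solution_nonlinear\<close> for Lipschitz constant 2 C
    and first error 8 C^2 V, that is 4 C^2 V for each of the two coefficients. It is linear in this
    error, so the rate (1/16)^k factors out.\<close>
  define B where "B = 8 * (c * (8 * C\<^sup>2 * V) * exp (16 * (2 * c * (2 * C)\<^sup>2 * T)))"
  have c0: "0 \<le> c" using horizon by (simp add: c_def)
  have B0: "0 \<le> B" using c0 V by (simp add: B_def)
  note mv = adapted_measurable[OF horizon v(1)]
  have main: "\<exists>X'. admissible_pair M F W T S U a b X0 X' (\<lambda>t \<omega>. u t \<omega> + (1/4) ^ k *\<^sub>R v t \<omega>) \<and>
    (\<forall>t\<in>{0..T}. msq M (\<lambda>\<omega>. X' t \<omega> - X t \<omega>) \<le> ennreal (B * (1/16) ^ k))" for k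
  proof -
    define u' where "u' t \<omega> = u t \<omega> + (1/4) ^ k *\<^sub>R v t \<omega>" for t \<omega>
    have u': "admissible_control M F T U u'"
      unfolding u'_def by (rule admissible_convex[OF conv u v(1,3)]) (auto simp: power_le_one)
    have p16: "((1/4::real) ^ k)\<^sup>2 = (1/16) ^ k" by (simp only: power2_eq_square flip: power_mult_distrib) simp
    have diff: "msq ?P (\<lambda>z. \<psi> (fst z) (snd z) (X (fst z) (snd z)) (u' (fst z) (snd z)) -
        \<psi> (fst z) (snd z) (X (fst z) (snd z)) (u (fst z) (snd z))) \<le> ennreal (4 * C\<^sup>2 * V * (1/16) ^ k)"
      if c: "C1_coefficient M F T U \<psi> fx fu C" for \<psi> :: "real \<Rightarrow> 'w \<Rightarrow> 'h \<Rightarrow> 'k \<Rightarrow> 'h" and fx fu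
    proof -
      have "AE z in ?P. norm (\<psi> (fst z) (snd z) (X (fst z) (snd z)) (u' (fst z) (snd z)) -
        \<psi> (fst z) (snd z) (X (fst z) (snd z)) (u (fst z) (snd z))) \<le> (2 * C * (1/4) ^ k) * norm (v (fst z) (snd z))"
        using C1_coefficient_lipschitz[OF c] AE_space
      proof eventually_elim
        case (elim z)
        have "norm (\<psi> (fst z) (snd z) (X (fst z) (snd z)) (u' (fst z) (snd z)) -
          \<psi> (fst z) (snd z) (X (fst z) (snd z)) (u (fst z) (snd z)))
          \<le> 2 * C * norm (X (fst z) (snd z) - X (fst z) (snd z), u' (fst z) (snd z) - u (fst z) (snd z))"
          using elim(1) admissible_in_U[OF u' elim(2)] admissible_in_U[OF u elim(2)] by blast
        then show ?case by (simp add: u'_def norm_Pair)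
      qed
      then have "msq ?P (\<lambda>z. \<psi> (fst z) (snd z) (X (fst z) (snd z)) (u' (fst z) (snd z)) -
        \<psi> (fst z) (snd z) (X (fst z) (snd z)) (u (fst z) (snd z))) \<le> ennreal ((2 * C * (1/4) ^ k)\<^sup>2) * msq ?P (\<lambda>z. v (fst z) (snd z))"
        by (intro msq_scale_le[OF mv]) (use C in simp_all)
      also have "\<dots> = ennreal (4 * C\<^sup>2 * V * (1/16) ^ k)"
        unfolding V(1) using V(2) by (subst ennreal_mult[symmetric]) (simp_all add: power_mult_distrib p16)
      finally show ?thesis .
    qed
    have "\<exists>X'. mild_solution M F W S 0 T (\<lambda>_. X0) (\<lambda>t \<omega>. a t \<omega> (X' t \<omega>) (u' t \<omega>)) (\<lambda>t \<omega>. b t \<omega> (X' t \<omega>) (u' t \<omega>)) X' \<and>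
      (\<forall>t\<in>{0..T}. msq M (\<lambda>\<omega>. X' t \<omega> - X t \<omega>) \<le>
        ennreal (8 * (c * (8 * C\<^sup>2 * V * (1/16) ^ k) * exp (16 * (2 * c * (2 * C)\<^sup>2 * T)))))"
    proof (rule mild_solution_nonlinear[OF S _ K(2) _ _ _ _ X])
      show "0 \<le> K" "0 \<le> 2 * C" using K C by auto
      show "(\<lambda>t \<omega>. a t \<omega> (X t \<omega>) (u' t \<omega>)) \<in> L2_proc M F 0 T" if "X \<in> L2_proc M F 0 T" "adapted F 0 T X" for X
        by (rule coefficient_L2[OF ca that u'])
      show "(\<lambda>t \<omega>. b t \<omega> (X t \<omega>) (u' t \<omega>)) \<in> L2_proc M F 0 T" if "X \<in> L2_proc M F 0 T" "adapted F 0 T X" for X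
        by (rule coefficient_L2[OF cb that u'])
      show "AE z in ?P. \<forall>x y. norm (a (fst z) (snd z) x (u' (fst z) (snd z)) - a (fst z) (snd z) y (u' (fst z) (snd z))) \<le> 2 * C * norm (x - y) \<and>
        norm (b (fst z) (snd z) x (u' (fst z) (snd z)) - b (fst z) (snd z) y (u' (fst z) (snd z))) \<le> 2 * C * norm (x - y)"
        using C1_coefficient_lipschitz[OF ca] C1_coefficient_lipschitz[OF cb] AE_space
      proof eventually_elim
        case (elim z)
        let ?u = "u' (fst z) (snd z)"
        have uU: "?u \<in> U" by (rule admissible_in_U[OF u' elim(3)])
        have n: "norm (x - y, ?u - ?u) = norm (x - y)" for x y :: 'h by (simp add: norm_Pair)
        have "norm (a (fst z) (snd z) x ?u - a (fst z) (snd z) y ?u) \<le> 2 * C * norm (x - y, ?u - ?u)"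
          "norm (b (fst z) (snd z) x ?u - b (fst z) (snd z) y ?u) \<le> 2 * C * norm (x - y, ?u - ?u)" for x y
          using elim(1,2) uU by blast+
        then show ?case unfolding n by blast
      qed
      show "(\<lambda>t \<omega>. a t \<omega> (X t \<omega>) (u t \<omega>)) \<in> L2_proc M F 0 T" by (rule coefficient_L2[OF ca C_proc_L2(1,2)[OF XC] u])
      show "(\<lambda>t \<omega>. b t \<omega> (X t \<omega>) (u t \<omega>)) \<in> L2_proc M F 0 T" by (rule coefficient_L2[OF cb C_proc_L2(1,2)[OF XC] u])
      have "ennreal (4 * C\<^sup>2 * V * (1/16) ^ k) + ennreal (4 * C\<^sup>2 * V * (1/16) ^ k) = ennreal (8 * C\<^sup>2 * V * (1/16) ^ k)"
        using V(2) by (subst ennreal_plus[symmetric]) simp_all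
      with add_mono[OF diff[OF ca] diff[OF cb]]
      show "msq ?P (\<lambda>z. a (fst z) (snd z) (X (fst z) (snd z)) (u' (fst z) (snd z)) - a (fst z) (snd z) (X (fst z) (snd z)) (u (fst z) (snd z))) +
        msq ?P (\<lambda>z. b (fst z) (snd z) (X (fst z) (snd z)) (u' (fst z) (snd z)) - b (fst z) (snd z) (X (fst z) (snd z)) (u (fst z) (snd z)))
        \<le> ennreal (8 * C\<^sup>2 * V * (1/16) ^ k)" by simp
      show "0 \<le> 8 * C\<^sup>2 * V * (1/16) ^ k" using V(2) by simp
    qed (simp_all add: c_def)
    then obtain X' where X': "mild_solution M F W S 0 T (\<lambda>_. X0) (\<lambda>t \<omega>. a t \<omega> (X' t \<omega>) (u' t \<omega>)) (\<lambda>t \<omega>. b t \<omega> (X' t \<omega>) (u' t \<omega>)) X'"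
      "\<And>t. t \<in> {0..T} \<Longrightarrow> msq M (\<lambda>\<omega>. X' t \<omega> - X t \<omega>) \<le>
        ennreal (8 * (c * (8 * C\<^sup>2 * V * (1/16) ^ k) * exp (16 * (2 * c * (2 * C)\<^sup>2 * T))))" by blast
    have B: "8 * (c * (8 * C\<^sup>2 * V * (1/16) ^ k) * exp (16 * (2 * c * (2 * C)\<^sup>2 * T))) = B * (1/16) ^ k"
      by (simp add: B_def)
    show ?thesis
    proof (intro exI[of _ X'] conjI ballI)
      show "admissible_pair M F W T S U a b X0 X' (\<lambda>t \<omega>. u t \<omega> + (1/4) ^ k *\<^sub>R v t \<omega>)"
        unfolding admissible_pair_def using u' X'(1) by (simp add: u'_def[abs_def])
      show "msq M (\<lambda>\<omega>. X' t \<omega> - X t \<omega>) \<le> ennreal (B * (1/16) ^ k)" if "t \<in> {0..T}" for t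
        using X'(2)[OF that] by (simp only: B)
    qed
  qed
  show ?thesis
  \<comment> \<open>One constant for two purposes: B bounds the second moment at the terminal time,
    T B its integral over time.\<close>
  proof (intro exI[of _ "B + T * B"] conjI allI)
    show "0 \<le> B + T * B" using B0 horizon by simp
    fix k
    obtain X' where X': "admissible_pair M F W T S U a b X0 X' (\<lambda>t \<omega>. u t \<omega> + (1/4) ^ k *\<^sub>R v t \<omega>)"
      "\<And>t. t \<in> {0..T} \<Longrightarrow> msq M (\<lambda>\<omega>. X' t \<omega> - X t \<omega>) \<le> ennreal (B * (1/16) ^ k)" using main[of k] by blast
    have X'C: "X' \<in> C_proc M F 0 T" using X'(1) by (simp add: admissible_pair_def mild_solution_def)
    have le: "B * (1/16) ^ k \<le> (B + T * B) * (1/16) ^ k" "T * (B * (1/16) ^ k) \<le> (B + T * B) * (1/16) ^ k"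
      using B0 horizon by (simp_all add: algebra_simps)
    have "msq ?P (\<lambda>z. X' (fst z) (snd z) - X (fst z) (snd z)) = (\<integral>\<^sup>+s. msq M (\<lambda>\<omega>. X' s \<omega> - X s \<omega>) * indicator {0..T} s \<partial>lborel)"
      by (rule msq_time_space_eq[OF C_proc_L2(2)[OF C_proc_diff[OF X'C XC]]]) (use horizon in simp)
    also have "\<dots> \<le> (\<integral>\<^sup>+s. ennreal (B * (1/16) ^ k) * indicator {0..T} s \<partial>lborel)"
      by (intro nn_integral_mono) (auto simp: indicator_def X'(2))
    also have "\<dots> = ennreal (B * (1/16) ^ k) * emeasure lborel {0..T}"
      by (rule nn_integral_cmult_indicator) simp
    also have "\<dots> = ennreal (T * (B * (1/16) ^ k))"
      using B0 horizon by (simp add: emeasure_lborel_Icc_eq ennreal_mult mult_ac)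
    also have "\<dots> \<le> ennreal ((B + T * B) * (1/16) ^ k)" by (rule ennreal_leI[OF le(2)])
    finally have "msq ?P (\<lambda>z. X' (fst z) (snd z) - X (fst z) (snd z)) \<le> ennreal ((B + T * B) * (1/16) ^ k)" .
    moreover have "msq M (\<lambda>\<omega>. X' T \<omega> - X T \<omega>) \<le> ennreal ((B + T * B) * (1/16) ^ k)"
      by (rule order_trans[OF X'(2) ennreal_leI[OF le(1)]]) (use horizon in simp)
    ultimately show "\<exists>X'. admissible_pair M F W T S U a b X0 X' (\<lambda>t \<omega>. u t \<omega> + (1/4) ^ k *\<^sub>R v t \<omega>) \<and>
      msq M (\<lambda>\<omega>. X' T \<omega> - X T \<omega>) \<le> ennreal ((B + T * B) * (1/16) ^ k) \<and>
      msq ?P (\<lambda>z. X' (fst z) (snd z) - X (fst z) (snd z)) \<le> ennreal ((B + T * B) * (1/16) ^ k)"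
      using X'(1) by blast
  qed
qed


section \<open>Terminal cost, duality with the adjoint process, and the cost functional\<close>

text \<open>\<open>M\<close> is complete already; this moves results stated over a
  \<open>completion\<close> back to \<open>M\<close>.\<close>

lemma integral_completion_M:
  fixes f :: "'w \<Rightarrow> real"
  assumes "ae_measurable M M f"
  shows "(LINT \<omega>|completion M. f \<omega>) = (LINT \<omega>|M. f \<omega>)" "integrable (completion M) f \<longleftrightarrow> integrable M f"
  using ae_measurable_borel[OF assms] by (simp_all add: integral_completion integrable_completion)

text \<open>The scheme of \<open>coefficient_expansion\<close> on the probability space alone, with
  the state as the only argument. The remainder bound 2 C adds the Lipschitz constant of
  \<open>h\<close> and the bound of its gradient.\<close>

lemma terminal_expansion:
  fixes X :: "'w \<Rightarrow> 'h::{real_inner, banach, second_countable_topology}"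
  assumes meas: "\<And>x. (\<lambda>\<omega>. h \<omega> x) \<in> borel_measurable M"
    and der: "AE \<omega> in M. \<forall>x. (h \<omega> has_derivative (\<lambda>y. hx \<omega> x \<bullet> y)) (at x)"
    and bd: "AE \<omega> in M. \<forall>x. norm (hx \<omega> x) \<le> C" and h0: "AE \<omega> in M. \<bar>h \<omega> 0\<bar> \<le> C" and C: "0 \<le> C"
    and X: "X \<in> borel_measurable M" "msq M X < \<infinity>"
    and X': "\<And>k. X' k \<in> borel_measurable M" and E: "0 \<le> E" "\<And>k. msq M (\<lambda>\<omega>. X' k \<omega> - X \<omega>) \<le> ennreal (E * (1/16) ^ k)"
  shows "integrable M (\<lambda>\<omega>. h \<omega> (X \<omega>))" and "integrable M (\<lambda>\<omega>. h \<omega> (X' k \<omega>))"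
    and "integrable M (\<lambda>\<omega>. hx \<omega> (X \<omega>) \<bullet> (X' k \<omega> - X \<omega>))"
    and "(\<lambda>k. 4 ^ k * ((LINT \<omega>|M. h \<omega> (X' k \<omega>)) - (LINT \<omega>|M. h \<omega> (X \<omega>))
       - (LINT \<omega>|M. hx \<omega> (X \<omega>) \<bullet> (X' k \<omega> - X \<omega>)))) \<longlonglongrightarrow> 0"
proof -
  note [measurable] = X(1) X'
  have lip: "AE \<omega> in M. \<forall>x y. \<bar>h \<omega> x - h \<omega> y\<bar> \<le> C * norm (x - y)"
    using der bd
  proof eventually_elim
    case (elim \<omega>)
    show ?case
    proof (intro allI)
      fix x y
      have "norm (h \<omega> x - h \<omega> y) \<le> C * norm (x - y)"
      proof (rule differentiable_bound[OF convex_UNIV])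
        show "(h \<omega> has_derivative (\<lambda>y. hx \<omega> x \<bullet> y)) (at x within UNIV)" for x using elim(1) by simp
        show "onorm (\<lambda>y. hx \<omega> x \<bullet> y) \<le> C" for x
        proof (rule onorm_bound[OF C])
          fix y
          have "norm (hx \<omega> x \<bullet> y) \<le> norm (hx \<omega> x) * norm y" by (simp add: Cauchy_Schwarz_ineq2)
          also have "\<dots> \<le> C * norm y" using elim(2) by (intro mult_right_mono) auto
          finally show "norm (hx \<omega> x \<bullet> y) \<le> C * norm y" .
        qed
      qed auto
      then show "\<bar>h \<omega> x - h \<omega> y\<bar> \<le> C * norm (x - y)" by simp
    qed
  qed
  have cont: "AE \<omega> in M. continuous_on UNIV (h \<omega>)"
    using der by eventually_elim (rule has_derivative_continuous_on, blast)
  have hm: "(\<lambda>\<omega>. h \<omega> (Z \<omega>)) \<in> borel_measurable M" if "Z \<in> borel_measurable M" for Z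
    by (rule ae_measurable_borel[OF ae_measurable_caratheodory[where V=UNIV and \<psi>=h and p=Z]]) (use that meas cont in auto)
  have hL: "msq M (\<lambda>\<omega>. h \<omega> (Z \<omega>)) < \<infinity>" if Z[measurable]: "Z \<in> borel_measurable M" and f: "msq M Z < \<infinity>" for Z
  proof -
    have "AE \<omega> in M. norm (h \<omega> (Z \<omega>)) \<le> norm (C + C * norm (Z \<omega>))"
      using lip h0
    proof eventually_elim
      case (elim \<omega>)
      have "\<bar>h \<omega> (Z \<omega>) - h \<omega> 0\<bar> \<le> C * norm (Z \<omega> - 0)" using elim(1) by blast
      then have "\<bar>h \<omega> (Z \<omega>)\<bar> \<le> C + C * norm (Z \<omega>)" using elim(2) by simp
      then show ?case using C by simp
    qed
    then have "msq M (\<lambda>\<omega>. h \<omega> (Z \<omega>)) \<le> msq M (\<lambda>\<omega>. C + C * norm (Z \<omega>))" by (rule msq_mono_AE)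
    also have "\<dots> \<le> 2 * msq M (\<lambda>\<omega>. C) + 2 * msq M (\<lambda>\<omega>. C * norm (Z \<omega>))" by (rule msq_add_le) measurable
    also have "\<dots> \<le> 2 * msq M (\<lambda>\<omega>. C) + 2 * (ennreal (C\<^sup>2) * msq M Z)"
      by (intro add_left_mono mult_left_mono msq_scale_le[OF Z]) (use C in auto)
    also have "\<dots> < \<infinity>" using f by (simp add: msq_def ennreal_mult_less_top emeasure_eq_measure)
    finally show ?thesis .
  qed
  \<comment> \<open>Pairing with the constant 1 brings plain expectations into the inner product
    form of the general lemmas.\<close>
  have one: "ae_measurable M M (\<lambda>\<omega>. 1::real)" "msq M (\<lambda>\<omega>. 1::real) < \<infinity>"
    by (simp_all add: ae_measurable_const msq_def emeasure_eq_measure)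
  have hi: "integrable M (\<lambda>\<omega>. h \<omega> (Z \<omega>))" if Z: "Z \<in> borel_measurable M" and f: "msq M Z < \<infinity>" for Z
  proof -
    have ae: "ae_measurable M M (\<lambda>\<omega>. h \<omega> (Z \<omega>))" by (rule ae_measurableI[OF hm[OF Z]])
    have "integrable (completion M) (\<lambda>\<omega>. h \<omega> (Z \<omega>) \<bullet> 1)" by (rule integrable_completion_inner[OF ae hL[OF Z f] one])
    then show ?thesis using integral_completion_M(2)[OF ae] by simp
  qed
  have fin: "msq M (\<lambda>\<omega>. X' k \<omega> - X \<omega>) < \<infinity>" for k using le_less_trans[OF E(2)[of k], of \<infinity>] by simp
  show i1: "integrable M (\<lambda>\<omega>. h \<omega> (X \<omega>))" by (rule hi[OF X])
  show i2: "integrable M (\<lambda>\<omega>. h \<omega> (X' k \<omega>))" for k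
  proof (rule hi[OF X'])
    have "msq M (\<lambda>\<omega>. X \<omega> + (X' k \<omega> - X \<omega>)) \<le> 2 * msq M X + 2 * msq M (\<lambda>\<omega>. X' k \<omega> - X \<omega>)" by (rule msq_add_le) measurable
    also have "\<dots> < \<infinity>" using X(2) fin[of k] by (simp add: ennreal_mult_less_top)
    finally show "msq M (X' k) < \<infinity>" by simp
  qed
  \<comment> \<open>The gradient is not assumed measurable either; its value in a measurable
    direction is again a limit of difference quotients.\<close>
  have hxm: "ae_measurable M M (\<lambda>\<omega>. hx \<omega> (X \<omega>) \<bullet> d \<omega>)" if [measurable]: "d \<in> borel_measurable M" for d
  proof (rule ae_measurable_LIMSEQ)
    show "ae_measurable M M (\<lambda>\<omega>. real (Suc n) *\<^sub>R (h \<omega> (X \<omega> + (1 / real (Suc n)) *\<^sub>R d \<omega>) - h \<omega> (X \<omega>)))" for n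
      by (intro ae_measurable_scaleR ae_measurable_diff ae_measurableI hm) measurable
    show "AE \<omega> in M. (\<lambda>n. real (Suc n) *\<^sub>R (h \<omega> (X \<omega> + (1 / real (Suc n)) *\<^sub>R d \<omega>) - h \<omega> (X \<omega>))) \<longlonglongrightarrow> hx \<omega> (X \<omega>) \<bullet> d \<omega>"
      using der by eventually_elim (rule has_derivative_directional_seq[where V=UNIV], auto)
  qed
  have hxb: "AE \<omega> in M. norm (hx \<omega> (X \<omega>) \<bullet> d \<omega>) \<le> C * norm (d \<omega>)" for d
    using bd
  proof eventually_elim
    case (elim \<omega>)
    have "norm (hx \<omega> (X \<omega>) \<bullet> d \<omega>) \<le> norm (hx \<omega> (X \<omega>)) * norm (d \<omega>)" by (simp add: Cauchy_Schwarz_ineq2)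
    also have "\<dots> \<le> C * norm (d \<omega>)" using elim by (intro mult_right_mono) auto
    finally show ?case .
  qed
  show i3: "integrable M (\<lambda>\<omega>. hx \<omega> (X \<omega>) \<bullet> (X' k \<omega> - X \<omega>))" for k
  proof -
    have m: "(\<lambda>\<omega>. X' k \<omega> - X \<omega>) \<in> borel_measurable M" by measurable
    have "msq M (\<lambda>\<omega>. hx \<omega> (X \<omega>) \<bullet> (X' k \<omega> - X \<omega>)) \<le> ennreal (C\<^sup>2) * msq M (\<lambda>\<omega>. X' k \<omega> - X \<omega>)"
      by (rule msq_scale_le[OF m C hxb])
    also have "\<dots> < \<infinity>" using fin[of k] by (simp add: ennreal_mult_less_top)
    finally have f: "msq M (\<lambda>\<omega>. hx \<omega> (X \<omega>) \<bullet> (X' k \<omega> - X \<omega>)) < \<infinity>" .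
    have "integrable (completion M) (\<lambda>\<omega>. (hx \<omega> (X \<omega>) \<bullet> (X' k \<omega> - X \<omega>)) \<bullet> 1)"
      by (rule integrable_completion_inner[OF hxm[OF m] f one])
    then show ?thesis using integral_completion_M(2)[OF hxm[OF m]] by simp
  qed
  have rm: "ae_measurable M M (\<lambda>\<omega>. h \<omega> (X \<omega> + (X' k \<omega> - X \<omega>)) - h \<omega> (X \<omega>) - hx \<omega> (X \<omega>) \<bullet> (X' k \<omega> - X \<omega>))" for k
    by (intro ae_measurable_diff ae_measurableI[OF hm] hxm) measurable
  have "(\<lambda>k. 4 ^ k * (LINT \<omega>|completion M. (h \<omega> (X \<omega> + (X' k \<omega> - X \<omega>)) - h \<omega> (X \<omega>) - hx \<omega> (X \<omega>) \<bullet> (X' k \<omega> - X \<omega>)) \<bullet> 1)) \<longlonglongrightarrow> 0"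
  proof (rule remainder_integral_tendsto_0[OF _ E(2) E(1) _ _ _ _ rm one, where V=UNIV and L="2 * C"])
    show "AE \<omega> in M. (h \<omega> has_derivative (\<lambda>d. hx \<omega> (X \<omega>) \<bullet> d)) (at (X \<omega>) within UNIV)"
      using der by eventually_elim blast
    show "AE \<omega> in M. norm (h \<omega> (X \<omega> + (X' k \<omega> - X \<omega>)) - h \<omega> (X \<omega>) - hx \<omega> (X \<omega>) \<bullet> (X' k \<omega> - X \<omega>)) \<le> 2 * C * norm (X' k \<omega> - X \<omega>)" for k
      using lip hxb[of "\<lambda>\<omega>. X' k \<omega> - X \<omega>"]
    proof eventually_elim
      case (elim \<omega>)
      have "\<bar>h \<omega> (X \<omega> + (X' k \<omega> - X \<omega>)) - h \<omega> (X \<omega>)\<bar> \<le> C * norm (X \<omega> + (X' k \<omega> - X \<omega>) - X \<omega>)" using elim(1) by blast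
      then show ?case using elim(2) by simp
    qed
  qed (use C in simp_all)
  moreover have "(LINT \<omega>|completion M. (h \<omega> (X \<omega> + (X' k \<omega> - X \<omega>)) - h \<omega> (X \<omega>) - hx \<omega> (X \<omega>) \<bullet> (X' k \<omega> - X \<omega>)) \<bullet> 1)
    = (LINT \<omega>|M. h \<omega> (X' k \<omega>)) - (LINT \<omega>|M. h \<omega> (X \<omega>)) - (LINT \<omega>|M. hx \<omega> (X \<omega>) \<bullet> (X' k \<omega> - X \<omega>))" for k
  proof -
    have "(LINT \<omega>|completion M. (h \<omega> (X \<omega> + (X' k \<omega> - X \<omega>)) - h \<omega> (X \<omega>) - hx \<omega> (X \<omega>) \<bullet> (X' k \<omega> - X \<omega>)) \<bullet> 1)
      = (LINT \<omega>|M. h \<omega> (X' k \<omega>) - h \<omega> (X \<omega>) - hx \<omega> (X \<omega>) \<bullet> (X' k \<omega> - X \<omega>))"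
      using integral_completion_M(1)[OF rm[of k]] by simp
    also have "\<dots> = (LINT \<omega>|M. h \<omega> (X' k \<omega>) - h \<omega> (X \<omega>)) - (LINT \<omega>|M. hx \<omega> (X \<omega>) \<bullet> (X' k \<omega> - X \<omega>))"
      by (rule Bochner_Integration.integral_diff[OF Bochner_Integration.integrable_diff[OF i2 i1] i3])
    also have "(LINT \<omega>|M. h \<omega> (X' k \<omega>) - h \<omega> (X \<omega>)) = (LINT \<omega>|M. h \<omega> (X' k \<omega>)) - (LINT \<omega>|M. h \<omega> (X \<omega>))"
      by (rule Bochner_Integration.integral_diff[OF i2 i1])
    finally show ?thesis .
  qed
  ultimately show "(\<lambda>k. 4 ^ k * ((LINT \<omega>|M. h \<omega> (X' k \<omega>)) - (LINT \<omega>|M. h \<omega> (X \<omega>))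
       - (LINT \<omega>|M. hx \<omega> (X \<omega>) \<bullet> (X' k \<omega> - X \<omega>)))) \<longlonglongrightarrow> 0" by simp
qed


text \<open>Transposition solutions are tested against drifts in \<open>L1_L2_proc\<close>. On a
  finite time interval sqrt x \<le> 1 + x places square integrable drifts in that class.\<close>

lemma L2_proc_imp_L1_L2_proc:
  assumes "f \<in> L2_proc M F 0 T"
  shows "f \<in> L1_L2_proc M F 0 T"
proof -
  obtain f' where f': "adapted F 0 T f'" "AE (t, \<omega>) in time_space M 0 T. f t \<omega> = f' t \<omega>"
    and i: "integrable (time_space M 0 T) (\<lambda>(t, \<omega>). (norm (f' t \<omega>))\<^sup>2)"
    using assms by (auto simp: L2_proc_def)
  interpret pair_sigma_finite "restrict_space lborel {0..T}" M by (rule pair_sigma_finite_time_space[OF prob_space_axioms])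
  interpret I: finite_measure "restrict_space lborel {0..T}"
    by (rule finite_measureI) (simp add: emeasure_restrict_space space_restrict_space emeasure_lborel_Icc_eq)
  have "AE t in restrict_space lborel {0..T}. integrable M (\<lambda>\<omega>. (norm (f' t \<omega>))\<^sup>2)"
    using AE_integrable_fst'[OF i] by simp
  moreover have j: "integrable (restrict_space lborel {0..T}) (\<lambda>t. LINT \<omega>|M. (norm (f' t \<omega>))\<^sup>2)"
    using integrable_fst'[OF i] by simp
  have "integrable (restrict_space lborel {0..T}) (\<lambda>t. sqrt (LINT \<omega>|M. (norm (f' t \<omega>))\<^sup>2))"
  proof (rule Bochner_Integration.integrable_bound)
    show "integrable (restrict_space lborel {0..T}) (\<lambda>t. 1 + (LINT \<omega>|M. (norm (f' t \<omega>))\<^sup>2))" using j by simp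
    show "(\<lambda>t. sqrt (LINT \<omega>|M. (norm (f' t \<omega>))\<^sup>2)) \<in> borel_measurable (restrict_space lborel {0..T})"
      using borel_measurable_integrable[OF j] by measurable
    have "norm (sqrt x) \<le> norm (1 + x)" if "0 \<le> x" for x :: real
    proof -
      have "sqrt x \<le> sqrt ((1 + x)\<^sup>2)" using that by (intro real_sqrt_le_mono) (simp add: power2_eq_square algebra_simps)
      then show ?thesis using that by simp
    qed
    then show "AE t in restrict_space lborel {0..T}. norm (sqrt (LINT \<omega>|M. (norm (f' t \<omega>))\<^sup>2)) \<le> norm (1 + (LINT \<omega>|M. (norm (f' t \<omega>))\<^sup>2))"
      by (intro AE_I2) auto
  qed
  ultimately show ?thesis using f' unfolding L1_L2_proc_def by blast
qed

text \<open>The difference of two mild solutions with the same initial value is a mild solution that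
  starts at 0, so testing at time 0 removes \<open>Y 0\<close>. The adjoints move onto the
  difference, which makes the state derivatives appear exactly as in the expansions.\<close>

lemma transposition_solution_diff:
  fixes S :: "real \<Rightarrow> 'h::{real_inner, banach, second_countable_topology} \<Rightarrow>\<^sub>L 'h"
    and \<alpha> \<beta> :: "real \<Rightarrow> 'w \<Rightarrow> 'h \<Rightarrow>\<^sub>L 'h"
  assumes YZ: "transposition_solution M F W T S
      (\<lambda>t \<omega> y z. - adjoint (blinfun_apply (\<alpha> t \<omega>)) y - adjoint (blinfun_apply (\<beta> t \<omega>)) z + \<gamma> t \<omega>) (\<lambda>\<omega>. - \<eta> \<omega>) Y Z"
    and X: "mild_solution M F W S 0 T (\<lambda>_. X0) f g X" "f \<in> L2_proc M F 0 T" "g \<in> L2_proc M F 0 T"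
    and X': "mild_solution M F W S 0 T (\<lambda>_. X0) f' g' X'" "f' \<in> L2_proc M F 0 T" "g' \<in> L2_proc M F 0 T"
    and i: "integrable (completion (time_space M 0 T)) (\<lambda>z. \<alpha> (fst z) (snd z) (X' (fst z) (snd z) - X (fst z) (snd z)) \<bullet> Y (fst z) (snd z))"
      "integrable (completion (time_space M 0 T)) (\<lambda>z. \<beta> (fst z) (snd z) (X' (fst z) (snd z) - X (fst z) (snd z)) \<bullet> Z (fst z) (snd z))"
      "integrable (completion (time_space M 0 T)) (\<lambda>z. \<gamma> (fst z) (snd z) \<bullet> (X' (fst z) (snd z) - X (fst z) (snd z)))"
    and j: "integrable (completion (time_space M 0 T)) (\<lambda>z. (f' (fst z) (snd z) - f (fst z) (snd z)) \<bullet> Y (fst z) (snd z))"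
      "integrable (completion (time_space M 0 T)) (\<lambda>z. (g' (fst z) (snd z) - g (fst z) (snd z)) \<bullet> Z (fst z) (snd z))"
  shows "- (LINT \<omega>|M. \<eta> \<omega> \<bullet> (X' T \<omega> - X T \<omega>))
      + (LINT z|completion (time_space M 0 T). \<alpha> (fst z) (snd z) (X' (fst z) (snd z) - X (fst z) (snd z)) \<bullet> Y (fst z) (snd z))
      + (LINT z|completion (time_space M 0 T). \<beta> (fst z) (snd z) (X' (fst z) (snd z) - X (fst z) (snd z)) \<bullet> Z (fst z) (snd z))
      - (LINT z|completion (time_space M 0 T). \<gamma> (fst z) (snd z) \<bullet> (X' (fst z) (snd z) - X (fst z) (snd z)))
    = (LINT z|completion (time_space M 0 T). (f' (fst z) (snd z) - f (fst z) (snd z)) \<bullet> Y (fst z) (snd z))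
      + (LINT z|completion (time_space M 0 T). (g' (fst z) (snd z) - g (fst z) (snd z)) \<bullet> Z (fst z) (snd z))"
proof -
  let ?Q = "completion (time_space M 0 T)"
  define D where "D t \<omega> = X' t \<omega> - X t \<omega>" for t \<omega>
  have D: "mild_solution M F W S 0 T (\<lambda>\<omega>. X0 - X0) (\<lambda>t \<omega>. f' t \<omega> - f t \<omega>) (\<lambda>t \<omega>. g' t \<omega> - g t \<omega>) D"
    unfolding D_def[abs_def] by (rule mild_solution_diff[OF X'(1) X(1)])
  have z: "(\<lambda>\<omega>. X0 - X0) \<in> L2_rv M (F 0)" by (simp add: L2_rv_def)
  have d: "(\<lambda>t \<omega>. f' t \<omega> - f t \<omega>) \<in> L2_proc M F 0 T" "(\<lambda>t \<omega>. g' t \<omega> - g t \<omega>) \<in> L2_proc M F 0 T"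
    by (rule L2_proc_diff[OF horizon X'(2) X(2)], rule L2_proc_diff[OF horizon X'(3) X(3)])
  note duality = YZ[unfolded transposition_solution_def, THEN conjunct2, THEN conjunct2]
  have "0 \<in> {0..T}" using horizon by simp
  from bspec[OF bspec[OF bspec[OF bspec[OF duality this] L2_proc_imp_L1_L2_proc[OF d(1)]] d(2)] z] D
  have eq: "(LINT \<omega>|M. D T \<omega> \<bullet> - \<eta> \<omega>)
      - (LINT \<omega>|M. (LINT s:{0..T}|lebesgue. D s \<omega> \<bullet> (- adjoint (blinfun_apply (\<alpha> s \<omega>)) (Y s \<omega>) - adjoint (blinfun_apply (\<beta> s \<omega>)) (Z s \<omega>) + \<gamma> s \<omega>)))
    = (LINT \<omega>|M. (X0 - X0) \<bullet> Y 0 \<omega>)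
      + (LINT \<omega>|M. (LINT s:{0..T}|lebesgue. (f' s \<omega> - f s \<omega>) \<bullet> Y s \<omega>))
      + (LINT \<omega>|M. (LINT s:{0..T}|lebesgue. (g' s \<omega> - g s \<omega>) \<bullet> Z s \<omega>))" by blast
  have inner: "D s \<omega> \<bullet> (- adjoint (blinfun_apply (\<alpha> s \<omega>)) (Y s \<omega>) - adjoint (blinfun_apply (\<beta> s \<omega>)) (Z s \<omega>) + \<gamma> s \<omega>)
    = \<gamma> s \<omega> \<bullet> D s \<omega> - \<alpha> s \<omega> (D s \<omega>) \<bullet> Y s \<omega> - \<beta> s \<omega> (D s \<omega>) \<bullet> Z s \<omega>" for s \<omega>
    by (simp add: inner_add_right inner_diff_right inner_adjoint inner_commute)
  note i' = i[folded D_def]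
  have ii: "integrable ?Q (\<lambda>z. \<gamma> (fst z) (snd z) \<bullet> D (fst z) (snd z) - \<alpha> (fst z) (snd z) (D (fst z) (snd z)) \<bullet> Y (fst z) (snd z) - \<beta> (fst z) (snd z) (D (fst z) (snd z)) \<bullet> Z (fst z) (snd z))"
    by (intro Bochner_Integration.integrable_diff i')
  have "(LINT z|?Q. \<gamma> (fst z) (snd z) \<bullet> D (fst z) (snd z) - \<alpha> (fst z) (snd z) (D (fst z) (snd z)) \<bullet> Y (fst z) (snd z) - \<beta> (fst z) (snd z) (D (fst z) (snd z)) \<bullet> Z (fst z) (snd z))
    = (LINT z|?Q. \<gamma> (fst z) (snd z) \<bullet> D (fst z) (snd z)) - (LINT z|?Q. \<alpha> (fst z) (snd z) (D (fst z) (snd z)) \<bullet> Y (fst z) (snd z))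
      - (LINT z|?Q. \<beta> (fst z) (snd z) (D (fst z) (snd z)) \<bullet> Z (fst z) (snd z))"
    by (subst Bochner_Integration.integral_diff[OF Bochner_Integration.integrable_diff[OF i'(3) i'(1)] i'(2)],
      subst Bochner_Integration.integral_diff[OF i'(3) i'(1)], rule refl)
  moreover have "(LINT \<omega>|M. (LINT s:{0..T}|lebesgue. \<gamma> s \<omega> \<bullet> D s \<omega> - \<alpha> s \<omega> (D s \<omega>) \<bullet> Y s \<omega> - \<beta> s \<omega> (D s \<omega>) \<bullet> Z s \<omega>))
    = (LINT z|?Q. \<gamma> (fst z) (snd z) \<bullet> D (fst z) (snd z) - \<alpha> (fst z) (snd z) (D (fst z) (snd z)) \<bullet> Y (fst z) (snd z) - \<beta> (fst z) (snd z) (D (fst z) (snd z)) \<bullet> Z (fst z) (snd z))"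
    using integral_iterated(2)[OF prob_space_axioms complete_measure_axioms ii] by simp
  moreover have "(LINT \<omega>|M. (LINT s:{0..T}|lebesgue. (f' s \<omega> - f s \<omega>) \<bullet> Y s \<omega>)) = (LINT z|?Q. (f' (fst z) (snd z) - f (fst z) (snd z)) \<bullet> Y (fst z) (snd z))"
    using integral_iterated(2)[OF prob_space_axioms complete_measure_axioms j(1)] by simp
  moreover have "(LINT \<omega>|M. (LINT s:{0..T}|lebesgue. (g' s \<omega> - g s \<omega>) \<bullet> Z s \<omega>)) = (LINT z|?Q. (g' (fst z) (snd z) - g (fst z) (snd z)) \<bullet> Z (fst z) (snd z))"
    using integral_iterated(2)[OF prob_space_axioms complete_measure_axioms j(2)] by simp
  moreover have "(LINT \<omega>|M. D T \<omega> \<bullet> - \<eta> \<omega>) = - (LINT \<omega>|M. \<eta> \<omega> \<bullet> D T \<omega>)"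
    by (simp add: inner_commute)
  moreover note eq[unfolded inner]
  ultimately show ?thesis unfolding D_def[symmetric] by simp
qed


lemma cost_eq:
  fixes X :: "real \<Rightarrow> 'w \<Rightarrow> 'h::{real_inner, banach, second_countable_topology}"
    and U :: "'k::{real_inner, second_countable_topology} set"
  assumes cg: "C1_coefficient M F T U g gx gu C" and X: "X \<in> C_proc M F 0 T" and u: "admissible_control M F T U u"
    and h: "integrable M (\<lambda>\<omega>. h \<omega> (X T \<omega>))"
  shows "integrable (completion (time_space M 0 T)) (\<lambda>z. g (fst z) (snd z) (X (fst z) (snd z)) (u (fst z) (snd z)))"
    and "cost M T g h X u = (LINT z|completion (time_space M 0 T). g (fst z) (snd z) (X (fst z) (snd z)) (u (fst z) (snd z)))
      + (LINT \<omega>|M. h \<omega> (X T \<omega>))"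
proof -
  let ?P = "time_space M 0 T"
  interpret P: finite_measure ?P by (rule finite_measure_time_space[OF prob_space_axioms])
  note gL = coefficient_L2[OF cg C_proc_L2(1,2)[OF X] u]
  have one: "ae_measurable ?P ?P (\<lambda>\<omega>. 1::real)" "msq ?P (\<lambda>\<omega>. 1::real) < \<infinity>"
    by (simp_all add: ae_measurable_const msq_def P.emeasure_eq_measure)
  show i: "integrable (completion ?P) (\<lambda>z. g (fst z) (snd z) (X (fst z) (snd z)) (u (fst z) (snd z)))"
    using integrable_completion_inner[OF ae_progressive_imp_ae_measurable[OF horizon L2_procD(1)[OF horizon gL]] L2_procD(2)[OF horizon gL] one] by simp
  note it = integral_iterated[OF prob_space_axioms complete_measure_axioms i, unfolded fst_conv snd_conv]
  show "cost M T g h X u = (LINT z|completion ?P. g (fst z) (snd z) (X (fst z) (snd z)) (u (fst z) (snd z)))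
      + (LINT \<omega>|M. h \<omega> (X T \<omega>))"
    unfolding cost_def by (subst Bochner_Integration.integral_add[OF it(1) h]) (simp only: it(2))
qed


section \<open>The variational inequality and its localization\<close>

text \<open>Four expansions, one duality identity and one optimality inequality hold for each k.
  Multiplied by 4^k, the remainders vanish in the limit and only the control derivatives are
  left.\<close>

lemma first_variation:
  fixes S :: "real \<Rightarrow> 'h::{real_inner, banach, second_countable_topology} \<Rightarrow>\<^sub>L 'h"
    and U :: "'k::{real_inner, second_countable_topology} set"
  assumes S: "C0_semigroup S"
    and ca: "C1_coefficient M F T U a ax au C" and cb: "C1_coefficient M F T U b bx bu C"
    and cg: "C1_coefficient M F T U g (\<lambda>t \<omega> x u. blinfun_inner_right (gx t \<omega> x u)) (\<lambda>t \<omega> x u. blinfun_inner_right (gu t \<omega> x u)) C"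
    and h: "\<And>x. (\<lambda>\<omega>. h \<omega> x) \<in> borel_measurable M"
      "AE \<omega> in M. \<forall>x. (h \<omega> has_derivative (\<lambda>y. hx \<omega> x \<bullet> y)) (at x)"
      "AE \<omega> in M. \<forall>x. norm (hx \<omega> x) \<le> C" "AE \<omega> in M. \<bar>h \<omega> 0\<bar> \<le> C"
    and opt: "optimal_pair M F W T S U a b g h X0 X u"
    and YZ: "transposition_solution M F W T S
      (\<lambda>t \<omega> y z. - adjoint (blinfun_apply (ax t \<omega> (X t \<omega>) (u t \<omega>))) y
                 - adjoint (blinfun_apply (bx t \<omega> (X t \<omega>) (u t \<omega>))) z
                 + gx t \<omega> (X t \<omega>) (u t \<omega>))
      (\<lambda>\<omega>. - hx \<omega> (X T \<omega>)) Y Z"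
    and v: "adapted F 0 T v" "msq (time_space M 0 T) (\<lambda>z. v (fst z) (snd z)) < \<infinity>"
      "admissible_control M F T U (\<lambda>t \<omega>. u t \<omega> + v t \<omega>)"
  defines "G z \<equiv> au (fst z) (snd z) (X (fst z) (snd z)) (u (fst z) (snd z)) (v (fst z) (snd z)) \<bullet> Y (fst z) (snd z)
    + bu (fst z) (snd z) (X (fst z) (snd z)) (u (fst z) (snd z)) (v (fst z) (snd z)) \<bullet> Z (fst z) (snd z)
    - gu (fst z) (snd z) (X (fst z) (snd z)) (u (fst z) (snd z)) \<bullet> v (fst z) (snd z)"
  shows "integrable (completion (time_space M 0 T)) G" "(LINT z|completion (time_space M 0 T). G z) \<le> 0"
proof -
  let ?P = "time_space M 0 T" and ?Q = "completion (time_space M 0 T)"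
  interpret P: finite_measure ?P by (rule finite_measure_time_space[OF prob_space_axioms])
  have C: "0 \<le> C" using ca by (auto simp: C1_coefficient_def)
  have adm: "admissible_pair M F W T S U a b X0 X u" using opt by (simp add: optimal_pair_def)
  then have u: "admissible_control M F T U u" and Xm: "mild_solution M F W S 0 T (\<lambda>_. X0) (\<lambda>t \<omega>. a t \<omega> (X t \<omega>) (u t \<omega>)) (\<lambda>t \<omega>. b t \<omega> (X t \<omega>) (u t \<omega>)) X"
    by (simp_all add: admissible_pair_def)
  have XC: "X \<in> C_proc M F 0 T" using Xm by (simp add: mild_solution_def)
  define w where "w k t \<omega> = u t \<omega> + (1/4) ^ k *\<^sub>R v t \<omega>" for k :: nat and t \<omega>
  from perturbed_state[OF S ca cb adm v, folded w_def] obtain E where E: "0 \<le> E"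
    and ex: "\<forall>k. \<exists>X'. admissible_pair M F W T S U a b X0 X' (w k) \<and> msq M (\<lambda>\<omega>. X' T \<omega> - X T \<omega>) \<le> ennreal (E * (1/16) ^ k) \<and>
      msq ?P (\<lambda>z. X' (fst z) (snd z) - X (fst z) (snd z)) \<le> ennreal (E * (1/16) ^ k)"
    by (elim exE conjE)
  from choice[OF ex] obtain X' where all: "\<forall>k. admissible_pair M F W T S U a b X0 (X' k) (w k) \<and> msq M (\<lambda>\<omega>. X' k T \<omega> - X T \<omega>) \<le> ennreal (E * (1/16) ^ k) \<and>
      msq ?P (\<lambda>z. X' k (fst z) (snd z) - X (fst z) (snd z)) \<le> ennreal (E * (1/16) ^ k)"
    by (elim exE)
  note X' = conjunct1[OF spec[OF all]]
    and ET = conjunct1[OF conjunct2[OF spec[OF all]]] and EP = conjunct2[OF conjunct2[OF spec[OF all]]]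
  have wu: "admissible_control M F T U (w k)"
    and X'm: "mild_solution M F W S 0 T (\<lambda>_. X0) (\<lambda>t \<omega>. a t \<omega> (X' k t \<omega>) (w k t \<omega>)) (\<lambda>t \<omega>. b t \<omega> (X' k t \<omega>) (w k t \<omega>)) (X' k)" for k
    using X'[of k] by (simp_all add: admissible_pair_def)
  have X'C: "X' k \<in> C_proc M F 0 T" for k using X'm[of k] by (simp add: mild_solution_def)
  have TT: "T \<in> {0..T}" using horizon by simp
  have YL: "Y \<in> L2_proc M F 0 T" and ZL: "Z \<in> L2_proc M F 0 T"
    using YZ by (auto simp: transposition_solution_def intro: D_proc_adapted_L2)
  note wY = ae_progressive_imp_ae_measurable[OF horizon L2_procD(1)[OF horizon YL]] L2_procD(2)[OF horizon YL]
  note wZ = ae_progressive_imp_ae_measurable[OF horizon L2_procD(1)[OF horizon ZL]] L2_procD(2)[OF horizon ZL]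
  have one: "ae_measurable ?P ?P (\<lambda>\<omega>. 1::real)" "msq ?P (\<lambda>\<omega>. 1::real) < \<infinity>"
    by (simp_all add: ae_measurable_const msq_def P.emeasure_eq_measure)
  note EA = coefficient_expansion[OF ca C_proc_L2(2)[OF XC] u C_proc_L2(2)[OF X'C] E EP v wY, folded w_def]
  note EB = coefficient_expansion[OF cb C_proc_L2(2)[OF XC] u C_proc_L2(2)[OF X'C] E EP v wZ, folded w_def]
  note EG = coefficient_expansion[OF cg C_proc_L2(2)[OF XC] u C_proc_L2(2)[OF X'C] E EP v one, folded w_def,
    unfolded inner_real_def mult_1_right blinfun_inner_right.rep_eq]
  note EH = terminal_expansion[OF h C C_proc_L2(4,5)[OF XC TT] C_proc_L2(4)[OF X'C TT] E ET]
  define A where "A k = (LINT z|?Q. (a (fst z) (snd z) (X' k (fst z) (snd z)) (w k (fst z) (snd z)) -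
    a (fst z) (snd z) (X (fst z) (snd z)) (u (fst z) (snd z))) \<bullet> Y (fst z) (snd z))" for k
  define A' where "A' k = (LINT z|?Q. ax (fst z) (snd z) (X (fst z) (snd z)) (u (fst z) (snd z)) (X' k (fst z) (snd z) - X (fst z) (snd z)) \<bullet> Y (fst z) (snd z))" for k
  define Au where "Au = (LINT z|?Q. au (fst z) (snd z) (X (fst z) (snd z)) (u (fst z) (snd z)) (v (fst z) (snd z)) \<bullet> Y (fst z) (snd z))"
  define B where "B k = (LINT z|?Q. (b (fst z) (snd z) (X' k (fst z) (snd z)) (w k (fst z) (snd z)) -
    b (fst z) (snd z) (X (fst z) (snd z)) (u (fst z) (snd z))) \<bullet> Z (fst z) (snd z))" for k
  define B' where "B' k = (LINT z|?Q. bx (fst z) (snd z) (X (fst z) (snd z)) (u (fst z) (snd z)) (X' k (fst z) (snd z) - X (fst z) (snd z)) \<bullet> Z (fst z) (snd z))" for k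
  define Bu where "Bu = (LINT z|?Q. bu (fst z) (snd z) (X (fst z) (snd z)) (u (fst z) (snd z)) (v (fst z) (snd z)) \<bullet> Z (fst z) (snd z))"
  define R where "R k = (LINT z|?Q. g (fst z) (snd z) (X' k (fst z) (snd z)) (w k (fst z) (snd z)) -
    g (fst z) (snd z) (X (fst z) (snd z)) (u (fst z) (snd z)))" for k
  define R' where "R' k = (LINT z|?Q. gx (fst z) (snd z) (X (fst z) (snd z)) (u (fst z) (snd z)) \<bullet> (X' k (fst z) (snd z) - X (fst z) (snd z)))" for k
  define Ru where "Ru = (LINT z|?Q. gu (fst z) (snd z) (X (fst z) (snd z)) (u (fst z) (snd z)) \<bullet> v (fst z) (snd z))"
  define H where "H k = (LINT \<omega>|M. h \<omega> (X' k T \<omega>)) - (LINT \<omega>|M. h \<omega> (X T \<omega>))" for k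
  define H' where "H' k = (LINT \<omega>|M. hx \<omega> (X T \<omega>) \<bullet> (X' k T \<omega> - X T \<omega>))" for k
  note limA = EA(4)[folded A_def A'_def Au_def]
  note limB = EB(4)[folded B_def B'_def Bu_def]
  note limR = EG(4)[folded R_def R'_def Ru_def]
  note limH = EH(4)[folded H_def H'_def]
  have coeffL: "(\<lambda>t \<omega>. \<psi> t \<omega> (X t \<omega>) (u t \<omega>)) \<in> L2_proc M F 0 T" "(\<lambda>t \<omega>. \<psi> t \<omega> (X' k t \<omega>) (w k t \<omega>)) \<in> L2_proc M F 0 T"
    if "C1_coefficient M F T U \<psi> fx fu C" for k and \<psi> :: "real \<Rightarrow> 'w \<Rightarrow> 'h \<Rightarrow> 'k \<Rightarrow> 'h" and fx fu
    by (rule coefficient_L2[OF that C_proc_L2(1,2)[OF XC] u], rule coefficient_L2[OF that C_proc_L2(1,2)[OF X'C] wu])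
  \<comment> \<open>This identity eliminates every term that is linear in the state difference, so
    no limit of the rescaled differences is ever taken.\<close>
  have duality: "- H' k + A' k + B' k - R' k = A k + B k" for k
    unfolding H'_def A'_def B'_def R'_def A_def B_def
    by (rule transposition_solution_diff[OF YZ Xm coeffL(1)[OF ca] coeffL(1)[OF cb] X'm coeffL(2)[OF ca] coeffL(2)[OF cb]
      EA(2) EB(2) EG(2) EA(1) EB(1)])
  have optimality: "0 \<le> R k + H k" for k
  proof -
    note c = cost_eq[where h=h, OF cg XC u EH(1)] and c' = cost_eq[where h=h, OF cg X'C wu EH(2), of k]
    have "ereal (cost M T g h X u) \<le> ereal (cost M T g h (X' k) (w k))"
      using opt X'[of k] unfolding optimal_pair_def by (auto intro!: INF_lower2[of "(X' k, w k)"])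
    then have "cost M T g h X u \<le> cost M T g h (X' k) (w k)" by simp
    moreover have "R k = (LINT z|?Q. g (fst z) (snd z) (X' k (fst z) (snd z)) (w k (fst z) (snd z))) - (LINT z|?Q. g (fst z) (snd z) (X (fst z) (snd z)) (u (fst z) (snd z)))"
      unfolding R_def by (rule Bochner_Integration.integral_diff[OF c'(1) c(1)])
    ultimately show ?thesis unfolding c(2) c'(2) H_def by linarith
  qed
  \<comment> \<open>The combination of remainders whose limit is \<open>Ru - Au - Bu\<close>. By
    \<open>duality\<close> it equals the rescaled cost difference
    \<open>4 ^ k * (R k + H k)\<close>, which optimality makes nonnegative.\<close>
  define s where "s k = 4 ^ k * (R k - R' k - (1/4) ^ k * Ru) + 4 ^ k * (H k - H' k)
     - 4 ^ k * (A k - A' k - (1/4) ^ k * Au) - 4 ^ k * (B k - B' k - (1/4) ^ k * Bu) + (Ru - Au - Bu)" for k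
  have "s \<longlonglongrightarrow> 0 + 0 - 0 - 0 + (Ru - Au - Bu)"
    unfolding s_def by (intro tendsto_add tendsto_diff limA limB limR limH tendsto_const)
  then have "s \<longlonglongrightarrow> Ru - Au - Bu" by simp
  moreover have "0 \<le> s k" for k
  proof -
    have one: "(4::real) ^ k * (1/4) ^ k = 1" by (simp flip: power_mult_distrib)
    have d: "H' k = A' k + B' k - R' k - A k - B k" using duality[of k] by linarith
    have e: "4 ^ k * ((1/4) ^ k * x) = x" for x :: real using one by (simp flip: mult.assoc)
    have "s k = 4 ^ k * (R k + H k)"
      unfolding s_def d right_diff_distrib distrib_left e by linarith
    then show ?thesis using optimality[of k] by simp
  qed
  ultimately have "0 \<le> Ru - Au - Bu" by (intro LIMSEQ_le_const) auto
  moreover have GE: "(LINT z|?Q. G z) = Au + Bu - Ru"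
    unfolding G_def Au_def Bu_def Ru_def
    by (subst Bochner_Integration.integral_diff[OF Bochner_Integration.integrable_add[OF EA(3) EB(3)] EG(3)],
      subst Bochner_Integration.integral_add[OF EA(3) EB(3)], rule refl)
  ultimately show "(LINT z|?Q. G z) \<le> 0" by simp
  show "integrable ?Q G"
    unfolding G_def by (intro Bochner_Integration.integrable_diff Bochner_Integration.integrable_add EA(3) EB(3) EG(3))
qed


text \<open>\<open>G\<close> is linear in the direction, so a variation multiplied by an indicator
  restricts the integral inequality to a set. Choosing the set where the integrand is positive
  forces it to be null.\<close>

lemma maximum_condition:
  fixes S :: "real \<Rightarrow> 'h::{real_inner, banach, second_countable_topology} \<Rightarrow>\<^sub>L 'h"
    and U :: "'k::{real_inner, banach, second_countable_topology} set"
  assumes S: "C0_semigroup S"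
    and ca: "C1_coefficient M F T U a ax au C" and cb: "C1_coefficient M F T U b bx bu C"
    and cg: "C1_coefficient M F T U g (\<lambda>t \<omega> x u. blinfun_inner_right (gx t \<omega> x u)) (\<lambda>t \<omega> x u. blinfun_inner_right (gu t \<omega> x u)) C"
    and h: "\<And>x. (\<lambda>\<omega>. h \<omega> x) \<in> borel_measurable M"
      "AE \<omega> in M. \<forall>x. (h \<omega> has_derivative (\<lambda>y. hx \<omega> x \<bullet> y)) (at x)"
      "AE \<omega> in M. \<forall>x. norm (hx \<omega> x) \<le> C" "AE \<omega> in M. \<bar>h \<omega> 0\<bar> \<le> C"
    and opt: "optimal_pair M F W T S U a b g h X0 X u"
    and YZ: "transposition_solution M F W T S
      (\<lambda>t \<omega> y z. - adjoint (blinfun_apply (ax t \<omega> (X t \<omega>) (u t \<omega>))) y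
                 - adjoint (blinfun_apply (bx t \<omega> (X t \<omega>) (u t \<omega>))) z
                 + gx t \<omega> (X t \<omega>) (u t \<omega>))
      (\<lambda>\<omega>. - hx \<omega> (X T \<omega>)) Y Z"
  defines "G v z \<equiv> au (fst z) (snd z) (X (fst z) (snd z)) (u (fst z) (snd z)) v \<bullet> Y (fst z) (snd z)
    + bu (fst z) (snd z) (X (fst z) (snd z)) (u (fst z) (snd z)) v \<bullet> Z (fst z) (snd z)
    - gu (fst z) (snd z) (X (fst z) (snd z)) (u (fst z) (snd z)) \<bullet> v"
  shows "AE z in time_space M 0 T. \<forall>\<rho>\<in>U. G (\<rho> - u (fst z) (snd z)) z \<le> 0"
proof (rule AE_ball_le_0)
  let ?P = "time_space M 0 T" and ?F = "progressive_field F 0 T"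
  show "AE z in ?P. continuous_on U (\<lambda>\<rho>. G (\<rho> - u (fst z) (snd z)) z)"
    unfolding G_def by (intro AE_I2 continuous_intros)
  fix \<rho> assume \<rho>: "\<rho> \<in> U"
  interpret P: finite_measure ?P by (rule finite_measure_time_space[OF prob_space_axioms])
  have adm: "admissible_pair M F W T S U a b X0 X u" using opt by (simp add: optimal_pair_def)
  then have u: "admissible_control M F T U u" and XC: "X \<in> C_proc M F 0 T"
    by (simp_all add: admissible_pair_def mild_solution_def)
  note Xa = C_proc_L2(2)[OF XC]
  have YL: "Y \<in> L2_proc M F 0 T" and ZL: "Z \<in> L2_proc M F 0 T"
    using YZ by (auto simp: transposition_solution_def intro: D_proc_adapted_L2)
  have um[measurable]: "(\<lambda>z. u (fst z) (snd z)) \<in> borel_measurable ?F"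
    using u by (simp add: admissible_control_def adapted_prog)
  have scale: "G (r *\<^sub>R x) z = r * G x z" for r x z
    unfolding G_def by (simp add: blinfun.scaleR_right algebra_simps)
  have zero: "G 0 z = 0" for z using scale[of 0 0 z] by simp
  have v: "adapted F 0 T (\<lambda>t \<omega>. indicator B (t, \<omega>) *\<^sub>R (\<rho> - u t \<omega>))"
      "msq ?P (\<lambda>z. indicator B (fst z, snd z) *\<^sub>R (\<rho> - u (fst z) (snd z))) < \<infinity>"
      "admissible_control M F T U (\<lambda>t \<omega>. u t \<omega> + indicator B (t, \<omega>) *\<^sub>R (\<rho> - u t \<omega>))"
    if B[measurable]: "B \<in> sets ?F" and bdd: "\<And>z. z \<in> B \<Longrightarrow> norm (u (fst z) (snd z)) \<le> real n" for B n
  proof -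
    show va: "adapted F 0 T (\<lambda>t \<omega>. indicator B (t, \<omega>) *\<^sub>R (\<rho> - u t \<omega>))"
      unfolding adapted_prog prod.collapse by measurable
    have "msq ?P (\<lambda>z. indicator B (fst z, snd z) *\<^sub>R (\<rho> - u (fst z) (snd z))) \<le> msq ?P (\<lambda>z. norm \<rho> + real n)"
    proof (rule msq_mono_AE, rule AE_I2)
      fix z
      show "norm (indicator B (fst z, snd z) *\<^sub>R (\<rho> - u (fst z) (snd z))) \<le> norm (norm \<rho> + real n)"
      proof (cases "z \<in> B")
        case True
        then have "norm (\<rho> - u (fst z) (snd z)) \<le> norm \<rho> + real n"
          using norm_triangle_ineq4[of \<rho> "u (fst z) (snd z)"] bdd[OF True] by linarith
        then show ?thesis using True by simp
      qed simp
    qed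
    also have "\<dots> < \<infinity>" by (simp add: msq_def ennreal_mult_less_top P.emeasure_eq_measure)
    finally show "msq ?P (\<lambda>z. indicator B (fst z, snd z) *\<^sub>R (\<rho> - u (fst z) (snd z))) < \<infinity>" .
    show "admissible_control M F T U (\<lambda>t \<omega>. u t \<omega> + indicator B (t, \<omega>) *\<^sub>R (\<rho> - u t \<omega>))"
      unfolding admissible_control_def
    proof (intro conjI ballI)
      show "adapted F 0 T (\<lambda>t \<omega>. u t \<omega> + indicator B (t, \<omega>) *\<^sub>R (\<rho> - u t \<omega>))"
        unfolding adapted_prog prod.collapse by measurable
      fix t \<omega> assume "t \<in> {0..T}" "\<omega> \<in> space M"
      then show "u t \<omega> + indicator B (t, \<omega>) *\<^sub>R (\<rho> - u t \<omega>) \<in> U"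
        using u \<rho> by (cases "(t, \<omega>) \<in> B") (auto simp: admissible_control_def)
    qed
  qed
  have "AE z in ?P. norm (u (fst z) (snd z)) \<le> real n \<longrightarrow> G (\<rho> - u (fst z) (snd z)) z \<le> 0" for n
  proof -
    \<comment> \<open>\<open>U\<close> and the optimal control may be unbounded; on this set the
      direction \<open>\<rho> - u\<close> is bounded, so the variation is square integrable.\<close>
    define B where "B = {z \<in> space ?F. norm (u (fst z) (snd z)) \<le> real n}"
    have B[measurable]: "B \<in> sets ?F" unfolding B_def by measurable
    have Bn: "norm (u (fst z) (snd z)) \<le> real n" if "z \<in> B" for z using that by (simp add: B_def)
    note vB = v[OF B Bn]
    have z0: "adapted F 0 T (\<lambda>t \<omega>. 0::'h)" "msq ?P (\<lambda>z. 0::'h) < \<infinity>" unfolding adapted_prog by (measurable, simp add: msq_def)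
    note der = coefficient_derivative(1)[OF _ Xa u z0 vB, unfolded blinfun.zero_right add_0_left]
    have "ae_measurable ?F ?P (\<lambda>z. G (indicator B (fst z, snd z) *\<^sub>R (\<rho> - u (fst z) (snd z))) z)"
      unfolding G_def
      by (intro ae_measurable_add ae_measurable_diff ae_measurable_inner der[OF ca] der[OF cb] L2_procD(1)[OF horizon YL]
        L2_procD(1)[OF horizon ZL] der[OF cg, unfolded blinfun_inner_right.rep_eq])
    \<comment> \<open>\<open>G\<close> is progressive only up to a null set and cannot define a
      progressive set itself; its version \<open>q\<close> can. The indicator of \<open>B\<close>
      inside \<open>G\<close> is there because measurability is known only for admissible square
      integrable directions.\<close>
    then obtain q where q[measurable]: "q \<in> borel_measurable ?F"
      and eq: "AE z in ?P. G (indicator B (fst z, snd z) *\<^sub>R (\<rho> - u (fst z) (snd z))) z = q z"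
      unfolding ae_measurable_def by blast
    txt \<open>The variation moves \<open>u\<close> towards \<open>\<rho>\<close> exactly where the claim fails.\<close>
    define B' where "B' = {z \<in> B. 0 < q z}"
    have "{z \<in> space ?F. z \<in> B \<and> 0 < q z} \<in> sets ?F" by measurable
    moreover have "{z \<in> space ?F. z \<in> B \<and> 0 < q z} = B'" by (auto simp: B'_def B_def)
    ultimately have B': "B' \<in> sets ?F" by simp
    have B'n: "norm (u (fst z) (snd z)) \<le> real n" if "z \<in> B'" for z using that by (simp add: B'_def Bn)
    note var = first_variation[OF S ca cb cg h opt YZ v[OF B' B'n], folded G_def]
    \<comment> \<open>The integrand of the localized variation is the positive part of
      \<open>q\<close>. Its integral is at most 0 by \<open>first_variation\<close>, so
      \<open>q\<close> is nonpositive almost everywhere.\<close>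
    have pos: "AE z in ?P. G (indicator B' (fst z, snd z) *\<^sub>R (\<rho> - u (fst z) (snd z))) z = max 0 (q z)"
      using eq
    proof eventually_elim
      case (elim z)
      show ?case
      proof (cases "z \<in> B")
        case True
        then show ?thesis using elim by (cases "0 < q z") (auto simp: B'_def zero)
      next
        case False
        then show ?thesis using elim by (simp add: B'_def zero)
      qed
    qed
    have posQ: "AE z in completion ?P. 0 \<le> G (indicator B' (fst z, snd z) *\<^sub>R (\<rho> - u (fst z) (snd z))) z"
      by (rule AE_completion) (use pos in eventually_elim, simp)
    have "(LINT z|completion ?P. G (indicator B' (fst z, snd z) *\<^sub>R (\<rho> - u (fst z) (snd z))) z) = 0"
      by (rule antisym[OF var(2) integral_nonneg_AE[OF posQ]])
    then have "AE z in completion ?P. G (indicator B' (fst z, snd z) *\<^sub>R (\<rho> - u (fst z) (snd z))) z = 0"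
      using integral_nonneg_eq_0_iff_AE[OF var(1) posQ] by blast
    then have "AE z in ?P. G (indicator B' (fst z, snd z) *\<^sub>R (\<rho> - u (fst z) (snd z))) z = 0"
      by (simp only: AE_completion_iff)
    with pos eq AE_space show ?thesis
    proof eventually_elim
      case (elim z)
      show ?case
      proof
        assume "norm (u (fst z) (snd z)) \<le> real n"
        then have "z \<in> B" using elim(3) sets_progressive_field(2)[OF horizon] by (simp add: B_def)
        then show "G (\<rho> - u (fst z) (snd z)) z \<le> 0" using elim(1,2,4) by (auto simp: max_def zero split: if_splits)
      qed
    qed
  qed
  then have "AE z in ?P. \<forall>n. norm (u (fst z) (snd z)) \<le> real n \<longrightarrow> G (\<rho> - u (fst z) (snd z)) z \<le> 0"
    unfolding AE_all_countable ..
  then show "AE z in ?P. G (\<rho> - u (fst z) (snd z)) z \<le> 0"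
  proof eventually_elim
    case (elim z)
    obtain n where "norm (u (fst z) (snd z)) \<le> real n" using real_arch_simple by blast
    then show ?case using elim by blast
  qed
qed


section \<open>From the assumptions to the abstract coefficient conditions\<close>

text \<open>The time interval has positive measure, so a property of \<omega> alone cannot fail on a
  set of positive probability. The bound on \<open>hx\<close> comes from a condition stated on the
  time strip and is brought down to \<open>M\<close> in this way.\<close>

lemma AE_time_const:
  assumes "AE z in time_space M 0 T. Q (snd z)"
  shows "AE \<omega> in M. Q \<omega>"
proof -
  interpret pair_sigma_finite "restrict_space lborel {0..T}" M by (rule pair_sigma_finite_time_space[OF prob_space_axioms])
  have "AE \<omega> in M. AE t in restrict_space lborel {0..T}. Q \<omega>" by (rule AE_pair_swap[OF assms])
  moreover have "ae_filter (restrict_space lborel {0..T}) \<noteq> bot"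
    using T_pos by (simp add: ae_filter_eq_bot_iff emeasure_restrict_space space_restrict_space emeasure_lborel_Icc_eq)
  ultimately show ?thesis by (auto simp: eventually_const_iff elim!: eventually_mono)
qed

text \<open>(AS2) bounds the running cost almost surely at each fixed time. Adaptedness makes the
  exceptional set jointly measurable, and Fubini then shows that it is null on the strip.\<close>

lemma AE_time_space_adapted:
  fixes f :: "real \<Rightarrow> 'w \<Rightarrow> real"
  assumes f: "adapted F 0 T f" and le: "\<And>t. t \<in> {0..T} \<Longrightarrow> AE \<omega> in M. \<bar>f t \<omega>\<bar> \<le> C"
  shows "AE z in time_space M 0 T. \<bar>f (fst z) (snd z)\<bar> \<le> C"
proof -
  interpret pair_sigma_finite "restrict_space lborel {0..T}" M by (rule pair_sigma_finite_time_space[OF prob_space_axioms])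
  note [measurable] = adapted_measurable[OF horizon f]
  show ?thesis
  proof (rule AE_pair_measure)
    show "{z \<in> space (time_space M 0 T). \<bar>f (fst z) (snd z)\<bar> \<le> C} \<in> sets (time_space M 0 T)" by measurable
    show "AE t in restrict_space lborel {0..T}. AE \<omega> in M. \<bar>f (fst (t, \<omega>)) (snd (t, \<omega>))\<bar> \<le> C"
      by (rule AE_I2) (use le in \<open>simp add: space_restrict_space\<close>)
  qed
qed

lemma AS1_coeff_zero_bound:
  fixes \<psi> :: "real \<Rightarrow> 'w \<Rightarrow> 'h::real_normed_vector \<Rightarrow> 'k::topological_space \<Rightarrow> 'h"
  assumes "AS1_coeff M F T U \<psi>"
  obtains C where "\<And>u. u \<in> U \<Longrightarrow> AE z in time_space M 0 T. norm (\<psi> (fst z) (snd z) 0 u) \<le> C"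
proof -
  obtain C where C: "\<forall>x1 x2. \<forall>u\<in>U. AE (t, \<omega>) in time_space M 0 T.
      norm (\<psi> t \<omega> x1 u - \<psi> t \<omega> x2 u) \<le> C * norm (x1 - x2) \<and> norm (\<psi> t \<omega> 0 u) \<le> C"
    using assms unfolding AS1_coeff_def by (elim conjE exE)
  show thesis
  proof (rule that)
    fix u assume "u \<in> U"
    from bspec[OF spec[OF spec[OF C]] this]
    show "AE z in time_space M 0 T. norm (\<psi> (fst z) (snd z) 0 u) \<le> C"
      unfolding case_prod_unfold by eventually_elim blast
  qed
qed

end

theorem theorem10p1:
  fixes M :: "'w measure"
    and F :: "real \<Rightarrow> 'w measure"
    and W :: "real \<Rightarrow> 'w \<Rightarrow> real"
    and T :: real
    and domA :: "'h::{real_inner, banach, second_countable_topology} set"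
    and A :: "'h \<Rightarrow> 'h"
    and S :: "real \<Rightarrow> 'h \<Rightarrow>\<^sub>L 'h"
    and U :: "'k::{real_inner, banach, second_countable_topology} set"
    and a b :: "real \<Rightarrow> 'w \<Rightarrow> 'h \<Rightarrow> 'k \<Rightarrow> 'h"
    and g :: "real \<Rightarrow> 'w \<Rightarrow> 'h \<Rightarrow> 'k \<Rightarrow> real"
    and h :: "'w \<Rightarrow> 'h \<Rightarrow> real"
    and ax bx :: "real \<Rightarrow> 'w \<Rightarrow> 'h \<Rightarrow> 'k \<Rightarrow> 'h \<Rightarrow>\<^sub>L 'h"
    and au bu :: "real \<Rightarrow> 'w \<Rightarrow> 'h \<Rightarrow> 'k \<Rightarrow> 'k \<Rightarrow>\<^sub>L 'h"
    and gx :: "real \<Rightarrow> 'w \<Rightarrow> 'h \<Rightarrow> 'k \<Rightarrow> 'h"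
    and gu :: "real \<Rightarrow> 'w \<Rightarrow> 'h \<Rightarrow> 'k \<Rightarrow> 'k"
    and hx :: "'w \<Rightarrow> 'h \<Rightarrow> 'h"
    and X0 :: 'h
    and Xbar Y Z :: "real \<Rightarrow> 'w \<Rightarrow> 'h"
    and ubar :: "real \<Rightarrow> 'w \<Rightarrow> 'k"
  assumes basis: "brownian_basis M T F W"
    and generator: "generates_C0_semigroup domA A S"
    and AS1: "AS1 M F T U a b"
    and AS2: "AS2 M F T U g h"
    and AS3: "convex U"
    and AS4: "AS4 M T U a b g h ax au bx bu gx gu hx"
    and optimal: "optimal_pair M F W T S U a b g h X0 Xbar ubar"
    and adjoint_eq: "transposition_solution M F W T S
      (\<lambda>t \<omega> y z. - adjoint (blinfun_apply (ax t \<omega> (Xbar t \<omega>) (ubar t \<omega>))) y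
                 - adjoint (blinfun_apply (bx t \<omega> (Xbar t \<omega>) (ubar t \<omega>))) z
                 + gx t \<omega> (Xbar t \<omega>) (ubar t \<omega>))
      (\<lambda>\<omega>. - hx \<omega> (Xbar T \<omega>)) Y Z"
  shows "AE (t, \<omega>) in time_space M 0 T. \<forall>\<rho>\<in>U.
    (adjoint (blinfun_apply (au t \<omega> (Xbar t \<omega>) (ubar t \<omega>))) (Y t \<omega>)
      + adjoint (blinfun_apply (bu t \<omega> (Xbar t \<omega>) (ubar t \<omega>))) (Z t \<omega>)
      - gu t \<omega> (Xbar t \<omega>) (ubar t \<omega>)) \<bullet> (\<rho> - ubar t \<omega>) \<le> 0"
proof -
  interpret brownian_basis M T F W by (rule basis)
  let ?P = "time_space M 0 T"
  have S: "C0_semigroup S" using generator by (simp add: generates_C0_semigroup_def)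
  have "admissible_control M F T U ubar" using optimal by (simp add: optimal_pair_def admissible_pair_def)
  moreover obtain \<omega>0 where "\<omega>0 \<in> space M" using not_empty by blast
  ultimately have "ubar 0 \<omega>0 \<in> U" using T_pos by (simp add: admissible_control_def)
  \<comment> \<open>The bounds on \<open>h\<close> and \<open>hx\<close> are stated under a
    quantifier over controls, so a point of \<open>U\<close> is required to extract them; the
    optimal control provides one.\<close>
  then obtain u0 where u0: "u0 \<in> U" by blast
  have a: "AS1_coeff M F T U a" and b: "AS1_coeff M F T U b" using AS1 by (simp_all add: AS1_def)
  obtain Ca where Ca: "\<And>u. u \<in> U \<Longrightarrow> AE z in ?P. norm (a (fst z) (snd z) 0 u) \<le> Ca"
    using AS1_coeff_zero_bound[OF a] by blast
  obtain Cb where Cb: "\<And>u. u \<in> U \<Longrightarrow> AE z in ?P. norm (b (fst z) (snd z) 0 u) \<le> Cb"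
    using AS1_coeff_zero_bound[OF b] by blast
  have g: "\<And>x u. u \<in> U \<Longrightarrow> adapted F 0 T (\<lambda>t \<omega>. g t \<omega> x u)"
    and hF: "\<And>x. (\<lambda>\<omega>. h \<omega> x) \<in> borel_measurable (F T)"
    using AS2 by (simp_all add: AS2_def)
  obtain Cg where Cg: "\<forall>t\<in>{0..T}. \<forall>x1 x2. \<forall>u\<in>U. AE \<omega> in M.
        \<bar>g t \<omega> x1 u - g t \<omega> x2 u\<bar> + \<bar>h \<omega> x1 - h \<omega> x2\<bar> \<le> Cg * norm (x1 - x2) \<and>
        \<bar>g t \<omega> 0 u\<bar> + \<bar>h \<omega> 0\<bar> \<le> Cg"
    using AS2 unfolding AS2_def by (elim conjE exE)
  have gh: "AE \<omega> in M. \<bar>g t \<omega> 0 u\<bar> + \<bar>h \<omega> 0\<bar> \<le> Cg" if "t \<in> {0..T}" "u \<in> U" for t u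
  proof -
    from bspec[OF spec[OF spec[OF bspec[OF Cg that(1)]]] that(2)]
    show ?thesis by eventually_elim (rule conjunct2)
  qed
  have g0: "AE z in ?P. \<bar>g (fst z) (snd z) 0 u\<bar> \<le> Cg" if "u \<in> U" for u
  proof (rule AE_time_space_adapted[OF g[OF that]])
    show "AE \<omega> in M. \<bar>g t \<omega> 0 u\<bar> \<le> Cg" if "t \<in> {0..T}" for t
      using gh[OF that \<open>u \<in> U\<close>] by eventually_elim linarith
  qed
  have h0: "AE \<omega> in M. \<bar>h \<omega> 0\<bar> \<le> Cg" using gh[OF _ u0, of T] T_pos by (simp, elim eventually_mono) linarith
  note AS4' = AS4[unfolded AS4_def case_prod_unfold]
  have C1: "AE z in ?P. C1_on_prod U (a (fst z) (snd z)) (ax (fst z) (snd z)) (au (fst z) (snd z)) \<and>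
        C1_on_prod U (b (fst z) (snd z)) (bx (fst z) (snd z)) (bu (fst z) (snd z)) \<and>
        C1_on_prod U (g (fst z) (snd z)) (\<lambda>x u. blinfun_inner_right (gx (fst z) (snd z) x u))
          (\<lambda>x u. blinfun_inner_right (gu (fst z) (snd z) x u))"
    and hd: "AE \<omega> in M. (\<forall>x. (h \<omega> has_derivative (\<lambda>y. hx \<omega> x \<bullet> y)) (at x)) \<and> continuous_on UNIV (hx \<omega>)"
    by (rule conjunct1[OF AS4'], rule conjunct1[OF conjunct2[OF AS4']])
  from AS4' obtain C4 where C4: "\<forall>x. \<forall>u\<in>U. AE z in ?P.
        norm (ax (fst z) (snd z) x u) + norm (bx (fst z) (snd z) x u) + norm (gx (fst z) (snd z) x u) + norm (hx (snd z) x) \<le> C4 \<and>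
        norm (au (fst z) (snd z) x u) + norm (bu (fst z) (snd z) x u) + norm (gu (fst z) (snd z) x u) \<le> C4"
    by (elim conjE exE)
  \<comment> \<open>A common constant for all coefficients. Absolute values make it nonnegative
    whatever the signs of the given constants.\<close>
  define C where "C = \<bar>Ca\<bar> + \<bar>Cb\<bar> + \<bar>Cg\<bar> + \<bar>C4\<bar>"
  have C: "0 \<le> C" "Ca \<le> C" "Cb \<le> C" "Cg \<le> C" "C4 \<le> C" unfolding C_def by linarith+
  \<comment> \<open>The gradients of \<open>g\<close> act as functionals through the inner product;
    this transfers their bounds to operator norms.\<close>
  have inner_le: "norm (blinfun_inner_right x) \<le> norm x" for x :: "'e::real_inner"
    by (rule norm_blinfun_bound) (simp_all add: Cauchy_Schwarz_ineq2)
  have bd: "AE z in ?P. norm (ax (fst z) (snd z) x u) \<le> C \<and> norm (au (fst z) (snd z) x u) \<le> C"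
    "AE z in ?P. norm (bx (fst z) (snd z) x u) \<le> C \<and> norm (bu (fst z) (snd z) x u) \<le> C"
    "AE z in ?P. norm (blinfun_inner_right (gx (fst z) (snd z) x u)) \<le> C \<and> norm (blinfun_inner_right (gu (fst z) (snd z) x u)) \<le> C"
    "AE z in ?P. norm (hx (snd z) x) \<le> C" if "u \<in> U" for x u
  proof -
    have "AE z in ?P. norm (ax (fst z) (snd z) x u) \<le> C \<and> norm (au (fst z) (snd z) x u) \<le> C \<and>
      norm (bx (fst z) (snd z) x u) \<le> C \<and> norm (bu (fst z) (snd z) x u) \<le> C \<and>
      norm (blinfun_inner_right (gx (fst z) (snd z) x u)) \<le> C \<and> norm (blinfun_inner_right (gu (fst z) (snd z) x u)) \<le> C \<and>
      norm (hx (snd z) x) \<le> C"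
      using bspec[OF spec[OF C4, of x] that]
    proof eventually_elim
      case (elim z)
      note n = norm_ge_zero[of "ax (fst z) (snd z) x u"] norm_ge_zero[of "bx (fst z) (snd z) x u"] norm_ge_zero[of "gx (fst z) (snd z) x u"]
        norm_ge_zero[of "au (fst z) (snd z) x u"] norm_ge_zero[of "bu (fst z) (snd z) x u"] norm_ge_zero[of "gu (fst z) (snd z) x u"]
        norm_ge_zero[of "hx (snd z) x"]
        inner_le[of "gx (fst z) (snd z) x u"] inner_le[of "gu (fst z) (snd z) x u"]
      show ?case using elim n C(5) by (intro conjI) linarith+
    qed
    then show "AE z in ?P. norm (ax (fst z) (snd z) x u) \<le> C \<and> norm (au (fst z) (snd z) x u) \<le> C"
      "AE z in ?P. norm (bx (fst z) (snd z) x u) \<le> C \<and> norm (bu (fst z) (snd z) x u) \<le> C"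
      "AE z in ?P. norm (blinfun_inner_right (gx (fst z) (snd z) x u)) \<le> C \<and> norm (blinfun_inner_right (gu (fst z) (snd z) x u)) \<le> C"
      "AE z in ?P. norm (hx (snd z) x) \<le> C"
      by (eventually_elim, blast)+
  qed
  have ca: "C1_coefficient M F T U a ax au C"
    unfolding C1_coefficient_def
  proof (intro conjI allI ballI AS3 C(1) bd(1))
    show "adapted F 0 T (\<lambda>t \<omega>. a t \<omega> x u)" if "u \<in> U" for x u using a that by (simp add: AS1_coeff_def)
    show "AE z in ?P. C1_on_prod U (a (fst z) (snd z)) (ax (fst z) (snd z)) (au (fst z) (snd z))"
      using C1 by eventually_elim blast
    show "AE z in ?P. norm (a (fst z) (snd z) 0 u) \<le> C" if "u \<in> U" for u
      using Ca[OF that] by eventually_elim (use C(2) in linarith)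
  qed
  have cb: "C1_coefficient M F T U b bx bu C"
    unfolding C1_coefficient_def
  proof (intro conjI allI ballI AS3 C(1) bd(2))
    show "adapted F 0 T (\<lambda>t \<omega>. b t \<omega> x u)" if "u \<in> U" for x u using b that by (simp add: AS1_coeff_def)
    show "AE z in ?P. C1_on_prod U (b (fst z) (snd z)) (bx (fst z) (snd z)) (bu (fst z) (snd z))"
      using C1 by eventually_elim blast
    show "AE z in ?P. norm (b (fst z) (snd z) 0 u) \<le> C" if "u \<in> U" for u
      using Cb[OF that] by eventually_elim (use C(3) in linarith)
  qed
  have cg: "C1_coefficient M F T U g (\<lambda>t \<omega> x u. blinfun_inner_right (gx t \<omega> x u)) (\<lambda>t \<omega> x u. blinfun_inner_right (gu t \<omega> x u)) C"
    unfolding C1_coefficient_def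
  proof (intro conjI allI ballI AS3 C(1) bd(3) g)
    show "AE z in ?P. C1_on_prod U (g (fst z) (snd z)) (\<lambda>x u. blinfun_inner_right (gx (fst z) (snd z) x u))
          (\<lambda>x u. blinfun_inner_right (gu (fst z) (snd z) x u))"
      using C1 by eventually_elim blast
    show "AE z in ?P. norm (g (fst z) (snd z) 0 u) \<le> C" if "u \<in> U" for u
      using g0[OF that] by eventually_elim (use C(4) in simp)
  qed
  have hm: "(\<lambda>\<omega>. h \<omega> x) \<in> borel_measurable M" for x
    by (rule measurable_from_subalg[OF subalg hF]) (use T_pos in simp)
  have hder: "AE \<omega> in M. \<forall>x. (h \<omega> has_derivative (\<lambda>y. hx \<omega> x \<bullet> y)) (at x)"
    using hd by eventually_elim blast
  have hbd: "AE \<omega> in M. \<forall>x. norm (hx \<omega> x) \<le> C"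
  proof -
    have "AE \<omega> in M. \<forall>x\<in>UNIV. norm (hx \<omega> x) - C \<le> 0"
    proof (rule AE_ball_le_0)
      show "AE \<omega> in M. continuous_on UNIV (\<lambda>x. norm (hx \<omega> x) - C)"
        using hd by eventually_elim (auto intro!: continuous_intros)
      show "AE \<omega> in M. norm (hx \<omega> x) - C \<le> 0" for x
        using AE_time_const[OF bd(4)[OF u0, of x]] by eventually_elim simp
    qed
    then show ?thesis by eventually_elim simp
  qed
  have h0': "AE \<omega> in M. \<bar>h \<omega> 0\<bar> \<le> C" using h0 by eventually_elim (use C(4) in linarith)
  have "AE z in ?P. \<forall>\<rho>\<in>U.
      au (fst z) (snd z) (Xbar (fst z) (snd z)) (ubar (fst z) (snd z)) (\<rho> - ubar (fst z) (snd z)) \<bullet> Y (fst z) (snd z)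
    + bu (fst z) (snd z) (Xbar (fst z) (snd z)) (ubar (fst z) (snd z)) (\<rho> - ubar (fst z) (snd z)) \<bullet> Z (fst z) (snd z)
    - gu (fst z) (snd z) (Xbar (fst z) (snd z)) (ubar (fst z) (snd z)) \<bullet> (\<rho> - ubar (fst z) (snd z)) \<le> 0"
    by (rule maximum_condition[OF S ca cb cg hm hder hbd h0' optimal adjoint_eq])
  then show ?thesis
    unfolding case_prod_unfold
    \<comment> \<open>Moving the adjoints back onto the direction turns the claim into the
      inequality just proved.\<close>
    by eventually_elim (simp only: inner_diff_left inner_add_left inner_adjoint inner_commute[of "adjoint _ _"])
qed

end
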